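(* Let $n\ge 1$, $0<s<t<1$, and let $\Omega\subset\mathbb{R}^n$ be a bounded Lipschitz domain, $\Omega_e=\mathbb{R}^n\setminus\overline{\Omega}$. Let $b_1,b_2,q_1,q_2\in C_c(\Omega)$ be continuous (real valued) functions with compact support in $\Omega$, and suppose that for $j=1,2$ the operator $\mathscr{L}_{b_j,q_j}=(-\Delta)^t+(-\Delta)^{s/2}_\Omega\, b_j\,(-\Delta)^{s/2}_\Omega+q_j$ satisfies the eigenvalue condition: the only $\varphi\in H^t(\mathbb{R}^n)$ with $\mathscr{L}_{b_j,q_j}\varphi=0$ in $\Omega$ and $\varphi=0$ in $\Omega_e$ is $\varphi=0$. Let $f\in\widetilde H^t(\Omega_e)$ be a fixed non-zero function and, for $j=1,2$, let $u_j\in H^t(\mathbb{R}^n)$ solve $\mathscr{L}_{b_j,q_j}u_j=0$ in $\Omega$ with $u_j=f$ in $\Omega_e$. If $\mathscr{N}_{b_1,q_1}(f)=\mathscr{N}_{b_2,q_2}(f)$ on $\widetilde W$, where $\widetilde W\subset\Omega_e$ is some non-empty open subset, then $u_1\equiv u_2$ in $\mathbb{R}^n$. Moreover, $q_1=q_2$ on the support of $u_1$ in $\Omega$, and $b_1=b_2$ on the support of $(-\Delta)^{s/2}_\Omega u_1$ in $\Omega$.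
   Context: All functions are real valued. Sobolev spaces: $H^r(\mathbb{R}^n)$ is the $L^2$-based Sobolev space with norm $\|\langle\xi\rangle^r\widehat u\|_{L^2}$, $\langle\xi\rangle=(1+|\xi|^2)^{1/2}$; for an open set $U$, $\widetilde H^r(U)$ is the closure of $C_c^\infty(U)$ in $H^r(\mathbb{R}^n)$, and $H^r(U)$ is the space of restrictions to $U$ of elements of $H^r(\mathbb{R}^n)$ with the quotient norm. Operators: $(-\Delta)^t$ is the Fourier multiplier $|\xi|^{2t}$ on $\mathbb{R}^n$; for $0<a<1$, $C_{n,a}>0$ is the constant for which $(-\Delta)^a u(x)=C_{n,a}\,\mathrm{p.v.}\int_{\mathbb{R}^n}\frac{u(x)-u(y)}{|x-y|^{n+2a}}dy$ for Schwartz $u$. The regional fractional Laplacian on $\Omega$ is $(-\Delta)^a_\Omega u(x)=C_{n,a}\,\mathrm{p.v.}\int_\Omega\frac{u(x)-u(y)}{|x-y|^{n+2a}}dy$ for smooth $u$ on $\overline\Omega$, extended to $u\in H^a(\Omega)$ weakly by $\langle(-\Delta)^a_\Omega u,v\rangle=\frac{C_{n,a}}{2}\int_\Omega\int_\Omega\frac{(u(x)-u(y))(v(x)-v(y))}{|x-y|^{n+2a}}dy\,dx$; applied to functions on $\mathbb{R}^n$ it acts on their restriction to $\Omega$. Weak solutions: for $f\in\widetilde H^t(\Omega_e)$, $u\in H^t(\mathbb{R}^n)$ solves $\mathscr{L}_{b,q}u=0$ in $\Omega$, $u=f$ in $\Omega_e$, if $u=f$ in $\Omega_e$ and for all $\varphi\in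 C_c^\infty(\Omega)$, $$\int_{\mathbb{R}^n}(-\Delta)^{t/2}u\,(-\Delta)^{t/2}\varphi\,dx+\int_\Omega b\,(-\Delta)^{s/2}_\Omega u\,(-\Delta)^{s/2}_\Omega\varphi\,dx+\int_\Omega q\,u\,\varphi\,dx=0.$$ (Here $u|_\Omega=(u-f)|_\Omega$ with $u-f\in\widetilde H^t(\Omega)$, and $(-\Delta)^{s/2}_\Omega u\in L^2(\Omega)$.) Under the eigenvalue condition there is a unique such solution, denoted $u_f$. Non-local Neumann data: $\mathscr{N}_{b,q}(f)(x)=C_{n,t}\int_\Omega\frac{u_f(x)-u_f(y)}{|x-y|^{n+2t}}dy$ for (a.e.) $x\in\Omega_e$. The support of an $L^2(\Omega)$ function in $\Omega$ is the complement in $\Omega$ of the largest open subset of $\Omega$ on which it vanishes a.e. *)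

theory Defs
  imports "HOL-Analysis.Analysis"
begin

text \<open>
  Conventions. The measure is Lebesgue measure on Borel sets (\<open>lborel\<close>). Elements of $L^2$ and
  of Sobolev spaces are represented by Borel functions, and equality of such elements is equality
  almost everywhere. A function on an open set \<open>U\<close> is represented by a function on the whole space
  whose values outside \<open>U\<close> play no role.
\<close>

section \<open>Smooth and compactly supported functions\<close>

primrec iter_deriv :: "'a::euclidean_space list \<Rightarrow> ('a \<Rightarrow> real) \<Rightarrow> 'a \<Rightarrow> real" where
  "iter_deriv [] f = f"
| "iter_deriv (v # vs) f = (\<lambda>x. frechet_derivative (iter_deriv vs f) (at x) v)"

text \<open>$C^\infty$: every iterated directional derivative is differentiable (hence continuous).\<close>

definition smooth :: "('a::euclidean_space \<Rightarrow> real) \<Rightarrow> bool" where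
  "smooth f \<longleftrightarrow> (\<forall>vs x. iter_deriv vs f differentiable (at x))"

definition schwartz :: "('a::euclidean_space \<Rightarrow> real) \<Rightarrow> bool" where
  "schwartz f \<longleftrightarrow> smooth f \<and>
     (\<forall>vs (k::nat). bounded (range (\<lambda>x. (1 + norm x) ^ k * iter_deriv vs f x)))"

text \<open>Elements of $C_c(U)$ and $C_c^\infty(U)$ are identified with their extensions by zero.\<close>

definition Cc :: "'a::euclidean_space set \<Rightarrow> ('a \<Rightarrow> real) set" where
  "Cc U = {f. continuous_on UNIV f \<and> compact (closure {x. f x \<noteq> 0}) \<and> closure {x. f x \<noteq> 0} \<subseteq> U}"

definition Cc_smooth :: "'a::euclidean_space set \<Rightarrow> ('a \<Rightarrow> real) set" where
  "Cc_smooth U = {f \<in> Cc U. smooth f}"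


section \<open>The Fourier transform on L2\<close>

definition L2_on :: "'a::euclidean_space set \<Rightarrow> ('a \<Rightarrow> 'b::{banach, second_countable_topology}) \<Rightarrow> bool" where
  "L2_on U u \<longleftrightarrow> set_borel_measurable lborel U u \<and> set_integrable lborel U (\<lambda>x. (norm (u x))\<^sup>2)"

definition fourier_L1 :: "('a::euclidean_space \<Rightarrow> real) \<Rightarrow> 'a \<Rightarrow> complex" where
  "fourier_L1 u \<xi> = (LINT x|lborel. u x *\<^sub>R cis (- (x \<bullet> \<xi>)))"

text \<open>
  The Fourier--Plancherel transform: the limit in $L^2$, as \<open>R\<close> tends to infinity, of the Fourier
  transforms of the truncations of \<open>u\<close> to balls of radius \<open>R\<close>. It is determined up to null sets.
\<close>

definition fourier :: "('a::euclidean_space \<Rightarrow> real) \<Rightarrow> 'a \<Rightarrow> complex" where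
  "fourier u = (SOME g. L2_on UNIV g \<and>
     ((\<lambda>R. \<integral>\<^sup>+\<xi>. ennreal ((norm (fourier_L1 (\<lambda>x. indicator (ball 0 R) x * u x) \<xi> - g \<xi>))\<^sup>2) \<partial>lborel)
        \<longlongrightarrow> 0) at_top)"


section \<open>Sobolev spaces of nonnegative order\<close>

text \<open>
  Only orders $r \ge 0$ are used, so that $H^r$ consists of $L^2$ functions. Note that
  $\langle\xi\rangle^{2r} = (1+|\xi|^2)^r$.
\<close>

definition sobolev :: "real \<Rightarrow> ('a::euclidean_space \<Rightarrow> real) set" where
  "sobolev r = {u. L2_on UNIV u \<and>
     integrable lborel (\<lambda>\<xi>. (1 + (norm \<xi>)\<^sup>2) powr r * (norm (fourier u \<xi>))\<^sup>2)}"

definition sobolev_norm :: "real \<Rightarrow> ('a::euclidean_space \<Rightarrow> real) \<Rightarrow> real" where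
  "sobolev_norm r u = sqrt (LINT \<xi>|lborel. (1 + (norm \<xi>)\<^sup>2) powr r * (norm (fourier u \<xi>))\<^sup>2)"

definition sobolev_tilde :: "real \<Rightarrow> 'a::euclidean_space set \<Rightarrow> ('a \<Rightarrow> real) set" where
  "sobolev_tilde r U = {u \<in> sobolev r. \<exists>\<phi>::nat \<Rightarrow> 'a \<Rightarrow> real.
     (\<forall>k. \<phi> k \<in> Cc_smooth U) \<and> (\<lambda>k. sobolev_norm r (\<lambda>x. \<phi> k x - u x)) \<longlonglongrightarrow> 0}"

definition sobolev_on :: "real \<Rightarrow> 'a::euclidean_space set \<Rightarrow> ('a \<Rightarrow> real) set" where
  "sobolev_on r U = {u. \<exists>v \<in> sobolev r. \<forall>x\<in>U. u x = v x}"


section \<open>Fractional Laplacians\<close>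

text \<open>The Fourier multiplier $|\xi|^{2a}$, acting on $H^{2a}$; determined up to null sets.\<close>

definition frac_laplacian :: "real \<Rightarrow> ('a::euclidean_space \<Rightarrow> real) \<Rightarrow> 'a \<Rightarrow> real" where
  "frac_laplacian a u = (SOME w. L2_on UNIV w \<and>
     (AE \<xi> in lborel. fourier w \<xi> = of_real (norm \<xi> powr (2 * a)) * fourier u \<xi>))"

text \<open>
  The constant $C_{n,a}$, where \<open>n = DIM('a)\<close>. The limit is the principal value integral.
\<close>

definition frac_const :: "'a::euclidean_space itself \<Rightarrow> real \<Rightarrow> real" where
  "frac_const _ a = (SOME c. c > 0 \<and>
     (\<forall>u :: 'a \<Rightarrow> real. schwartz u \<longrightarrow>
        (AE x in lborel.
           ((\<lambda>\<epsilon>. c * (LINT y:{y. dist x y > \<epsilon>}|lborel.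
                (u x - u y) / norm (x - y) powr (real DIM('a) + 2 * a)))
              \<longlongrightarrow> frac_laplacian a u x) (at_right 0))))"

definition regional_form ::
    "real \<Rightarrow> 'a::euclidean_space set \<Rightarrow> ('a \<Rightarrow> real) \<Rightarrow> ('a \<Rightarrow> real) \<Rightarrow> real" where
  "regional_form a \<Omega> u v = frac_const TYPE('a) a / 2 *
     (LINT x:\<Omega>|lborel. (LINT y:\<Omega>|lborel.
        (u x - u y) * (v x - v y) / norm (x - y) powr (real DIM('a) + 2 * a)))"

text \<open>
  The weak regional fractional Laplacian of \<open>u\<close>, in the case where it is represented by a function
  in $L^2(\Omega)$; that function is determined up to null sets.
\<close>

definition regional_frac_laplacian ::
    "real \<Rightarrow> 'a::euclidean_space set \<Rightarrow> ('a \<Rightarrow> real) \<Rightarrow> 'a \<Rightarrow> real" where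
  "regional_frac_laplacian a \<Omega> u = (SOME w. L2_on \<Omega> w \<and>
     (\<forall>v \<in> sobolev_on a \<Omega>. (LINT x:\<Omega>|lborel. w x * v x) = regional_form a \<Omega> u v))"


section \<open>Domains and supports\<close>

text \<open>
  Near each boundary point, \<open>\<Omega>\<close> is the part above the graph of a Lipschitz function
  over the hyperplane orthogonal to some unit vector \<open>e\<close>.
\<close>

definition bounded_lipschitz_domain :: "'a::euclidean_space set \<Rightarrow> bool" where
  "bounded_lipschitz_domain \<Omega> \<longleftrightarrow>
     open \<Omega> \<and> connected \<Omega> \<and> \<Omega> \<noteq> {} \<and> bounded \<Omega> \<and>
     (\<forall>p \<in> frontier \<Omega>. \<exists>r > 0. \<exists>e. \<exists>L. \<exists>g :: 'a \<Rightarrow> real. norm e = 1 \<and>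
        L-lipschitz_on {y. y \<bullet> e = 0} g \<and>
        \<Omega> \<inter> ball p r = {x \<in> ball p r. x \<bullet> e > g (x - (x \<bullet> e) *\<^sub>R e)})"

definition exterior :: "'a::euclidean_space set \<Rightarrow> 'a set" where
  "exterior \<Omega> = - closure \<Omega>"

definition support_in :: "'a::euclidean_space set \<Rightarrow> ('a \<Rightarrow> real) \<Rightarrow> 'a set" where
  "support_in \<Omega> u = \<Omega> - \<Union>{V. open V \<and> V \<subseteq> \<Omega> \<and> (AE x in lborel. x \<in> V \<longrightarrow> u x = 0)}"


section \<open>The exterior value problem\<close>

definition weak_solution ::
    "real \<Rightarrow> real \<Rightarrow> 'a::euclidean_space set \<Rightarrow> ('a \<Rightarrow> real) \<Rightarrow> ('a \<Rightarrow> real) \<Rightarrow>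
     ('a \<Rightarrow> real) \<Rightarrow> ('a \<Rightarrow> real) \<Rightarrow> bool" where
  "weak_solution s t \<Omega> b q f u \<longleftrightarrow>
     u \<in> sobolev t \<and>
     (AE x in lborel. x \<in> exterior \<Omega> \<longrightarrow> u x = f x) \<and>
     (\<forall>\<phi> \<in> Cc_smooth \<Omega>.
        (LINT x|lborel. frac_laplacian (t / 2) u x * frac_laplacian (t / 2) \<phi> x)
      + (LINT x:\<Omega>|lborel. b x * regional_frac_laplacian (s / 2) \<Omega> u x
                               * regional_frac_laplacian (s / 2) \<Omega> \<phi> x)
      + (LINT x:\<Omega>|lborel. q x * u x * \<phi> x) = 0)"

definition eigenvalue_condition ::
    "real \<Rightarrow> real \<Rightarrow> 'a::euclidean_space set \<Rightarrow> ('a \<Rightarrow> real) \<Rightarrow> ('a \<Rightarrow> real) \<Rightarrow> bool" where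
  "eigenvalue_condition s t \<Omega> b q \<longleftrightarrow>
     (\<forall>\<phi>. weak_solution s t \<Omega> b q (\<lambda>_. 0) \<phi> \<longrightarrow> (AE x in lborel. \<phi> x = 0))"

text \<open>The solution $u_f$, unique up to null sets under the eigenvalue condition.\<close>

definition solution ::
    "real \<Rightarrow> real \<Rightarrow> 'a::euclidean_space set \<Rightarrow> ('a \<Rightarrow> real) \<Rightarrow> ('a \<Rightarrow> real) \<Rightarrow>
     ('a \<Rightarrow> real) \<Rightarrow> 'a \<Rightarrow> real" where
  "solution s t \<Omega> b q f = (SOME u. weak_solution s t \<Omega> b q f u)"

definition nonlocal_neumann ::
    "real \<Rightarrow> real \<Rightarrow> 'a::euclidean_space set \<Rightarrow> ('a \<Rightarrow> real) \<Rightarrow> ('a \<Rightarrow> real) \<Rightarrow>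
     ('a \<Rightarrow> real) \<Rightarrow> 'a \<Rightarrow> real" where
  "nonlocal_neumann s t \<Omega> b q f x = frac_const TYPE('a) t *
     (LINT y:\<Omega>|lborel. (solution s t \<Omega> b q f x - solution s t \<Omega> b q f y)
                          / norm (x - y) powr (real DIM('a) + 2 * t))"

end

theory Submission
  imports Defs "HOL-Probability.Probability"
begin

text \<open>
  The theorem rests on one unique continuation principle, \<open>riesz_potential_unique_continuation\<close>: if
  $g \in L^2$ has compact support $K$ and the potential $\int g(y)\,|x-y|^{-q}\,dy$ vanishes on a non-empty
  open set $W$ away from $K$, then $g = 0$. On $W$ the potential can be differentiated under the integral
  sign, and the Laplacian of $|x-y|^{-q}$ is $q(q+2-n)\,|x-y|^{-q-2}$. Hence the potentials with exponents
  $q, q+2, q+4, \ldots$ all vanish on $W$. By the Weierstrass theorem every continuous radial profile about a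
  point of $W$ then integrates to zero against $g$, in particular the Gaussian one. Moving the centre of the
  Gaussian inside $W$ gives all moments of $g(y)\,e^{-|x-y|^2}$, hence its Fourier transform, hence $g = 0$.

  The principle is used twice. Both solutions equal $f$ outside $\Omega$, so the difference of their Neumann
  data on $\widetilde W$ is a constant multiple of the potential of $1_\Omega (u_1 - u_2)$ with $q = n+2t$;
  therefore $u_1 = u_2 = u$. Subtracting the two weak equations leaves
  $\int (b_1-b_2)\,Au\,A\varphi + \int (q_1-q_2)\,u\,\varphi = 0$ for all test functions $\varphi$, where
  $A = (-\Delta)^{s/2}_\Omega$. For $\varphi$ supported in a small ball of $\Omega$ that avoids the supports
  of the coefficients, the second integral is zero, and on these supports $A\varphi(x)$ is the convergent integral
  $-C\int \varphi(y)\,|x-y|^{-n-s}\,dy$. So the potential of $(b_1-b_2)\,Au$ with $q = n+s$ vanishes in this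
  ball, and the principle gives $(b_1-b_2)\,Au = 0$. The equation that remains gives $(q_1-q_2)\,u = 0$.
  Continuity of the coefficients turns both facts into statements on supports.

  For this argument the operators, which are defined as solutions of their characteristic equations, have
  to be computed. The Plancherel theorem makes $(-\Delta)^a u$, for $u \in H^{2a}$, a multiple of the $L^2$
  limit of truncated singular integrals, whose symbols increase to a multiple of $|\xi|^{2a}$; comparison with
  the pointwise limit for Schwartz functions identifies the constant $C_{n,a}$ and shows that it is positive.
  For a function $U \in H^t$ that vanishes outside $\Omega$, the regional operator is the full one minus
  multiplication by $C_{n,a}\,\kappa_a$ with $\kappa_a(x) = \int_{\mathbb{R}^n\setminus\Omega} |x-y|^{-n-2a}\,dy$, so that one needs
  $\kappa_a U \in L^2$ for $a = s/2$. This is a Hardy inequality: exterior balls at the boundary give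
  $\kappa_a^2 \le C_1 \kappa_t + C_2$ because $2a \le t$, and $\int \kappa_t U^2$ is part of the Gagliardo seminorm of $U$.
\<close>

section \<open>Square-integrable functions\<close>

text \<open>The squared $L^2$ norm is kept in \<^typ>\<open>ennreal\<close>, so that it can be computed before finiteness is known.\<close>

definition norm2sq :: "('a::euclidean_space \<Rightarrow> 'b::real_normed_vector) \<Rightarrow> ennreal" where
  "norm2sq u = (\<integral>\<^sup>+x. ennreal ((norm (u x))\<^sup>2) \<partial>lborel)"

lemma L2_on_UNIV_iff:
  fixes u :: "'a::euclidean_space \<Rightarrow> 'b::{banach, second_countable_topology}"
  shows "L2_on UNIV u \<longleftrightarrow> u \<in> borel_measurable borel \<and> norm2sq u < \<infinity>"
proof -
  have "integrable lborel (\<lambda>x. (norm (u x))\<^sup>2) \<longleftrightarrow> norm2sq u < \<infinity>" if "u \<in> borel_measurable borel"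
    using that by (subst integrable_iff_bounded) (auto simp: norm2sq_def)
  then show ?thesis
    by (auto simp: L2_on_def set_borel_measurable_def set_integrable_def)
qed

lemma L2_measurable [measurable_dest]:
  fixes u :: "'a::euclidean_space \<Rightarrow> 'b::{banach, second_countable_topology}"
  shows "L2_on UNIV u \<Longrightarrow> u \<in> borel_measurable borel"
  by (simp add: L2_on_UNIV_iff)

lemma norm2sq_finite:
  fixes u :: "'a::euclidean_space \<Rightarrow> 'b::{banach, second_countable_topology}"
  shows "L2_on UNIV u \<Longrightarrow> norm2sq u < \<infinity>"
  by (simp add: L2_on_UNIV_iff)

lemma L2_onI:
  fixes u :: "'a::euclidean_space \<Rightarrow> 'b::{banach, second_countable_topology}"
  shows "u \<in> borel_measurable borel \<Longrightarrow> norm2sq u < \<infinity> \<Longrightarrow> L2_on UNIV u"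
  by (simp add: L2_on_UNIV_iff)

lemma L2_on_iff_indicator:
  fixes u :: "'a::euclidean_space \<Rightarrow> 'b::{banach, second_countable_topology}"
  shows "L2_on A u \<longleftrightarrow> L2_on UNIV (\<lambda>x. indicator A x *\<^sub>R u x)"
proof -
  have "(\<lambda>x. indicator A x *\<^sub>R (norm (u x))\<^sup>2) = (\<lambda>x. (norm (indicator A x *\<^sub>R u x))\<^sup>2)"
    by (auto simp: indicator_def)
  then show ?thesis
    by (simp add: L2_on_def set_borel_measurable_def set_integrable_def)
qed

lemma integrable_norm_sq:
  fixes u :: "'a::euclidean_space \<Rightarrow> 'b::{banach, second_countable_topology}"
  shows "L2_on UNIV u \<Longrightarrow> integrable lborel (\<lambda>x. (norm (u x))\<^sup>2)"
  by (simp add: L2_on_def set_integrable_def)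

lemma norm2sq_eq_integral:
  fixes u :: "'a::euclidean_space \<Rightarrow> 'b::{banach, second_countable_topology}"
  assumes "L2_on UNIV u"
  shows "norm2sq u = ennreal (LINT x|lborel. (norm (u x))\<^sup>2)"
  using integrable_norm_sq[OF assms] unfolding norm2sq_def by (intro nn_integral_eq_integral) auto

lemma norm2sq_cong_AE: "(AE x in lborel. u x = v x) \<Longrightarrow> norm2sq u = norm2sq v"
  unfolding norm2sq_def by (intro nn_integral_cong_AE) auto

lemma norm2sq_mono_AE: "(AE x in lborel. norm (u x) \<le> norm (v x)) \<Longrightarrow> norm2sq u \<le> norm2sq v"
  unfolding norm2sq_def by (intro nn_integral_mono_AE) (auto elim!: eventually_mono)

lemma norm2sq_mono: "(\<And>x. norm (u x) \<le> norm (v x)) \<Longrightarrow> norm2sq u \<le> norm2sq v"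
  by (rule norm2sq_mono_AE) auto

lemma norm2sq_minus_commute: "norm2sq (\<lambda>x. u x - v x) = norm2sq (\<lambda>x. v x - u x)"
  by (simp add: norm2sq_def norm_minus_commute)

lemma norm2sq_eq_0_iff:
  fixes u :: "'a::euclidean_space \<Rightarrow> 'b::{banach, second_countable_topology}"
  assumes [measurable]: "u \<in> borel_measurable borel"
  shows "norm2sq u = 0 \<longleftrightarrow> (AE x in lborel. u x = 0)"
  unfolding norm2sq_def by (subst nn_integral_0_iff_AE) (auto simp: ennreal_eq_0_iff)

lemma norm2sq_scaleR: "norm2sq (\<lambda>x. c *\<^sub>R u x) = ennreal (c\<^sup>2) * norm2sq (u :: 'a::euclidean_space \<Rightarrow> 'b::{banach, second_countable_topology})"
  if [measurable]: "u \<in> borel_measurable borel"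
  unfolding norm2sq_def
  by (subst nn_integral_cmult[symmetric]) (auto simp: power_mult_distrib ennreal_mult)

text \<open>The free parameter $d$ keeps the constant in front of one term close to $1$; this yields continuity
  of the squared norm without passing to square roots.\<close>

lemma norm_add_sq_le:
  assumes "(d::real) > 0"
  shows "(norm (x + y))\<^sup>2 \<le> (1 + d) * (norm x)\<^sup>2 + (1 + 1 / d) * (norm (y :: 'b::real_normed_vector))\<^sup>2"
proof -
  have "(norm (x + y))\<^sup>2 \<le> (norm x + norm y)\<^sup>2"
    by (intro power_mono norm_triangle_ineq) auto
  also have "\<dots> = (norm x)\<^sup>2 + (norm y)\<^sup>2 + 2 * (sqrt d * norm x) * (norm y / sqrt d)"
    using assms by (simp add: power2_eq_square algebra_simps)
  also have "2 * (sqrt d * norm x) * (norm y / sqrt d) \<le> (sqrt d * norm x)\<^sup>2 + (norm y / sqrt d)\<^sup>2"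
    by (rule sum_squares_bound)
  also have "(sqrt d * norm x)\<^sup>2 + (norm y / sqrt d)\<^sup>2 = d * (norm x)\<^sup>2 + (norm y)\<^sup>2 / d"
    using assms by (simp add: power_mult_distrib power_divide)
  finally show ?thesis by (simp add: algebra_simps)
qed

lemma norm2sq_add_le_weighted:
  fixes u v :: "'a::euclidean_space \<Rightarrow> 'b::{banach, second_countable_topology}"
  assumes [measurable]: "u \<in> borel_measurable borel" "v \<in> borel_measurable borel" and d: "d > 0"
  shows "norm2sq (\<lambda>x. u x + v x) \<le> ennreal (1 + d) * norm2sq u + ennreal (1 + 1 / d) * norm2sq v"
proof -
  have "norm2sq (\<lambda>x. u x + v x)
      \<le> (\<integral>\<^sup>+x. ennreal (1 + d) * ennreal ((norm (u x))\<^sup>2) + ennreal (1 + 1 / d) * ennreal ((norm (v x))\<^sup>2) \<partial>lborel)"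
    unfolding norm2sq_def using d norm_add_sq_le[OF d]
    by (intro nn_integral_mono) (auto simp: ennreal_mult[symmetric] ennreal_plus[symmetric] simp del: ennreal_plus intro!: ennreal_leI)
  also have "\<dots> = ennreal (1 + d) * norm2sq u + ennreal (1 + 1 / d) * norm2sq v"
    unfolding norm2sq_def by (subst nn_integral_add) (auto simp: nn_integral_cmult)
  finally show ?thesis .
qed

lemma norm2sq_add_le:
  fixes u v :: "'a::euclidean_space \<Rightarrow> 'b::{banach, second_countable_topology}"
  assumes "u \<in> borel_measurable borel" "v \<in> borel_measurable borel"
  shows "norm2sq (\<lambda>x. u x + v x) \<le> 2 * norm2sq u + 2 * norm2sq v"
  using norm2sq_add_le_weighted[OF assms, of 1] by simp

lemma norm2sq_triangle:
  fixes u v w :: "'a::euclidean_space \<Rightarrow> 'b::{banach, second_countable_topology}"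
  assumes [measurable]: "u \<in> borel_measurable borel" "v \<in> borel_measurable borel" "w \<in> borel_measurable borel"
  shows "norm2sq (\<lambda>x. u x - w x) \<le> 2 * norm2sq (\<lambda>x. u x - v x) + 2 * norm2sq (\<lambda>x. v x - w x)"
  using norm2sq_add_le[of "\<lambda>x. u x - v x" "\<lambda>x. v x - w x"] by simp

lemma L2_add:
  fixes u v :: "'a::euclidean_space \<Rightarrow> 'b::{banach, second_countable_topology}"
  assumes "L2_on UNIV u" "L2_on UNIV v" shows "L2_on UNIV (\<lambda>x. u x + v x)"
proof -
  note [measurable] = assms[THEN L2_measurable]
  show ?thesis
    using norm2sq_add_le[of u v] assms[THEN norm2sq_finite]
    by (intro L2_onI) (auto simp: ennreal_mult_less_top elim!: order.strict_trans1 intro!: ennreal_mult_less_top)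
qed

lemma L2_scaleR:
  fixes u :: "'a::euclidean_space \<Rightarrow> 'b::{banach, second_countable_topology}"
  assumes "L2_on UNIV u" shows "L2_on UNIV (\<lambda>x. c *\<^sub>R u x)"
proof -
  note [measurable] = assms[THEN L2_measurable]
  show ?thesis
    using norm2sq_finite[OF assms] by (intro L2_onI) (auto simp: norm2sq_scaleR ennreal_mult_less_top)
qed

lemma L2_cmult: "L2_on UNIV u \<Longrightarrow> L2_on UNIV (\<lambda>x. c * u x)" for u :: "'a::euclidean_space \<Rightarrow> real"
  using L2_scaleR[of u c] by simp

lemma L2_diff:
  fixes u v :: "'a::euclidean_space \<Rightarrow> 'b::{banach, second_countable_topology}"
  assumes "L2_on UNIV u" "L2_on UNIV v" shows "L2_on UNIV (\<lambda>x. u x - v x)"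
  using L2_add[OF assms(1) L2_scaleR[OF assms(2), of "-1"]] by simp

lemma L2_0: "L2_on UNIV (\<lambda>x::'a::euclidean_space. 0::'b::{banach, second_countable_topology})"
  by (intro L2_onI) (auto simp: norm2sq_def)

lemma L2_indicator:
  fixes S :: "'a::euclidean_space set"
  assumes S: "S \<in> sets borel" "bounded S"
  shows "L2_on UNIV (indicator S :: 'a \<Rightarrow> real)"
proof (rule L2_onI)
  have "norm2sq (indicator S :: 'a \<Rightarrow> real) = (\<integral>\<^sup>+x. indicator S x \<partial>lborel)"
    unfolding norm2sq_def by (intro nn_integral_cong) (auto simp: indicator_def)
  also have "\<dots> = emeasure lborel S" using S by simp
  also have "\<dots> < \<infinity>" using S(2) by (rule emeasure_bounded_finite)
  finally show "norm2sq (indicator S :: 'a \<Rightarrow> real) < \<infinity>" .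
qed (use S in auto)

lemma L2_dominated:
  fixes u :: "'a::euclidean_space \<Rightarrow> 'b::{banach, second_countable_topology}"
    and v :: "'a::euclidean_space \<Rightarrow> 'c::{banach, second_countable_topology}"
  assumes "u \<in> borel_measurable borel" "L2_on UNIV v" "AE x in lborel. norm (u x) \<le> norm (v x)"
  shows "L2_on UNIV u"
  using norm2sq_finite[OF assms(2)] norm2sq_mono_AE[OF assms(3)] assms(1)
  by (intro L2_onI) auto

lemma L2_cong_AE:
  fixes u v :: "'a::euclidean_space \<Rightarrow> 'b::{banach, second_countable_topology}"
  assumes "v \<in> borel_measurable borel" "L2_on UNIV u" "AE x in lborel. u x = v x"
  shows "L2_on UNIV v"
  using assms by (intro L2_dominated[OF assms(1,2)]) auto

lemma tendsto_0_ennreal_realI: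
  fixes f :: "'c \<Rightarrow> ennreal"
  assumes "\<And>e::real. e > 0 \<Longrightarrow> eventually (\<lambda>x. f x \<le> ennreal e) F"
  shows "(f \<longlongrightarrow> 0) F"
proof (rule order_tendstoI)
  fix a :: ennreal assume "0 < a"
  then obtain e where e: "0 < e" "e < a" by (rule dense[THEN exE]) auto
  then obtain r where r: "e = ennreal r" "r > 0" by (cases e) (auto simp: top_unique ennreal_less_zero_iff)
  show "eventually (\<lambda>x. f x < a) F" using assms[OF r(2)] by eventually_elim (use e r in auto)
qed auto

lemma tendsto_0_bound_ennreal:
  fixes f :: "'c \<Rightarrow> ennreal"
  assumes "(g \<longlongrightarrow> 0) F" "eventually (\<lambda>x. f x \<le> g x) F"
  shows "(f \<longlongrightarrow> 0) F"
  by (rule tendsto_sandwich[OF _ assms(2) tendsto_const assms(1)]) auto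

lemma tendsto_0_cmult_ennreal:
  fixes f :: "'c \<Rightarrow> ennreal"
  assumes "(f \<longlongrightarrow> 0) F" "c < \<infinity>"
  shows "((\<lambda>x. c * f x) \<longlongrightarrow> 0) F"
  using ennreal_tendsto_cmult[OF _ assms(1), of c] assms(2) by simp

lemma tendsto_0_add_ennreal:
  fixes f g :: "'c \<Rightarrow> ennreal"
  assumes "(f \<longlongrightarrow> 0) F" "(g \<longlongrightarrow> 0) F"
  shows "((\<lambda>x. f x + g x) \<longlongrightarrow> 0) F"
  using tendsto_add[OF assms] by simp

lemma norm2sq_tendsto_add:
  fixes u v :: "'k \<Rightarrow> 'a::euclidean_space \<Rightarrow> 'b::{banach, second_countable_topology}"
  assumes "\<And>k. u k \<in> borel_measurable borel" "\<And>k. v k \<in> borel_measurable borel"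
    and "((\<lambda>k. norm2sq (u k)) \<longlongrightarrow> 0) F" "((\<lambda>k. norm2sq (v k)) \<longlongrightarrow> 0) F"
  shows "((\<lambda>k. norm2sq (\<lambda>x. u k x + v k x)) \<longlongrightarrow> 0) F"
  using tendsto_0_add_ennreal[OF assms(3,4)[THEN tendsto_0_cmult_ennreal[of _ _ 2]]] norm2sq_add_le[OF assms(1,2)]
  by (auto elim!: tendsto_0_bound_ennreal)

lemma norm2sq_convergent_Cauchy:
  fixes u :: "nat \<Rightarrow> 'a::euclidean_space \<Rightarrow> 'b::{banach, second_countable_topology}"
  assumes [measurable]: "\<And>k. u k \<in> borel_measurable borel" "w \<in> borel_measurable borel"
    and lim: "(\<lambda>k. norm2sq (\<lambda>x. u k x - w x)) \<longlonglongrightarrow> 0" and e: "(e::real) > 0"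
  shows "\<exists>N. \<forall>m\<ge>N. \<forall>n\<ge>N. norm2sq (\<lambda>x. u m x - u n x) \<le> ennreal e"
proof -
  have "\<forall>\<^sub>F k in sequentially. norm2sq (\<lambda>x. u k x - w x) < ennreal (e / 4)"
    using order_tendstoD(2)[OF lim] e by simp
  then obtain N where N: "\<And>k. k \<ge> N \<Longrightarrow> norm2sq (\<lambda>x. u k x - w x) < ennreal (e / 4)"
    by (auto simp: eventually_sequentially)
  have "norm2sq (\<lambda>x. u m x - u n x) \<le> ennreal e" if "m \<ge> N" "n \<ge> N" for m n
  proof -
    have "norm2sq (\<lambda>x. u m x - u n x) \<le> 2 * norm2sq (\<lambda>x. u m x - w x) + 2 * norm2sq (\<lambda>x. w x - u n x)"
      by (rule norm2sq_triangle) auto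
    also have "\<dots> \<le> 2 * ennreal (e / 4) + 2 * ennreal (e / 4)"
      using N[OF that(1)] N[OF that(2)] by (intro add_mono mult_left_mono) (auto simp: norm2sq_minus_commute[of w])
    also have "\<dots> = (2 + 2) * ennreal (e / 4)" by (simp only: distrib_right)
    also have "\<dots> = ennreal (4 * (e / 4))" using e by (subst ennreal_mult) auto
    finally show ?thesis by simp
  qed
  then show ?thesis by blast
qed

lemma norm2sq_limit_unique:
  fixes u :: "'k \<Rightarrow> 'a::euclidean_space \<Rightarrow> 'b::{banach, second_countable_topology}"
  assumes [measurable]: "\<And>k. u k \<in> borel_measurable borel" "v \<in> borel_measurable borel" "w \<in> borel_measurable borel"
    and F: "F \<noteq> bot"
    and "((\<lambda>k. norm2sq (\<lambda>x. u k x - v x)) \<longlongrightarrow> 0) F" "((\<lambda>k. norm2sq (\<lambda>x. u k x - w x)) \<longlongrightarrow> 0) F"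
  shows "AE x in lborel. v x = w x"
proof -
  have "((\<lambda>k. norm2sq (\<lambda>x. (v x - u k x) + (u k x - w x))) \<longlongrightarrow> 0) F"
    by (rule norm2sq_tendsto_add) (use assms in \<open>auto simp: norm2sq_minus_commute[of v]\<close>)
  then have "((\<lambda>k. norm2sq (\<lambda>x. v x - w x)) \<longlongrightarrow> 0) F" by simp
  then have "norm2sq (\<lambda>x. v x - w x) = 0"
    using F by (simp add: tendsto_const_iff)
  then show ?thesis by (subst (asm) norm2sq_eq_0_iff) auto
qed

lemma norm2sq_dominated:
  fixes u :: "nat \<Rightarrow> 'a::euclidean_space \<Rightarrow> 'b::{banach, second_countable_topology}"
    and g :: "'a::euclidean_space \<Rightarrow> real"
  assumes [measurable]: "\<And>k. u k \<in> borel_measurable borel" "w \<in> borel_measurable borel"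
    and g: "L2_on UNIV g"
    and bd: "\<And>k. AE x in lborel. norm (u k x) \<le> g x"
    and lim: "AE x in lborel. (\<lambda>k. u k x) \<longlonglongrightarrow> w x"
  shows "(\<lambda>k. norm2sq (\<lambda>x. u k x - w x)) \<longlonglongrightarrow> 0"
proof -
  note [measurable] = L2_measurable[OF g]
  have bd': "AE x in lborel. \<forall>k. norm (u k x) \<le> g x"
    using bd by (simp add: AE_all_countable)
  have bdw: "AE x in lborel. norm (w x) \<le> g x"
    using lim bd'
  proof eventually_elim
    case (elim x)
    then show ?case by (intro tendsto_upperbound[OF tendsto_norm[OF elim(1)]]) auto
  qed
  have "(\<lambda>k. \<integral>\<^sup>+x. ennreal ((norm (u k x - w x))\<^sup>2) \<partial>lborel) \<longlonglongrightarrow> (\<integral>\<^sup>+x. 0 \<partial>(lborel::'a measure))"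
  proof (rule nn_integral_dominated_convergence[where w="\<lambda>x. ennreal (4 * (norm (g x))\<^sup>2)"])
    show "AE x in lborel. ennreal ((norm (u k x - w x))\<^sup>2) \<le> ennreal (4 * (norm (g x))\<^sup>2)" for k
      using bd[of k] bdw
    proof eventually_elim
      case (elim x)
      have "norm (u k x - w x) \<le> norm (u k x) + norm (w x)" by (rule norm_triangle_ineq4)
      with elim have "norm (u k x - w x) \<le> 2 * norm (g x)" by auto
      then have "(norm (u k x - w x))\<^sup>2 \<le> (2 * norm (g x))\<^sup>2" by (intro power_mono) auto
      then show ?case by (intro ennreal_leI) (simp add: power_mult_distrib)
    qed
    show "(\<integral>\<^sup>+x. ennreal (4 * (norm (g x))\<^sup>2) \<partial>lborel) < \<infinity>"
      using norm2sq_finite[OF g] by (simp add: ennreal_mult nn_integral_cmult norm2sq_def ennreal_mult_less_top)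
    show "AE x in lborel. (\<lambda>k. ennreal ((norm (u k x - w x))\<^sup>2)) \<longlonglongrightarrow> 0"
      using lim
    proof eventually_elim
      case (elim x)
      then have "(\<lambda>k. (norm (u k x - w x))\<^sup>2) \<longlonglongrightarrow> (norm (w x - w x))\<^sup>2"
        by (intro tendsto_intros)
      then show ?case by (intro tendsto_ennrealI[where x=0, simplified]) simp
    qed
  qed auto
  then show ?thesis by (simp add: norm2sq_def)
qed

lemma norm2sq_fatou:
  fixes u :: "nat \<Rightarrow> 'a::euclidean_space \<Rightarrow> 'b::{banach, second_countable_topology}"
  assumes [measurable]: "\<And>k. u k \<in> borel_measurable borel"
    and lim: "AE x in lborel. (\<lambda>k. u k x) \<longlonglongrightarrow> w x"
  shows "norm2sq w \<le> liminf (\<lambda>k. norm2sq (u k))"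
proof -
  have "norm2sq w = (\<integral>\<^sup>+x. liminf (\<lambda>k. ennreal ((norm (u k x))\<^sup>2)) \<partial>lborel)"
    unfolding norm2sq_def
  proof (rule nn_integral_cong_AE)
    show "AE x in lborel. ennreal ((norm (w x))\<^sup>2) = liminf (\<lambda>k. ennreal ((norm (u k x))\<^sup>2))"
      using lim
    proof eventually_elim
      case (elim x)
      then have "(\<lambda>k. ennreal ((norm (u k x))\<^sup>2)) \<longlonglongrightarrow> ennreal ((norm (w x))\<^sup>2)"
        by (intro tendsto_intros)
      then show ?case by (intro lim_imp_Liminf[symmetric]) auto
    qed
  qed
  also have "\<dots> \<le> liminf (\<lambda>k. norm2sq (u k))"
    unfolding norm2sq_def by (rule nn_integral_liminf) auto
  finally show ?thesis .
qed

lemma norm2sq_limit_pointwise: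
  fixes u :: "nat \<Rightarrow> 'a::euclidean_space \<Rightarrow> 'b::{banach, second_countable_topology}"
  assumes [measurable]: "\<And>k. u k \<in> borel_measurable borel" "w \<in> borel_measurable borel" "v \<in> borel_measurable borel"
    and lim: "AE x in lborel. (\<lambda>k. u k x) \<longlonglongrightarrow> w x"
    and L2: "(\<lambda>k. norm2sq (\<lambda>x. u k x - v x)) \<longlonglongrightarrow> 0"
  shows "AE x in lborel. w x = v x"
proof -
  have "norm2sq (\<lambda>x. w x - v x) \<le> liminf (\<lambda>k. norm2sq (\<lambda>x. u k x - v x))"
    by (rule norm2sq_fatou) (use lim in \<open>auto elim!: eventually_mono intro!: tendsto_intros\<close>)
  also have "\<dots> = 0" using lim_imp_Liminf[OF _ L2] by simp
  finally show ?thesis by (simp add: norm2sq_eq_0_iff)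
qed

text \<open>The Riesz--Fischer theorem: a rapidly Cauchy subsequence converges almost everywhere, and the lemma
  of Fatou shows that its pointwise limit is also the limit in norm.\<close>

lemma L2_complete:
  fixes u :: "nat \<Rightarrow> 'a::euclidean_space \<Rightarrow> 'b::{banach, second_countable_topology}"
  assumes L2: "\<And>k. L2_on UNIV (u k)"
    and Cauchy: "\<And>e::real. e > 0 \<Longrightarrow> \<exists>N. \<forall>m\<ge>N. \<forall>n\<ge>N. norm2sq (\<lambda>x. u m x - u n x) \<le> ennreal e"
  obtains w where "L2_on UNIV w" "(\<lambda>k. norm2sq (\<lambda>x. u k x - w x)) \<longlonglongrightarrow> 0"
proof -
  note [measurable] = L2[THEN L2_measurable]
  \<comment> \<open>The bound $8^{-j}$ leaves room for the weights $2^j$ below, which force geometric decay of the differences.\<close>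
  have "\<forall>j::nat. \<exists>N. \<forall>m\<ge>N. \<forall>n\<ge>N. norm2sq (\<lambda>x. u m x - u n x) \<le> ennreal ((1/8)^j)"
    using Cauchy by simp
  then obtain N where N: "\<And>j m n. m \<ge> N j \<Longrightarrow> n \<ge> N j \<Longrightarrow> norm2sq (\<lambda>x. u m x - u n x) \<le> ennreal ((1/8)^j)"
    by metis
  define r where "r j = j + (\<Sum>i\<le>j. N i)" for j
  have r1: "N j \<le> r j" for j unfolding r_def using member_le_sum[of j "{..j}" N] by auto
  have r2: "N j \<le> r (Suc j)" for j using r1[of j] unfolding r_def by simp
  define d where "d j x = u (r (Suc j)) x - u (r j) x" for j x
  have [measurable]: "d j \<in> borel_measurable borel" for j unfolding d_def[abs_def] by measurable
  have dj: "norm2sq (d j) \<le> ennreal ((1/8)^j)" for j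
    unfolding d_def[abs_def] by (rule N[OF r2 r1])
  have "(\<integral>\<^sup>+x. (\<Sum>j. ennreal (2^j) * ennreal ((norm (d j x))\<^sup>2)) \<partial>lborel) = (\<Sum>j. ennreal (2^j) * norm2sq (d j))"
    by (subst nn_integral_suminf) (auto simp: nn_integral_cmult norm2sq_def)
  also have "\<dots> \<le> (\<Sum>j. ennreal ((1/4)^j))"
  proof (rule suminf_le)
    show "ennreal (2^j) * norm2sq (d j) \<le> ennreal ((1/4)^j)" for j
    proof -
      have "ennreal (2^j) * norm2sq (d j) \<le> ennreal (2^j) * ennreal ((1/8)^j)"
        by (intro mult_left_mono dj) auto
      also have "\<dots> = ennreal ((2 * (1/8))^j)" by (subst power_mult_distrib) (rule ennreal_mult[symmetric]; simp)
      finally show ?thesis by simp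
    qed
  qed auto
  also have "\<dots> < \<infinity>"
    using summable_geometric[of "1/4::real"] by (subst suminf_ennreal2) (auto)
  finally have "AE x in lborel. (\<Sum>j. ennreal (2^j) * ennreal ((norm (d j x))\<^sup>2)) \<noteq> \<infinity>"
    by (intro nn_integral_PInf_AE) auto
  then have conv: "AE x in lborel. convergent (\<lambda>j. u (r j) x)"
  proof eventually_elim
    case (elim x)
    then obtain M where M: "(\<Sum>j. ennreal (2^j) * ennreal ((norm (d j x))\<^sup>2)) = ennreal M" "M \<ge> 0"
      by (cases "(\<Sum>j. ennreal (2^j) * ennreal ((norm (d j x))\<^sup>2))") auto
    have "norm (d j x) \<le> sqrt M * (sqrt (1/2))^j" for j
    proof -
      have "ennreal (2^j) * ennreal ((norm (d j x))\<^sup>2) \<le> (\<Sum>j. ennreal (2^j) * ennreal ((norm (d j x))\<^sup>2))"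
        using sum_le_suminf[of "\<lambda>j. ennreal (2^j) * ennreal ((norm (d j x))\<^sup>2)" "{j}"] by auto
      then have "ennreal (2^j * (norm (d j x))\<^sup>2) \<le> ennreal M"
        unfolding M by (subst ennreal_mult) auto
      then have "2^j * (norm (d j x))\<^sup>2 \<le> M" using M(2) by (simp add: ennreal_le_iff)
      then have "(norm (d j x))\<^sup>2 \<le> M * (1/2)^j" by (simp add: field_simps power_divide)
      then have "sqrt ((norm (d j x))\<^sup>2) \<le> sqrt (M * (1/2)^j)" by (rule real_sqrt_le_mono)
      then show ?thesis by (simp add: real_sqrt_mult real_sqrt_power)
    qed
    then have "summable (\<lambda>j. d j x)"
      by (intro summable_comparison_test'[OF summable_mult[OF summable_geometric[of "sqrt (1/2)"]], of 0])
         (auto simp: real_sqrt_divide)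
    then have "convergent (\<lambda>n. \<Sum>j<n. d j x)" by (simp add: summable_iff_convergent)
    moreover have "(\<Sum>j<n. d j x) = u (r n) x - u (r 0) x" for n
      unfolding d_def by (rule sum_lessThan_telescope)
    ultimately have "convergent (\<lambda>n. (u (r n) x - u (r 0) x) + u (r 0) x)"
      by (intro convergent_add convergent_const) simp
    then show ?case by simp
  qed
  define w where "w x = lim (\<lambda>j. u (r j) x)" for x
  have [measurable]: "w \<in> borel_measurable borel" unfolding w_def[abs_def] by measurable
  have lim: "AE x in lborel. (\<lambda>j. u (r j) x) \<longlonglongrightarrow> w x"
    using conv by eventually_elim (simp add: w_def convergent_LIMSEQ_iff)
  have key: "\<exists>K. \<forall>n\<ge>K. norm2sq (\<lambda>x. u n x - w x) \<le> ennreal e" if e: "e > 0" for e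
  proof -
    obtain K where K: "\<And>m n. m \<ge> K \<Longrightarrow> n \<ge> K \<Longrightarrow> norm2sq (\<lambda>x. u m x - u n x) \<le> ennreal e"
      using Cauchy[OF e] by metis
    have "norm2sq (\<lambda>x. u n x - w x) \<le> ennreal e" if n: "n \<ge> K" for n
    proof -
      have "norm2sq (\<lambda>x. u n x - w x) \<le> liminf (\<lambda>j. norm2sq (\<lambda>x. u n x - u (r j) x))"
        by (rule norm2sq_fatou) (use lim in \<open>auto elim!: eventually_mono intro!: tendsto_intros\<close>)
      also have "\<dots> \<le> limsup (\<lambda>j. norm2sq (\<lambda>x. u n x - u (r j) x))" by (rule Liminf_le_Limsup) auto
      also have "\<dots> \<le> ennreal e"
      proof (rule Limsup_bounded)
        show "\<forall>\<^sub>F j in sequentially. norm2sq (\<lambda>x. u n x - u (r j) x) \<le> ennreal e"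
          using eventually_ge_at_top[of K] by eventually_elim (rule K[OF n], simp add: r_def)
      qed
      finally show ?thesis .
    qed
    then show ?thesis by blast
  qed
  have tends: "(\<lambda>k. norm2sq (\<lambda>x. u k x - w x)) \<longlonglongrightarrow> 0"
  proof (rule tendsto_0_ennreal_realI)
    fix e :: real assume "e > 0"
    from key[OF this] show "\<forall>\<^sub>F k in sequentially. norm2sq (\<lambda>x. u k x - w x) \<le> ennreal e"
      by (auto simp: eventually_sequentially)
  qed
  obtain K where "norm2sq (\<lambda>x. u K x - w x) \<le> ennreal 1" using key[of 1] by auto
  then have "norm2sq (\<lambda>x. u K x - w x) < \<infinity>" using ennreal_less_top[of 1] by (metis infinity_ennreal_def order.strict_trans1)
  then have "L2_on UNIV (\<lambda>x. u K x - w x)" by (intro L2_onI) auto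
  from L2_diff[OF L2[of K] this] have "L2_on UNIV w" by simp
  then show ?thesis using tends by (rule that)
qed

lemma norm2sq_tendsto:
  fixes u :: "nat \<Rightarrow> 'a::euclidean_space \<Rightarrow> 'b::{banach, second_countable_topology}"
  assumes u: "\<And>k. L2_on UNIV (u k)"
    and w: "L2_on UNIV w" and lim: "(\<lambda>k. norm2sq (\<lambda>x. u k x - w x)) \<longlonglongrightarrow> 0"
  shows "(\<lambda>k. norm2sq (u k)) \<longlonglongrightarrow> norm2sq w"
proof -
  note [measurable] = u[THEN L2_measurable] w[THEN L2_measurable]
  define A where "A = enn2real (norm2sq w)"
  define B where "B k = enn2real (norm2sq (u k))" for k
  define D where "D k = enn2real (norm2sq (\<lambda>x. u k x - w x))" for k
  have A: "norm2sq w = ennreal A" "A \<ge> 0" using norm2sq_finite[OF w] by (auto simp: A_def)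
  have B: "norm2sq (u k) = ennreal (B k)" "B k \<ge> 0" for k using norm2sq_finite[OF u] by (auto simp: B_def)
  have D: "norm2sq (\<lambda>x. u k x - w x) = ennreal (D k)" "D k \<ge> 0" for k
    using norm2sq_finite[OF L2_diff[OF u w]] by (auto simp: D_def)
  have D0: "D \<longlonglongrightarrow> 0" using lim unfolding D(1) by (subst (asm) ennreal_0[symmetric], subst (asm) tendsto_ennreal_iff) (auto simp: D)
  have ineq1: "B k \<le> (1 + d) * A + (1 + 1 / d) * D k" if d: "d > 0" for k d
  proof -
    have "norm2sq (\<lambda>x. w x + (u k x - w x)) \<le> ennreal (1 + d) * norm2sq w + ennreal (1 + 1/d) * norm2sq (\<lambda>x. u k x - w x)"
      by (rule norm2sq_add_le_weighted) (use d in auto)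
    then have "ennreal (B k) \<le> ennreal ((1 + d) * A + (1 + 1/d) * D k)"
      using d A D by (simp add: A B D ennreal_mult ennreal_plus)
    then show ?thesis using d A(2) D(2)[of k] by (subst (asm) ennreal_le_iff) auto
  qed
  have ineq2: "A \<le> (1 + d) * B k + (1 + 1 / d) * D k" if d: "d > 0" for k d
  proof -
    have "norm2sq (\<lambda>x. u k x + (w x - u k x)) \<le> ennreal (1 + d) * norm2sq (u k) + ennreal (1 + 1/d) * norm2sq (\<lambda>x. w x - u k x)"
      by (rule norm2sq_add_le_weighted) (use d in auto)
    then have "ennreal A \<le> ennreal ((1 + d) * B k + (1 + 1/d) * D k)"
      using d B D by (simp add: A B D ennreal_mult ennreal_plus norm2sq_minus_commute[of w])
    then show ?thesis using d B(2)[of k] D(2)[of k] by (subst (asm) ennreal_le_iff) auto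
  qed
  have "B \<longlonglongrightarrow> A"
  proof (rule tendstoI)
    fix e :: real assume e: "e > 0"
    define d where "d = min 1 (e / (4 * (A + 1)))"
    have d: "d > 0" "d \<le> 1" "4 * d * A < e"
    proof -
      have "4 * d * A \<le> 4 * (e / (4 * (A + 1))) * A"
        using A(2) by (intro mult_right_mono mult_left_mono) (auto simp: d_def)
      also have "\<dots> = e * (A / (A + 1))" using A(2) by (simp add: field_simps)
      also have "\<dots> < e * 1" using e A(2) by (intro mult_strict_left_mono) auto
      finally show "4 * d * A < e" by simp
    qed (use e A in \<open>auto simp: d_def\<close>)
    have "(\<lambda>k. 4 * ((1 + 1/d) * D k)) \<longlonglongrightarrow> 4 * ((1 + 1/d) * 0)" by (intro tendsto_intros D0)
    then have "\<forall>\<^sub>F k in sequentially. 4 * ((1 + 1/d) * D k) < e"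
      using e by (intro order_tendstoD) auto
    then show "\<forall>\<^sub>F k in sequentially. dist (B k) A < e"
    proof eventually_elim
      case (elim k)
      let ?X = "(1 + 1/d) * D k"
      have X: "0 \<le> ?X" "4 * ?X < e" using d D(2)[of k] elim by auto
      have i1: "B k \<le> A + d * A + ?X" using ineq1[OF d(1), of k] by (simp add: algebra_simps)
      have "d * B k \<le> d * (A + d * A + ?X)" using i1 d by (intro mult_left_mono) auto
      also have "\<dots> = d * A + d * (d * A) + d * ?X" by (simp add: distrib_left)
      also have "\<dots> \<le> d * A + 1 * (d * A) + 1 * ?X"
        using d A X by (intro add_mono mult_right_mono) auto
      finally have "d * B k \<le> 2 * (d * A) + ?X" by (simp add: mult.commute)
      moreover have "A \<le> B k + d * B k + ?X" using ineq2[OF d(1), of k] by (simp add: algebra_simps)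
      ultimately have "A \<le> B k + 2 * (d * A) + 2 * ?X" by linarith
      moreover have "0 \<le> d * A" using d A by simp
      ultimately show ?case using i1 d(3) X unfolding dist_real_def by linarith
    qed
  qed
  then show ?thesis unfolding A(1) B(1) by (intro tendsto_ennrealI)
qed

lemma L2_inner_bound:
  fixes u v :: "'a::euclidean_space \<Rightarrow> real"
  assumes u: "L2_on UNIV u" and v: "L2_on UNIV v"
  shows integrable_L2_mult: "integrable lborel (\<lambda>x. u x * v x)"
    and L2_Cauchy_Schwarz: "(\<integral>\<^sup>+x. ennreal \<bar>u x * v x\<bar> \<partial>lborel)\<^sup>2 \<le> norm2sq u * norm2sq v"
proof -
  note [measurable] = u[THEN L2_measurable] v[THEN L2_measurable]
  have "(\<integral>\<^sup>+x. ennreal \<bar>u x\<bar> * ennreal \<bar>v x\<bar> \<partial>lborel)\<^sup>2 \<le> (\<integral>\<^sup>+x. (ennreal \<bar>u x\<bar>)\<^sup>2 \<partial>lborel) * (\<integral>\<^sup>+x. (ennreal \<bar>v x\<bar>)\<^sup>2 \<partial>lborel)"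
    by (rule Cauchy_Schwarz_nn_integral) auto
  then show CS: "(\<integral>\<^sup>+x. ennreal \<bar>u x * v x\<bar> \<partial>lborel)\<^sup>2 \<le> norm2sq u * norm2sq v"
    by (simp add: norm2sq_def abs_mult ennreal_mult ennreal_power)
  have "norm2sq u * norm2sq v < \<infinity>" using norm2sq_finite[OF u] norm2sq_finite[OF v] by (auto simp: ennreal_mult_less_top)
  with CS have "(\<integral>\<^sup>+x. ennreal \<bar>u x * v x\<bar> \<partial>lborel)\<^sup>2 < \<infinity>" by (rule order.strict_trans1)
  then have "(\<integral>\<^sup>+x. ennreal \<bar>u x * v x\<bar> \<partial>lborel) < \<infinity>"
    by (auto simp: power2_eq_square ennreal_mult_less_top ennreal_mult_eq_top_iff less_top)
  then show "integrable lborel (\<lambda>x. u x * v x)"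
    by (subst integrable_iff_bounded) auto
qed

lemma L2_inner_tendsto:
  fixes u :: "nat \<Rightarrow> 'a::euclidean_space \<Rightarrow> real"
  assumes u: "\<And>k. L2_on UNIV (u k)" and w: "L2_on UNIV w" and v: "L2_on UNIV v"
    and lim: "(\<lambda>k. norm2sq (\<lambda>x. u k x - w x)) \<longlonglongrightarrow> 0"
  shows "(\<lambda>k. LINT x|lborel. u k x * v x) \<longlonglongrightarrow> (LINT x|lborel. w x * v x)"
proof -
  note uw = L2_diff[OF u w]
  note [measurable] = u[THEN L2_measurable] v[THEN L2_measurable] w[THEN L2_measurable]
  have bound: "norm (LINT x|lborel. (u k x - w x) * v x) \<le> sqrt (enn2real (norm2sq (\<lambda>x. u k x - w x) * norm2sq v))" for k
  proof -
    let ?I = "LINT x|lborel. \<bar>(u k x - w x) * v x\<bar>"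
    have i: "integrable lborel (\<lambda>x. \<bar>(u k x - w x) * v x\<bar>)" by (intro integrable_abs integrable_L2_mult[OF uw v])
    have "(ennreal ?I)\<^sup>2 \<le> norm2sq (\<lambda>x. u k x - w x) * norm2sq v"
      using L2_Cauchy_Schwarz[OF uw[of k] v] nn_integral_eq_integral[OF i] by simp
    then have "ennreal (?I\<^sup>2) \<le> norm2sq (\<lambda>x. u k x - w x) * norm2sq v"
      by (subst ennreal_power[symmetric]) auto
    then have "?I\<^sup>2 \<le> enn2real (norm2sq (\<lambda>x. u k x - w x) * norm2sq v)"
      using norm2sq_finite[OF uw[of k]] norm2sq_finite[OF v]
      by (subst ennreal_le_iff[symmetric]) (auto simp: ennreal_mult_less_top)
    then have "?I \<le> sqrt (enn2real (norm2sq (\<lambda>x. u k x - w x) * norm2sq v))"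
      by (simp add: real_le_rsqrt)
    moreover have "norm (LINT x|lborel. (u k x - w x) * v x) \<le> ?I"
      using integral_norm_bound[of lborel "\<lambda>x. (u k x - w x) * v x"] by simp
    ultimately show ?thesis by linarith
  qed
  have "(\<lambda>k. norm2sq (\<lambda>x. u k x - w x) * norm2sq v) \<longlonglongrightarrow> ennreal 0"
    using tendsto_0_cmult_ennreal[OF lim norm2sq_finite[OF v]] by (simp add: mult.commute)
  then have "(\<lambda>k. enn2real (norm2sq (\<lambda>x. u k x - w x) * norm2sq v)) \<longlonglongrightarrow> 0"
    by (rule tendsto_enn2real) simp
  then have lim0: "(\<lambda>k. sqrt (enn2real (norm2sq (\<lambda>x. u k x - w x) * norm2sq v))) \<longlonglongrightarrow> 0"
    using tendsto_real_sqrt by fastforce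
  have "(\<lambda>k. LINT x|lborel. (u k x - w x) * v x) \<longlonglongrightarrow> 0"
    by (rule Lim_null_comparison[OF always_eventually[OF allI] lim0], rule bound)
  moreover have "(LINT x|lborel. (u k x - w x) * v x) = (LINT x|lborel. u k x * v x) - (LINT x|lborel. w x * v x)" for k
    unfolding left_diff_distrib
    by (rule Bochner_Integration.integral_diff[OF integrable_L2_mult[OF u v] integrable_L2_mult[OF w v]])
  ultimately have "(\<lambda>k. (LINT x|lborel. u k x * v x) - (LINT x|lborel. w x * v x)) \<longlonglongrightarrow> 0" by simp
  then show ?thesis by (rule LIM_zero_cancel)
qed

text \<open>Dominated convergence, with the function itself as majorant.\<close>

lemma L2_truncate:
  fixes u :: "'a::euclidean_space \<Rightarrow> 'b::{banach, second_countable_topology}"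
  assumes u: "L2_on UNIV u"
  shows "((\<lambda>R. norm2sq (\<lambda>x. indicator (ball 0 R) x *\<^sub>R u x - u x)) \<longlongrightarrow> 0) at_top"
proof (rule tendsto_at_topI_sequentially)
  fix X :: "nat \<Rightarrow> real" assume X: "filterlim X at_top sequentially"
  note [measurable] = u[THEN L2_measurable]
  have nu: "L2_on UNIV (\<lambda>x. norm (u x))" by (rule L2_dominated[OF _ u]) auto
  show "(\<lambda>n. norm2sq (\<lambda>x. indicator (ball 0 (X n)) x *\<^sub>R u x - u x)) \<longlonglongrightarrow> 0"
  proof (rule norm2sq_dominated[OF _ _ nu])
    show "AE x in lborel. (\<lambda>k. indicator (ball 0 (X k)) x *\<^sub>R u x) \<longlonglongrightarrow> u x"
    proof (rule AE_I2)
      fix x :: 'a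
      have "\<forall>\<^sub>F k in sequentially. norm x < X k" using X by (simp add: filterlim_at_top_dense)
      then show "(\<lambda>k. indicator (ball 0 (X k)) x *\<^sub>R u x) \<longlonglongrightarrow> u x"
        by (intro tendsto_eventually) (erule eventually_mono, simp add: indicator_def)
    qed
  qed (auto simp: indicator_def)
qed

text \<open>Lebesgue measurable functions are almost everywhere limits of continuous ones; this starts the proof
  that continuous functions of compact support are dense in $L^2$.\<close>

lemma borel_AE_limit_continuous:
  fixes u :: "'a::euclidean_space \<Rightarrow> real"
  assumes "u \<in> borel_measurable borel"
  obtains g where "\<And>n. continuous_on UNIV (g n :: 'a \<Rightarrow> real)" "AE x in lborel. (\<lambda>n. g n x) \<longlonglongrightarrow> u x"
proof -
  have "u \<in> borel_measurable lebesgue" using assms by (intro measurable_completion) auto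
  then have "u measurable_on UNIV" by (rule lebesgue_measurable_imp_measurable_on) auto
  then obtain N g where N: "negligible N" and g: "\<And>n. continuous_on UNIV (g n)"
    and lim: "\<And>x. x \<notin> N \<Longrightarrow> (\<lambda>n. g n x) \<longlonglongrightarrow> u x"
    unfolding measurable_on_def by auto
  have "AE x in lebesgue. (\<lambda>n. g n x) \<longlonglongrightarrow> u x"
    using N lim by (intro AE_I'[of N]) (auto simp: negligible_iff_null_sets)
  then have "AE x in lborel. (\<lambda>n. g n x) \<longlonglongrightarrow> u x"
    by (subst (asm) AE_completion_iff)
  with g show ?thesis by (rule that)
qed

text \<open>Clipping the continuous approximants to the bound of the function and cutting them off outside a ball
  provides a majorant, which turns convergence almost everywhere into convergence in $L^2$.\<close>

lemma L2_dense_Cc_bounded: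
  fixes u :: "'a::euclidean_space \<Rightarrow> real"
  assumes [measurable]: "u \<in> borel_measurable borel" and M: "\<And>x. \<bar>u x\<bar> \<le> M" and R: "\<And>x. R \<le> norm x \<Longrightarrow> u x = 0"
  obtains g where "\<And>n. continuous_on UNIV (g n :: 'a \<Rightarrow> real)" "\<And>n x. R + 1 \<le> norm x \<Longrightarrow> g n x = 0"
    "\<And>n. L2_on UNIV (g n)" "(\<lambda>n. norm2sq (\<lambda>x. g n x - u x)) \<longlonglongrightarrow> 0"
proof -
  obtain h where h: "\<And>n. continuous_on UNIV (h n :: 'a \<Rightarrow> real)" and hl: "AE x in lborel. (\<lambda>n. h n x) \<longlonglongrightarrow> u x"
    using borel_AE_limit_continuous[OF assms(1)] by blast
  define chi where "chi x = max 0 (min 1 (R + 1 - norm x))" for x :: 'a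
  define g where "g n x = chi x * max (- M) (min M (h n x))" for n x
  have M0: "M \<ge> 0" using M[of 0] by simp
  have cont: "continuous_on UNIV (g n)" for n
    unfolding g_def chi_def by (intro continuous_intros h)
  have [measurable]: "g n \<in> borel_measurable borel" for n
    using cont by (rule borel_measurable_continuous_onI)
  define G where "G x = M * indicator (ball 0 (R + 1)) x" for x :: 'a
  have G: "L2_on UNIV G" unfolding G_def[abs_def] by (intro L2_cmult L2_indicator) auto
  have bd: "norm (g n x) \<le> G x" for n x
  proof (cases "norm x < R + 1")
    case True
    have "\<bar>chi x\<bar> * \<bar>max (- M) (min M (h n x))\<bar> \<le> 1 * M"
      using M0 by (intro mult_mono) (simp_all add: chi_def abs_le_iff)
    then show ?thesis using True by (simp add: g_def G_def abs_mult)
  next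
    case False
    then show ?thesis by (simp add: g_def G_def chi_def)
  qed
  show ?thesis
  proof (rule that[OF cont])
    show "R + 1 \<le> norm x \<Longrightarrow> g n x = 0" for n x by (simp add: g_def chi_def)
    show "L2_on UNIV (g n)" for n
      by (rule L2_dominated[OF _ G]) (use order.trans[OF bd abs_ge_self] in auto)
    show "(\<lambda>n. norm2sq (\<lambda>x. g n x - u x)) \<longlonglongrightarrow> 0"
    proof (rule norm2sq_dominated[OF _ _ G])
      show "AE x in lborel. (\<lambda>k. g k x) \<longlonglongrightarrow> u x"
        using hl
      proof eventually_elim
        case (elim x)
        have "(\<lambda>k. g k x) \<longlonglongrightarrow> chi x * max (- M) (min M (u x))"
          unfolding g_def by (intro tendsto_intros elim)
        also have "chi x * max (- M) (min M (u x)) = u x"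
          using M[of x] R[of x] by (cases "R \<le> norm x") (auto simp: chi_def)
        finally show ?case .
      qed
    qed (use bd in auto)
  qed
qed

lemma L2_approx_bounded:
  fixes u :: "'a::euclidean_space \<Rightarrow> real"
  assumes u: "L2_on UNIV u"
  obtains v where "\<And>n. v n \<in> borel_measurable borel" "\<And>n x. \<bar>v n x\<bar> \<le> real n" "\<And>n x. real n \<le> norm x \<Longrightarrow> v n x = 0"
     "(\<lambda>n. norm2sq (\<lambda>x. v n x - u x)) \<longlonglongrightarrow> 0"
proof -
  note [measurable] = u[THEN L2_measurable]
  define v where "v n x = indicator (ball 0 (real n)) x * max (- real n) (min (real n) (u x))" for n x
  have [measurable]: "v n \<in> borel_measurable borel" for n unfolding v_def[abs_def]
    by (intro borel_measurable_times borel_measurable_indicator borel_measurable_max borel_measurable_min) auto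
  have nu: "L2_on UNIV (\<lambda>x. \<bar>u x\<bar>)" by (rule L2_dominated[OF _ u]) auto
  show ?thesis
  proof (rule that)
    show "v n \<in> borel_measurable borel" for n by measurable
    show "\<bar>v n x\<bar> \<le> real n" for n x by (auto simp: v_def indicator_def)
    show "(\<lambda>n. norm2sq (\<lambda>x. v n x - u x)) \<longlonglongrightarrow> 0"
    proof (rule norm2sq_dominated[OF _ _ nu])
      show "AE x in lborel. norm (v n x) \<le> \<bar>u x\<bar>" for n by (auto simp: v_def indicator_def)
      show "AE x in lborel. (\<lambda>n. v n x) \<longlonglongrightarrow> u x"
      proof (rule AE_I2)
        fix x
        have "\<forall>\<^sub>F n in sequentially. max (norm x) \<bar>u x\<bar> < real n"
          using filterlim_real_sequentially unfolding filterlim_at_top_dense by blast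
        then show "(\<lambda>n. v n x) \<longlonglongrightarrow> u x"
          by (intro tendsto_eventually) (erule eventually_mono, auto simp: v_def indicator_def)
      qed
    qed auto
  qed (auto simp: v_def)
qed

lemma L2_dense_Cc:
  fixes u :: "'a::euclidean_space \<Rightarrow> real"
  assumes u: "L2_on UNIV u" and e: "(e::real) > 0"
  obtains g R where "continuous_on UNIV g" "\<And>x. R \<le> norm x \<Longrightarrow> g x = 0" "L2_on UNIV g" "norm2sq (\<lambda>x. g x - u x) \<le> ennreal e"
proof -
  note [measurable] = u[THEN L2_measurable]
  obtain v where v[measurable]: "\<And>n. v n \<in> borel_measurable borel" and vb: "\<And>n x. \<bar>v n x\<bar> \<le> real n" "\<And>n x. real n \<le> norm x \<Longrightarrow> v n x = 0"
     and vl: "(\<lambda>n. norm2sq (\<lambda>x. v n x - u x)) \<longlonglongrightarrow> 0"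
    using L2_approx_bounded[OF u] by blast
  have "\<forall>\<^sub>F n in sequentially. norm2sq (\<lambda>x. v n x - u x) < ennreal (e / 4)"
    using order_tendstoD(2)[OF vl] e by simp
  then obtain n where n: "norm2sq (\<lambda>x. v n x - u x) < ennreal (e / 4)"
    by (auto simp: eventually_sequentially)
  obtain g where g: "\<And>k. continuous_on UNIV (g k)" "\<And>k x. real n + 1 \<le> norm x \<Longrightarrow> g k x = 0" "\<And>k. L2_on UNIV (g k)"
      and gl: "(\<lambda>k. norm2sq (\<lambda>x. g k x - v n x)) \<longlonglongrightarrow> 0"
    using L2_dense_Cc_bounded[OF v[of n] vb] by blast
  have "\<forall>\<^sub>F k in sequentially. norm2sq (\<lambda>x. g k x - v n x) < ennreal (e / 4)"
    using order_tendstoD(2)[OF gl] e by simp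
  then obtain k where k: "norm2sq (\<lambda>x. g k x - v n x) < ennreal (e / 4)"
    by (auto simp: eventually_sequentially)
  note [measurable] = L2_measurable[OF g(3)]
  have "norm2sq (\<lambda>x. g k x - u x) \<le> 2 * norm2sq (\<lambda>x. g k x - v n x) + 2 * norm2sq (\<lambda>x. v n x - u x)"
    by (rule norm2sq_triangle) auto
  also have "\<dots> \<le> 2 * ennreal (e / 4) + 2 * ennreal (e / 4)"
    using k n by (intro add_mono mult_left_mono) auto
  also have "\<dots> = ennreal e"
  proof -
    have "2 * ennreal (e / 4) = ennreal (2 * (e / 4))" by (subst ennreal_mult) (use e in auto)
    then show ?thesis using e by (simp add: ennreal_plus[symmetric] del: ennreal_plus)
  qed
  finally show ?thesis by (intro that[of "g k" "real n + 1"] g)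
qed

lemma nn_integral_translate:
  fixes f :: "'a::euclidean_space \<Rightarrow> ennreal"
  assumes [measurable]: "f \<in> borel_measurable borel"
  shows "(\<integral>\<^sup>+x. f (x + h) \<partial>lborel) = (\<integral>\<^sup>+x. f x \<partial>lborel)"
proof -
  have "(\<integral>\<^sup>+x. f x \<partial>lborel) = (\<integral>\<^sup>+x. f x \<partial>(distr lborel borel ((+) h)))"
    by (simp add: lborel_distr_plus)
  also have "\<dots> = (\<integral>\<^sup>+x. f (x + h) \<partial>lborel)" by (subst nn_integral_distr) (auto simp: add.commute)
  finally show ?thesis by simp
qed

lemma norm2sq_translate:
  fixes u :: "'a::euclidean_space \<Rightarrow> 'b::{banach, second_countable_topology}"
  assumes [measurable]: "u \<in> borel_measurable borel"
  shows "norm2sq (\<lambda>x. u (x + h)) = norm2sq u"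
  unfolding norm2sq_def by (rule nn_integral_translate[of "\<lambda>x. ennreal ((norm (u x))\<^sup>2)"]) simp

lemma L2_translate:
  fixes u :: "'a::euclidean_space \<Rightarrow> 'b::{banach, second_countable_topology}"
  assumes u: "L2_on UNIV u"
  shows "L2_on UNIV (\<lambda>x. u (x + h))"
proof -
  note [measurable] = u[THEN L2_measurable]
  show ?thesis using norm2sq_finite[OF u] by (intro L2_onI) (auto simp: norm2sq_translate)
qed

lemma Cc_translation_tendsto:
  fixes g :: "'a::euclidean_space \<Rightarrow> real"
  assumes g: "continuous_on UNIV g" "\<And>x. R \<le> norm x \<Longrightarrow> g x = 0" and X: "X \<longlonglongrightarrow> 0"
  shows "(\<lambda>n. norm2sq (\<lambda>x. g (x + X n) - g x)) \<longlonglongrightarrow> 0"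
proof -
  have [measurable]: "g \<in> borel_measurable borel" using g(1) by (rule borel_measurable_continuous_onI)
  obtain B where B: "\<And>n. norm (X n) \<le> B" using convergent_imp_Bseq[OF convergentI[OF X]] by (auto simp: Bseq_def)
  have "compact (g ` cball 0 R)" by (intro compact_continuous_image continuous_on_subset[OF g(1)]) auto
  then obtain M where "\<forall>y\<in>g ` cball 0 R. norm y \<le> M"
    using compact_imp_bounded bounded_iff by metis
  then have M: "\<And>x. x \<in> cball 0 R \<Longrightarrow> \<bar>g x\<bar> \<le> M" by auto
  have M': "\<bar>g x\<bar> \<le> \<bar>M\<bar>" for x using M[of x] g(2)[of x] by (cases "R \<le> norm x") auto
  define G where "G x = \<bar>M\<bar> * indicator (ball 0 (R + B)) x" for x :: 'a
  have G: "L2_on UNIV G" unfolding G_def[abs_def] by (intro L2_cmult L2_indicator) auto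
  show ?thesis
  proof (rule norm2sq_dominated[OF _ _ G])
    show "AE x in lborel. norm (g (x + X n)) \<le> G x" for n
    proof (rule AE_I2)
      fix x
      show "norm (g (x + X n)) \<le> G x"
      proof (cases "norm x < R + B")
        case True then show ?thesis using M'[of "x + X n"] by (simp add: G_def)
      next
        case False
        then have "R \<le> norm (x + X n)" using B[of n] norm_triangle_ineq4[of "x + X n" "X n"] by simp
        then show ?thesis using g(2) by (simp add: G_def)
      qed
    qed
    show "AE x in lborel. (\<lambda>n. g (x + X n)) \<longlonglongrightarrow> g x"
    proof (rule AE_I2)
      fix x
      have "(\<lambda>n. x + X n) \<longlonglongrightarrow> x + 0" by (intro tendsto_intros X)
      then have "(\<lambda>n. x + X n) \<longlonglongrightarrow> x" by simp
      then show "(\<lambda>n. g (x + X n)) \<longlonglongrightarrow> g x"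
        by (intro continuous_on_tendsto_compose[OF g(1)]) auto
    qed
  qed auto
qed

text \<open>Translations are isometries, so their continuity passes from continuous functions of compact support
  to all of $L^2$ by density.\<close>

lemma L2_translation_tendsto:
  fixes u :: "'a::euclidean_space \<Rightarrow> real"
  assumes u: "L2_on UNIV u" and X: "X \<longlonglongrightarrow> 0"
  shows "(\<lambda>n. norm2sq (\<lambda>x. u (x + X n) - u x)) \<longlonglongrightarrow> 0"
proof (rule tendsto_0_ennreal_realI)
  fix e :: real assume e: "e > 0"
  note [measurable] = u[THEN L2_measurable]
  obtain g R where g: "continuous_on UNIV g" "\<And>x. R \<le> norm x \<Longrightarrow> g x = 0" "L2_on UNIV g" "norm2sq (\<lambda>x. g x - u x) \<le> ennreal (e / 12)"
    using L2_dense_Cc[OF u, of "e / 12"] e by auto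
  note [measurable] = g(3)[THEN L2_measurable]
  have "\<forall>\<^sub>F n in sequentially. norm2sq (\<lambda>x. g (x + X n) - g x) < ennreal (e / 12)"
    using order_tendstoD(2)[OF Cc_translation_tendsto[OF g(1,2) X]] e by simp
  then show "\<forall>\<^sub>F n in sequentially. norm2sq (\<lambda>x. u (x + X n) - u x) \<le> ennreal e"
  proof eventually_elim
    case (elim n)
    have t: "norm2sq (\<lambda>x. u (x + X n) - g (x + X n)) \<le> ennreal (e / 12)"
      using g(4) norm2sq_translate[of "\<lambda>x. u x - g x" "X n"] by (simp add: norm2sq_minus_commute[of u])
    have "norm2sq (\<lambda>x. u (x + X n) - u x) \<le> 2 * norm2sq (\<lambda>x. u (x + X n) - g (x + X n)) + 2 * norm2sq (\<lambda>x. g (x + X n) - u x)"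
      by (rule norm2sq_triangle) auto
    also have "\<dots> \<le> 2 * norm2sq (\<lambda>x. u (x + X n) - g (x + X n)) + 2 * (2 * norm2sq (\<lambda>x. g (x + X n) - g x) + 2 * norm2sq (\<lambda>x. g x - u x))"
      by (intro add_mono mult_left_mono norm2sq_triangle order_refl) auto
    also have "\<dots> \<le> 2 * ennreal (e / 12) + 2 * (2 * ennreal (e / 12) + 2 * ennreal (e / 12))"
      using t elim g(4) by (intro add_mono mult_left_mono) auto
    also have "\<dots> = ennreal (10 * (e / 12))"
    proof -
      have "2 * x + 2 * (2 * x + 2 * x) = (2 + 2 * (2 + 2)) * x" for x :: ennreal
        by (simp only: distrib_right mult.assoc)
      then show ?thesis using e by (subst ennreal_mult) (auto simp only: ennreal_numeral, auto)
    qed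
    also have "\<dots> \<le> ennreal e" using e by (intro ennreal_leI) auto
    finally show ?case .
  qed
qed

lemma integral_translate:
  fixes f :: "'a::euclidean_space \<Rightarrow> 'b::{banach, second_countable_topology}"
  assumes [measurable]: "f \<in> borel_measurable borel"
  shows "(LINT x|lborel. f (x + h)) = (LINT x|lborel. f x)"
proof -
  have "(LINT x|lborel. f x) = (LINT x|distr lborel borel ((+) h). f x)"
    by (simp add: lborel_distr_plus)
  also have "\<dots> = (LINT x|lborel. f (x + h))" by (subst integral_distr) (auto simp: add.commute)
  finally show ?thesis by simp
qed

lemma integrable_translate:
  fixes f :: "'a::euclidean_space \<Rightarrow> 'b::{banach, second_countable_topology}"
  assumes f: "integrable lborel f"
  shows "integrable lborel (\<lambda>x. f (x + h))"
proof -
  have [measurable]: "f \<in> borel_measurable borel" using borel_measurable_integrable[OF f] by simp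
  have "integrable (distr lborel borel ((+) h)) f" using f by (simp add: lborel_distr_plus)
  then show ?thesis by (subst (asm) integrable_distr_eq) (auto simp: add.commute)
qed

lemma lborel_distr_scaleR:
  assumes "c \<noteq> 0"
  shows "distr lborel borel ((*\<^sub>R) c :: 'a::euclidean_space \<Rightarrow> 'a) = density lborel (\<lambda>_. inverse (\<bar>c\<bar> ^ DIM('a)))"
proof -
  have "distr lborel borel ((*\<^sub>R) c :: 'a \<Rightarrow> 'a) = distr lborel lborel ((*\<^sub>R) c)" by (simp cong: distr_cong)
  also have "\<dots> = density lborel (\<lambda>_. inverse (\<bar>c\<bar> ^ DIM('a)))"
    using assms by (subst lborel_affine[of "inverse c" 0]) (auto simp: o_def distr_density_distr power_inverse)
  finally show ?thesis .
qed

lemma nn_integral_scaleR: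
  fixes f :: "'a::euclidean_space \<Rightarrow> ennreal"
  assumes [measurable]: "f \<in> borel_measurable borel" and c: "c \<noteq> 0"
  shows "(\<integral>\<^sup>+x. f (c *\<^sub>R x) \<partial>lborel) = ennreal (inverse (\<bar>c\<bar> ^ DIM('a))) * (\<integral>\<^sup>+x. f x \<partial>lborel)"
proof -
  have "(\<integral>\<^sup>+x. f (c *\<^sub>R x) \<partial>lborel) = (\<integral>\<^sup>+x. f x \<partial>distr lborel borel ((*\<^sub>R) c))"
    by (subst nn_integral_distr) auto
  also have "\<dots> = ennreal (inverse (\<bar>c\<bar> ^ DIM('a))) * (\<integral>\<^sup>+x. f x \<partial>lborel)"
    by (subst lborel_distr_scaleR[OF c], subst nn_integral_density) (auto simp: nn_integral_cmult)
  finally show ?thesis .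
qed

lemma integral_scaleR_arg:
  fixes f :: "'a::euclidean_space \<Rightarrow> 'b::{banach, second_countable_topology}"
  assumes [measurable]: "f \<in> borel_measurable borel" and c: "c \<noteq> 0"
  shows "(LINT x|lborel. f (c *\<^sub>R x)) = inverse (\<bar>c\<bar> ^ DIM('a)) *\<^sub>R (LINT x|lborel. f x)"
proof -
  have "(LINT x|lborel. f (c *\<^sub>R x)) = (LINT x|distr lborel borel ((*\<^sub>R) c). f x)"
    by (subst integral_distr) auto
  also have "\<dots> = inverse (\<bar>c\<bar> ^ DIM('a)) *\<^sub>R (LINT x|lborel. f x)"
    by (subst lborel_distr_scaleR[OF c], subst integral_density) auto
  finally show ?thesis .
qed

section \<open>The Fourier transform of integrable functions\<close>

lemma borel_measurable_cis [measurable]: "cis \<in> borel_measurable borel"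
  by (intro borel_measurable_continuous_onI continuous_intros continuous_on_cis)

lemma integrable_fourier_L1:
  assumes "integrable lborel u"
  shows "integrable lborel (\<lambda>x. u x *\<^sub>R cis (- (x \<bullet> \<xi>)))"
proof -
  have [measurable]: "u \<in> borel_measurable borel" using borel_measurable_integrable[OF assms] by simp
  show ?thesis by (rule Bochner_Integration.integrable_bound[OF assms]) auto
qed

lemma fourier_L1_measurable [measurable]:
  assumes [measurable]: "u \<in> borel_measurable borel"
  shows "fourier_L1 u \<in> borel_measurable borel"
  unfolding fourier_L1_def[abs_def] by measurable

lemma fourier_L1_diff:
  assumes "integrable lborel u" "integrable lborel v"
  shows "fourier_L1 (\<lambda>x. u x - v x) \<xi> = fourier_L1 u \<xi> - fourier_L1 v \<xi>"
  unfolding fourier_L1_def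
  by (subst Bochner_Integration.integral_diff[symmetric]) (auto intro!: integrable_fourier_L1 assms simp: algebra_simps)

lemma fourier_L1_translate:
  assumes "integrable lborel u"
  shows "fourier_L1 (\<lambda>x. u (x + h)) \<xi> = cis (h \<bullet> \<xi>) * fourier_L1 u \<xi>"
proof -
  have [measurable]: "u \<in> borel_measurable borel" using borel_measurable_integrable[OF assms] by simp
  have "fourier_L1 (\<lambda>x. u (x + h)) \<xi> = (LINT x|lborel. u (x + h) *\<^sub>R (cis (h \<bullet> \<xi>) * cis (- ((x + h) \<bullet> \<xi>))))"
    unfolding fourier_L1_def by (simp add: cis_mult inner_add_left)
  also have "\<dots> = (LINT x|lborel. u x *\<^sub>R (cis (h \<bullet> \<xi>) * cis (- (x \<bullet> \<xi>))))"
    by (rule integral_translate[of "\<lambda>x. u x *\<^sub>R (cis (h \<bullet> \<xi>) * cis (- (x \<bullet> \<xi>)))"]) measurable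
  also have "\<dots> = (LINT x|lborel. cis (h \<bullet> \<xi>) * (u x *\<^sub>R cis (- (x \<bullet> \<xi>))))" by simp
  also have "\<dots> = cis (h \<bullet> \<xi>) * fourier_L1 u \<xi>"
    unfolding fourier_L1_def by (rule integral_mult_right_zero)
  finally show ?thesis .
qed

lemma integrable_prod_translate:
  fixes k u :: "'a::euclidean_space \<Rightarrow> real"
  assumes k: "integrable lborel k" and u: "integrable lborel u"
  shows "integrable (lborel \<Otimes>\<^sub>M lborel) (\<lambda>(h, x). k h * u (x + h))"
proof -
  have [measurable]: "k \<in> borel_measurable borel" "u \<in> borel_measurable borel"
    using borel_measurable_integrable[OF k] borel_measurable_integrable[OF u] by auto
  show ?thesis
  proof (rule lborel_pair.Fubini_integrable)
    have "(LINT x|lborel. norm (k h * u (x + h))) = \<bar>k h\<bar> * (LINT x|lborel. \<bar>u x\<bar>)" for h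
      by (simp add: abs_mult integral_translate[of "\<lambda>x. \<bar>u x\<bar>"])
    then show "integrable lborel (\<lambda>h. LINT x|lborel. norm (case (h, x) of (h, x) \<Rightarrow> k h * u (x + h)))"
      using k by simp
    show "AE h in lborel. integrable lborel (\<lambda>x. case (h, x) of (h, x) \<Rightarrow> k h * u (x + h))"
      using integrable_translate[OF u] by auto
  qed measurable
qed

lemma integrable_correlation:
  fixes k u :: "'a::euclidean_space \<Rightarrow> real"
  assumes "integrable lborel k" "integrable lborel u"
  shows "integrable lborel (\<lambda>x. LINT h|lborel. k h * u (x + h))"
  using lborel_pair.integrable_snd[OF integrable_prod_translate[OF assms]] .

lemma fourier_L1_correlation:
  fixes k u :: "'a::euclidean_space \<Rightarrow> real"
  assumes k: "integrable lborel k" and u: "integrable lborel u"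
  shows "fourier_L1 (\<lambda>x. LINT h|lborel. k h * u (x + h)) \<xi> = (LINT h|lborel. k h *\<^sub>R cis (h \<bullet> \<xi>)) * fourier_L1 u \<xi>"
proof -
  have [measurable]: "k \<in> borel_measurable borel" "u \<in> borel_measurable borel"
    using borel_measurable_integrable[OF k] borel_measurable_integrable[OF u] by auto
  have int: "integrable (lborel \<Otimes>\<^sub>M lborel) (\<lambda>(h, x). (k h * u (x + h)) *\<^sub>R cis (- (x \<bullet> \<xi>)))"
    by (rule Bochner_Integration.integrable_bound[OF integrable_prod_translate[OF k u]]) (auto simp: split_beta)
  have "fourier_L1 (\<lambda>x. LINT h|lborel. k h * u (x + h)) \<xi>
      = (LINT x|lborel. (LINT h|lborel. (k h * u (x + h)) *\<^sub>R cis (- (x \<bullet> \<xi>))))"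
    unfolding fourier_L1_def
  proof (rule integral_cong_AE)
    show "AE x in lborel. (LINT h|lborel. k h * u (x + h)) *\<^sub>R cis (- (x \<bullet> \<xi>)) = (LINT h|lborel. (k h * u (x + h)) *\<^sub>R cis (- (x \<bullet> \<xi>)))"
      using lborel_pair.AE_integrable_snd[OF integrable_prod_translate[OF k u]]
      by eventually_elim (rule integral_scaleR_left[symmetric], blast)
  qed measurable
  also have "\<dots> = (LINT h|lborel. (LINT x|lborel. (k h * u (x + h)) *\<^sub>R cis (- (x \<bullet> \<xi>))))"
    using lborel_pair.Fubini_integral[OF int] by simp
  also have "\<dots> = (LINT h|lborel. (k h *\<^sub>R cis (h \<bullet> \<xi>)) * fourier_L1 u \<xi>)"
  proof (rule Bochner_Integration.integral_cong[OF refl])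
    fix h
    have "(LINT x|lborel. (k h * u (x + h)) *\<^sub>R cis (- (x \<bullet> \<xi>))) = (LINT x|lborel. k h *\<^sub>R (u (x + h) *\<^sub>R cis (- (x \<bullet> \<xi>))))"
      by simp
    also have "\<dots> = k h *\<^sub>R fourier_L1 (\<lambda>x. u (x + h)) \<xi>"
      unfolding fourier_L1_def by (rule integral_scaleR_right)
    finally show "(LINT x|lborel. (k h * u (x + h)) *\<^sub>R cis (- (x \<bullet> \<xi>))) = (k h *\<^sub>R cis (h \<bullet> \<xi>)) * fourier_L1 u \<xi>"
      by (simp add: fourier_L1_translate[OF u])
  qed
  also have "\<dots> = (LINT h|lborel. k h *\<^sub>R cis (h \<bullet> \<xi>)) * fourier_L1 u \<xi>"
    by (rule integral_mult_left_zero)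
  finally show ?thesis .
qed

lemma fourier_L1_cnj: "(LINT h|lborel. u h *\<^sub>R cis (h \<bullet> \<xi>)) = cnj (fourier_L1 u \<xi>)"
  unfolding fourier_L1_def using Bochner_Integration.integral_cnj[of lborel "\<lambda>h. u h *\<^sub>R cis (- (h \<bullet> \<xi>))"] by (simp add: cis_cnj)

text \<open>This reduces the energy of the transform to the value of the autocorrelation at the origin.\<close>

lemma fourier_L1_autocorrelation:
  assumes u: "integrable lborel u"
  shows "fourier_L1 (\<lambda>x. LINT h|lborel. u h * u (x + h)) \<xi> = of_real ((norm (fourier_L1 u \<xi>))\<^sup>2)"
  unfolding fourier_L1_correlation[OF u u] fourier_L1_cnj
  by (simp add: complex_norm_square mult.commute del: of_real_power)

lemma fourier_L1_multiplication_formula: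
  fixes A g :: "'a::euclidean_space \<Rightarrow> real"
  assumes A: "integrable lborel A" and g: "integrable lborel g"
  shows "(LINT \<xi>|lborel. g \<xi> *\<^sub>R fourier_L1 A \<xi>) = (LINT z|lborel. A z *\<^sub>R fourier_L1 g z)"
proof -
  have [measurable]: "A \<in> borel_measurable borel" "g \<in> borel_measurable borel"
    using borel_measurable_integrable[OF A] borel_measurable_integrable[OF g] by auto
  have int: "integrable (lborel \<Otimes>\<^sub>M lborel) (\<lambda>(\<xi>, z). (g \<xi> * A z) *\<^sub>R cis (- (z \<bullet> \<xi>)))"
  proof (rule lborel_pair.Fubini_integrable)
    have "(LINT z|lborel. norm ((g \<xi> * A z) *\<^sub>R cis (- (z \<bullet> \<xi>)))) = \<bar>g \<xi>\<bar> * (LINT z|lborel. \<bar>A z\<bar>)" for \<xi>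
      by (simp add: abs_mult)
    then show "integrable lborel (\<lambda>\<xi>. LINT z|lborel. norm (case (\<xi>, z) of (\<xi>, z) \<Rightarrow> (g \<xi> * A z) *\<^sub>R cis (- (z \<bullet> \<xi>))))"
      using g by simp
    show "AE \<xi> in lborel. integrable lborel (\<lambda>z. case (\<xi>, z) of (\<xi>, z) \<Rightarrow> (g \<xi> * A z) *\<^sub>R cis (- (z \<bullet> \<xi>)))"
      using integrable_scaleR_right[OF integrable_fourier_L1[OF A]] by (simp add: scaleR_scaleR[symmetric] del: scaleR_scaleR)
  qed measurable
  have "(LINT \<xi>|lborel. g \<xi> *\<^sub>R fourier_L1 A \<xi>) = (LINT \<xi>|lborel. (LINT z|lborel. (g \<xi> * A z) *\<^sub>R cis (- (z \<bullet> \<xi>))))"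
    unfolding fourier_L1_def by (simp add: scaleR_scaleR[symmetric] del: scaleR_scaleR)
  also have "\<dots> = (LINT z|lborel. (LINT \<xi>|lborel. (g \<xi> * A z) *\<^sub>R cis (- (z \<bullet> \<xi>))))"
    using lborel_pair.Fubini_integral[OF int] by simp
  also have "\<dots> = (LINT z|lborel. (LINT \<xi>|lborel. A z *\<^sub>R (g \<xi> *\<^sub>R cis (- (\<xi> \<bullet> z)))))"
    by (simp add: inner_commute mult.commute)
  also have "\<dots> = (LINT z|lborel. A z *\<^sub>R fourier_L1 g z)"
    unfolding fourier_L1_def by (simp only: integral_scaleR_right)
  finally show ?thesis .
qed

section \<open>The Gaussian and the Plancherel identity\<close>

definition gauss :: "'a::euclidean_space \<Rightarrow> real" where
  "gauss x = exp (- ((norm x)\<^sup>2 / 2))"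

lemma gauss_measurable [measurable]: "gauss \<in> borel_measurable borel"
  unfolding gauss_def[abs_def] by measurable

lemma exp_square_1d:
  shows "integrable lborel (\<lambda>t::real. exp (- t\<^sup>2 / 2) *\<^sub>R cis (- (t * z)))" (is ?I)
    and "(LINT t|lborel. exp (- t\<^sup>2 / 2) *\<^sub>R cis (- (t * z))) = of_real (sqrt (2 * pi) * exp (- z\<^sup>2 / 2))" (is ?E)
proof -
  have d: "std_normal_density t = exp (- t\<^sup>2 / 2) / sqrt (2 * pi)" for t
    by (simp add: normal_density_def)
  have "integrable lborel std_normal_density" by (rule integrable_normal_density) simp
  then have "integrable lborel (\<lambda>t. sqrt (2 * pi) * std_normal_density t)" by (rule integrable_mult_right)
  then have i: "integrable lborel (\<lambda>t::real. exp (- t\<^sup>2 / 2))" unfolding d by simp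
  show ?I by (rule Bochner_Integration.integrable_bound[OF i]) auto
  have "of_real (exp (- z\<^sup>2 / 2)) = char std_normal_distribution (- z)"
    by (simp add: char_std_normal_distribution)
  also have "\<dots> = (LINT t|lborel. std_normal_density t *\<^sub>R cis (- (t * z)))"
  proof -
    have "iexp (- z * t) = cis (- (t * z))" for t by (simp add: cis_conv_exp mult.commute)
    then have "char std_normal_distribution (- z) = (LINT t|std_normal_distribution. cis (- (t * z)))"
      unfolding char_def by (simp only:)
    also have "\<dots> = (LINT t|lborel. std_normal_density t *\<^sub>R cis (- (t * z)))"
      by (rule integral_density) (auto simp: normal_density_nonneg)
    finally show ?thesis .
  qed
  also have "\<dots> = (LINT t|lborel. (1 / sqrt (2 * pi)) *\<^sub>R (exp (- t\<^sup>2 / 2) *\<^sub>R cis (- (t * z))))"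
    by (rule Bochner_Integration.integral_cong[OF refl]) (simp add: d)
  also have "\<dots> = (1 / sqrt (2 * pi)) *\<^sub>R (LINT t|lborel. exp (- t\<^sup>2 / 2) *\<^sub>R cis (- (t * z)))"
    by (rule integral_scaleR_right)
  finally have *: "of_real (exp (- z\<^sup>2 / 2)) = (1 / sqrt (2 * pi)) *\<^sub>R (LINT t|lborel. exp (- t\<^sup>2 / 2) *\<^sub>R cis (- (t * z)))" .
  define c where "c = sqrt (2 * pi)"
  have "c \<noteq> 0" by (simp add: c_def)
  then have "(LINT t|lborel. exp (- t\<^sup>2 / 2) *\<^sub>R cis (- (t * z))) = c *\<^sub>R of_real (exp (- z\<^sup>2 / 2))"
    unfolding * c_def[symmetric] by simp
  then show ?E unfolding c_def[symmetric] by (simp only: of_real_mult scaleR_conv_of_real)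
qed

lemma norm_sq_Basis_sum:
  "(norm (\<Sum>b\<in>Basis. f b *\<^sub>R b :: 'a::euclidean_space))\<^sup>2 = (\<Sum>b\<in>Basis. (f b)\<^sup>2)"
  by (subst power2_norm_eq_inner, subst euclidean_inner) (auto simp: power2_eq_square inner_sum_left inner_Basis if_distrib cong: if_cong)

lemma cis_sum: "finite A \<Longrightarrow> cis (sum f A) = (\<Prod>a\<in>A. cis (f a))"
  by (induction A rule: finite_induct) (auto simp: cis_mult[symmetric])

lemma fourier_L1_gauss:
  fixes z :: "'a::euclidean_space"
  shows "integrable lborel (gauss :: 'a \<Rightarrow> real)"
    and "fourier_L1 gauss z = of_real (sqrt (2 * pi) ^ DIM('a) * gauss z)"
proof -
  interpret product_sigma_finite "\<lambda>_::'a. lborel :: real measure" ..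
  define F where "F z b t = exp (- t\<^sup>2 / 2) *\<^sub>R cis (- (t * (z \<bullet> b)))" for z b :: 'a and t :: real
  have split: "gauss (\<Sum>b\<in>Basis. f b *\<^sub>R b) *\<^sub>R cis (- ((\<Sum>b\<in>Basis. f b *\<^sub>R b) \<bullet> z)) = (\<Prod>b\<in>Basis. F z b (f b))" for f and z :: 'a
  proof -
    have "gauss (\<Sum>b\<in>Basis. f b *\<^sub>R b :: 'a) = (\<Prod>b\<in>(Basis::'a set). exp (- (f b)\<^sup>2 / 2))"
      unfolding gauss_def norm_sq_Basis_sum by (simp add: exp_sum[symmetric] sum_negf sum_divide_distrib)
    moreover have "- ((\<Sum>b\<in>Basis. f b *\<^sub>R b) \<bullet> z) = (\<Sum>b\<in>Basis. - (f b * (z \<bullet> b)))"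
      by (simp add: inner_sum_left sum_negf inner_commute[of z])
    ultimately show ?thesis
      by (simp add: F_def cis_sum scaleR_conv_of_real prod.distrib)
  qed
  have Fint: "integrable lborel (F z b)" for z b
    unfolding F_def[abs_def] by (rule exp_square_1d)
  have [measurable]: "(\<lambda>f. \<Sum>b\<in>Basis. f b *\<^sub>R b) \<in> (\<Pi>\<^sub>M b\<in>Basis. lborel) \<rightarrow>\<^sub>M (borel :: 'a measure)"
    by measurable
  have int: "integrable (\<Pi>\<^sub>M b\<in>Basis. lborel) (\<lambda>f. \<Prod>b\<in>Basis. F z b (f b))" for z
    using product_integrable_prod[OF finite_Basis, of "F z"] Fint by auto
  have "integrable lborel (\<lambda>x. gauss x *\<^sub>R cis (- (x \<bullet> z)))" for z :: 'a
    unfolding lborel_eq[where 'a='a]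
    by (subst integrable_distr_eq) (auto simp: split int)
  from this[of 0] have "integrable lborel (\<lambda>x::'a. of_real (gauss x) :: complex)" by (simp add: scaleR_conv_of_real)
  then show "integrable lborel (gauss :: 'a \<Rightarrow> real)"
    by (simp add: complex_of_real_integrable_eq)
  have "fourier_L1 gauss z = (LINT f|(\<Pi>\<^sub>M b\<in>Basis. lborel). (\<Prod>b\<in>Basis. F z b (f b)))"
    unfolding fourier_L1_def lborel_eq[where 'a='a]
    by (subst integral_distr) (auto simp: split)
  also have "\<dots> = (\<Prod>b\<in>Basis. (LINT t|lborel. F z b t))"
    using product_integral_prod[OF finite_Basis, of "F z"] Fint by auto
  also have "\<dots> = (\<Prod>b\<in>Basis. of_real (sqrt (2 * pi) * exp (- (z \<bullet> b)\<^sup>2 / 2)))"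
    unfolding F_def exp_square_1d ..
  also have "\<dots> = of_real (sqrt (2 * pi) ^ DIM('a) * gauss z)"
    unfolding gauss_def norm_eq_sqrt_inner[of z] euclidean_inner[of z z] of_real_prod[symmetric] prod.distrib
    by (simp add: exp_sum[symmetric] sum_negf sum_divide_distrib power2_eq_square sum_nonneg)
  finally show "fourier_L1 gauss z = of_real (sqrt (2 * pi) ^ DIM('a) * gauss z)" .
qed

lemma integral_gauss: "(LINT x|lborel. gauss (x::'a::euclidean_space)) = sqrt (2 * pi) ^ DIM('a)"
proof -
  have "of_real (LINT x|lborel. gauss (x::'a)) = fourier_L1 gauss (0::'a)"
    unfolding fourier_L1_def by (simp add: scaleR_conv_of_real)
  also have "\<dots> = of_real (sqrt (2 * pi) ^ DIM('a))"
    unfolding fourier_L1_gauss(2) by (simp add: gauss_def)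
  finally show ?thesis by (simp only: of_real_eq_iff)
qed

text \<open>Against a Gaussian of width \<open>1/e\<close>, the energy of the transform is an average of the autocorrelation
  over the scale \<open>e\<close>.\<close>

lemma gauss_weighted_energy:
  fixes u :: "'a::euclidean_space \<Rightarrow> real"
  assumes u: "integrable lborel u" and e: "e > 0"
  defines "A \<equiv> \<lambda>z. LINT h|lborel. u h * u (z + h)"
  shows "integrable lborel (\<lambda>\<xi>. gauss (e *\<^sub>R \<xi>) * (norm (fourier_L1 u \<xi>))\<^sup>2)"
    and "(LINT \<xi>|lborel. gauss (e *\<^sub>R \<xi>) * (norm (fourier_L1 u \<xi>))\<^sup>2)
       = sqrt (2 * pi) ^ DIM('a) * (LINT z|lborel. A (e *\<^sub>R z) * gauss z)"
proof -
  have [measurable]: "u \<in> borel_measurable borel" using borel_measurable_integrable[OF u] by simp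
  have A: "integrable lborel A" unfolding A_def by (rule integrable_correlation[OF u u])
  have [measurable]: "A \<in> borel_measurable borel" using borel_measurable_integrable[OF A] by simp
  define c :: real where "c = sqrt (2 * pi) ^ DIM('a)"
  define g where "g \<xi> = gauss (e *\<^sub>R \<xi>)" for \<xi> :: 'a
  have [measurable]: "g \<in> borel_measurable borel" unfolding g_def[abs_def] by measurable
  have g: "integrable lborel g"
  proof (rule integrableI_nonneg)
    have "(\<integral>\<^sup>+\<xi>. ennreal (g \<xi>) \<partial>lborel) = ennreal (inverse (\<bar>e\<bar> ^ DIM('a))) * (\<integral>\<^sup>+x. ennreal (gauss (x::'a)) \<partial>lborel)"
      unfolding g_def using e by (subst nn_integral_scaleR) auto
    also have "\<dots> = ennreal (inverse (\<bar>e\<bar> ^ DIM('a))) * ennreal (LINT x|lborel. gauss (x::'a))"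
      by (subst nn_integral_eq_integral[OF fourier_L1_gauss(1)]) (auto simp: gauss_def)
    also have "\<dots> < \<infinity>" by (simp add: ennreal_mult_less_top)
    finally show "(\<integral>\<^sup>+\<xi>. ennreal (g \<xi>) \<partial>lborel) < \<infinity>" .
  qed (auto simp: g_def gauss_def)
  have gbd: "\<bar>g x\<bar> \<le> 1" for x by (simp add: g_def gauss_def)
  define M where "M = (LINT x|lborel. \<bar>u x\<bar>)"
  have Fb: "norm (fourier_L1 u \<xi>) \<le> M" for \<xi>
    unfolding fourier_L1_def M_def by (rule order.trans[OF integral_norm_bound]) simp
  have Fg: "fourier_L1 g z = of_real (inverse (e ^ DIM('a)) * c * gauss (inverse e *\<^sub>R z))" for z
  proof -
    have "(e *\<^sub>R x) \<bullet> (inverse e *\<^sub>R z) = x \<bullet> z" for x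
      using e by (simp add: field_simps)
    then have "fourier_L1 g z = (LINT x|lborel. gauss (e *\<^sub>R x) *\<^sub>R cis (- ((e *\<^sub>R x) \<bullet> (inverse e *\<^sub>R z))))"
      unfolding fourier_L1_def g_def by (simp only:)
    also have "\<dots> = inverse (\<bar>e\<bar> ^ DIM('a)) *\<^sub>R (LINT x|lborel. gauss x *\<^sub>R cis (- (x \<bullet> (inverse e *\<^sub>R z))))"
      by (rule integral_scaleR_arg[of "\<lambda>x. gauss x *\<^sub>R cis (- (x \<bullet> (inverse e *\<^sub>R z)))"]) (use e in auto)
    also have "(LINT x|lborel. gauss x *\<^sub>R cis (- (x \<bullet> (inverse e *\<^sub>R z)))) = fourier_L1 gauss (inverse e *\<^sub>R z)"
      unfolding fourier_L1_def ..
    finally show ?thesis using e by (simp add: fourier_L1_gauss c_def scaleR_conv_of_real)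
  qed
  show I: "integrable lborel (\<lambda>\<xi>. gauss (e *\<^sub>R \<xi>) * (norm (fourier_L1 u \<xi>))\<^sup>2)"
  proof (rule Bochner_Integration.integrable_bound[OF integrable_mult_left[OF g, of "M\<^sup>2"]])
    show "AE \<xi> in lborel. norm (gauss (e *\<^sub>R \<xi>) * (norm (fourier_L1 u \<xi>))\<^sup>2) \<le> norm (g \<xi> * M\<^sup>2)"
      using Fb by (auto simp: g_def abs_mult intro!: mult_left_mono power_mono)
  qed measurable
  have "of_real (LINT \<xi>|lborel. gauss (e *\<^sub>R \<xi>) * (norm (fourier_L1 u \<xi>))\<^sup>2) = (LINT \<xi>|lborel. g \<xi> *\<^sub>R fourier_L1 A \<xi>)"
    unfolding A_def fourier_L1_autocorrelation[OF u] integral_complex_of_real[symmetric]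
    by (simp add: g_def scaleR_conv_of_real)
  also have "\<dots> = (LINT z|lborel. A z *\<^sub>R fourier_L1 g z)"
    by (rule fourier_L1_multiplication_formula[OF A g])
  also have "\<dots> = of_real (LINT z|lborel. inverse (e ^ DIM('a)) * c * (A (e *\<^sub>R (inverse e *\<^sub>R z)) * gauss (inverse e *\<^sub>R z)))"
    unfolding Fg integral_complex_of_real[symmetric] using e by (simp add: scaleR_conv_of_real mult_ac)
  also have "(LINT z|lborel. inverse (e ^ DIM('a)) * c * (A (e *\<^sub>R (inverse e *\<^sub>R z)) * gauss (inverse e *\<^sub>R z)))
      = inverse (e ^ DIM('a)) * c * (LINT z|lborel. (A (e *\<^sub>R (inverse e *\<^sub>R z)) * gauss (inverse e *\<^sub>R z)))"
    by (rule integral_mult_right_zero)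
  also have "(LINT z|lborel. (A (e *\<^sub>R (inverse e *\<^sub>R z)) * gauss (inverse e *\<^sub>R z)))
      = inverse (\<bar>inverse e\<bar> ^ DIM('a)) *\<^sub>R (LINT z|lborel. A (e *\<^sub>R z) * gauss z)"
    by (rule integral_scaleR_arg[of "\<lambda>z. A (e *\<^sub>R z) * gauss z"]) (use e in auto)
  also have "inverse (e ^ DIM('a)) * c * (inverse (\<bar>inverse e\<bar> ^ DIM('a)) *\<^sub>R (LINT z|lborel. A (e *\<^sub>R z) * gauss z))
      = c * (LINT z|lborel. A (e *\<^sub>R z) * gauss z)"
    using e by (simp add: power_inverse)
  finally show "(LINT \<xi>|lborel. gauss (e *\<^sub>R \<xi>) * (norm (fourier_L1 u \<xi>))\<^sup>2)
       = sqrt (2 * pi) ^ DIM('a) * (LINT z|lborel. A (e *\<^sub>R z) * gauss z)"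
    unfolding c_def by (simp only: of_real_eq_iff)
qed

text \<open>As the Gaussian weight widens, the weighted energy increases to the full energy of the transform; on the
  other side the scale tends to zero, and the autocorrelation, which is continuous because translations
  are, tends to its value $\|u\|^2$ at the origin.\<close>

theorem plancherel_L1:
  fixes u :: "'a::euclidean_space \<Rightarrow> real"
  assumes u: "integrable lborel u" and u2: "L2_on UNIV u"
  shows "norm2sq (fourier_L1 u) = ennreal ((2 * pi) ^ DIM('a)) * norm2sq u"
proof -
  have [measurable]: "u \<in> borel_measurable borel" using borel_measurable_integrable[OF u] by simp
  define A where "A z = (LINT h|lborel. u h * u (z + h))" for z
  have A: "integrable lborel A" unfolding A_def by (rule integrable_correlation[OF u u])
  have [measurable]: "A \<in> borel_measurable borel" using borel_measurable_integrable[OF A] by simp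
  define c :: real where "c = sqrt (2 * pi) ^ DIM('a)"
  have c2: "c * c = (2 * pi) ^ DIM('a)" unfolding c_def by (subst power_mult_distrib[symmetric]) simp
  have c0: "c \<ge> 0" unfolding c_def by simp
  define N where "N = (LINT x|lborel. (norm (u x))\<^sup>2)"
  have N: "norm2sq u = ennreal N" "N \<ge> 0" using norm2sq_eq_integral[OF u2] by (auto simp: N_def)
  define e where "e k = inverse (real (Suc k))" for k
  have e: "e k > 0" for k by (simp add: e_def)
  have e0: "e \<longlonglongrightarrow> 0" unfolding e_def by (rule LIMSEQ_inverse_real_of_nat)
  have A0: "A 0 = N" unfolding A_def N_def by (simp add: power2_eq_square)
  have Acont: "(\<lambda>k. A (e k *\<^sub>R z)) \<longlonglongrightarrow> A 0" for z
  proof -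
    have "(\<lambda>k. e k *\<^sub>R z) \<longlonglongrightarrow> 0 *\<^sub>R z" by (intro tendsto_intros e0)
    then have "(\<lambda>k. norm2sq (\<lambda>x. u (x + e k *\<^sub>R z) - u x)) \<longlonglongrightarrow> 0"
      by (intro L2_translation_tendsto[OF u2]) simp
    then have "(\<lambda>k. LINT x|lborel. u (x + e k *\<^sub>R z) * u x) \<longlonglongrightarrow> (LINT x|lborel. u x * u x)"
      by (intro L2_inner_tendsto L2_translate u2)
    then show ?thesis by (simp add: A_def mult.commute add.commute)
  qed
  have Abd: "\<bar>A z\<bar> \<le> N" for z
  proof -
    have "\<bar>A z\<bar> \<le> (LINT h|lborel. \<bar>u h * u (z + h)\<bar>)" unfolding A_def by (rule integral_abs_bound)
    also have "\<dots> \<le> (LINT h|lborel. ((u h)\<^sup>2 + (u (h + z))\<^sup>2) / 2)"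
    proof (rule integral_mono)
      show "integrable lborel (\<lambda>h. \<bar>u h * u (z + h)\<bar>)"
        using integrable_abs[OF integrable_L2_mult[OF u2 L2_translate[OF u2, of z]]] by (simp add: add.commute)
      show "integrable lborel (\<lambda>h. ((u h)\<^sup>2 + (u (h + z))\<^sup>2) / 2)"
        using integrable_norm_sq[OF u2] integrable_norm_sq[OF L2_translate[OF u2, of z]] by simp
      show "\<bar>u h * u (z + h)\<bar> \<le> ((u h)\<^sup>2 + (u (h + z))\<^sup>2) / 2" for h
        using sum_squares_bound[of "\<bar>u h\<bar>" "\<bar>u (z + h)\<bar>"] by (simp add: abs_mult add.commute)
    qed
    also have "\<dots> = N"
      using integrable_norm_sq[OF u2] integrable_norm_sq[OF L2_translate[OF u2, of z]]
        integral_translate[of "\<lambda>x. (u x)\<^sup>2" z] by (simp add: N_def)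
    finally show ?thesis .
  qed
  have "(\<lambda>k. LINT z|lborel. A (e k *\<^sub>R z) * gauss z) \<longlonglongrightarrow> (LINT z|lborel. A 0 * gauss (z::'a))"
  proof (rule integral_dominated_convergence[where w="\<lambda>z. N * gauss z"])
    show "integrable lborel (\<lambda>z::'a. N * gauss z)" using fourier_L1_gauss(1) by (rule integrable_mult_right)
    show "AE z in lborel. norm (A (e k *\<^sub>R z) * gauss z) \<le> N * gauss z" for k
      using Abd by (auto simp: abs_mult gauss_def intro!: mult_right_mono)
  qed (auto intro!: tendsto_intros Acont)
  then have "(\<lambda>k. c * (LINT z|lborel. A (e k *\<^sub>R z) * gauss z)) \<longlonglongrightarrow> c * (N * c)"
    by (intro tendsto_intros) (simp add: A0 integral_gauss c_def)
  then have "(\<lambda>k. ennreal (LINT \<xi>|lborel. gauss (e k *\<^sub>R \<xi>) * (norm (fourier_L1 u \<xi>))\<^sup>2)) \<longlonglongrightarrow> ennreal (c * (N * c))"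
    unfolding gauss_weighted_energy(2)[OF u e] A_def c_def by (rule tendsto_ennrealI)
  then have R: "(\<lambda>k. \<integral>\<^sup>+\<xi>. ennreal (gauss (e k *\<^sub>R \<xi>) * (norm (fourier_L1 u \<xi>))\<^sup>2) \<partial>lborel) \<longlonglongrightarrow> ennreal (c * (N * c))"
    by (subst nn_integral_eq_integral[OF gauss_weighted_energy(1)[OF u e]]) (auto simp: gauss_def)
  have L: "(\<lambda>k. \<integral>\<^sup>+\<xi>. ennreal (gauss (e k *\<^sub>R \<xi>) * (norm (fourier_L1 u \<xi>))\<^sup>2) \<partial>lborel) \<longlonglongrightarrow> (\<integral>\<^sup>+\<xi>. ennreal ((norm (fourier_L1 u \<xi>))\<^sup>2) \<partial>lborel)"
  proof (rule nn_integral_LIMSEQ)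
    have mono: "gauss (e m *\<^sub>R \<xi>) \<le> gauss (e n *\<^sub>R \<xi>)" if "m \<le> n" for m n and \<xi> :: 'a
    proof -
      have "e n \<le> e m" using that by (simp add: e_def field_simps)
      then have "(e n * norm \<xi>)\<^sup>2 \<le> (e m * norm \<xi>)\<^sup>2"
        by (intro power_mono mult_right_mono) (auto simp: less_imp_le[OF e])
      then show ?thesis using e by (simp add: gauss_def abs_of_pos)
    qed
    show "incseq (\<lambda>k \<xi>. ennreal (gauss (e k *\<^sub>R \<xi>) * (norm (fourier_L1 u \<xi>))\<^sup>2))"
      by (auto simp: incseq_def le_fun_def intro!: ennreal_leI mult_right_mono mono)
    show "(\<lambda>k. ennreal (gauss (e k *\<^sub>R \<xi>) * (norm (fourier_L1 u \<xi>))\<^sup>2)) \<longlonglongrightarrow> ennreal ((norm (fourier_L1 u \<xi>))\<^sup>2)" for \<xi>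
    proof -
      have "(\<lambda>k. gauss (e k *\<^sub>R \<xi>) * (norm (fourier_L1 u \<xi>))\<^sup>2) \<longlonglongrightarrow> exp (- ((norm (0 *\<^sub>R \<xi>))\<^sup>2 / 2)) * (norm (fourier_L1 u \<xi>))\<^sup>2"
        unfolding gauss_def by (intro tendsto_intros e0) auto
      then show ?thesis by (intro tendsto_ennrealI) simp
    qed
  qed measurable
  from LIMSEQ_unique[OF L R] have "norm2sq (fourier_L1 u) = ennreal (c * (N * c))"
    by (simp add: norm2sq_def)
  also have "c * (N * c) = (2 * pi) ^ DIM('a) * N" using c2 by (simp add: mult_ac)
  finally show ?thesis using N by (simp add: ennreal_mult)
qed

section \<open>The Fourier--Plancherel transform\<close>

abbreviation trunc :: "real \<Rightarrow> ('a::euclidean_space \<Rightarrow> real) \<Rightarrow> 'a \<Rightarrow> real" where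
  "trunc R u \<equiv> (\<lambda>x. indicator (ball 0 R) x * u x)"

lemma L2_trunc: "L2_on UNIV u \<Longrightarrow> L2_on UNIV (trunc R u)"
  by (rule L2_dominated[of _ u]) (auto simp: indicator_def intro!: borel_measurable_times borel_measurable_indicator dest: L2_measurable)

lemma L2_bounded_support_integrable:
  fixes u :: "'a::euclidean_space \<Rightarrow> real"
  assumes u: "L2_on UNIV u" and S: "S \<in> sets borel" "bounded S" and s: "\<And>x. x \<notin> S \<Longrightarrow> u x = 0"
  shows "integrable lborel u"
proof -
  have "integrable lborel (\<lambda>x. u x * indicator S x)" by (rule integrable_L2_mult[OF u L2_indicator[OF S]])
  moreover have "u x * indicator S x = u x" for x using s[of x] by (auto simp: indicator_def)
  ultimately show ?thesis by simp
qed

lemma integrable_trunc: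
  assumes "L2_on UNIV u" shows "integrable lborel (trunc R u)"
  by (rule L2_bounded_support_integrable[OF L2_trunc[OF assms], of "ball 0 R"]) auto

lemma trunc_tendsto:
  assumes "L2_on UNIV u"
  shows "((\<lambda>R. norm2sq (\<lambda>x. trunc R u x - u x)) \<longlongrightarrow> 0) at_top"
  using L2_truncate[OF assms] by simp

lemma trunc_tendsto_seq:
  assumes "L2_on UNIV u"
  shows "(\<lambda>k. norm2sq (\<lambda>x. trunc (real k) u x - u x)) \<longlonglongrightarrow> 0"
  using filterlim_compose[OF trunc_tendsto[OF assms] filterlim_real_sequentially] .

lemma L2_fourier_L1:
  assumes "integrable lborel u" "L2_on UNIV u"
  shows "L2_on UNIV (fourier_L1 u)"
  using borel_measurable_integrable[OF assms(1)] norm2sq_finite[OF assms(2)]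
  by (intro L2_onI) (auto simp: plancherel_L1[OF assms] ennreal_mult_less_top)

lemma plancherel_L1_diff:
  fixes u v :: "'a::euclidean_space \<Rightarrow> real"
  assumes u: "integrable lborel u" "L2_on UNIV u" and v: "integrable lborel v" "L2_on UNIV v"
  shows "norm2sq (\<lambda>\<xi>. fourier_L1 u \<xi> - fourier_L1 v \<xi>) = ennreal ((2 * pi) ^ DIM('a)) * norm2sq (\<lambda>x. u x - v x)"
  unfolding fourier_L1_diff[OF u(1) v(1), symmetric]
  by (intro plancherel_L1 L2_diff Bochner_Integration.integrable_diff u v)

lemma fourier_L1_zero:
  fixes u :: "'a::euclidean_space \<Rightarrow> real"
  assumes u: "integrable lborel u" "L2_on UNIV u" and z: "\<And>\<xi>. fourier_L1 u \<xi> = 0"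
  shows "AE x in lborel. u x = 0"
proof -
  have "ennreal ((2 * pi) ^ DIM('a)) * norm2sq u = 0"
    unfolding plancherel_L1[OF u, symmetric] by (simp add: norm2sq_def z)
  moreover have "0 < ((2 * pi) ^ DIM('a) :: real)" by (intro zero_less_power) simp
  ultimately have "norm2sq u = 0" by (simp only: mult_eq_0_iff ennreal_eq_0_iff) linarith
  then show ?thesis using L2_measurable[OF u(2)] by (simp add: norm2sq_eq_0_iff)
qed

lemma fourier_L1_limit_exists:
  fixes u :: "nat \<Rightarrow> 'a::euclidean_space \<Rightarrow> real"
  assumes u: "\<And>k. integrable lborel (u k)" "\<And>k. L2_on UNIV (u k)" and w: "L2_on UNIV w"
    and lim: "(\<lambda>k. norm2sq (\<lambda>x. u k x - w x)) \<longlonglongrightarrow> 0"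
  obtains g where "L2_on UNIV g" "(\<lambda>k. norm2sq (\<lambda>\<xi>. fourier_L1 (u k) \<xi> - g \<xi>)) \<longlonglongrightarrow> 0"
proof (rule L2_complete[of "\<lambda>k. fourier_L1 (u k)"])
  note [measurable] = u(2)[THEN L2_measurable] w[THEN L2_measurable]
  define c :: real where "c = (2 * pi) ^ DIM('a)"
  have c: "c > 0" by (simp add: c_def)
  show "L2_on UNIV (fourier_L1 (u k))" for k by (rule L2_fourier_L1[OF u])
  fix e :: real assume e: "e > 0"
  obtain N where N: "\<And>m n. m \<ge> N \<Longrightarrow> n \<ge> N \<Longrightarrow> norm2sq (\<lambda>x. u m x - u n x) \<le> ennreal (e / c)"
    using norm2sq_convergent_Cauchy[OF _ _ lim, of "e / c"] e c by auto
  have "norm2sq (\<lambda>\<xi>. fourier_L1 (u m) \<xi> - fourier_L1 (u n) \<xi>) \<le> ennreal e" if "m \<ge> N" "n \<ge> N" for m n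
  proof -
    have "ennreal c * norm2sq (\<lambda>x. u m x - u n x) \<le> ennreal c * ennreal (e / c)" by (rule mult_left_mono[OF N[OF that]]) simp
    also have "\<dots> = ennreal e" using e c by (subst ennreal_mult[symmetric]) auto
    finally show ?thesis by (simp add: plancherel_L1_diff[OF u u] c_def)
  qed
  then show "\<exists>N. \<forall>m\<ge>N. \<forall>n\<ge>N. norm2sq (\<lambda>x. fourier_L1 (u m) x - fourier_L1 (u n) x) \<le> ennreal e" by blast
qed (rule that)

text \<open>The limit of the transforms depends on the limit function alone, so that the transform may be computed
  along any approximation by integrable functions and not just by truncations.\<close>

lemma fourier_L1_limit_general:
  fixes u :: "nat \<Rightarrow> 'a::euclidean_space \<Rightarrow> real" and v :: "'k \<Rightarrow> 'a \<Rightarrow> real"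
  assumes u: "\<And>k. integrable lborel (u k)" "\<And>k. L2_on UNIV (u k)" and w: "L2_on UNIV w"
    and lim: "(\<lambda>k. norm2sq (\<lambda>x. u k x - w x)) \<longlonglongrightarrow> 0"
    and g: "L2_on UNIV g" "(\<lambda>k. norm2sq (\<lambda>\<xi>. fourier_L1 (u k) \<xi> - g \<xi>)) \<longlonglongrightarrow> 0"
    and v: "\<And>k. integrable lborel (v k)" "\<And>k. L2_on UNIV (v k)"
    and limv: "((\<lambda>k. norm2sq (\<lambda>x. v k x - w x)) \<longlongrightarrow> 0) F"
  shows "((\<lambda>k. norm2sq (\<lambda>\<xi>. fourier_L1 (v k) \<xi> - g \<xi>)) \<longlongrightarrow> 0) F"
proof -
  note [measurable] = u(2)[THEN L2_measurable] v(2)[THEN L2_measurable] w[THEN L2_measurable] g(1)[THEN L2_measurable]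
  define c :: ennreal where "c = ennreal ((2 * pi) ^ DIM('a))"
  have c: "c < \<infinity>" by (simp add: c_def)
  have bd: "norm2sq (\<lambda>\<xi>. fourier_L1 (v k) \<xi> - g \<xi>) \<le> 4 * c * norm2sq (\<lambda>x. v k x - w x)" for k
  proof -
    let ?V = "norm2sq (\<lambda>x. v k x - w x)"
    have V: "?V < \<infinity>" by (intro norm2sq_finite L2_diff v w)
    have "norm2sq (\<lambda>\<xi>. fourier_L1 (v k) \<xi> - g \<xi>) \<le>
        4 * c * ?V + (4 * c * norm2sq (\<lambda>x. u j x - w x) + 2 * norm2sq (\<lambda>\<xi>. fourier_L1 (u j) \<xi> - g \<xi>))" for j
    proof -
      have "norm2sq (\<lambda>\<xi>. fourier_L1 (v k) \<xi> - g \<xi>) \<le> 2 * norm2sq (\<lambda>\<xi>. fourier_L1 (v k) \<xi> - fourier_L1 (u j) \<xi>)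
          + 2 * norm2sq (\<lambda>\<xi>. fourier_L1 (u j) \<xi> - g \<xi>)"
        by (rule norm2sq_triangle) auto
      also have "norm2sq (\<lambda>\<xi>. fourier_L1 (v k) \<xi> - fourier_L1 (u j) \<xi>) = c * norm2sq (\<lambda>x. v k x - u j x)"
        unfolding c_def by (rule plancherel_L1_diff[OF v u])
      also have "2 * (c * norm2sq (\<lambda>x. v k x - u j x)) \<le> 2 * (c * (2 * ?V + 2 * norm2sq (\<lambda>x. w x - u j x)))"
        by (intro mult_left_mono norm2sq_triangle) auto
      also have "\<dots> = 4 * c * ?V + 4 * c * norm2sq (\<lambda>x. u j x - w x)"
        unfolding norm2sq_minus_commute[of w] by (simp add: distrib_left mult_ac)
      finally show ?thesis by (simp add: add.assoc)
    qed
    moreover have "(\<lambda>j. 4 * c * ?V + (4 * c * norm2sq (\<lambda>x. u j x - w x) + 2 * norm2sq (\<lambda>\<xi>. fourier_L1 (u j) \<xi> - g \<xi>))) \<longlonglongrightarrow> 4 * c * ?V + 0"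
      using c by (intro tendsto_add tendsto_const tendsto_0_add_ennreal tendsto_0_cmult_ennreal lim g(2)) (auto simp: ennreal_mult_less_top)
    ultimately show ?thesis by (intro LIMSEQ_le_const) auto
  qed
  show ?thesis
    by (rule tendsto_0_bound_ennreal[OF tendsto_0_cmult_ennreal[OF limv, of "4 * c"]]) (use bd c in \<open>auto simp: ennreal_mult_less_top\<close>)
qed

lemma fourier_spec:
  fixes u :: "'a::euclidean_space \<Rightarrow> real"
  assumes u: "L2_on UNIV u"
  shows L2_fourier: "L2_on UNIV (fourier u)"
    and fourier_trunc_tendsto: "((\<lambda>R. norm2sq (\<lambda>\<xi>. fourier_L1 (trunc R u) \<xi> - fourier u \<xi>)) \<longlongrightarrow> 0) at_top"
proof -
  obtain g where g: "L2_on UNIV g" "(\<lambda>k. norm2sq (\<lambda>\<xi>. fourier_L1 (trunc (real k) u) \<xi> - g \<xi>)) \<longlonglongrightarrow> 0"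
    using fourier_L1_limit_exists[OF integrable_trunc[OF u] L2_trunc[OF u] u trunc_tendsto_seq[OF u]] by blast
  have "((\<lambda>R. norm2sq (\<lambda>\<xi>. fourier_L1 (trunc R u) \<xi> - g \<xi>)) \<longlongrightarrow> 0) at_top"
    by (rule fourier_L1_limit_general[OF integrable_trunc[OF u] L2_trunc[OF u] u trunc_tendsto_seq[OF u] g
          integrable_trunc[OF u] L2_trunc[OF u] trunc_tendsto[OF u]])
  then have "\<exists>g. L2_on UNIV g \<and>
     ((\<lambda>R. \<integral>\<^sup>+\<xi>. ennreal ((norm (fourier_L1 (\<lambda>x. indicator (ball 0 R) x * u x) \<xi> - g \<xi>))\<^sup>2) \<partial>lborel) \<longlongrightarrow> 0) at_top"
    using g(1) by (auto simp: norm2sq_def)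
  from someI_ex[OF this]
  show "L2_on UNIV (fourier u)" "((\<lambda>R. norm2sq (\<lambda>\<xi>. fourier_L1 (trunc R u) \<xi> - fourier u \<xi>)) \<longlongrightarrow> 0) at_top"
    unfolding fourier_def[symmetric] norm2sq_def by auto
qed

lemma fourier_measurable [measurable]: "L2_on UNIV u \<Longrightarrow> fourier u \<in> borel_measurable borel"
  using L2_fourier L2_measurable by blast

lemma fourier_L1_tendsto_fourier:
  fixes u :: "'k \<Rightarrow> 'a::euclidean_space \<Rightarrow> real"
  assumes u: "\<And>k. integrable lborel (u k)" "\<And>k. L2_on UNIV (u k)" and w: "L2_on UNIV w"
    and lim: "((\<lambda>k. norm2sq (\<lambda>x. u k x - w x)) \<longlongrightarrow> 0) F"
  shows "((\<lambda>k. norm2sq (\<lambda>\<xi>. fourier_L1 (u k) \<xi> - fourier w \<xi>)) \<longlongrightarrow> 0) F"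
proof (rule fourier_L1_limit_general[OF integrable_trunc[OF w] L2_trunc[OF w] w trunc_tendsto_seq[OF w] L2_fourier[OF w] _ u lim])
  show "(\<lambda>k. norm2sq (\<lambda>\<xi>. fourier_L1 (trunc (real k) w) \<xi> - fourier w \<xi>)) \<longlonglongrightarrow> 0"
    using filterlim_compose[OF fourier_trunc_tendsto[OF w] filterlim_real_sequentially] .
qed

lemma fourier_eq_fourier_L1:
  assumes u: "integrable lborel u" "L2_on UNIV u"
  shows "AE \<xi> in lborel. fourier u \<xi> = fourier_L1 u \<xi>"
proof -
  have "((\<lambda>k::nat. norm2sq (\<lambda>\<xi>. fourier_L1 u \<xi> - fourier u \<xi>)) \<longlonglongrightarrow> 0)"
    by (rule fourier_L1_tendsto_fourier) (use u in \<open>auto simp: norm2sq_def\<close>)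
  then have "norm2sq (\<lambda>\<xi>. fourier_L1 u \<xi> - fourier u \<xi>) = 0" by (simp add: tendsto_const_iff)
  moreover have "(\<lambda>\<xi>. fourier_L1 u \<xi> - fourier u \<xi>) \<in> borel_measurable borel"
    using u(2) L2_measurable[OF u(2)] by measurable
  ultimately have "AE \<xi> in lborel. fourier_L1 u \<xi> - fourier u \<xi> = 0" by (simp add: norm2sq_eq_0_iff)
  then show ?thesis by eventually_elim simp
qed

lemma fourier_add:
  fixes u v :: "'a::euclidean_space \<Rightarrow> real"
  assumes u: "L2_on UNIV u" and v: "L2_on UNIV v"
  shows "AE \<xi> in lborel. fourier (\<lambda>x. u x + c * v x) \<xi> = fourier u \<xi> + of_real c * fourier v \<xi>"
proof -
  note [measurable] = u[THEN L2_measurable] v[THEN L2_measurable] L2_trunc[OF u, THEN L2_measurable] L2_trunc[OF v, THEN L2_measurable]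
     L2_fourier[OF u, THEN L2_measurable] L2_fourier[OF v, THEN L2_measurable]
  let ?w = "\<lambda>x. u x + c * v x"
  have w: "L2_on UNIV ?w" using u v by (intro L2_add L2_cmult)
  note [measurable] = w[THEN L2_measurable] L2_fourier[OF w, THEN L2_measurable] L2_trunc[OF w, THEN L2_measurable]
  note lim = fourier_L1_tendsto_fourier[OF integrable_trunc L2_trunc _ trunc_tendsto_seq]
  have e: "fourier_L1 (trunc (real k) ?w) \<xi> = fourier_L1 (trunc (real k) u) \<xi> + of_real c * fourier_L1 (trunc (real k) v) \<xi>" for k \<xi>
  proof -
    have "fourier_L1 (trunc (real k) u) \<xi> + of_real c * fourier_L1 (trunc (real k) v) \<xi>
        = (LINT x|lborel. trunc (real k) u x *\<^sub>R cis (- (x \<bullet> \<xi>))) + (LINT x|lborel. of_real c * (trunc (real k) v x *\<^sub>R cis (- (x \<bullet> \<xi>))))"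
      unfolding fourier_L1_def by (simp only: integral_mult_right_zero)
    also have "\<dots> = (LINT x|lborel. trunc (real k) u x *\<^sub>R cis (- (x \<bullet> \<xi>)) + of_real c * (trunc (real k) v x *\<^sub>R cis (- (x \<bullet> \<xi>))))"
      by (intro Bochner_Integration.integral_add[symmetric] integrable_mult_right integrable_fourier_L1 integrable_trunc u v)
    also have "\<dots> = fourier_L1 (trunc (real k) ?w) \<xi>"
      unfolding fourier_L1_def by (intro Bochner_Integration.integral_cong) (auto simp: scaleR_conv_of_real algebra_simps)
    finally show ?thesis ..
  qed
  have 1: "(\<lambda>k. norm2sq (\<lambda>\<xi>. fourier_L1 (trunc (real k) ?w) \<xi> - fourier ?w \<xi>)) \<longlonglongrightarrow> 0" by (rule lim) (rule w)+
  have "(\<lambda>k. norm2sq (\<lambda>\<xi>. (fourier_L1 (trunc (real k) u) \<xi> - fourier u \<xi>) + c *\<^sub>R (fourier_L1 (trunc (real k) v) \<xi> - fourier v \<xi>))) \<longlonglongrightarrow> 0"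
  proof (rule norm2sq_tendsto_add)
    show "(\<lambda>k. norm2sq (\<lambda>\<xi>. fourier_L1 (trunc (real k) u) \<xi> - fourier u \<xi>)) \<longlonglongrightarrow> 0" by (rule lim) (rule u)+
    have "(\<lambda>k. norm2sq (\<lambda>\<xi>. fourier_L1 (trunc (real k) v) \<xi> - fourier v \<xi>)) \<longlonglongrightarrow> 0" by (rule lim) (rule v)+
    then show "(\<lambda>k. norm2sq (\<lambda>\<xi>. c *\<^sub>R (fourier_L1 (trunc (real k) v) \<xi> - fourier v \<xi>))) \<longlonglongrightarrow> 0"
      by (subst norm2sq_scaleR) (auto intro!: tendsto_0_cmult_ennreal)
  qed auto
  then have 2: "(\<lambda>k. norm2sq (\<lambda>\<xi>. fourier_L1 (trunc (real k) ?w) \<xi> - (fourier u \<xi> + of_real c * fourier v \<xi>))) \<longlonglongrightarrow> 0"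
    unfolding e by (simp add: scaleR_conv_of_real algebra_simps)
  show ?thesis by (rule norm2sq_limit_unique[OF _ _ _ _ 1 2]) auto
qed

lemma fourier_diff:
  assumes "L2_on UNIV u" "L2_on UNIV v"
  shows "AE \<xi> in lborel. fourier (\<lambda>x. u x - v x) \<xi> = fourier u \<xi> - fourier v \<xi>"
  using fourier_add[OF assms, of "-1"] by simp

lemma fourier_cmult:
  assumes "L2_on UNIV u"
  shows "AE \<xi> in lborel. fourier (\<lambda>x. c * u x) \<xi> = of_real c * fourier u \<xi>"
  using fourier_add[OF L2_0 assms, of c] fourier_add[OF L2_0 L2_0, of 1]
  by eventually_elim simp

lemma fourier_cong_AE:
  assumes [measurable]: "u \<in> borel_measurable borel" "v \<in> borel_measurable borel" and uv: "AE x in lborel. u x = v x"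
  shows "fourier u = fourier v"
proof -
  have "fourier_L1 (\<lambda>x. indicator (ball 0 R) x * u x) = fourier_L1 (\<lambda>x. indicator (ball 0 R) x * v x)" for R
    unfolding fourier_L1_def
  proof (rule ext, rule integral_cong_AE)
    have [measurable]: "(\<lambda>x::'a. indicator (ball 0 R) x :: real) \<in> borel_measurable borel"
      by (rule borel_measurable_indicator) simp
    show "(\<lambda>x. (indicator (ball 0 R) x * u x) *\<^sub>R cis (- (x \<bullet> \<xi>))) \<in> borel_measurable lborel"
      "(\<lambda>x. (indicator (ball 0 R) x * v x) *\<^sub>R cis (- (x \<bullet> \<xi>))) \<in> borel_measurable lborel" for \<xi> by measurable
    show "AE x in lborel. (indicator (ball 0 R) x * u x) *\<^sub>R cis (- (x \<bullet> \<xi>)) = (indicator (ball 0 R) x * v x) *\<^sub>R cis (- (x \<bullet> \<xi>))" for \<xi>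
      using uv by eventually_elim simp
  qed
  then show ?thesis unfolding fourier_def by simp
qed

theorem plancherel:
  fixes u :: "'a::euclidean_space \<Rightarrow> real"
  assumes u: "L2_on UNIV u"
  shows "norm2sq (fourier u) = ennreal ((2 * pi) ^ DIM('a)) * norm2sq u"
proof -
  have "(\<lambda>k. norm2sq (\<lambda>\<xi>. fourier_L1 (trunc (real k) u) \<xi> - fourier u \<xi>)) \<longlonglongrightarrow> 0"
    by (rule fourier_L1_tendsto_fourier[OF integrable_trunc[OF u] L2_trunc[OF u] u trunc_tendsto_seq[OF u]])
  then have "(\<lambda>k. norm2sq (fourier_L1 (trunc (real k) u))) \<longlonglongrightarrow> norm2sq (fourier u)"
    by (intro norm2sq_tendsto L2_fourier_L1 integrable_trunc L2_trunc L2_fourier u)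
  moreover have "(\<lambda>k. norm2sq (fourier_L1 (trunc (real k) u))) \<longlonglongrightarrow> ennreal ((2 * pi) ^ DIM('a)) * norm2sq u"
    unfolding plancherel_L1[OF integrable_trunc[OF u] L2_trunc[OF u]]
    by (intro ennreal_tendsto_cmult norm2sq_tendsto L2_trunc u trunc_tendsto_seq) auto
  ultimately show ?thesis by (rule LIMSEQ_unique)
qed

lemma plancherel_diff:
  fixes u v :: "'a::euclidean_space \<Rightarrow> real"
  assumes u: "L2_on UNIV u" and v: "L2_on UNIV v"
  shows "norm2sq (\<lambda>\<xi>. fourier u \<xi> - fourier v \<xi>) = ennreal ((2 * pi) ^ DIM('a)) * norm2sq (\<lambda>x. u x - v x)"
proof -
  have "norm2sq (\<lambda>\<xi>. fourier u \<xi> - fourier v \<xi>) = norm2sq (fourier (\<lambda>x. u x - v x))"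
    by (rule norm2sq_cong_AE) (use fourier_diff[OF u v] in \<open>auto elim!: eventually_mono\<close>)
  then show ?thesis using plancherel[OF L2_diff[OF u v]] by simp
qed

lemma fourier_injective:
  fixes u v :: "'a::euclidean_space \<Rightarrow> real"
  assumes u: "L2_on UNIV u" and v: "L2_on UNIV v" and eq: "AE \<xi> in lborel. fourier u \<xi> = fourier v \<xi>"
  shows "AE x in lborel. u x = v x"
proof -
  have "norm2sq (\<lambda>\<xi>. fourier u \<xi> - fourier v \<xi>) = norm2sq (\<lambda>\<xi>::'a. 0::complex)"
    by (rule norm2sq_cong_AE) (use eq in \<open>auto elim!: eventually_mono\<close>)
  then have "ennreal ((2 * pi) ^ DIM('a)) * norm2sq (\<lambda>x. u x - v x) = 0"
    unfolding plancherel_diff[OF u v] by (simp add: norm2sq_def)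
  moreover have "0 < ((2 * pi) ^ DIM('a) :: real)" by (intro zero_less_power) simp
  ultimately have "norm2sq (\<lambda>x. u x - v x) = 0" by (simp only: mult_eq_0_iff ennreal_eq_0_iff) linarith
  then have "AE x in lborel. u x - v x = 0"
    using L2_measurable[OF L2_diff[OF u v]] by (simp add: norm2sq_eq_0_iff)
  then show ?thesis by eventually_elim simp
qed

lemma fourier_tendsto:
  fixes u :: "'k \<Rightarrow> 'a::euclidean_space \<Rightarrow> real"
  assumes u: "\<And>k. L2_on UNIV (u k)" and w: "L2_on UNIV w"
    and lim: "((\<lambda>k. norm2sq (\<lambda>x. u k x - w x)) \<longlongrightarrow> 0) F"
  shows "((\<lambda>k. norm2sq (\<lambda>\<xi>. fourier (u k) \<xi> - fourier w \<xi>)) \<longlongrightarrow> 0) F"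
  unfolding plancherel_diff[OF u w] by (rule tendsto_0_cmult_ennreal[OF lim]) simp

text \<open>Truncations are integrable, and both sides are continuous in $L^2$.\<close>

lemma fourier_multiplier_extend:
  fixes T :: "('a::euclidean_space \<Rightarrow> real) \<Rightarrow> 'a \<Rightarrow> real" and m :: "'a \<Rightarrow> complex"
  assumes u: "L2_on UNIV u"
    and T: "\<And>v. L2_on UNIV v \<Longrightarrow> L2_on UNIV (T v)"
    and Tlim: "(\<lambda>k. norm2sq (\<lambda>x. T (trunc (real k) u) x - T u x)) \<longlonglongrightarrow> 0"
    and m [measurable]: "m \<in> borel_measurable borel" and mb: "\<And>\<xi>. norm (m \<xi>) \<le> M"
    and eq: "\<And>v. integrable lborel v \<Longrightarrow> L2_on UNIV v \<Longrightarrow> AE \<xi> in lborel. fourier (T v) \<xi> = m \<xi> * fourier v \<xi>"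
  shows "AE \<xi> in lborel. fourier (T u) \<xi> = m \<xi> * fourier u \<xi>"
proof -
  let ?u = "\<lambda>k. trunc (real k) u"
  note tu = L2_trunc[OF u] L2_fourier[OF L2_trunc[OF u]] T[OF L2_trunc[OF u]] L2_fourier[OF T[OF L2_trunc[OF u]]]
  note [measurable] = L2_fourier[OF u, THEN L2_measurable] L2_fourier[OF T[OF u], THEN L2_measurable] tu[THEN L2_measurable]
  have M: "M \<ge> 0" using order.trans[OF norm_ge_zero mb] .
  have 1: "(\<lambda>k. norm2sq (\<lambda>\<xi>. fourier (T (?u k)) \<xi> - fourier (T u) \<xi>)) \<longlonglongrightarrow> 0"
    by (rule fourier_tendsto[OF T[OF L2_trunc[OF u]] T[OF u] Tlim])
  have 2: "(\<lambda>k. norm2sq (\<lambda>\<xi>. fourier (?u k) \<xi> - fourier u \<xi>)) \<longlonglongrightarrow> 0"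
    by (rule fourier_tendsto[OF L2_trunc[OF u] u trunc_tendsto_seq[OF u]])
  have 3: "(\<lambda>k. norm2sq (\<lambda>\<xi>. fourier (T (?u k)) \<xi> - m \<xi> * fourier u \<xi>)) \<longlonglongrightarrow> 0"
  proof (rule tendsto_0_bound_ennreal[OF tendsto_0_cmult_ennreal[OF 2, of "ennreal (M\<^sup>2)"]])
    have "norm2sq (\<lambda>\<xi>. fourier (T (?u k)) \<xi> - m \<xi> * fourier u \<xi>) \<le> norm2sq (\<lambda>\<xi>. M *\<^sub>R (fourier (?u k) \<xi> - fourier u \<xi>))" for k
    proof (rule norm2sq_mono_AE)
      show "AE \<xi> in lborel. norm (fourier (T (?u k)) \<xi> - m \<xi> * fourier u \<xi>) \<le> norm (M *\<^sub>R (fourier (?u k) \<xi> - fourier u \<xi>))"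
        using eq[OF integrable_trunc[OF u] L2_trunc[OF u], of "real k"]
      proof eventually_elim
        case (elim \<xi>)
        have "norm (fourier (T (?u k)) \<xi> - m \<xi> * fourier u \<xi>) = norm (m \<xi>) * norm (fourier (?u k) \<xi> - fourier u \<xi>)"
          unfolding elim right_diff_distrib[symmetric] by (rule norm_mult)
        also have "\<dots> \<le> M * norm (fourier (?u k) \<xi> - fourier u \<xi>)" by (intro mult_right_mono mb) auto
        finally show ?case using M by simp
      qed
    qed
    then show "\<forall>\<^sub>F k in sequentially. norm2sq (\<lambda>\<xi>. fourier (T (?u k)) \<xi> - m \<xi> * fourier u \<xi>) \<le> ennreal (M\<^sup>2) * norm2sq (\<lambda>\<xi>. fourier (?u k) \<xi> - fourier u \<xi>)"
      by (subst norm2sq_scaleR[symmetric]) auto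
  qed simp
  show ?thesis by (rule norm2sq_limit_unique[OF _ _ _ _ 1 3]) auto
qed

text \<open>Up to a constant the transform is an isometry, hence convergence of the transforms forces convergence of
  the functions. This is how functions with a prescribed transform are produced.\<close>

lemma fourier_limit_inverse:
  fixes u :: "nat \<Rightarrow> 'a::euclidean_space \<Rightarrow> real"
  assumes u: "\<And>k. L2_on UNIV (u k)" and G: "L2_on UNIV G"
    and lim: "(\<lambda>k. norm2sq (\<lambda>\<xi>. fourier (u k) \<xi> - G \<xi>)) \<longlonglongrightarrow> 0"
  obtains w where "L2_on UNIV w" "(\<lambda>k. norm2sq (\<lambda>x. u k x - w x)) \<longlonglongrightarrow> 0" "AE \<xi> in lborel. fourier w \<xi> = G \<xi>"
proof -
  note [measurable] = u[THEN L2_measurable] u[THEN L2_fourier, THEN L2_measurable] G[THEN L2_measurable]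
  define c :: real where "c = (2 * pi) ^ DIM('a)"
  have c: "c > 0" unfolding c_def by (intro zero_less_power) simp
  obtain w where w: "L2_on UNIV w" "(\<lambda>k. norm2sq (\<lambda>x. u k x - w x)) \<longlonglongrightarrow> 0"
  proof (rule L2_complete[OF u])
    fix e :: real assume e: "e > 0"
    obtain N where N: "\<And>m n. m \<ge> N \<Longrightarrow> n \<ge> N \<Longrightarrow> norm2sq (\<lambda>\<xi>. fourier (u m) \<xi> - fourier (u n) \<xi>) \<le> ennreal (c * e)"
      using norm2sq_convergent_Cauchy[OF _ _ lim, of "c * e"] e c by auto
    have "norm2sq (\<lambda>x. u m x - u n x) \<le> ennreal e" if "m \<ge> N" "n \<ge> N" for m n
    proof -
      have "ennreal c * norm2sq (\<lambda>x. u m x - u n x) \<le> ennreal (c * e)"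
        using N[OF that] unfolding c_def plancherel_diff[OF u u] .
      also have "\<dots> = ennreal c * ennreal e" using e c by (subst ennreal_mult[symmetric]) auto
      finally show ?thesis using c by (subst (asm) ennreal_mult_le_mult_iff) auto
    qed
    then show "\<exists>N. \<forall>m\<ge>N. \<forall>n\<ge>N. norm2sq (\<lambda>x. u m x - u n x) \<le> ennreal e" by blast
  qed
  note [measurable] = w(1)[THEN L2_fourier, THEN L2_measurable]
  have "AE \<xi> in lborel. fourier w \<xi> = G \<xi>"
    by (rule norm2sq_limit_unique[OF _ _ _ _ fourier_tendsto[OF u w(1) w(2)] lim]) auto
  with w show ?thesis by (rule that)
qed

section \<open>Correlation with an integrable kernel\<close>

definition corr :: "('a::euclidean_space \<Rightarrow> real) \<Rightarrow> ('a \<Rightarrow> real) \<Rightarrow> 'a \<Rightarrow> real" where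
  "corr k u x = (LINT h|lborel. k h * u (x + h))"

lemma corr_measurable [measurable]:
  assumes [measurable]: "k \<in> borel_measurable borel" "u \<in> borel_measurable borel"
  shows "corr k u \<in> borel_measurable borel"
  unfolding corr_def[abs_def] by measurable

text \<open>The inequality of Young: Cauchy--Schwarz with respect to the weight $|k|$, and then Fubini.\<close>

lemma corr_nn_bound:
  fixes k u :: "'a::euclidean_space \<Rightarrow> real"
  assumes k: "integrable lborel k" and u: "L2_on UNIV u"
  shows "(\<integral>\<^sup>+x. (\<integral>\<^sup>+h. ennreal \<bar>k h * u (x + h)\<bar> \<partial>lborel)\<^sup>2 \<partial>lborel) \<le> ennreal ((LINT h|lborel. \<bar>k h\<bar>)\<^sup>2) * norm2sq u"
proof -
  have [measurable]: "k \<in> borel_measurable borel" using borel_measurable_integrable[OF k] by simp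
  note [measurable] = u[THEN L2_measurable]
  define K where "K = (LINT h|lborel. \<bar>k h\<bar>)"
  have K: "(\<integral>\<^sup>+h. ennreal \<bar>k h\<bar> \<partial>lborel) = ennreal K" "K \<ge> 0"
    unfolding K_def using k by (auto intro: nn_integral_eq_integral)
  have "(\<integral>\<^sup>+h. ennreal \<bar>k h * u (x + h)\<bar> \<partial>lborel)\<^sup>2 \<le> ennreal K * (\<integral>\<^sup>+h. ennreal (\<bar>k h\<bar> * (u (x + h))\<^sup>2) \<partial>lborel)" for x
  proof -
    have "\<bar>k h * y\<bar> = sqrt \<bar>k h\<bar> * (sqrt \<bar>k h\<bar> * \<bar>y\<bar>)" for h y by (simp add: abs_mult)
    then have "(\<integral>\<^sup>+h. ennreal \<bar>k h * u (x + h)\<bar> \<partial>lborel)\<^sup>2 = (\<integral>\<^sup>+h. ennreal (sqrt \<bar>k h\<bar>) * ennreal (sqrt \<bar>k h\<bar> * \<bar>u (x + h)\<bar>) \<partial>lborel)\<^sup>2"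
      by (simp only: ennreal_mult[symmetric] real_sqrt_ge_zero abs_ge_zero mult_nonneg_nonneg)
    also have "\<dots> \<le> (\<integral>\<^sup>+h. (ennreal (sqrt \<bar>k h\<bar>))\<^sup>2 \<partial>lborel) * (\<integral>\<^sup>+h. (ennreal (sqrt \<bar>k h\<bar> * \<bar>u (x + h)\<bar>))\<^sup>2 \<partial>lborel)"
      by (rule Cauchy_Schwarz_nn_integral) measurable
    finally show ?thesis by (simp add: ennreal_power K power_mult_distrib)
  qed
  then have "(\<integral>\<^sup>+x. (\<integral>\<^sup>+h. ennreal \<bar>k h * u (x + h)\<bar> \<partial>lborel)\<^sup>2 \<partial>lborel)
      \<le> (\<integral>\<^sup>+x. ennreal K * (\<integral>\<^sup>+h. ennreal (\<bar>k h\<bar> * (u (x + h))\<^sup>2) \<partial>lborel) \<partial>lborel)"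
    by (intro nn_integral_mono) auto
  also have "\<dots> = ennreal K * (\<integral>\<^sup>+x. (\<integral>\<^sup>+h. ennreal (\<bar>k h\<bar> * (u (x + h))\<^sup>2) \<partial>lborel) \<partial>lborel)"
    by (rule nn_integral_cmult) measurable
  also have "(\<integral>\<^sup>+x. (\<integral>\<^sup>+h. ennreal (\<bar>k h\<bar> * (u (x + h))\<^sup>2) \<partial>lborel) \<partial>lborel)
     = (\<integral>\<^sup>+h. (\<integral>\<^sup>+x. ennreal (\<bar>k h\<bar> * (u (x + h))\<^sup>2) \<partial>lborel) \<partial>lborel)"
    by (rule lborel_pair.Fubini') measurable
  also have "\<dots> = (\<integral>\<^sup>+h. ennreal \<bar>k h\<bar> * norm2sq u \<partial>lborel)"
  proof (rule nn_integral_cong)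
    fix h
    have "(\<integral>\<^sup>+x. ennreal (\<bar>k h\<bar> * (u (x + h))\<^sup>2) \<partial>lborel) = ennreal \<bar>k h\<bar> * norm2sq (\<lambda>x. u (x + h))"
      unfolding norm2sq_def by (subst nn_integral_cmult[symmetric]) (auto simp: ennreal_mult)
    then show "(\<integral>\<^sup>+x. ennreal (\<bar>k h\<bar> * (u (x + h))\<^sup>2) \<partial>lborel) = ennreal \<bar>k h\<bar> * norm2sq u"
      by (simp add: norm2sq_translate)
  qed
  also have "\<dots> = ennreal K * norm2sq u" by (subst nn_integral_multc) (auto simp: K)
  finally show ?thesis using K(2) unfolding K_def[symmetric]
    by (simp add: power2_eq_square ennreal_mult mult.assoc)
qed

lemma corr_AE_integrable:
  fixes k u :: "'a::euclidean_space \<Rightarrow> real"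
  assumes k: "integrable lborel k" and u: "L2_on UNIV u"
  shows "AE x in lborel. integrable lborel (\<lambda>h. k h * u (x + h))"
proof -
  have [measurable]: "k \<in> borel_measurable borel" using borel_measurable_integrable[OF k] by simp
  note [measurable] = u[THEN L2_measurable]
  have "(\<integral>\<^sup>+x. (\<integral>\<^sup>+h. ennreal \<bar>k h * u (x + h)\<bar> \<partial>lborel)\<^sup>2 \<partial>lborel) < \<infinity>"
    by (rule order.strict_trans1[OF corr_nn_bound[OF k u]]) (use norm2sq_finite[OF u] in \<open>auto simp: ennreal_mult_less_top\<close>)
  then have "AE x in lborel. (\<integral>\<^sup>+h. ennreal \<bar>k h * u (x + h)\<bar> \<partial>lborel)\<^sup>2 \<noteq> \<infinity>"
    by (intro nn_integral_PInf_AE) auto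
  then show ?thesis
  proof eventually_elim
    case (elim x)
    then have "(\<integral>\<^sup>+h. ennreal \<bar>k h * u (x + h)\<bar> \<partial>lborel) < \<infinity>"
      by (auto simp: power2_eq_square ennreal_mult_eq_top_iff less_top)
    then show ?case by (subst integrable_iff_bounded) auto
  qed
qed

lemma norm2sq_corr:
  fixes k u :: "'a::euclidean_space \<Rightarrow> real"
  assumes k: "integrable lborel k" and u: "L2_on UNIV u"
  shows "norm2sq (corr k u) \<le> ennreal ((LINT h|lborel. \<bar>k h\<bar>)\<^sup>2) * norm2sq u"
proof -
  have "norm2sq (corr k u) \<le> (\<integral>\<^sup>+x. (\<integral>\<^sup>+h. ennreal \<bar>k h * u (x + h)\<bar> \<partial>lborel)\<^sup>2 \<partial>lborel)"
    unfolding norm2sq_def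
  proof (rule nn_integral_mono_AE)
    show "AE x in lborel. ennreal ((norm (corr k u x))\<^sup>2) \<le> (\<integral>\<^sup>+h. ennreal \<bar>k h * u (x + h)\<bar> \<partial>lborel)\<^sup>2"
      using corr_AE_integrable[OF k u]
    proof eventually_elim
      case (elim x)
      then have "ennreal (norm (corr k u x)) \<le> (\<integral>\<^sup>+h. ennreal (norm (k h * u (x + h))) \<partial>lborel)"
        unfolding corr_def by (rule integral_norm_bound_ennreal)
      then have "(ennreal (norm (corr k u x)))\<^sup>2 \<le> (\<integral>\<^sup>+h. ennreal \<bar>k h * u (x + h)\<bar> \<partial>lborel)\<^sup>2"
        by (intro power_mono) auto
      then show ?case by (simp add: ennreal_power)
    qed
  qed
  also note corr_nn_bound[OF k u]
  finally show ?thesis .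
qed

lemma L2_corr:
  assumes k: "integrable lborel k" and u: "L2_on UNIV u"
  shows "L2_on UNIV (corr k u)"
proof (rule L2_onI)
  show "corr k u \<in> borel_measurable borel"
    using borel_measurable_integrable[OF k] L2_measurable[OF u] by measurable
  show "norm2sq (corr k u) < \<infinity>"
    by (rule order.strict_trans1[OF norm2sq_corr[OF k u]]) (use norm2sq_finite[OF u] in \<open>auto simp: ennreal_mult_less_top\<close>)
qed

lemma corr_diff:
  assumes k: "integrable lborel k" and u: "L2_on UNIV u" and v: "L2_on UNIV v"
  shows "AE x in lborel. corr k (\<lambda>x. u x - v x) x = corr k u x - corr k v x"
  using corr_AE_integrable[OF k u] corr_AE_integrable[OF k v]
  by eventually_elim (simp add: corr_def right_diff_distrib)

lemma norm_kernel_transform_le: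
  "norm (LINT h|lborel. k h *\<^sub>R cis (h \<bullet> \<xi>)) \<le> (LINT h|lborel. \<bar>k h\<bar>)"
  by (rule order.trans[OF integral_norm_bound]) simp

lemma fourier_corr:
  fixes k u :: "'a::euclidean_space \<Rightarrow> real"
  assumes k: "integrable lborel k" and u: "L2_on UNIV u"
  shows "AE \<xi> in lborel. fourier (corr k u) \<xi> = (LINT h|lborel. k h *\<^sub>R cis (h \<bullet> \<xi>)) * fourier u \<xi>"
proof (rule fourier_multiplier_extend[OF u L2_corr[OF k] _ _ norm_kernel_transform_le])
  have [measurable]: "k \<in> borel_measurable borel" using borel_measurable_integrable[OF k] by simp
  show "(\<lambda>\<xi>. LINT h|lborel. k h *\<^sub>R cis (h \<bullet> \<xi>)) \<in> borel_measurable borel" by measurable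
  show "(\<lambda>n. norm2sq (\<lambda>x. corr k (trunc (real n) u) x - corr k u x)) \<longlonglongrightarrow> 0"
  proof (rule tendsto_0_bound_ennreal[OF tendsto_0_cmult_ennreal[OF trunc_tendsto_seq[OF u], of "ennreal ((LINT h|lborel. \<bar>k h\<bar>)\<^sup>2)"]])
    have "norm2sq (\<lambda>x. corr k (trunc (real n) u) x - corr k u x) = norm2sq (corr k (\<lambda>x. trunc (real n) u x - u x))" for n
    proof (rule norm2sq_cong_AE)
      show "AE x in lborel. corr k (trunc (real n) u) x - corr k u x = corr k (\<lambda>x. trunc (real n) u x - u x) x"
        using corr_diff[OF k L2_trunc[OF u, of "real n"] u] by eventually_elim simp
    qed
    then show "\<forall>\<^sub>F n in sequentially. norm2sq (\<lambda>x. corr k (trunc (real n) u) x - corr k u x)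
        \<le> ennreal ((LINT h|lborel. \<bar>k h\<bar>)\<^sup>2) * norm2sq (\<lambda>x. trunc (real n) u x - u x)"
      using norm2sq_corr[OF k L2_diff[OF L2_trunc[OF u] u]] by (auto intro!: always_eventually)
  qed simp
  fix v :: "'a \<Rightarrow> real" assume v: "integrable lborel v" "L2_on UNIV v"
  have i: "integrable lborel (corr k v)" unfolding corr_def[abs_def] by (rule integrable_correlation[OF k v(1)])
  show "AE \<xi> in lborel. fourier (corr k v) \<xi> = (LINT h|lborel. k h *\<^sub>R cis (h \<bullet> \<xi>)) * fourier v \<xi>"
    using fourier_eq_fourier_L1[OF i L2_corr[OF k v(2)]] fourier_eq_fourier_L1[OF v]
    by eventually_elim (use fourier_L1_correlation[OF k v(1)] in \<open>simp add: corr_def[abs_def]\<close>)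
qed

lemma fourier_translate:
  fixes u :: "'a::euclidean_space \<Rightarrow> real"
  assumes u: "L2_on UNIV u"
  shows "AE \<xi> in lborel. fourier (\<lambda>x. u (x + h)) \<xi> = cis (h \<bullet> \<xi>) * fourier u \<xi>"
proof (rule fourier_multiplier_extend[where T="\<lambda>u x. u (x + h)" and M=1, OF u L2_translate])
  note [measurable] = u[THEN L2_measurable] L2_trunc[OF u, THEN L2_measurable]
  have "norm2sq (\<lambda>x. trunc (real k) u (x + h) - u (x + h)) = norm2sq (\<lambda>x. trunc (real k) u x - u x)" for k
    by (rule norm2sq_translate[of "\<lambda>x. trunc (real k) u x - u x" h]) measurable
  then show "(\<lambda>k. norm2sq (\<lambda>x. trunc (real k) u (x + h) - u (x + h))) \<longlonglongrightarrow> 0"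
    using trunc_tendsto_seq[OF u] by simp
  fix v :: "'a \<Rightarrow> real" assume v: "integrable lborel v" "L2_on UNIV v"
  show "AE \<xi> in lborel. fourier (\<lambda>x. v (x + h)) \<xi> = cis (h \<bullet> \<xi>) * fourier v \<xi>"
    using fourier_eq_fourier_L1[OF integrable_translate[OF v(1)] L2_translate[OF v(2)]] fourier_eq_fourier_L1[OF v]
    by eventually_elim (simp add: fourier_L1_translate[OF v(1)])
qed auto

section \<open>Powers of the norm and reflections\<close>

lemma dyadic_scale_large: "1 \<le> x \<Longrightarrow> \<exists>k::nat. 1 \<le> (1/2)^k * x \<and> (1/2)^k * x \<le> (2::real)"
proof -
  assume x: "1 \<le> x"
  obtain n :: nat where n: "x < 2 ^ n" using real_arch_pow[of 2 x] by auto
  define k where "k = (LEAST n. x < 2 ^ n)"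
  have k: "x < 2 ^ k" unfolding k_def by (rule LeastI[of _ n]) (rule n)
  have "k \<noteq> 0" using k x by (cases k) auto
  then obtain j where j: "k = Suc j" by (cases k) auto
  have "\<not> x < 2 ^ j" using not_less_Least[of j "\<lambda>n. x < 2 ^ n"] j unfolding k_def[symmetric] by simp
  then show ?thesis using k j by (intro exI[of _ j]) (auto simp: field_simps power_divide)
qed

lemma dyadic_scale_small: "0 < x \<Longrightarrow> x \<le> 1 \<Longrightarrow> \<exists>k::nat. 1 \<le> 2^k * x \<and> 2^k * x \<le> (2::real)"
proof -
  assume x: "0 < x" "x \<le> 1"
  obtain k :: nat where k: "1 \<le> (1/2)^k * (1/x)" "(1/2)^k * (1/x) \<le> (2::real)"
    using dyadic_scale_large[of "1/x"] x by auto
  then have "2^k * x \<le> 1" "1 \<le> 2^Suc k * x" using x by (auto simp: field_simps power_divide)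
  then show ?thesis by (intro exI[of _ "Suc k"]) auto
qed

text \<open>By scaling, the integrals over the dyadic shells form a geometric series. With $r = 2$ the shells cover
  the exterior of the unit ball, with $r = 1/2$ the unit ball itself.\<close>

lemma nn_integral_dyadic:
  fixes p r :: real
  assumes r: "r > 0" and small: "r powr (real DIM('a) - p) < 1"
  shows "(\<integral>\<^sup>+x. indicator {x. \<exists>k::nat. 1 \<le> inverse r^k * norm x \<and> inverse r^k * norm x \<le> 2} x * ennreal (norm x powr - p) \<partial>(lborel :: 'a::euclidean_space measure)) < \<infinity>"
proof -
  define A where "A = {x::'a. 1 \<le> norm x \<and> norm x \<le> 2}"
  have [measurable]: "A \<in> sets borel" unfolding A_def by measurable
  define I where "I = (\<integral>\<^sup>+x. indicator A x * ennreal (norm x powr - p) \<partial>(lborel :: 'a::euclidean_space measure))"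
  have I: "I < \<infinity>"
  proof -
    have "I \<le> (\<integral>\<^sup>+x. ennreal (2 powr \<bar>p\<bar>) * indicator A x \<partial>lborel)"
      unfolding I_def
    proof (rule nn_integral_mono)
      fix x :: 'a
      show "indicator A x * ennreal (norm x powr - p) \<le> ennreal (2 powr \<bar>p\<bar>) * indicator A x"
      proof (cases "x \<in> A")
        case True
        then have "norm x powr - p \<le> norm x powr \<bar>p\<bar>" by (intro powr_mono) (auto simp: A_def)
        also have "\<dots> \<le> 2 powr \<bar>p\<bar>" using True by (intro powr_mono2) (auto simp: A_def)
        finally show ?thesis by (simp add: ennreal_leI mult.commute mult_left_mono)
      qed simp
    qed
    also have "\<dots> = ennreal (2 powr \<bar>p\<bar>) * emeasure lborel A" by (simp add: nn_integral_cmult_indicator)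
    also have "bounded A" unfolding A_def by (rule boundedI[of _ 2]) auto
    then have "ennreal (2 powr \<bar>p\<bar>) * emeasure lborel A < \<infinity>"
      using emeasure_bounded_finite[of A] by (simp add: ennreal_mult_less_top)
    finally show ?thesis .
  qed
  have shell: "(\<integral>\<^sup>+x. indicator A (inverse r^k *\<^sub>R x) * ennreal (norm x powr - p) \<partial>(lborel :: 'a::euclidean_space measure)) = ennreal ((r powr (real DIM('a) - p))^k) * I" for k
  proof -
    define c where "c = inverse r ^ k"
    have c: "c > 0" using r by (simp add: c_def)
    have "(\<integral>\<^sup>+x. indicator A (c *\<^sub>R x) * ennreal (norm x powr - p) \<partial>(lborel :: 'a::euclidean_space measure))
        = (\<integral>\<^sup>+x. ennreal (c powr p) * (indicator A (c *\<^sub>R x) * ennreal (norm (c *\<^sub>R x) powr - p)) \<partial>lborel)"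
    proof (rule nn_integral_cong)
      fix x :: 'a
      have "norm x powr - p = c powr p * norm (c *\<^sub>R x) powr - p"
        using c by (simp add: powr_mult powr_minus field_simps)
      then show "indicator A (c *\<^sub>R x) * ennreal (norm x powr - p) = ennreal (c powr p) * (indicator A (c *\<^sub>R x) * ennreal (norm (c *\<^sub>R x) powr - p))"
        by (simp only: ennreal_mult[OF powr_ge_zero powr_ge_zero] mult_ac)
    qed
    also have "\<dots> = ennreal (c powr p) * (\<integral>\<^sup>+x. (indicator A (c *\<^sub>R x) * ennreal (norm (c *\<^sub>R x) powr - p)) \<partial>lborel)"
      by (rule nn_integral_cmult) measurable
    also have "(\<integral>\<^sup>+x. (indicator A (c *\<^sub>R x) * ennreal (norm (c *\<^sub>R x) powr - p)) \<partial>lborel) = ennreal (inverse (\<bar>c\<bar> ^ DIM('a))) * I"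
      unfolding I_def by (rule nn_integral_scaleR[of "\<lambda>x. indicator A x * ennreal (norm x powr - p)"]) (use c in auto)
    also have "ennreal (c powr p) * (ennreal (inverse (\<bar>c\<bar> ^ DIM('a))) * I) = ennreal (c powr p * inverse (c ^ DIM('a))) * I"
      using c by (simp add: ennreal_mult mult.assoc)
    also have "c powr p * inverse (c ^ DIM('a)) = c powr (p - real DIM('a))"
      using c by (simp add: powr_diff powr_realpow divide_inverse)
    also have "\<dots> = (r powr (real DIM('a) - p))^k"
    proof -
      have "c = r powr (- real k)" using r by (simp add: c_def powr_minus powr_realpow power_inverse)
      then have "c powr (p - real DIM('a)) = r powr (- real k * (p - real DIM('a)))" by (simp only: powr_powr)
      also have "- real k * (p - real DIM('a)) = (real DIM('a) - p) * real k" by (simp add: algebra_simps)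
      also have "r powr \<dots> = (r powr (real DIM('a) - p)) powr real k" by (rule powr_powr[symmetric])
      finally show ?thesis using r by (simp add: powr_realpow)
    qed
    finally show ?thesis unfolding c_def .
  qed
  have "(\<integral>\<^sup>+x. indicator {x. \<exists>k::nat. 1 \<le> inverse r^k * norm x \<and> inverse r^k * norm x \<le> 2} x * ennreal (norm x powr - p) \<partial>(lborel :: 'a::euclidean_space measure))
      \<le> (\<integral>\<^sup>+x. (\<Sum>k. indicator A (inverse r^k *\<^sub>R x) * ennreal (norm x powr - p)) \<partial>lborel)"
  proof (rule nn_integral_mono)
    fix x :: 'a
    show "indicator {x. \<exists>k::nat. 1 \<le> inverse r^k * norm x \<and> inverse r^k * norm x \<le> 2} x * ennreal (norm x powr - p)
       \<le> (\<Sum>k. indicator A (inverse r^k *\<^sub>R x) * ennreal (norm x powr - p))"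
    proof (cases "\<exists>k::nat. 1 \<le> inverse r^k * norm x \<and> inverse r^k * norm x \<le> 2")
      case True
      then obtain k where "1 \<le> inverse r^k * norm x \<and> inverse r^k * norm x \<le> 2" by blast
      then have "inverse r^k *\<^sub>R x \<in> A" using r by (auto simp: A_def)
      then have "ennreal (norm x powr - p) = (\<Sum>k\<in>{k}. indicator A (inverse r^k *\<^sub>R x) * ennreal (norm x powr - p))" by simp
      also have "\<dots> \<le> (\<Sum>k. indicator A (inverse r^k *\<^sub>R x) * ennreal (norm x powr - p))"
        by (rule sum_le_suminf) auto
      finally show ?thesis using True by simp
    qed simp
  qed
  also have "\<dots> = (\<Sum>k. ennreal ((r powr (real DIM('a) - p))^k) * I)"
    by (subst nn_integral_suminf) (auto simp: shell)
  also have "\<dots> = (\<Sum>k. ennreal ((r powr (real DIM('a) - p))^k)) * I"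
    by (rule ennreal_suminf_multc)
  also have "\<dots> < \<infinity>"
  proof -
    have "(\<Sum>k. ennreal ((r powr (real DIM('a) - p))^k)) = ennreal (\<Sum>k. (r powr (real DIM('a) - p))^k)"
      using small by (intro suminf_ennreal2 summable_geometric) auto
    then show ?thesis using I by (simp add: ennreal_mult_less_top)
  qed
  finally show ?thesis .
qed

lemma nn_integral_norm_powr_large:
  assumes p: "p > real DIM('a)"
  shows "(\<integral>\<^sup>+x. indicator {x. 1 \<le> norm x} x * ennreal (norm x powr - p) \<partial>(lborel :: 'a::euclidean_space measure)) < \<infinity>"
proof (rule order.strict_trans1[OF _ nn_integral_dyadic[of 2 p]])
  show "(2::real) powr (real DIM('a) - p) < 1" using p powr_less_mono[of "real DIM('a) - p" 0 2] by simp
  show "(\<integral>\<^sup>+x. indicator {x. 1 \<le> norm x} x * ennreal (norm x powr - p) \<partial>(lborel :: 'a::euclidean_space measure))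
     \<le> (\<integral>\<^sup>+x. indicator {x. \<exists>k::nat. 1 \<le> inverse 2^k * norm x \<and> inverse 2^k * norm x \<le> 2} x * ennreal (norm x powr - p) \<partial>(lborel :: 'a::euclidean_space measure))"
    using dyadic_scale_large by (intro nn_integral_mono mult_right_mono) (auto simp: indicator_def inverse_eq_divide)
qed auto

lemma nn_integral_norm_powr_small:
  assumes p: "p < real DIM('a)"
  shows "(\<integral>\<^sup>+x. indicator {x. norm x \<le> 1} x * ennreal (norm x powr - p) \<partial>(lborel :: 'a::euclidean_space measure)) < \<infinity>"
proof (rule order.strict_trans1[OF _ nn_integral_dyadic[of "1/2" p]])
  show "(1/2::real) powr (real DIM('a) - p) < 1" using p powr_less_mono'[of "1/2" 0 "real DIM('a) - p"] by simp
  show "(\<integral>\<^sup>+x. indicator {x. norm x \<le> 1} x * ennreal (norm x powr - p) \<partial>(lborel :: 'a::euclidean_space measure))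
     \<le> (\<integral>\<^sup>+x. indicator {x. \<exists>k::nat. 1 \<le> inverse (1/2)^k * norm x \<and> inverse (1/2)^k * norm x \<le> 2} x * ennreal (norm x powr - p) \<partial>(lborel :: 'a::euclidean_space measure))"
  proof (intro nn_integral_mono)
    fix x :: 'a
    show "indicator {x. norm x \<le> 1} x * ennreal (norm x powr - p)
      \<le> indicator {x. \<exists>k::nat. 1 \<le> inverse (1/2)^k * norm x \<and> inverse (1/2)^k * norm x \<le> 2} x * ennreal (norm x powr - p)"
      using dyadic_scale_small[of "norm x"] by (cases "x = 0") (auto simp: indicator_def)
  qed
qed auto

lemma integrable_norm_powr_large:
  assumes p: "p > real DIM('a)" and e: "e > 0"
  shows "integrable lborel (\<lambda>x::'a::euclidean_space. indicator {x. e < norm x} x * norm x powr - p)"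
proof (rule integrableI_nonneg)
  have "(\<integral>\<^sup>+x. ennreal (indicator {x. e < norm x} x * norm x powr - p) \<partial>(lborel::'a measure))
     \<le> (\<integral>\<^sup>+x. ennreal (e powr - p) * (indicator {x. 1 \<le> norm x} ((1/e) *\<^sub>R x) * ennreal (norm ((1/e) *\<^sub>R x) powr - p)) \<partial>(lborel::'a measure))"
  proof (rule nn_integral_mono)
    fix x :: 'a
    show "ennreal (indicator {x. e < norm x} x * norm x powr - p)
      \<le> ennreal (e powr - p) * (indicator {x. 1 \<le> norm x} ((1/e) *\<^sub>R x) * ennreal (norm ((1/e) *\<^sub>R x) powr - p))"
    proof (cases "e < norm x")
      case True
      then have "norm x powr - p = e powr - p * norm ((1/e) *\<^sub>R x) powr - p"
        using e by (simp add: powr_mult[symmetric])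
      then have "ennreal (norm x powr - p) = ennreal (e powr - p) * ennreal (norm ((1/e) *\<^sub>R x) powr - p)"
        by (simp only: ennreal_mult[OF powr_ge_zero powr_ge_zero])
      then show ?thesis using True e by (simp add: indicator_def)
    qed simp
  qed
  also have "\<dots> = ennreal (e powr - p) * (\<integral>\<^sup>+x. (indicator {x. 1 \<le> norm x} ((1/e) *\<^sub>R x) * ennreal (norm ((1/e) *\<^sub>R x) powr - p)) \<partial>(lborel::'a measure))"
    by (rule nn_integral_cmult) measurable
  also have "(\<integral>\<^sup>+x. (indicator {x. 1 \<le> norm x} ((1/e) *\<^sub>R x) * ennreal (norm ((1/e) *\<^sub>R x) powr - p)) \<partial>(lborel::'a measure))
     = ennreal (inverse (\<bar>1/e\<bar> ^ DIM('a))) * (\<integral>\<^sup>+x. indicator {x. 1 \<le> norm x} x * ennreal (norm x powr - p) \<partial>(lborel :: 'a measure))"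
    by (rule nn_integral_scaleR[of "\<lambda>x. indicator {x. 1 \<le> norm x} x * ennreal (norm x powr - p)"]) (use e in auto)
  also have "ennreal (e powr - p) * \<dots> < \<infinity>"
    using nn_integral_norm_powr_large[OF p] by (simp add: ennreal_mult_less_top)
  finally show "(\<integral>\<^sup>+x. ennreal (indicator {x. e < norm x} x * norm x powr - p) \<partial>(lborel::'a measure)) < \<infinity>" .
qed auto

lemma nn_integral_diff_left:
  fixes f :: "'a::euclidean_space \<Rightarrow> ennreal"
  assumes [measurable]: "f \<in> borel_measurable borel"
  shows "(\<integral>\<^sup>+y. f (z - y) \<partial>lborel) = (\<integral>\<^sup>+y. f y \<partial>lborel)"
proof -
  have "(\<integral>\<^sup>+y. f (z - y) \<partial>lborel) = (\<integral>\<^sup>+y. f (z - (-1) *\<^sub>R y) \<partial>lborel)"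
    using nn_integral_scaleR[of "\<lambda>y. f (z - y)" "-1"] by simp
  also have "\<dots> = (\<integral>\<^sup>+y. f (y + z) \<partial>lborel)" by (simp add: add.commute)
  also have "\<dots> = (\<integral>\<^sup>+y. f y \<partial>lborel)" by (rule nn_integral_translate) simp
  finally show ?thesis .
qed

text \<open>Invariance under $R$ follows from translation invariance alone: in the double integral of
  $f(Rx)\,B(y+Rx)$, where $B$ is the indicator of the unit ball, the order of integration decides whether
  $R$ is moved onto the invariant factor $B$.\<close>

lemma nn_integral_involution:
  fixes f :: "'a::euclidean_space \<Rightarrow> ennreal"
  assumes f [measurable]: "f \<in> borel_measurable borel"
    and R: "linear R" "\<And>x. R (R x) = x" "\<And>x. norm (R x) = norm x"
  shows "(\<integral>\<^sup>+x. f (R x) \<partial>lborel) = (\<integral>\<^sup>+x. f x \<partial>lborel)"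
proof -
  have [measurable]: "R \<in> borel_measurable borel"
    using R(1) by (intro borel_measurable_continuous_onI linear_continuous_on linear_conv_bounded_linear[THEN iffD1])
  define B :: "'a \<Rightarrow> ennreal" where "B = indicator (ball 0 1)"
  have [measurable]: "B \<in> borel_measurable borel" unfolding B_def by (rule borel_measurable_indicator) simp
  have BR: "B (R x) = B x" for x using R(3)[of x] by (simp add: B_def indicator_def)
  have Radd: "R (x - R y) = R x - y" for x y using R by (simp add: linear_diff)
  have "(\<integral>\<^sup>+x. f (R x) \<partial>lborel) * (\<integral>\<^sup>+y. B y \<partial>lborel) = (\<integral>\<^sup>+x. (\<integral>\<^sup>+y. f (R x) * B (y + R x) \<partial>lborel) \<partial>lborel)"
    by (subst nn_integral_multc[symmetric]) (auto simp: nn_integral_cmult nn_integral_translate)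
  also have "\<dots> = (\<integral>\<^sup>+y. (\<integral>\<^sup>+x. f (R x) * B (y + R x) \<partial>lborel) \<partial>lborel)"
    by (rule lborel_pair.Fubini') measurable
  also have "\<dots> = (\<integral>\<^sup>+y. (\<integral>\<^sup>+x. f (R x - y) * B (R x) \<partial>lborel) \<partial>lborel)"
  proof (rule nn_integral_cong)
    fix y
    have "(\<integral>\<^sup>+x. f (R (x + - R y)) * B (y + R (x + - R y)) \<partial>lborel) = (\<integral>\<^sup>+x. f (R x) * B (y + R x) \<partial>lborel)"
      by (rule nn_integral_translate[of "\<lambda>x. f (R x) * B (y + R x)"]) measurable
    then show "(\<integral>\<^sup>+x. f (R x) * B (y + R x) \<partial>lborel) = (\<integral>\<^sup>+x. f (R x - y) * B (R x) \<partial>lborel)"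
      by (simp add: Radd)
  qed
  also have "\<dots> = (\<integral>\<^sup>+x. (\<integral>\<^sup>+y. f (R x - y) * B (R x) \<partial>lborel) \<partial>lborel)"
    by (rule lborel_pair.Fubini') measurable
  also have "\<dots> = (\<integral>\<^sup>+x. (\<integral>\<^sup>+y. f y \<partial>lborel) * B (R x) \<partial>lborel)"
    by (subst nn_integral_multc) (auto simp: nn_integral_diff_left)
  also have "\<dots> = (\<integral>\<^sup>+x. f x \<partial>lborel) * (\<integral>\<^sup>+y. B y \<partial>lborel)"
    by (simp add: BR nn_integral_cmult)
  finally have eq: "(\<integral>\<^sup>+x. f (R x) \<partial>lborel) * (\<integral>\<^sup>+y. B y \<partial>lborel) = (\<integral>\<^sup>+x. f x \<partial>lborel) * (\<integral>\<^sup>+y. B y \<partial>lborel)" .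
  have B: "(\<integral>\<^sup>+y. B y \<partial>lborel) = ennreal (unit_ball_vol (real DIM('a)))"
    unfolding B_def by (simp add: emeasure_ball)
  have pos: "unit_ball_vol (real DIM('a)) > 0" by (rule unit_ball_vol_pos) simp
  have nz: "ennreal (unit_ball_vol (real DIM('a))) \<noteq> 0" using pos unfolding ennreal_eq_0_iff by linarith
  show ?thesis
    using eq nz ennreal_mult_le_mult_iff[of "ennreal (unit_ball_vol (real DIM('a)))" "\<integral>\<^sup>+x. f (R x) \<partial>lborel" "\<integral>\<^sup>+x. f x \<partial>lborel"]
       ennreal_mult_le_mult_iff[of "ennreal (unit_ball_vol (real DIM('a)))" "\<integral>\<^sup>+x. f x \<partial>lborel" "\<integral>\<^sup>+x. f (R x) \<partial>lborel"]
    unfolding B by (simp add: mult.commute)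
qed

text \<open>The reflection in the hyperplane orthogonal to $a - b$.\<close>

lemma reflection_exists:
  fixes a b :: "'a::euclidean_space"
  assumes ab: "norm a = norm b"
  obtains R where "linear R" "\<And>x. R (R x) = x" "\<And>x. norm (R x) = norm x" "\<And>x y. R x \<bullet> y = x \<bullet> R y" "R a = b"
proof (cases "a = b")
  case True
  then show ?thesis by (intro that[of "\<lambda>x. x"]) (auto simp: linear_iff)
next
  case False
  define d where "d = a - b"
  have d: "d \<bullet> d \<noteq> 0" using False by (simp add: d_def)
  define R where "R x = x - (2 * (x \<bullet> d) / (d \<bullet> d)) *\<^sub>R d" for x
  have self: "R x \<bullet> y = x \<bullet> R y" for x y by (simp add: R_def inner_diff_left inner_diff_right inner_commute)
  have inv: "R (R x) = x" for x
    using d by (simp add: R_def inner_diff_left scaleR_diff_left[symmetric] algebra_simps)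
  have nrm: "norm (R x) = norm x" for x
    unfolding norm_eq_sqrt_inner self inv ..
  have ab': "a \<bullet> a = b \<bullet> b" using ab by (simp add: norm_eq_sqrt_inner)
  have "2 * (a \<bullet> d) = d \<bullet> d" unfolding d_def using ab' by (simp add: inner_diff_left inner_diff_right inner_commute)
  then have "R a = b" using d by (simp add: R_def d_def)
  moreover have "linear R"
    by (rule linearI) (auto simp: R_def inner_add_left algebra_simps add_divide_distrib)
  ultimately show ?thesis using self inv nrm by (intro that[of R]) auto
qed

section \<open>Truncated singular integrals\<close>

definition kern :: "real \<Rightarrow> 'a::euclidean_space \<Rightarrow> real" where
  "kern a h = norm h powr - (real DIM('a) + 2 * a)"

definition kern_trunc :: "real \<Rightarrow> real \<Rightarrow> 'a::euclidean_space \<Rightarrow> real" where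
  "kern_trunc a e h = indicator {h. e < norm h} h * kern a h"

lemma kern_measurable [measurable]: "kern a \<in> borel_measurable borel"
  unfolding kern_def[abs_def] by measurable

lemma kern_trunc_measurable [measurable]: "kern_trunc a e \<in> borel_measurable borel"
  unfolding kern_trunc_def[abs_def] by measurable

lemma kern_nonneg [simp]: "0 \<le> kern a h"
  by (simp add: kern_def)

lemma kern_pos: "h \<noteq> 0 \<Longrightarrow> 0 < kern a h"
  by (simp add: kern_def)

lemma kern_trunc_nonneg [simp]: "0 \<le> kern_trunc a e h"
  by (simp add: kern_trunc_def)

lemma kern_trunc_le: "kern_trunc a e h \<le> kern a h"
  by (simp add: kern_trunc_def indicator_def)

lemma kern_minus [simp]: "kern a (- h) = kern a h"
  by (simp add: kern_def)

lemma kern_trunc_minus [simp]: "kern_trunc a e (- h) = kern_trunc a e h"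
  by (simp add: kern_trunc_def indicator_def)

lemma kern_diff_commute: "kern a (x - y) = kern a (y - x)"
  by (simp add: kern_def norm_minus_commute)

lemma divide_norm_powr: "c / norm h powr (real DIM('a) + 2 * a) = c * kern a (h :: 'a::euclidean_space)"
  by (simp only: kern_def powr_minus divide_inverse)

lemma integrable_kern_trunc:
  assumes "0 < a" "0 < e"
  shows "integrable lborel (kern_trunc a e :: 'a::euclidean_space \<Rightarrow> real)"
  using integrable_norm_powr_large[of "real DIM('a) + 2 * a" e, where 'a='a] assms
  by (simp add: kern_trunc_def[abs_def] kern_def)

lemma one_minus_cos_le: "1 - cos x \<le> x\<^sup>2 / 2" for x :: real
proof -
  have "1 - cos x = 2 * (sin (x/2))\<^sup>2" using cos_double_sin[of "x/2"] by simp
  also have "(sin (x/2))\<^sup>2 \<le> (x/2)\<^sup>2" using abs_sin_x_le_abs_x[of "x/2"] by (metis abs_le_square_iff)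
  finally show ?thesis by (simp add: power_divide)
qed

text \<open>The Fourier symbol of the singular integral with kernel \<open>kern a\<close>: the sine part cancels by symmetry.\<close>

definition symb :: "real \<Rightarrow> 'a::euclidean_space \<Rightarrow> ennreal" where
  "symb a \<xi> = (\<integral>\<^sup>+h. ennreal (kern a h * (1 - cos (h \<bullet> \<xi>))) \<partial>lborel)"

lemma nn_integral_kern_small:
  assumes "a < 1"
  shows "(\<integral>\<^sup>+h. indicator {h. norm h \<le> 1} h * ennreal (kern a h * (norm h)\<^sup>2) \<partial>(lborel :: 'a::euclidean_space measure)) < \<infinity>"
proof -
  have e: "kern a h * (norm h)\<^sup>2 = norm h powr - (real DIM('a) + 2 * a - 2)" for h :: 'a
  proof (cases "h = 0")
    case False
    then have "(norm h)\<^sup>2 = norm h powr 2" by simp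
    moreover have "norm h powr - (real DIM('a) + 2 * a) * norm h powr 2 = norm h powr (- (real DIM('a) + 2 * a) + 2)"
      by (rule powr_add[symmetric])
    ultimately show ?thesis unfolding kern_def by (simp add: algebra_simps)
  qed (simp add: kern_def)
  show ?thesis unfolding e by (rule nn_integral_norm_powr_small) (use assms in simp)
qed

lemma nn_integral_kern_large:
  assumes "0 < a"
  shows "(\<integral>\<^sup>+h. indicator {h. 1 \<le> norm h} h * ennreal (kern a h) \<partial>(lborel :: 'a::euclidean_space measure)) < \<infinity>"
  unfolding kern_def by (rule nn_integral_norm_powr_large) (use assms in simp)

lemma nn_integral_kern_bound:
  fixes f :: "'a::euclidean_space \<Rightarrow> real"
  assumes a: "0 < a" "a < 1" and f: "\<And>h. f h \<le> C * (norm h)\<^sup>2" "\<And>h. f h \<le> D" and CD: "0 \<le> C" "0 \<le> D"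
  shows "(\<integral>\<^sup>+h. ennreal (kern a h * f h) \<partial>lborel) < \<infinity>"
proof -
  have "(\<integral>\<^sup>+h. ennreal (kern a h * f h) \<partial>lborel)
    \<le> (\<integral>\<^sup>+h. ennreal C * (indicator {h. norm h \<le> 1} h * ennreal (kern a h * (norm h)\<^sup>2))
        + ennreal D * (indicator {h. 1 \<le> norm h} h * ennreal (kern a h)) \<partial>(lborel :: 'a measure))"
  proof (rule nn_integral_mono)
    fix h :: 'a
    show "ennreal (kern a h * f h) \<le> ennreal C * (indicator {h. norm h \<le> 1} h * ennreal (kern a h * (norm h)\<^sup>2))
        + ennreal D * (indicator {h. 1 \<le> norm h} h * ennreal (kern a h))"
    proof (cases "norm h \<le> 1")
      case True
      have "kern a h * f h \<le> C * (kern a h * (norm h)\<^sup>2)"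
        using mult_left_mono[OF f(1)[of h] kern_nonneg[of a h]] by (simp add: mult.left_commute)
      then have "ennreal (kern a h * f h) \<le> ennreal C * ennreal (kern a h * (norm h)\<^sup>2)"
        using CD by (simp add: ennreal_mult[symmetric] ennreal_leI)
      then show ?thesis using True by (intro add_increasing2) auto
    next
      case False
      have "kern a h * f h \<le> D * kern a h"
        using mult_left_mono[OF f(2)[of h] kern_nonneg[of a h]] by (simp add: mult.commute)
      then have "ennreal (kern a h * f h) \<le> ennreal D * ennreal (kern a h)"
        using CD by (simp add: ennreal_mult[symmetric] ennreal_leI)
      then show ?thesis using False by simp
    qed
  qed
  also have "\<dots> = ennreal C * (\<integral>\<^sup>+h. indicator {h. norm h \<le> 1} h * ennreal (kern a h * (norm h)\<^sup>2) \<partial>(lborel :: 'a measure))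
     + ennreal D * (\<integral>\<^sup>+h. indicator {h. 1 \<le> norm h} h * ennreal (kern a h) \<partial>(lborel :: 'a measure))"
    by (subst nn_integral_add) (auto simp: nn_integral_cmult)
  also have "\<dots> < \<infinity>"
    using nn_integral_kern_small[OF a(2), where 'a='a] nn_integral_kern_large[OF a(1), where 'a='a]
    by (simp add: ennreal_mult_less_top)
  finally show ?thesis .
qed

lemma symb_finite:
  fixes \<xi> :: "'a::euclidean_space"
  assumes a: "0 < a" "a < 1"
  shows "symb a \<xi> < \<infinity>"
  unfolding symb_def
proof (rule nn_integral_kern_bound[OF a, of _ "(norm \<xi>)\<^sup>2 / 2" 2])
  fix h :: 'a
  have "\<bar>h \<bullet> \<xi>\<bar>\<^sup>2 \<le> (norm h * norm \<xi>)\<^sup>2" by (intro power_mono Cauchy_Schwarz_ineq2) auto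
  then show "1 - cos (h \<bullet> \<xi>) \<le> (norm \<xi>)\<^sup>2 / 2 * (norm h)\<^sup>2"
    using one_minus_cos_le[of "h \<bullet> \<xi>"] by (simp add: power_mult_distrib mult.commute)
  show "1 - cos (h \<bullet> \<xi>) \<le> 2" using cos_ge_minus_one[of "h \<bullet> \<xi>"] by linarith
qed auto

lemma symb_scale:
  fixes \<xi> :: "'a::euclidean_space"
  assumes r: "r > 0"
  shows "symb a (r *\<^sub>R \<xi>) = ennreal (r powr (2 * a)) * symb a \<xi>"
proof -
  let ?p = "real DIM('a) + 2 * a"
  have k: "kern a h = r powr ?p * kern a (r *\<^sub>R h)" for h :: 'a
    using r by (simp add: kern_def powr_mult mult.assoc[symmetric] powr_add[symmetric])
  have "symb a (r *\<^sub>R \<xi>) = (\<integral>\<^sup>+h. ennreal (r powr ?p) * ennreal (kern a (r *\<^sub>R h) * (1 - cos ((r *\<^sub>R h) \<bullet> \<xi>))) \<partial>lborel)"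
    unfolding symb_def
  proof (rule nn_integral_cong)
    fix h :: 'a
    show "ennreal (kern a h * (1 - cos (h \<bullet> r *\<^sub>R \<xi>))) = ennreal (r powr ?p) * ennreal (kern a (r *\<^sub>R h) * (1 - cos ((r *\<^sub>R h) \<bullet> \<xi>)))"
      by (subst k) (simp add: ennreal_mult[symmetric] mult.assoc)
  qed
  also have "\<dots> = ennreal (r powr ?p) * (\<integral>\<^sup>+h. ennreal (kern a (r *\<^sub>R h) * (1 - cos ((r *\<^sub>R h) \<bullet> \<xi>))) \<partial>lborel)"
    by (rule nn_integral_cmult) measurable
  also have "(\<integral>\<^sup>+h. ennreal (kern a (r *\<^sub>R h) * (1 - cos ((r *\<^sub>R h) \<bullet> \<xi>))) \<partial>lborel) = ennreal (inverse (\<bar>r\<bar> ^ DIM('a))) * symb a \<xi>"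
    unfolding symb_def by (rule nn_integral_scaleR[of "\<lambda>h. ennreal (kern a h * (1 - cos (h \<bullet> \<xi>)))"]) (use r in auto)
  also have "ennreal (r powr ?p) * (ennreal (inverse (\<bar>r\<bar> ^ DIM('a))) * symb a \<xi>) = ennreal (r powr ?p * inverse (r ^ DIM('a))) * symb a \<xi>"
    using r by (simp add: ennreal_mult mult.assoc)
  also have "r powr ?p * inverse (r ^ DIM('a)) = r powr (2 * a)"
    using r by (simp add: powr_add powr_realpow)
  finally show ?thesis .
qed

text \<open>Two frequencies of equal norm are exchanged by a reflection, which leaves the kernel invariant.\<close>

lemma symb_radial:
  fixes \<xi> \<eta> :: "'a::euclidean_space"
  assumes "norm \<xi> = norm \<eta>"
  shows "symb a \<xi> = symb a \<eta>"
proof -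
  obtain R where R: "linear R" "\<And>x. R (R x) = x" "\<And>x. norm (R x) = norm x" "\<And>x y. R x \<bullet> y = x \<bullet> R y" "R \<xi> = \<eta>"
    using reflection_exists[OF assms] by metis
  have "symb a \<xi> = (\<integral>\<^sup>+h. ennreal (kern a (R h) * (1 - cos (R h \<bullet> \<xi>))) \<partial>lborel)"
    unfolding symb_def
    by (rule nn_integral_involution[OF _ R(1-3), of "\<lambda>h. ennreal (kern a h * (1 - cos (h \<bullet> \<xi>)))", symmetric]) measurable
  also have "\<dots> = symb a \<eta>" unfolding symb_def using R by (simp add: kern_def)
  finally show ?thesis .
qed

lemma nn_integral_open_pos:
  fixes f :: "'a::euclidean_space \<Rightarrow> ennreal"
  assumes [measurable]: "f \<in> borel_measurable borel" and S: "open S" "S \<noteq> {}" and pos: "\<And>x. x \<in> S \<Longrightarrow> f x > 0"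
  shows "(\<integral>\<^sup>+x. f x \<partial>lborel) > 0"
proof (rule ccontr)
  assume "\<not> ?thesis"
  then have "(\<integral>\<^sup>+x. f x \<partial>lborel) = 0" by (simp add: zero_less_iff_neq_zero)
  then have "AE x in lborel. f x = 0" by (subst (asm) nn_integral_0_iff_AE) auto
  then have "AE x in lborel. x \<notin> S" by eventually_elim (metis less_irrefl pos)
  then have "emeasure lborel S = 0" using S(1)
    by (subst (asm) AE_iff_measurable[OF _ refl]) auto
  moreover obtain x e where "e > 0" "ball x e \<subseteq> S" using S by (metis ex_in_conv open_contains_ball)
  moreover have "emeasure lborel (ball x e) > 0"
  proof -
    have "0 < unit_ball_vol (real DIM('a)) * e ^ DIM('a)"
      using \<open>e > 0\<close> by (intro mult_pos_pos unit_ball_vol_pos) auto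
    then show ?thesis using \<open>e > 0\<close> unfolding emeasure_ball[OF less_imp_le[OF \<open>e > 0\<close>]] ennreal_less_zero_iff by simp
  qed
  ultimately show False using emeasure_mono[of "ball x e" S lborel] S(1) by auto
qed

text \<open>The value of the symbol at unit frequencies; by \<open>symb_radial\<close> the choice of the basis vector is immaterial.\<close>

definition symb_const :: "'a::euclidean_space itself \<Rightarrow> real \<Rightarrow> real" where
  "symb_const _ a = enn2real (symb a (SOME b. b \<in> (Basis :: 'a set)))"

context
  fixes a :: real
  assumes a: "0 < a" "a < 1"
begin

lemma symb_const_pos: "symb_const TYPE('a::euclidean_space) a > 0"
proof -
  define b where "b = (SOME b. b \<in> (Basis :: 'a set))"
  have b: "b \<in> Basis" unfolding b_def by (rule someI_ex) (use nonempty_Basis in blast)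
  have bb: "b \<bullet> b = 1" using b by simp
  have "symb a b > 0"
    unfolding symb_def
  proof (rule nn_integral_open_pos[where S="{h. 0 < h \<bullet> b \<and> h \<bullet> b < 1}"])
    show "open {h. 0 < h \<bullet> b \<and> h \<bullet> b < 1}"
      by (intro open_Collect_conj open_Collect_less continuous_intros)
    have "(1/2) *\<^sub>R b \<in> {h. 0 < h \<bullet> b \<and> h \<bullet> b < 1}" using bb by simp
    then show "{h. 0 < h \<bullet> b \<and> h \<bullet> b < 1} \<noteq> {}" by blast
    fix h assume h: "h \<in> {h. 0 < h \<bullet> b \<and> h \<bullet> b < 1}"
    then have "h \<noteq> 0" by auto
    have "cos (h \<bullet> b) < cos 0" using h pi_gt3 by (intro cos_monotone_0_pi) auto
    then show "0 < ennreal (kern a h * (1 - cos (h \<bullet> b)))" using kern_pos[OF \<open>h \<noteq> 0\<close>] by simp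
  qed measurable
  then show ?thesis using symb_finite[OF a, of b] unfolding symb_const_def b_def[symmetric]
    by (simp add: enn2real_positive_iff)
qed

text \<open>The symbol is radial and homogeneous of degree $2a$.\<close>

lemma symb_eq: "symb a \<xi> = ennreal (symb_const TYPE('a) a * norm \<xi> powr (2 * a))" for \<xi> :: "'a::euclidean_space"
proof (cases "\<xi> = 0")
  case True then show ?thesis by (simp add: symb_def)
next
  case False
  define b where "b = (SOME b. b \<in> (Basis :: 'a set))"
  have b: "b \<in> Basis" unfolding b_def by (rule someI_ex) (use nonempty_Basis in blast)
  have "symb a \<xi> = symb a (norm \<xi> *\<^sub>R b)" using b by (intro symb_radial) simp
  also have "\<dots> = ennreal (norm \<xi> powr (2 * a)) * symb a b" using False by (intro symb_scale) simp
  also have "symb a b = ennreal (symb_const TYPE('a) a)"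
    using symb_finite[OF a, of b] unfolding symb_const_def b_def[symmetric] by simp
  also have "ennreal (norm \<xi> powr (2 * a)) * ennreal (symb_const TYPE('a) a) = ennreal (symb_const TYPE('a) a * norm \<xi> powr (2 * a))"
    using symb_const_pos[where 'a='a] by (simp add: ennreal_mult[symmetric] mult.commute)
  finally show ?thesis .
qed

lemma integrable_symb: "integrable lborel (\<lambda>h::'a::euclidean_space. kern a h * (1 - cos (h \<bullet> \<xi>)))"
  and integral_symb: "(LINT h|lborel. kern a (h::'a) * (1 - cos (h \<bullet> \<xi>))) = symb_const TYPE('a) a * norm \<xi> powr (2 * a)"
proof -
  have nn: "0 \<le> kern a h * (1 - cos (h \<bullet> \<xi>))" for h :: 'a by simp
  show "integrable lborel (\<lambda>h::'a::euclidean_space. kern a h * (1 - cos (h \<bullet> \<xi>)))"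
    using symb_finite[OF a, of \<xi>] unfolding symb_def by (intro integrableI_nonneg) auto
  have "(LINT h|lborel. kern a (h::'a) * (1 - cos (h \<bullet> \<xi>))) = enn2real (symb a \<xi>)"
    unfolding symb_def using nn by (intro integral_eq_nn_integral) auto
  then show "(LINT h|lborel. kern a (h::'a) * (1 - cos (h \<bullet> \<xi>))) = symb_const TYPE('a) a * norm \<xi> powr (2 * a)"
    using symb_const_pos[where 'a='a] by (simp add: symb_eq)
qed

section \<open>The truncated operator and its limit\<close>

text \<open>The Fourier symbol of the truncated operator; it lies below the full symbol and converges to it.\<close>

definition msym :: "real \<Rightarrow> 'a::euclidean_space \<Rightarrow> real" where
  "msym e \<xi> = (LINT h|lborel. kern_trunc a e h * (1 - cos (h \<bullet> \<xi>)))"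

lemma msym_measurable [measurable]: "msym e \<in> borel_measurable borel"
  unfolding msym_def[abs_def] by measurable

lemma msym_bounds:
  fixes \<xi> :: "'a::euclidean_space"
  shows "0 \<le> msym e \<xi>" "msym e \<xi> \<le> symb_const TYPE('a) a * norm \<xi> powr (2 * a)"
proof -
  show "0 \<le> msym e \<xi>" unfolding msym_def by (intro integral_nonneg_AE) auto
  have i: "integrable lborel (\<lambda>h::'a. kern_trunc a e h * (1 - cos (h \<bullet> \<xi>)))"
    by (rule Bochner_Integration.integrable_bound[OF integrable_symb[of \<xi>]])
       (auto simp: abs_mult intro!: mult_right_mono kern_trunc_le)
  show "msym e \<xi> \<le> symb_const TYPE('a) a * norm \<xi> powr (2 * a)"
    unfolding msym_def integral_symb[symmetric]
    by (rule integral_mono[OF i integrable_symb]) (auto intro!: mult_right_mono kern_trunc_le)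
qed

lemma msym_tendsto:
  fixes \<xi> :: "'a::euclidean_space"
  assumes e: "e \<longlonglongrightarrow> 0" "\<And>k. 0 < e k"
  shows "(\<lambda>k. msym (e k) \<xi>) \<longlonglongrightarrow> symb_const TYPE('a) a * norm \<xi> powr (2 * a)"
  unfolding msym_def integral_symb[symmetric]
proof (rule integral_dominated_convergence[OF _ _ integrable_symb[of \<xi>]])
  show "AE h in lborel. (\<lambda>k. kern_trunc a (e k) h * (1 - cos (h \<bullet> \<xi>))) \<longlonglongrightarrow> kern a h * (1 - cos (h \<bullet> \<xi>))"
  proof (rule AE_I2)
    fix h :: 'a
    show "(\<lambda>k. kern_trunc a (e k) h * (1 - cos (h \<bullet> \<xi>))) \<longlonglongrightarrow> kern a h * (1 - cos (h \<bullet> \<xi>))"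
    proof (cases "h = 0")
      case False
      then have "\<forall>\<^sub>F k in sequentially. e k < norm h" using e by (intro order_tendstoD(2)[OF e(1)]) auto
      then show ?thesis by (intro tendsto_eventually) (erule eventually_mono, simp add: kern_trunc_def indicator_def)
    qed simp
  qed
  show "AE h in lborel. norm (kern_trunc a (e k) h * (1 - cos (h \<bullet> \<xi>))) \<le> kern a h * (1 - cos (h \<bullet> \<xi>))" for k
    by (auto simp: abs_mult intro!: mult_right_mono kern_trunc_le)
qed measurable

definition sing_trunc :: "real \<Rightarrow> ('a::euclidean_space \<Rightarrow> real) \<Rightarrow> 'a \<Rightarrow> real" where
  "sing_trunc e u x = (LINT h|lborel. kern_trunc a e h * (u x - u (x + h)))"

lemma sing_trunc_measurable [measurable]:
  assumes [measurable]: "u \<in> borel_measurable borel"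
  shows "sing_trunc e u \<in> borel_measurable borel"
  unfolding sing_trunc_def[abs_def] by measurable

text \<open>The truncated kernel is integrable, so that the two terms of the difference can be separated.\<close>

lemma sing_trunc_eq_corr:
  fixes u :: "'a::euclidean_space \<Rightarrow> real"
  assumes u: "L2_on UNIV u" and e: "0 < e"
  shows "AE x in lborel. sing_trunc e u x = (LINT h|lborel. kern_trunc a e (h::'a)) * u x - corr (kern_trunc a e) u x"
  using corr_AE_integrable[OF integrable_kern_trunc[OF a(1) e] u]
proof eventually_elim
  case (elim x)
  have "integrable lborel (\<lambda>h. kern_trunc a e h * u x)"
    by (intro integrable_mult_left integrable_kern_trunc a e)
  then show ?case unfolding sing_trunc_def corr_def right_diff_distrib
    using elim by (subst Bochner_Integration.integral_diff) auto
qed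

lemma L2_sing_trunc:
  fixes u :: "'a::euclidean_space \<Rightarrow> real"
  assumes u: "L2_on UNIV u" and e: "0 < e"
  shows "L2_on UNIV (sing_trunc e u)"
proof (rule L2_cong_AE)
  show "sing_trunc e u \<in> borel_measurable borel" using L2_measurable[OF u] by measurable
  show "L2_on UNIV (\<lambda>x. (LINT h|lborel. kern_trunc a e (h::'a)) * u x - corr (kern_trunc a e) u x)"
    by (intro L2_diff L2_cmult L2_corr integrable_kern_trunc a e u)
  show "AE x in lborel. (LINT h|lborel. kern_trunc a e (h::'a)) * u x - corr (kern_trunc a e) u x = sing_trunc e u x"
    using sing_trunc_eq_corr[OF u e] by eventually_elim simp
qed

lemma kern_trunc_transform:
  fixes \<xi> :: "'a::euclidean_space"
  assumes e: "0 < e"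
  shows "of_real (LINT h|lborel. kern_trunc a e (h::'a)) - (LINT h|lborel. kern_trunc a e h *\<^sub>R cis (h \<bullet> \<xi>)) = of_real (msym e \<xi>)"
proof -
  note k = integrable_kern_trunc[OF a(1) e, where 'a='a]
  have c: "integrable lborel (\<lambda>h. kern_trunc a e h * cos (h \<bullet> \<xi>))"
    and s: "integrable lborel (\<lambda>h. kern_trunc a e h * sin (h \<bullet> \<xi>))"
    by (rule Bochner_Integration.integrable_bound[OF k]; auto simp: abs_mult intro!: mult_left_le)+
  have "(LINT h|lborel. kern_trunc a e ((-1) *\<^sub>R h) * sin (((-1) *\<^sub>R h) \<bullet> \<xi>)) = inverse (\<bar>-1\<bar> ^ DIM('a)) *\<^sub>R (LINT h|lborel. kern_trunc a e h * sin (h \<bullet> \<xi>))"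
    by (rule integral_scaleR_arg[of "\<lambda>h. kern_trunc a e h * sin (h \<bullet> \<xi>)"]) auto
  then have s0: "(LINT h|lborel. kern_trunc a e h * sin (h \<bullet> \<xi>)) = 0" by simp
  have e1: "kern_trunc a e h *\<^sub>R cis (h \<bullet> \<xi>) = of_real (kern_trunc a e h * cos (h \<bullet> \<xi>)) + \<i> * of_real (kern_trunc a e h * sin (h \<bullet> \<xi>))" for h
    by (simp add: complex_eq_iff)
  have "(LINT h|lborel. kern_trunc a e h *\<^sub>R cis (h \<bullet> \<xi>)) = of_real (LINT h|lborel. kern_trunc a e h * cos (h \<bullet> \<xi>)) + \<i> * of_real (LINT h|lborel. kern_trunc a e h * sin (h \<bullet> \<xi>))"
    unfolding e1 using c s
    by (subst Bochner_Integration.integral_add) (auto simp only: integral_complex_of_real integral_mult_right_zero complex_of_real_integrable_eq intro!: integrable_mult_right)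
  moreover have "msym e \<xi> = (LINT h|lborel. kern_trunc a e (h::'a)) - (LINT h|lborel. kern_trunc a e h * cos (h \<bullet> \<xi>))"
    unfolding msym_def using Bochner_Integration.integral_diff[OF k c] by (simp add: right_diff_distrib)
  ultimately show ?thesis by (simp add: s0)
qed

lemma fourier_sing_trunc:
  fixes u :: "'a::euclidean_space \<Rightarrow> real"
  assumes u: "L2_on UNIV u" and e: "0 < e"
  shows "AE \<xi> in lborel. fourier (sing_trunc e u) \<xi> = of_real (msym e \<xi>) * fourier u \<xi>"
proof -
  note k = integrable_kern_trunc[OF a(1) e, where 'a='a]
  let ?L = "LINT h|lborel. kern_trunc a e (h::'a)"
  let ?w = "\<lambda>x. ?L * u x - corr (kern_trunc a e) u x"
  have [measurable]: "sing_trunc e u \<in> borel_measurable borel" "?w \<in> borel_measurable borel"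
    using L2_measurable[OF u] by measurable
  have "fourier (sing_trunc e u) = fourier ?w"
    by (rule fourier_cong_AE[OF _ _ sing_trunc_eq_corr[OF u e]]) measurable
  moreover have "AE \<xi> in lborel. fourier ?w \<xi> = of_real (msym e \<xi>) * fourier u \<xi>"
    using fourier_diff[OF L2_cmult[OF u, of ?L] L2_corr[OF k u]] fourier_cmult[OF u, of ?L] fourier_corr[OF k u]
  proof eventually_elim
    case (elim \<xi>)
    then show ?case by (simp only: left_diff_distrib[symmetric] kern_trunc_transform[OF e])
  qed
  ultimately show ?thesis by simp
qed

text \<open>On the Fourier side the convergence is dominated, because the truncated symbols lie below the full symbol.\<close>

lemma sing_trunc_limit:
  fixes u :: "'a::euclidean_space \<Rightarrow> real"
  assumes u: "L2_on UNIV u" and H: "L2_on UNIV (\<lambda>\<xi>. of_real (norm \<xi> powr (2 * a)) * fourier u \<xi>)"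
    and e: "e \<longlonglongrightarrow> 0" "\<And>k. 0 < e k"
  obtains w where "L2_on UNIV w" "(\<lambda>k. norm2sq (\<lambda>x. sing_trunc (e k) u x - w x)) \<longlonglongrightarrow> 0"
    "AE \<xi> in lborel. fourier w \<xi> = of_real (symb_const TYPE('a) a * norm \<xi> powr (2 * a)) * fourier u \<xi>"
proof -
  let ?c = "symb_const TYPE('a) a"
  note [measurable] = u[THEN L2_measurable] u[THEN L2_fourier, THEN L2_measurable] L2_sing_trunc[OF u e(2), THEN L2_fourier, THEN L2_measurable]
  define G where "G \<xi> = of_real (?c * norm \<xi> powr (2 * a)) * fourier u \<xi>" for \<xi>
  have G: "L2_on UNIV G"
    using L2_scaleR[OF H, of ?c] by (simp add: G_def[abs_def] scaleR_conv_of_real mult.assoc)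
  note [measurable] = G[THEN L2_measurable]
  have nG: "L2_on UNIV (\<lambda>\<xi>. norm (G \<xi>))" by (rule L2_dominated[OF _ G]) auto
  have "(\<lambda>k. norm2sq (\<lambda>\<xi>. fourier (sing_trunc (e k) u) \<xi> - G \<xi>)) \<longlonglongrightarrow> 0"
  proof (rule norm2sq_dominated[OF _ _ nG])
    have ft: "AE \<xi> in lborel. fourier (sing_trunc (e k) u) \<xi> = of_real (msym (e k) \<xi>) * fourier u \<xi>" for k
      by (rule fourier_sing_trunc[OF u e(2)])
    show "AE \<xi> in lborel. norm (fourier (sing_trunc (e k) u) \<xi>) \<le> norm (G \<xi>)" for k
      using ft[of k]
    proof eventually_elim
      case (elim \<xi>)
      have "\<bar>msym (e k) \<xi>\<bar> \<le> \<bar>?c * norm \<xi> powr (2 * a)\<bar>" using msym_bounds[of "e k" \<xi>] by linarith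
      then show ?case by (simp only: elim G_def norm_mult norm_of_real) (rule mult_right_mono, auto)
    qed
    have "AE \<xi> in lborel. \<forall>k. fourier (sing_trunc (e k) u) \<xi> = of_real (msym (e k) \<xi>) * fourier u \<xi>"
      using ft by (simp add: AE_all_countable)
    then show "AE \<xi> in lborel. (\<lambda>k. fourier (sing_trunc (e k) u) \<xi>) \<longlonglongrightarrow> G \<xi>"
    proof eventually_elim
      case (elim \<xi>)
      show ?case unfolding elim[rule_format] G_def by (intro tendsto_intros msym_tendsto e)
    qed
  qed auto
  from fourier_limit_inverse[OF L2_sing_trunc[OF u e(2)] G this] that show ?thesis
    unfolding G_def by blast
qed

end

lemma powr_square: "(y powr r)\<^sup>2 = y powr (2 * r)" for y r :: real
  unfolding power2_eq_square powr_add[symmetric] mult_2 ..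

text \<open>By Plancherel, $\|u(\cdot+h)-u\|^2$ is the integral of $2(1-\cos(h\cdot\xi))\,|\widehat u|^2$ up to a
  constant; integration over $h$ against the kernel produces the symbol.\<close>

lemma nn_integral_kern_translation:
  fixes u :: "'a::euclidean_space \<Rightarrow> real"
  assumes r: "0 < r" "r < 1" and u: "L2_on UNIV u"
  shows "ennreal ((2 * pi) ^ DIM('a)) * (\<integral>\<^sup>+h. ennreal (kern r h) * norm2sq (\<lambda>x. u (x + h) - u x) \<partial>lborel)
       = ennreal (2 * symb_const TYPE('a) r) * norm2sq (\<lambda>\<xi>. of_real (norm \<xi> powr r) * fourier u \<xi>)"
proof -
  note [measurable] = u[THEN L2_measurable] u[THEN L2_fourier, THEN L2_measurable]
  let ?c = "ennreal ((2 * pi) ^ DIM('a))"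
  have nc: "(norm (cis t - 1))\<^sup>2 = 2 * (1 - cos t)" for t
  proof -
    have "(norm (cis t - 1))\<^sup>2 = (cos t)\<^sup>2 + (sin t)\<^sup>2 - 2 * cos t + 1"
      by (simp add: cmod_power2 power2_diff)
    then show ?thesis by simp
  qed
  have t: "?c * norm2sq (\<lambda>x. u (x + h) - u x) = (\<integral>\<^sup>+\<xi>. ennreal (2 * (1 - cos (h \<bullet> \<xi>)) * (norm (fourier u \<xi>))\<^sup>2) \<partial>lborel)" for h
  proof -
    have "?c * norm2sq (\<lambda>x. u (x + h) - u x) = norm2sq (\<lambda>\<xi>. fourier (\<lambda>x. u (x + h)) \<xi> - fourier u \<xi>)"
      by (rule plancherel_diff[OF L2_translate[OF u] u, symmetric])
    also have "\<dots> = norm2sq (\<lambda>\<xi>. (cis (h \<bullet> \<xi>) - 1) * fourier u \<xi>)"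
      by (rule norm2sq_cong_AE) (use fourier_translate[OF u, of h] in \<open>eventually_elim, simp add: left_diff_distrib\<close>)
    also have "\<dots> = (\<integral>\<^sup>+\<xi>. ennreal (2 * (1 - cos (h \<bullet> \<xi>)) * (norm (fourier u \<xi>))\<^sup>2) \<partial>lborel)"
      unfolding norm2sq_def norm_mult power_mult_distrib nc ..
    finally show ?thesis .
  qed
  have [measurable]: "(\<lambda>h. norm2sq (\<lambda>x. u (x + h) - u x)) \<in> borel_measurable borel"
    unfolding norm2sq_def by measurable
  have "?c * (\<integral>\<^sup>+h. ennreal (kern r h) * norm2sq (\<lambda>x. u (x + h) - u x) \<partial>lborel)
      = (\<integral>\<^sup>+h. ennreal (kern r h) * (?c * norm2sq (\<lambda>x. u (x + h) - u x)) \<partial>lborel)"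
    by (subst nn_integral_cmult[symmetric]) (auto simp: mult.left_commute)
  also have "\<dots> = (\<integral>\<^sup>+h. (\<integral>\<^sup>+\<xi>. ennreal (kern r h) * ennreal (2 * (1 - cos (h \<bullet> \<xi>)) * (norm (fourier u \<xi>))\<^sup>2) \<partial>lborel) \<partial>lborel)"
    unfolding t by (subst nn_integral_cmult) auto
  also have "\<dots> = (\<integral>\<^sup>+\<xi>. (\<integral>\<^sup>+h. ennreal (kern r h) * ennreal (2 * (1 - cos (h \<bullet> \<xi>)) * (norm (fourier u \<xi>))\<^sup>2) \<partial>lborel) \<partial>lborel)"
    by (rule lborel_pair.Fubini') measurable
  also have "\<dots> = (\<integral>\<^sup>+\<xi>. ennreal (2 * symb_const TYPE('a) r) * ennreal ((norm (of_real (norm \<xi> powr r) * fourier u \<xi>))\<^sup>2) \<partial>lborel)"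
  proof (rule nn_integral_cong)
    fix \<xi> :: 'a
    have "(\<integral>\<^sup>+h. ennreal (kern r h) * ennreal (2 * (1 - cos (h \<bullet> \<xi>)) * (norm (fourier u \<xi>))\<^sup>2) \<partial>lborel)
       = (\<integral>\<^sup>+h. ennreal (2 * (norm (fourier u \<xi>))\<^sup>2) * ennreal (kern r h * (1 - cos (h \<bullet> \<xi>))) \<partial>lborel)"
      by (rule nn_integral_cong) (simp add: ennreal_mult[symmetric] mult_ac)
    also have "\<dots> = ennreal (2 * (norm (fourier u \<xi>))\<^sup>2) * symb r \<xi>"
      unfolding symb_def by (rule nn_integral_cmult) measurable
    also have "\<dots> = ennreal (2 * symb_const TYPE('a) r) * ennreal ((norm (of_real (norm \<xi> powr r) * fourier u \<xi>))\<^sup>2)"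
      using symb_const_pos[OF r, where 'a='a]
      by (simp add: symb_eq[OF r] ennreal_mult[symmetric] norm_mult power_mult_distrib powr_square mult_ac)
    finally show "(\<integral>\<^sup>+h. ennreal (kern r h) * ennreal (2 * (1 - cos (h \<bullet> \<xi>)) * (norm (fourier u \<xi>))\<^sup>2) \<partial>lborel)
      = ennreal (2 * symb_const TYPE('a) r) * ennreal ((norm (of_real (norm \<xi> powr r) * fourier u \<xi>))\<^sup>2)" .
  qed
  also have "\<dots> = ennreal (2 * symb_const TYPE('a) r) * norm2sq (\<lambda>\<xi>. of_real (norm \<xi> powr r) * fourier u \<xi>)"
    unfolding norm2sq_def by (rule nn_integral_cmult) measurable
  finally show ?thesis .
qed

lemma gagliardo_finite:
  fixes u :: "'a::euclidean_space \<Rightarrow> real"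
  assumes r: "0 < r" "r < 1" and u: "L2_on UNIV u" and H: "L2_on UNIV (\<lambda>\<xi>. of_real (norm \<xi> powr r) * fourier u \<xi>)"
  shows "(\<integral>\<^sup>+x. (\<integral>\<^sup>+y. ennreal (kern r (x - y) * (u x - u y)\<^sup>2) \<partial>lborel) \<partial>lborel) < \<infinity>"
proof -
  note [measurable] = u[THEN L2_measurable]
  have [measurable]: "(\<lambda>h. norm2sq (\<lambda>x. u (x + h) - u x)) \<in> borel_measurable borel"
    unfolding norm2sq_def by measurable
  have "(\<integral>\<^sup>+x. (\<integral>\<^sup>+y. ennreal (kern r (x - y) * (u x - u y)\<^sup>2) \<partial>lborel) \<partial>lborel)
    = (\<integral>\<^sup>+x. (\<integral>\<^sup>+h. ennreal (kern r h * (u (x + h) - u x)\<^sup>2) \<partial>lborel) \<partial>lborel)"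
  proof (rule nn_integral_cong)
    fix x
    have "(\<integral>\<^sup>+y. ennreal (kern r (x - y) * (u x - u y)\<^sup>2) \<partial>lborel) = (\<integral>\<^sup>+h. ennreal (kern r (x - (h + x)) * (u x - u (h + x))\<^sup>2) \<partial>lborel)"
      by (rule nn_integral_translate[symmetric, of "\<lambda>y. ennreal (kern r (x - y) * (u x - u y)\<^sup>2)"]) measurable
    then show "(\<integral>\<^sup>+y. ennreal (kern r (x - y) * (u x - u y)\<^sup>2) \<partial>lborel) = (\<integral>\<^sup>+h. ennreal (kern r h * (u (x + h) - u x)\<^sup>2) \<partial>lborel)"
      by (simp add: add.commute power2_commute)
  qed
  also have "\<dots> = (\<integral>\<^sup>+h. (\<integral>\<^sup>+x. ennreal (kern r h * (u (x + h) - u x)\<^sup>2) \<partial>lborel) \<partial>lborel)"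
    by (rule lborel_pair.Fubini') measurable
  also have "\<dots> = (\<integral>\<^sup>+h. ennreal (kern r h) * norm2sq (\<lambda>x. u (x + h) - u x) \<partial>lborel)" (is "_ = ?G")
    unfolding norm2sq_def by (subst nn_integral_cmult[symmetric]) (auto simp: ennreal_mult)
  also have "\<dots> < \<infinity>"
  proof -
    define C :: real where "C = (2 * pi) ^ DIM('a)"
    have C: "C > 0" unfolding C_def by (intro zero_less_power) simp
    have "ennreal C * ?G < \<infinity>"
      unfolding C_def nn_integral_kern_translation[OF r u] using norm2sq_finite[OF H] by (auto simp: ennreal_mult_less_top)
    then show ?thesis using C by (auto simp: ennreal_mult_less_top ennreal_eq_0_iff)
  qed
  finally show ?thesis .
qed

section \<open>Sobolev spaces\<close>

lemma bessel_weight_bounds: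
  assumes "0 \<le> r" "0 \<le> (y::real)"
  shows "y powr (2 * r) \<le> (1 + y\<^sup>2) powr r" "1 \<le> (1 + y\<^sup>2) powr r" "(1 + y\<^sup>2) powr r \<le> 2 powr r * (1 + y powr (2 * r))"
proof -
  have y2: "(y\<^sup>2) powr r = y powr (2 * r)"
  proof (cases "y = 0")
    case False
    then have "y\<^sup>2 = y powr 2" using assms by simp
    then show ?thesis by (simp only: powr_powr)
  qed simp
  show "y powr (2 * r) \<le> (1 + y\<^sup>2) powr r" unfolding y2[symmetric] using assms by (intro powr_mono2) auto
  show "1 \<le> (1 + y\<^sup>2) powr r" using assms by (intro ge_one_powr_ge_zero) auto
  show "(1 + y\<^sup>2) powr r \<le> 2 powr r * (1 + y powr (2 * r))"
  proof (cases "y \<le> 1")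
    case True
    then have "y\<^sup>2 \<le> 1" using assms by (simp add: power_le_one)
    then have "(1 + y\<^sup>2) powr r \<le> 2 powr r" using assms by (intro powr_mono2) auto
    also have "\<dots> \<le> 2 powr r * (1 + y powr (2 * r))" by simp
    finally show ?thesis .
  next
    case False
    then have "1 \<le> y\<^sup>2" by (simp add: one_le_power)
    then have "(1 + y\<^sup>2) powr r \<le> (2 * y\<^sup>2) powr r" using assms by (intro powr_mono2) auto
    also have "\<dots> = 2 powr r * y powr (2 * r)" by (simp add: powr_mult y2)
    also have "\<dots> \<le> 2 powr r * (1 + y powr (2 * r))" by (intro mult_left_mono) auto
    finally show ?thesis .
  qed
qed

lemma norm_powr_sq: "(norm (of_real (norm \<xi> powr r) * z :: complex))\<^sup>2 = norm \<xi> powr (2 * r) * (norm z)\<^sup>2"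
  by (simp add: norm_mult power_mult_distrib powr_square)

text \<open>For $r \ge 0$ the weights $(1+|\xi|^2)^r$ and $1+|\xi|^{2r}$ are comparable.\<close>

lemma sobolev_iff:
  assumes r: "0 \<le> r"
  shows "u \<in> sobolev r \<longleftrightarrow> L2_on UNIV u \<and> L2_on UNIV (\<lambda>\<xi>. of_real (norm \<xi> powr r) * fourier u \<xi>)"
proof (cases "L2_on UNIV u")
  case True
  note [measurable] = True[THEN L2_fourier, THEN L2_measurable]
  note fi = integrable_norm_sq[OF L2_fourier[OF True]]
  have "integrable lborel (\<lambda>\<xi>. (1 + (norm \<xi>)\<^sup>2) powr r * (norm (fourier u \<xi>))\<^sup>2)
     \<longleftrightarrow> L2_on UNIV (\<lambda>\<xi>. of_real (norm \<xi> powr r) * fourier u \<xi>)" (is "?A \<longleftrightarrow> ?B")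
  proof
    assume A: ?A
    have "integrable lborel (\<lambda>\<xi>. (norm (of_real (norm \<xi> powr r) * fourier u \<xi>))\<^sup>2)"
      by (rule Bochner_Integration.integrable_bound[OF A])
         (auto simp: norm_powr_sq abs_mult intro!: mult_right_mono bessel_weight_bounds r)
    then show ?B unfolding L2_on_def set_borel_measurable_def set_integrable_def by simp
  next
    assume B: ?B
    have "integrable lborel (\<lambda>\<xi>. 2 powr r * ((norm (fourier u \<xi>))\<^sup>2 + (norm (of_real (norm \<xi> powr r) * fourier u \<xi>))\<^sup>2))"
      by (intro integrable_mult_right Bochner_Integration.integrable_add fi integrable_norm_sq[OF B])
    then show ?A
    proof (rule Bochner_Integration.integrable_bound)
      show "AE \<xi> in lborel. norm ((1 + (norm \<xi>)\<^sup>2) powr r * (norm (fourier u \<xi>))\<^sup>2)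
        \<le> norm (2 powr r * ((norm (fourier u \<xi>))\<^sup>2 + (norm (of_real (norm \<xi> powr r) * fourier u \<xi>))\<^sup>2))"
      proof (rule AE_I2)
        fix \<xi> :: 'a
        have "(1 + (norm \<xi>)\<^sup>2) powr r * (norm (fourier u \<xi>))\<^sup>2 \<le> 2 powr r * (1 + norm \<xi> powr (2 * r)) * (norm (fourier u \<xi>))\<^sup>2"
          by (intro mult_right_mono bessel_weight_bounds r) auto
        then show "norm ((1 + (norm \<xi>)\<^sup>2) powr r * (norm (fourier u \<xi>))\<^sup>2)
          \<le> norm (2 powr r * ((norm (fourier u \<xi>))\<^sup>2 + (norm (of_real (norm \<xi> powr r) * fourier u \<xi>))\<^sup>2))"
          unfolding norm_powr_sq by (simp add: abs_mult distrib_right distrib_left)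
      qed
    qed measurable
  qed
  then show ?thesis using True by (simp add: sobolev_def)
qed (simp add: sobolev_def)

lemma sobolev_L2: "u \<in> sobolev r \<Longrightarrow> L2_on UNIV u"
  by (simp add: sobolev_def)

lemma sobolev_mono:
  assumes "0 \<le> s" "s \<le> r" and u: "u \<in> sobolev r"
  shows "u \<in> sobolev s"
proof -
  have r: "0 \<le> r" using assms by simp
  note uL = sobolev_L2[OF u]
  note [measurable] = uL[THEN L2_fourier, THEN L2_measurable]
  have "integrable lborel (\<lambda>\<xi>. (1 + (norm \<xi>)\<^sup>2) powr s * (norm (fourier u \<xi>))\<^sup>2)"
  proof (rule Bochner_Integration.integrable_bound)
    show "integrable lborel (\<lambda>\<xi>. (1 + (norm \<xi>)\<^sup>2) powr r * (norm (fourier u \<xi>))\<^sup>2)" using u by (simp add: sobolev_def)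
    show "AE \<xi> in lborel. norm ((1 + (norm \<xi>)\<^sup>2) powr s * (norm (fourier u \<xi>))\<^sup>2) \<le> norm ((1 + (norm \<xi>)\<^sup>2) powr r * (norm (fourier u \<xi>))\<^sup>2)"
      using assms by (auto simp: abs_mult intro!: mult_right_mono powr_mono)
  qed measurable
  then show ?thesis using uL by (simp add: sobolev_def)
qed

lemma sobolev_cong_AE:
  assumes u: "u \<in> sobolev r" and v: "v \<in> borel_measurable borel" and uv: "AE x in lborel. u x = v x"
  shows "v \<in> sobolev r"
proof -
  have "fourier u = fourier v" by (rule fourier_cong_AE[OF L2_measurable[OF sobolev_L2[OF u]] v uv])
  moreover have "L2_on UNIV v" by (rule L2_cong_AE[OF v sobolev_L2[OF u] uv])
  ultimately show ?thesis using u by (simp add: sobolev_def)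
qed

lemma sobolev_diff:
  assumes r: "0 \<le> r" and u: "u \<in> sobolev r" and v: "v \<in> sobolev r"
  shows "(\<lambda>x. u x - v x) \<in> sobolev r"
proof -
  note uv = sobolev_L2[OF u] sobolev_L2[OF v]
  note [measurable] = L2_fourier[OF L2_diff[OF uv], THEN L2_measurable]
  have "L2_on UNIV (\<lambda>\<xi>. of_real (norm \<xi> powr r) * fourier u \<xi> - of_real (norm \<xi> powr r) * fourier v \<xi>)"
    using u v by (intro L2_diff) (auto simp: sobolev_iff[OF r])
  then have "L2_on UNIV (\<lambda>\<xi>. of_real (norm \<xi> powr r) * fourier (\<lambda>x. u x - v x) \<xi>)"
  proof (rule L2_cong_AE[rotated])
    show "(\<lambda>\<xi>. of_real (norm \<xi> powr r) * fourier (\<lambda>x. u x - v x) \<xi>) \<in> borel_measurable borel" by measurable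
    show "AE \<xi> in lborel. of_real (norm \<xi> powr r) * fourier u \<xi> - of_real (norm \<xi> powr r) * fourier v \<xi> = of_real (norm \<xi> powr r) * fourier (\<lambda>x. u x - v x) \<xi>"
      using fourier_diff[OF uv] by eventually_elim (simp add: right_diff_distrib)
  qed
  then show ?thesis using L2_diff[OF uv] by (simp add: sobolev_iff[OF r])
qed

lemma norm2sq_le_sobolev_norm:
  fixes u :: "'a::euclidean_space \<Rightarrow> real"
  assumes r: "0 \<le> r" and u: "u \<in> sobolev r"
  shows "ennreal ((2 * pi) ^ DIM('a)) * norm2sq u \<le> ennreal ((sobolev_norm r u)\<^sup>2)"
proof -
  note uL = sobolev_L2[OF u]
  have i: "integrable lborel (\<lambda>\<xi>. (1 + (norm \<xi>)\<^sup>2) powr r * (norm (fourier u \<xi>))\<^sup>2)" using u by (simp add: sobolev_def)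
  have "ennreal ((2 * pi) ^ DIM('a)) * norm2sq u = ennreal (LINT \<xi>|lborel. (norm (fourier u \<xi>))\<^sup>2)"
    unfolding plancherel[OF uL, symmetric] by (rule norm2sq_eq_integral[OF L2_fourier[OF uL]])
  also have "\<dots> \<le> ennreal (LINT \<xi>|lborel. (1 + (norm \<xi>)\<^sup>2) powr r * (norm (fourier u \<xi>))\<^sup>2)"
  proof (intro ennreal_leI integral_mono integrable_norm_sq[OF L2_fourier[OF uL]] i)
    fix \<xi> :: 'a
    show "(norm (fourier u \<xi>))\<^sup>2 \<le> (1 + (norm \<xi>)\<^sup>2) powr r * (norm (fourier u \<xi>))\<^sup>2"
      using mult_right_mono[OF bessel_weight_bounds(2)[OF r, of "norm \<xi>"], of "(norm (fourier u \<xi>))\<^sup>2"] by simp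
  qed
  also have "(LINT \<xi>|lborel. (1 + (norm \<xi>)\<^sup>2) powr r * (norm (fourier u \<xi>))\<^sup>2) = (sobolev_norm r u)\<^sup>2"
    unfolding sobolev_norm_def by (subst real_sqrt_pow2) (auto intro!: integral_nonneg_AE)
  finally show ?thesis .
qed

section \<open>The fractional Laplacian on Sobolev spaces\<close>

context
  fixes a :: real
  assumes a: "0 < a" "a < 1"
begin

text \<open>The limit of the truncated singular integrals, divided by the constant of the symbol, is a function with
  the required transform.\<close>

lemma frac_laplacian_spec:
  fixes u :: "'a::euclidean_space \<Rightarrow> real"
  assumes u: "u \<in> sobolev (2 * a)"
  shows L2_frac_laplacian: "L2_on UNIV (frac_laplacian a u)"
    and fourier_frac_laplacian: "AE \<xi> in lborel. fourier (frac_laplacian a u) \<xi> = of_real (norm \<xi> powr (2 * a)) * fourier u \<xi>"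
proof -
  let ?c = "symb_const TYPE('a) a"
  have c: "?c > 0" by (rule symb_const_pos[OF a])
  have uL: "L2_on UNIV u" and H: "L2_on UNIV (\<lambda>\<xi>. of_real (norm \<xi> powr (2 * a)) * fourier u \<xi>)"
    using u a by (simp_all add: sobolev_iff)
  obtain w where w: "L2_on UNIV w" "AE \<xi> in lborel. fourier w \<xi> = of_real (?c * norm \<xi> powr (2 * a)) * fourier u \<xi>"
    by (rule sing_trunc_limit[OF a uL H LIMSEQ_inverse_real_of_nat]) simp_all
  have "L2_on UNIV (\<lambda>x. inverse ?c * w x)" by (rule L2_cmult[OF w(1)])
  moreover have "AE \<xi> in lborel. fourier (\<lambda>x. inverse ?c * w x) \<xi> = of_real (norm \<xi> powr (2 * a)) * fourier u \<xi>"
    using w(2) fourier_cmult[OF w(1), of "inverse ?c"] by eventually_elim (use c in simp)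
  ultimately have "\<exists>w. L2_on UNIV w \<and> (AE \<xi> in lborel. fourier w \<xi> = of_real (norm \<xi> powr (2 * a)) * fourier u \<xi>)"
    by blast
  from someI_ex[OF this]
  show "L2_on UNIV (frac_laplacian a u)" "AE \<xi> in lborel. fourier (frac_laplacian a u) \<xi> = of_real (norm \<xi> powr (2 * a)) * fourier u \<xi>"
    unfolding frac_laplacian_def by auto
qed

lemma frac_laplacian_eqI:
  fixes u :: "'a::euclidean_space \<Rightarrow> real"
  assumes u: "u \<in> sobolev (2 * a)" and w: "L2_on UNIV w"
    and eq: "AE \<xi> in lborel. fourier w \<xi> = of_real (norm \<xi> powr (2 * a)) * fourier u \<xi>"
  shows "AE x in lborel. frac_laplacian a u x = w x"
  by (rule fourier_injective[OF L2_frac_laplacian[OF u] w])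
     (use eq fourier_frac_laplacian[OF u] in \<open>eventually_elim, simp\<close>)

lemma frac_laplacian_diff:
  fixes u v :: "'a::euclidean_space \<Rightarrow> real"
  assumes u: "u \<in> sobolev (2 * a)" and v: "v \<in> sobolev (2 * a)"
  shows "AE x in lborel. frac_laplacian a (\<lambda>x. u x - v x) x = frac_laplacian a u x - frac_laplacian a v x"
proof (rule frac_laplacian_eqI)
  show "(\<lambda>x. u x - v x) \<in> sobolev (2 * a)" using a by (intro sobolev_diff u v) auto
  show "L2_on UNIV (\<lambda>x. frac_laplacian a u x - frac_laplacian a v x)" by (intro L2_diff L2_frac_laplacian u v)
  show "AE \<xi> in lborel. fourier (\<lambda>x. frac_laplacian a u x - frac_laplacian a v x) \<xi> = of_real (norm \<xi> powr (2 * a)) * fourier (\<lambda>x. u x - v x) \<xi>"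
    using fourier_diff[OF L2_frac_laplacian[OF u] L2_frac_laplacian[OF v]] fourier_diff[OF sobolev_L2[OF u] sobolev_L2[OF v]]
      fourier_frac_laplacian[OF u] fourier_frac_laplacian[OF v]
    by eventually_elim (simp add: right_diff_distrib)
qed

lemma sing_trunc_tendsto_frac_laplacian:
  fixes u :: "'a::euclidean_space \<Rightarrow> real"
  assumes u: "u \<in> sobolev (2 * a)" and e: "e \<longlonglongrightarrow> 0" "\<And>k. 0 < e k"
  shows "(\<lambda>k. norm2sq (\<lambda>x. sing_trunc a (e k) u x - symb_const TYPE('a) a * frac_laplacian a u x)) \<longlonglongrightarrow> 0"
proof -
  let ?c = "symb_const TYPE('a) a"
  have c: "?c > 0" by (rule symb_const_pos[OF a])
  have uL: "L2_on UNIV u" and H: "L2_on UNIV (\<lambda>\<xi>. of_real (norm \<xi> powr (2 * a)) * fourier u \<xi>)"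
    using u a by (simp_all add: sobolev_iff)
  obtain w where w: "L2_on UNIV w" "(\<lambda>k. norm2sq (\<lambda>x. sing_trunc a (e k) u x - w x)) \<longlonglongrightarrow> 0"
    "AE \<xi> in lborel. fourier w \<xi> = of_real (?c * norm \<xi> powr (2 * a)) * fourier u \<xi>"
    using sing_trunc_limit[OF a uL H e] by blast
  have "AE x in lborel. ?c * frac_laplacian a u x = w x"
    by (rule fourier_injective[OF L2_cmult[OF L2_frac_laplacian[OF u]] w(1)])
       (use w(3) fourier_frac_laplacian[OF u] fourier_cmult[OF L2_frac_laplacian[OF u], of ?c] in \<open>eventually_elim, simp\<close>)
  then have "norm2sq (\<lambda>x. sing_trunc a (e k) u x - ?c * frac_laplacian a u x) = norm2sq (\<lambda>x. sing_trunc a (e k) u x - w x)" for k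
    by (intro norm2sq_cong_AE) (auto elim!: eventually_mono)
  then show ?thesis using w(2) by simp
qed

end

section \<open>Rapidly decreasing functions\<close>

lemma iter_deriv_append: "iter_deriv (ws @ vs) f = iter_deriv ws (iter_deriv vs f)"
  by (induction ws) auto

declare iter_deriv.simps(2) [simp del]

lemma smooth_iter_deriv: "smooth f \<Longrightarrow> smooth (iter_deriv vs f)"
  unfolding smooth_def by (simp add: iter_deriv_append[symmetric])

lemma schwartz_iter_deriv: "schwartz f \<Longrightarrow> schwartz (iter_deriv vs f)"
  unfolding schwartz_def by (simp add: smooth_iter_deriv iter_deriv_append[symmetric])

lemma schwartz_smooth: "schwartz f \<Longrightarrow> smooth f"
  by (simp add: schwartz_def)

lemma smooth_has_derivative:
  "smooth f \<Longrightarrow> (f has_derivative frechet_derivative f (at x)) (at x)"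
  unfolding smooth_def frechet_derivative_works[symmetric] by (drule spec[of _ "[]"]) simp

lemma smooth_continuous: "smooth f \<Longrightarrow> continuous_on UNIV f"
  by (intro continuous_at_imp_continuous_on ballI) (rule has_derivative_continuous[OF smooth_has_derivative])

lemma smooth_measurable [measurable_dest]: "smooth f \<Longrightarrow> f \<in> borel_measurable borel"
  by (intro borel_measurable_continuous_onI smooth_continuous)

lemma smooth_line_derivative:
  assumes f: "smooth f"
  shows "((\<lambda>t. f (x + t *\<^sub>R v)) has_real_derivative iter_deriv [v] f (x + t *\<^sub>R v)) (at t)"
proof -
  have "((\<lambda>t. x + t *\<^sub>R v) has_derivative (\<lambda>s. s *\<^sub>R v)) (at t)"
    by (auto intro!: derivative_eq_intros)
  from has_derivative_compose[OF this smooth_has_derivative[OF f]]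
  have "((\<lambda>t. f (x + t *\<^sub>R v)) has_derivative (\<lambda>s. frechet_derivative f (at (x + t *\<^sub>R v)) (s *\<^sub>R v))) (at t)" .
  moreover have "frechet_derivative f (at (x + t *\<^sub>R v)) (s *\<^sub>R v) = iter_deriv [v] f (x + t *\<^sub>R v) * s" for s
    using has_derivative_linear[OF smooth_has_derivative[OF f, of "x + t *\<^sub>R v"]] by (simp add: linear_cmul mult.commute iter_deriv.simps)
  ultimately show ?thesis by (simp add: has_field_derivative_def)
qed

lemma smooth_deriv_expand:
  assumes f: "smooth (f :: 'a::euclidean_space \<Rightarrow> real)"
  shows "iter_deriv [h] f x = (\<Sum>b\<in>Basis. (h \<bullet> b) * iter_deriv [b] f x)"
proof -
  note lin = has_derivative_linear[OF smooth_has_derivative[OF f, of x]]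
  have "frechet_derivative f (at x) (\<Sum>b\<in>Basis. (h \<bullet> b) *\<^sub>R b) = (\<Sum>b\<in>Basis. (h \<bullet> b) * frechet_derivative f (at x) b)"
    using lin by (simp add: linear_sum linear_cmul)
  then show ?thesis by (simp add: euclidean_representation iter_deriv.simps)
qed

lemma smooth_mean_value:
  assumes f: "smooth (f :: 'a::euclidean_space \<Rightarrow> real)"
  obtains s where "0 < s" "s < 1" "f (x + v) - f x = iter_deriv [v] f (x + s *\<^sub>R v)"
proof -
  have "\<exists>z>0. z < 1 \<and> f (x + 1 *\<^sub>R v) - f (x + 0 *\<^sub>R v) = (1 - 0) * iter_deriv [v] f (x + z *\<^sub>R v)"
    by (rule MVT2) (auto intro: smooth_line_derivative[OF f])
  then show ?thesis using that by auto
qed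

lemma smooth_lipschitz:
  assumes f: "smooth (f :: 'a::euclidean_space \<Rightarrow> real)" and M: "\<And>b x. b \<in> Basis \<Longrightarrow> \<bar>iter_deriv [b] f x\<bar> \<le> M"
  shows "\<bar>f (x + v) - f x\<bar> \<le> real DIM('a) * M * norm v"
proof -
  obtain s where s: "f (x + v) - f x = iter_deriv [v] f (x + s *\<^sub>R v)" by (rule smooth_mean_value[OF f])
  have "\<bar>iter_deriv [v] f (x + s *\<^sub>R v)\<bar> \<le> (\<Sum>b\<in>Basis. \<bar>(v \<bullet> b) * iter_deriv [b] f (x + s *\<^sub>R v)\<bar>)"
    unfolding smooth_deriv_expand[OF f, of v] by (rule sum_abs)
  also have "\<dots> \<le> (\<Sum>b\<in>(Basis::'a set). norm v * M)"
    unfolding abs_mult by (intro sum_mono mult_mono Basis_le_norm M) auto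
  finally show ?thesis using s by (simp add: mult_ac)
qed

text \<open>The symmetric second difference is of order $|h|^2$: the mean value theorem is applied once to
  $f(x+\tau h)+f(x-\tau h)$ and once to the first derivatives. Against the kernel this compensates the
  singularity at $h = 0$.\<close>

lemma smooth_second_difference:
  assumes f: "smooth (f :: 'a::euclidean_space \<Rightarrow> real)"
    and M: "\<And>b c x. b \<in> Basis \<Longrightarrow> c \<in> Basis \<Longrightarrow> \<bar>iter_deriv [c, b] f x\<bar> \<le> M"
  shows "\<bar>2 * f x - f (x + h) - f (x - h)\<bar> \<le> (2 * (real DIM('a))\<^sup>2 * M) * (norm h)\<^sup>2"
proof -
  let ?p = "\<lambda>t. f (x + t *\<^sub>R h) + f (x + t *\<^sub>R (- h))"
  have d: "(?p has_real_derivative iter_deriv [h] f (x + t *\<^sub>R h) + iter_deriv [- h] f (x + t *\<^sub>R (- h))) (at t)" for t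
    by (intro DERIV_add smooth_line_derivative f)
  have "\<exists>z>0. z < 1 \<and> ?p 1 - ?p 0 = (1 - 0) * (iter_deriv [h] f (x + z *\<^sub>R h) + iter_deriv [- h] f (x + z *\<^sub>R (- h)))"
    by (rule MVT2) (use d in auto)
  then obtain z where z: "0 < z" "z < 1" "?p 1 - ?p 0 = iter_deriv [h] f (x + z *\<^sub>R h) + iter_deriv [- h] f (x + z *\<^sub>R (- h))"
    by auto
  have E: "iter_deriv [h] f (x + z *\<^sub>R h) + iter_deriv [- h] f (x + z *\<^sub>R (- h))
     = (\<Sum>b\<in>Basis. (h \<bullet> b) * (iter_deriv [b] f (x + z *\<^sub>R h) - iter_deriv [b] f (x + z *\<^sub>R (- h))))"
    unfolding smooth_deriv_expand[OF f, of h] smooth_deriv_expand[OF f, of "- h"]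
    by (simp add: sum_subtractf right_diff_distrib sum_negf)
  have "\<bar>?p 1 - ?p 0\<bar> \<le> (\<Sum>b\<in>Basis. \<bar>(h \<bullet> b) * (iter_deriv [b] f (x + z *\<^sub>R h) - iter_deriv [b] f (x + z *\<^sub>R (- h)))\<bar>)"
    unfolding z(3) E by (rule sum_abs)
  also have "\<dots> \<le> (\<Sum>b\<in>(Basis::'a set). norm h * (real DIM('a) * M * (2 * norm h)))"
  proof (rule sum_mono)
    fix b :: 'a assume b: "b \<in> Basis"
    have M0: "0 \<le> M" by (rule order.trans[OF abs_ge_zero M[OF b b, of 0]])
    have "\<bar>iter_deriv [b] f ((x + z *\<^sub>R (- h)) + (2 * z) *\<^sub>R h) - iter_deriv [b] f (x + z *\<^sub>R (- h))\<bar> \<le> real DIM('a) * M * norm ((2 * z) *\<^sub>R h)"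
      by (rule smooth_lipschitz[OF smooth_iter_deriv[OF f]]) (simp only: iter_deriv_append[symmetric] append_Cons append_Nil M[OF b])
    also have "(x + z *\<^sub>R (- h)) + (2 * z) *\<^sub>R h = x + z *\<^sub>R h"
      by (simp only: mult_2 scaleR_add_left scaleR_minus_right) simp
    also have "real DIM('a) * M * norm ((2 * z) *\<^sub>R h) \<le> real DIM('a) * M * (2 * norm h)"
      using z M0 by (intro mult_left_mono) (simp_all add: mult_left_le_one_le)
    finally have "\<bar>iter_deriv [b] f (x + z *\<^sub>R h) - iter_deriv [b] f (x + z *\<^sub>R (- h))\<bar> \<le> real DIM('a) * M * (2 * norm h)" .
    then show "\<bar>(h \<bullet> b) * (iter_deriv [b] f (x + z *\<^sub>R h) - iter_deriv [b] f (x + z *\<^sub>R (- h)))\<bar>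
        \<le> norm h * (real DIM('a) * M * (2 * norm h))"
      unfolding abs_mult by (rule mult_mono[OF Basis_le_norm[OF b]]) simp_all
  qed
  also have "\<dots> = real DIM('a) * (norm h * (real DIM('a) * M * (2 * norm h)))" by simp
  also have "\<dots> = (2 * (real DIM('a))\<^sup>2 * M) * (norm h)\<^sup>2" by (simp add: power2_eq_square)
  finally have "\<bar>?p 1 - ?p 0\<bar> \<le> (2 * (real DIM('a))\<^sup>2 * M) * (norm h)\<^sup>2" .
  moreover have "\<bar>?p 1 - ?p 0\<bar> = \<bar>2 * f x - f (x + h) - f (x - h)\<bar>" by (simp add: abs_minus_commute)
  ultimately show ?thesis by (simp only:)
qed

lemma schwartz_bound:
  assumes "schwartz f"
  obtains C where "0 \<le> C" "\<And>x. \<bar>iter_deriv vs f x\<bar> \<le> C / (1 + norm x) ^ k"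
proof -
  have "bounded (range (\<lambda>x. (1 + norm x) ^ k * iter_deriv vs f x))" using assms by (simp add: schwartz_def)
  then obtain C where "\<forall>y\<in>range (\<lambda>x. (1 + norm x) ^ k * iter_deriv vs f x). norm y \<le> C" unfolding bounded_iff ..
  then have C: "\<bar>(1 + norm x) ^ k * iter_deriv vs f x\<bar> \<le> C" for x by simp
  have "0 \<le> C" using order.trans[OF abs_ge_zero C] .
  moreover have "\<bar>iter_deriv vs f x\<bar> \<le> C / (1 + norm x) ^ k" for x
  proof -
    have "(1 + norm x) ^ k > 0" by (intro zero_less_power) (use norm_ge_zero[of x] in linarith)
    then show ?thesis using C[of x] by (simp add: abs_mult field_simps)
  qed
  ultimately show ?thesis by (rule that)
qed

lemma integrable_decay: "integrable lborel (\<lambda>x::'a::euclidean_space. 1 / (1 + norm x) ^ (DIM('a) + 1))"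
proof (rule integrableI_nonneg)
  let ?n = "DIM('a) + 1"
  have "(\<integral>\<^sup>+x. ennreal (1 / (1 + norm x) ^ ?n) \<partial>(lborel::'a measure))
     \<le> (\<integral>\<^sup>+x. indicator (ball 0 1) x + indicator {x. 1 \<le> norm x} x * ennreal (norm x powr - real ?n) \<partial>(lborel::'a measure))"
  proof (rule nn_integral_mono)
    fix x :: 'a
    show "ennreal (1 / (1 + norm x) ^ ?n) \<le> indicator (ball 0 1) x + indicator {x. 1 \<le> norm x} x * ennreal (norm x powr - real ?n)"
    proof (cases "norm x < 1")
      case True
      have "1 \<le> (1 + norm x) ^ ?n" by (rule one_le_power) simp
      then have "1 / (1 + norm x) ^ ?n \<le> 1" by (intro divide_le_eq_1[THEN iffD2] disjI1 conjI) linarith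
      then have "ennreal (1 / (1 + norm x) ^ ?n) \<le> 1" using ennreal_leI[of _ 1] by simp
      then show ?thesis using True by simp
    next
      case False
      then have "norm x ^ ?n \<le> (1 + norm x) ^ ?n" by (intro power_mono) auto
      moreover have "0 < norm x ^ ?n" using False by (intro zero_less_power) auto
      ultimately have "1 / (1 + norm x) ^ ?n \<le> 1 / norm x ^ ?n" by (intro divide_left_mono) (auto intro: mult_pos_pos less_le_trans)
      also have "\<dots> = norm x powr - real ?n" using False by (subst powr_minus_divide, subst powr_realpow) auto
      finally show ?thesis using False by (simp add: ennreal_leI)
    qed
  qed
  also have "\<dots> = (\<integral>\<^sup>+x. indicator (ball 0 1) x \<partial>(lborel::'a measure)) + (\<integral>\<^sup>+x. indicator {x. 1 \<le> norm x} x * ennreal (norm x powr - real ?n) \<partial>(lborel::'a measure))"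
    by (rule nn_integral_add) (intro borel_measurable_indicator, simp, measurable)
  also have "\<dots> < \<infinity>"
    using nn_integral_norm_powr_large[of "real ?n", where 'a='a] emeasure_lborel_ball_finite[of "0::'a" 1] by simp
  finally show "(\<integral>\<^sup>+x. ennreal (1 / (1 + norm x) ^ ?n) \<partial>(lborel::'a measure)) < \<infinity>" .
qed auto

lemma schwartz_integrable:
  assumes f: "schwartz (f :: 'a::euclidean_space \<Rightarrow> real)" shows "integrable lborel f"
proof -
  note [measurable] = smooth_measurable[OF schwartz_smooth[OF f]]
  obtain C where C: "\<And>x. \<bar>iter_deriv [] f x\<bar> \<le> C / (1 + norm x) ^ (DIM('a) + 1)" using schwartz_bound[OF f, of "[]" "DIM('a) + 1"] by blast
  show ?thesis
    by (rule Bochner_Integration.integrable_bound[OF integrable_mult_right[OF integrable_decay, of C]])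
       (measurable, rule AE_I2, use order.trans[OF C abs_ge_self] in simp)
qed

lemma schwartz_bounded:
  assumes f: "schwartz (f :: 'a::euclidean_space \<Rightarrow> real)"
  obtains C where "0 \<le> C" "\<And>x. \<bar>iter_deriv vs f x\<bar> \<le> C"
proof (rule schwartz_bound[OF f, of vs 0])
  fix C assume "0 \<le> C" "\<And>x. \<bar>iter_deriv vs f x\<bar> \<le> C / (1 + norm x) ^ 0"
  then show thesis by (intro that[of C]) simp_all
qed

lemma schwartz_L2:
  assumes f: "schwartz (f :: 'a::euclidean_space \<Rightarrow> real)" shows "L2_on UNIV f"
proof -
  note [measurable] = smooth_measurable[OF schwartz_smooth[OF f]]
  obtain C where C: "0 \<le> C" "\<And>x. \<bar>iter_deriv [] f x\<bar> \<le> C" using schwartz_bounded[OF f, of "[]"] by blast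
  have "integrable lborel (\<lambda>x. (norm (f x))\<^sup>2)"
  proof (rule Bochner_Integration.integrable_bound[OF integrable_mult_right[OF integrable_abs[OF schwartz_integrable[OF f]], of C]])
    show "AE x in lborel. norm ((norm (f x))\<^sup>2) \<le> norm (C * \<bar>f x\<bar>)"
    proof (rule AE_I2)
      fix x
      have "\<bar>f x\<bar> * \<bar>f x\<bar> \<le> C * \<bar>f x\<bar>" using C(2)[of x] by (intro mult_right_mono) simp_all
      then show "norm ((norm (f x))\<^sup>2) \<le> norm (C * \<bar>f x\<bar>)" using C(1) by (simp add: power2_eq_square abs_mult)
    qed
  qed measurable
  then show ?thesis unfolding L2_on_def set_borel_measurable_def set_integrable_def by simp
qed

lemma inverse_le_of_le_mult: "A \<le> V * Y \<Longrightarrow> 0 < A \<Longrightarrow> 0 < Y \<Longrightarrow> 1 / Y \<le> V * (1 / A)" for A V Y :: real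
  by (simp add: field_simps)

text \<open>The transform of a difference quotient is explicit; the quotients have a common integrable majorant.\<close>

lemma fourier_L1_deriv:
  assumes f: "schwartz (f :: 'a::euclidean_space \<Rightarrow> real)"
  shows "fourier_L1 (iter_deriv [v] f) \<xi> = \<i> * of_real (v \<bullet> \<xi>) * fourier_L1 f \<xi>"
proof -
  let ?N = "DIM('a) + 1"
  note sm = schwartz_smooth[OF f]
  note [measurable] = smooth_measurable[OF sm] smooth_measurable[OF smooth_iter_deriv[OF sm]]
  note fi = schwartz_integrable[OF f]
  obtain C where C: "0 \<le> C" "\<And>x. \<bar>iter_deriv [v] f x\<bar> \<le> C / (1 + norm x) ^ ?N" using schwartz_bound[OF f, of "[v]" ?N] by blast
  define e where "e k = inverse (real (Suc k))" for k
  have e: "e k > 0" "e k \<le> 1" for k by (auto simp: e_def field_simps)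
  have e0: "e \<longlonglongrightarrow> 0" unfolding e_def by (rule LIMSEQ_inverse_real_of_nat)
  define q where "q k x = (f (x + e k *\<^sub>R v) - f x) / e k" for k x
  have qF: "fourier_L1 (q k) \<xi> = of_real (inverse (e k)) * (cis (e k * (v \<bullet> \<xi>)) - 1) * fourier_L1 f \<xi>" for k
  proof -
    have "fourier_L1 (q k) \<xi> = (LINT x|lborel. of_real (inverse (e k)) * ((f (x + e k *\<^sub>R v) - f x) *\<^sub>R cis (- (x \<bullet> \<xi>))))"
      unfolding fourier_L1_def q_def by (simp add: scaleR_conv_of_real divide_inverse mult_ac)
    also have "\<dots> = of_real (inverse (e k)) * fourier_L1 (\<lambda>x. f (x + e k *\<^sub>R v) - f x) \<xi>"
      unfolding fourier_L1_def by (rule integral_mult_right_zero)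
    also have "fourier_L1 (\<lambda>x. f (x + e k *\<^sub>R v) - f x) \<xi> = cis ((e k *\<^sub>R v) \<bullet> \<xi>) * fourier_L1 f \<xi> - fourier_L1 f \<xi>"
      by (simp only: fourier_L1_diff[OF integrable_translate[OF fi] fi] fourier_L1_translate[OF fi])
    finally show ?thesis by (simp add: algebra_simps)
  qed
  have L: "(\<lambda>k. fourier_L1 (q k) \<xi>) \<longlonglongrightarrow> fourier_L1 (iter_deriv [v] f) \<xi>"
    unfolding fourier_L1_def
  proof (rule integral_dominated_convergence[where w="\<lambda>x. C * (1 + norm v) ^ ?N * (1 / (1 + norm x) ^ ?N)"])
    show "integrable lborel (\<lambda>x::'a. C * (1 + norm v) ^ ?N * (1 / (1 + norm x) ^ ?N))"
      by (rule integrable_mult_right[OF integrable_decay])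
    show "AE x in lborel. (\<lambda>k. q k x *\<^sub>R cis (- (x \<bullet> \<xi>))) \<longlonglongrightarrow> iter_deriv [v] f x *\<^sub>R cis (- (x \<bullet> \<xi>))"
    proof (rule AE_I2, intro tendsto_scaleR tendsto_const)
      fix x
      have "((\<lambda>t. f (x + t *\<^sub>R v)) has_real_derivative iter_deriv [v] f (x + 0 *\<^sub>R v)) (at 0)"
        by (rule smooth_line_derivative[OF sm])
      then have "((\<lambda>h. (f (x + (0 + h) *\<^sub>R v) - f (x + 0 *\<^sub>R v)) / h) \<longlongrightarrow> iter_deriv [v] f (x + 0 *\<^sub>R v)) (at 0)"
        by (simp add: DERIV_def)
      moreover have "filterlim e (at 0) sequentially"
        using e0 e by (simp add: filterlim_at less_imp_neq[symmetric])
      ultimately have "(\<lambda>k. (f (x + (0 + e k) *\<^sub>R v) - f (x + 0 *\<^sub>R v)) / e k) \<longlonglongrightarrow> iter_deriv [v] f (x + 0 *\<^sub>R v)"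
        by (rule filterlim_compose)
      then show "(\<lambda>k. q k x) \<longlonglongrightarrow> iter_deriv [v] f x" by (simp add: q_def)
    qed
    show "AE x in lborel. norm (q k x *\<^sub>R cis (- (x \<bullet> \<xi>))) \<le> C * (1 + norm v) ^ ?N * (1 / (1 + norm x) ^ ?N)" for k
    proof (rule AE_I2)
      fix x
      have "\<exists>z>0. z < e k \<and> f (x + e k *\<^sub>R v) - f (x + 0 *\<^sub>R v) = (e k - 0) * iter_deriv [v] f (x + z *\<^sub>R v)"
        by (rule MVT2) (use e in \<open>auto intro: smooth_line_derivative[OF sm]\<close>)
      then obtain z where z: "0 < z" "z < e k" and eq: "f (x + e k *\<^sub>R v) - f x = e k * iter_deriv [v] f (x + z *\<^sub>R v)" by auto
      have "norm x \<le> norm (x + z *\<^sub>R v) + norm (z *\<^sub>R v)" using norm_triangle_ineq4[of "x + z *\<^sub>R v" "z *\<^sub>R v"] by simp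
      also have "norm (z *\<^sub>R v) \<le> 1 * norm v" unfolding norm_scaleR using z e(2)[of k] by (intro mult_right_mono) auto
      finally have "1 + norm x \<le> 1 + norm (x + z *\<^sub>R v) + norm v" by simp
      also have "\<dots> \<le> (1 + norm v) * (1 + norm (x + z *\<^sub>R v))" by (simp add: algebra_simps)
      finally have "(1 + norm x) ^ ?N \<le> (1 + norm v) ^ ?N * (1 + norm (x + z *\<^sub>R v)) ^ ?N"
        by (subst power_mult_distrib[symmetric]) (rule power_mono, auto)
      moreover have p: "0 < (1 + norm y) ^ ?N" for y :: 'a by (intro zero_less_power) (use norm_ge_zero[of y] in linarith)
      ultimately have "1 / (1 + norm (x + z *\<^sub>R v)) ^ ?N \<le> (1 + norm v) ^ ?N * (1 / (1 + norm x) ^ ?N)"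
        by - (rule inverse_le_of_le_mult[OF _ p p], assumption)
      then have "C * (1 / (1 + norm (x + z *\<^sub>R v)) ^ ?N) \<le> C * ((1 + norm v) ^ ?N * (1 / (1 + norm x) ^ ?N))"
        by (rule mult_left_mono[OF _ C(1)])
      moreover have "q k x = iter_deriv [v] f (x + z *\<^sub>R v)" unfolding q_def eq using e(1)[of k] by simp
      moreover have "\<bar>iter_deriv [v] f (x + z *\<^sub>R v)\<bar> \<le> C * (1 / (1 + norm (x + z *\<^sub>R v)) ^ ?N)" using C(2)[of "x + z *\<^sub>R v"] by (simp only: times_divide_eq_right mult_1_right)
      ultimately show "norm (q k x *\<^sub>R cis (- (x \<bullet> \<xi>))) \<le> C * (1 + norm v) ^ ?N * (1 / (1 + norm x) ^ ?N)"
        by (simp only: norm_scaleR norm_cis mult_1_right mult.assoc)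
    qed
  qed (unfold q_def, measurable)
  have "(\<lambda>k. of_real (inverse (e k)) * (cis (e k * (v \<bullet> \<xi>)) - 1) * fourier_L1 f \<xi>) \<longlonglongrightarrow> \<i> * of_real (v \<bullet> \<xi>) * fourier_L1 f \<xi>"
  proof (rule tendsto_mult[OF _ tendsto_const])
    let ?c = "\<i> * of_real (v \<bullet> \<xi>)"
    have "((\<lambda>w. exp (?c * w)) has_field_derivative ?c) (at 0)"
      by (auto intro!: derivative_eq_intros)
    then have "((\<lambda>w. (exp (?c * (0 + w)) - exp (?c * 0)) / w) \<longlongrightarrow> ?c) (at 0)"
      by (simp only: DERIV_def)
    moreover have "filterlim (\<lambda>k. of_real (e k) :: complex) (at 0) sequentially"
      using tendsto_of_real[OF e0, where 'a=complex] e by (simp add: filterlim_at less_imp_neq[symmetric])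
    ultimately have "(\<lambda>k. (exp (?c * (0 + of_real (e k))) - exp (?c * 0)) / of_real (e k)) \<longlonglongrightarrow> ?c"
      by (rule filterlim_compose)
    moreover have "(exp (?c * (0 + of_real (e k))) - exp (?c * 0)) / of_real (e k) = of_real (inverse (e k)) * (cis (e k * (v \<bullet> \<xi>)) - 1)" for k
      by (simp add: cis_conv_exp divide_inverse mult_ac)
    ultimately show "(\<lambda>k. of_real (inverse (e k)) * (cis (e k * (v \<bullet> \<xi>)) - 1)) \<longlonglongrightarrow> ?c"
      by (simp only:)
  qed
  then have "(\<lambda>k. fourier_L1 (q k) \<xi>) \<longlonglongrightarrow> \<i> * of_real (v \<bullet> \<xi>) * fourier_L1 f \<xi>" unfolding qF .
  from LIMSEQ_unique[OF L this] show ?thesis .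
qed

text \<open>$|\xi|^2\,\widehat f$ is a sum of transforms of second derivatives, hence square integrable.\<close>

lemma schwartz_sobolev:
  fixes f :: "'a::euclidean_space \<Rightarrow> real"
  assumes f: "schwartz f" and r: "0 \<le> r" "r \<le> 2"
  shows "f \<in> sobolev r"
proof (rule sobolev_mono[OF r])
  note fL = schwartz_integrable[OF f] schwartz_L2[OF f]
  note [measurable] = L2_fourier[OF fL(2), THEN L2_measurable]
  have part: "L2_on UNIV (\<lambda>\<xi>. of_real ((b \<bullet> \<xi>)\<^sup>2) * fourier_L1 f \<xi>)" for b
  proof -
    have "fourier_L1 (iter_deriv [b] (iter_deriv [b] f)) = (\<lambda>\<xi>. - (of_real ((b \<bullet> \<xi>)\<^sup>2) * fourier_L1 f \<xi>))"
      by (rule ext) (simp add: fourier_L1_deriv[OF schwartz_iter_deriv[OF f]] fourier_L1_deriv[OF f] power2_eq_square mult_ac)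
    moreover have "L2_on UNIV (fourier_L1 (iter_deriv [b] (iter_deriv [b] f)))"
      by (intro L2_fourier_L1 schwartz_integrable schwartz_L2 schwartz_iter_deriv f)
    ultimately have "L2_on UNIV (\<lambda>\<xi>. - (of_real ((b \<bullet> \<xi>)\<^sup>2) * fourier_L1 f \<xi>))" by (simp only:)
    from L2_scaleR[OF this, of "-1"] show ?thesis by simp
  qed
  have "L2_on UNIV (\<lambda>\<xi>. \<Sum>b\<in>B. of_real ((b \<bullet> \<xi>)\<^sup>2) * fourier_L1 f \<xi>)" if "finite B" for B :: "'a set"
    using that by (induction B rule: finite_induct) (simp_all add: L2_0 L2_add part del: of_real_power)
  from this[OF finite_Basis]
  have L: "L2_on UNIV (\<lambda>\<xi>. \<Sum>b\<in>(Basis::'a set). of_real ((b \<bullet> \<xi>)\<^sup>2) * fourier_L1 f \<xi>)" .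
  have eq: "(\<Sum>b\<in>(Basis::'a set). of_real ((b \<bullet> \<xi>)\<^sup>2) * fourier_L1 f \<xi>) = of_real (norm \<xi> powr 2) * fourier_L1 f \<xi>" for \<xi>
  proof -
    have "(norm \<xi>)\<^sup>2 = (\<Sum>b\<in>Basis. (b \<bullet> \<xi>)\<^sup>2)"
      unfolding power2_norm_eq_inner euclidean_inner[of \<xi> \<xi>] by (simp add: power2_eq_square inner_commute)
    then show ?thesis by (simp add: sum_distrib_right[symmetric] del: of_real_power)
  qed
  have "L2_on UNIV (\<lambda>\<xi>. of_real (norm \<xi> powr 2) * fourier f \<xi>)"
  proof (rule L2_cong_AE[rotated, OF L[unfolded eq]])
    show "AE \<xi> in lborel. of_real (norm \<xi> powr 2) * fourier_L1 f \<xi> = of_real (norm \<xi> powr 2) * fourier f \<xi>"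
      using fourier_eq_fourier_L1[OF fL] by eventually_elim simp
  qed measurable
  then show "f \<in> sobolev 2" using fL(2) by (simp add: sobolev_iff)
qed

section \<open>The normalising constant\<close>

text \<open>Replacing $h$ by $-h$ turns the difference into half a symmetric second difference, which is integrable
  against the whole kernel.\<close>

lemma sing_trunc_pointwise:
  fixes u :: "'a::euclidean_space \<Rightarrow> real"
  assumes a: "0 < a" "a < 1" and u: "schwartz u" and e: "e \<longlonglongrightarrow> 0" "\<And>k. 0 < e k"
  shows "(\<lambda>k. sing_trunc a (e k) u x) \<longlonglongrightarrow> (LINT h|lborel. kern a h * (2 * u x - u (x + h) - u (x - h)) / 2)"
proof -
  note sm = schwartz_smooth[OF u]
  note [measurable] = smooth_measurable[OF sm]
  obtain B where B: "0 \<le> B" "\<And>x. \<bar>iter_deriv [] u x\<bar> \<le> B" using schwartz_bounded[OF u, of "[]"] by blast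
  have "\<forall>p\<in>Basis \<times> Basis. \<exists>M. \<forall>x. \<bar>iter_deriv [fst p, snd p] u x\<bar> \<le> M"
    using schwartz_bounded[OF u] by metis
  then obtain Mf where Mf: "\<And>p x. p \<in> Basis \<times> Basis \<Longrightarrow> \<bar>iter_deriv [fst p, snd p] u x\<bar> \<le> Mf p"
    by metis
  define M where "M = Max (insert 0 (Mf ` (Basis \<times> Basis)))"
  have M0: "0 \<le> M" unfolding M_def by (rule Max_ge) auto
  have M: "\<bar>iter_deriv [c, b] u x\<bar> \<le> M" if "b \<in> Basis" "c \<in> Basis" for b c x
  proof -
    have "\<bar>iter_deriv [c, b] u x\<bar> \<le> Mf (c, b)" using Mf[of "(c, b)"] that by simp
    also have "\<dots> \<le> M" unfolding M_def using that by (intro Max_ge) auto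
    finally show ?thesis .
  qed
  define D where "D h = 2 * u x - u (x + h) - u (x - h)" for h
  have [measurable]: "D \<in> borel_measurable borel" unfolding D_def[abs_def] by measurable
  have D1: "\<bar>D h\<bar> \<le> (2 * (real DIM('a))\<^sup>2 * M) * (norm h)\<^sup>2" for h
    unfolding D_def by (rule smooth_second_difference[OF sm M])
  have D2: "\<bar>D h\<bar> \<le> 4 * B" for h
    using B(2)[of x] B(2)[of "x + h"] B(2)[of "x - h"] unfolding D_def by simp
  have "(\<integral>\<^sup>+h. ennreal (kern a h * \<bar>D h\<bar>) \<partial>lborel) < \<infinity>"
    by (rule nn_integral_kern_bound[OF a D1 D2]) (use M0 B in auto)
  then have int: "integrable lborel (\<lambda>h. kern a h * \<bar>D h\<bar>)"
    by (intro integrableI_nonneg) auto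
  have sym: "sing_trunc a \<epsilon> u x = (LINT h|lborel. kern_trunc a \<epsilon> h * D h / 2)" if "0 < \<epsilon>" for \<epsilon>
  proof -
    have i: "integrable lborel (\<lambda>h. kern_trunc a \<epsilon> h * (u x - u (x + h)))"
    proof (rule Bochner_Integration.integrable_bound[OF integrable_mult_left[OF integrable_kern_trunc[OF a(1) that], of "2 * B"]])
      show "AE h in lborel. norm (kern_trunc a \<epsilon> h * (u x - u (x + h))) \<le> norm (kern_trunc a \<epsilon> h * (2 * B))"
      proof (rule AE_I2)
        fix h
        have "\<bar>u x - u (x + h)\<bar> \<le> 2 * B" using B(2)[of x] B(2)[of "x + h"] by simp
        then show "norm (kern_trunc a \<epsilon> h * (u x - u (x + h))) \<le> norm (kern_trunc a \<epsilon> h * (2 * B))"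
          using B(1) by (simp add: abs_mult mult_left_mono)
      qed
    qed measurable
    have "(LINT h|lborel. kern_trunc a \<epsilon> ((-1) *\<^sub>R h) * (u x - u (x + (-1) *\<^sub>R h))) = inverse (\<bar>-1\<bar> ^ DIM('a)) *\<^sub>R (LINT h|lborel. kern_trunc a \<epsilon> h * (u x - u (x + h)))"
      by (rule integral_scaleR_arg[of "\<lambda>h. kern_trunc a \<epsilon> h * (u x - u (x + h))"]) auto
    then have r: "(LINT h|lborel. kern_trunc a \<epsilon> h * (u x - u (x - h))) = sing_trunc a \<epsilon> u x" by (simp add: sing_trunc_def[OF a])
    have i': "integrable lborel (\<lambda>h. kern_trunc a \<epsilon> h * (u x - u (x - h)))"
    proof (rule Bochner_Integration.integrable_bound[OF integrable_mult_left[OF integrable_kern_trunc[OF a(1) that], of "2 * B"]])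
      show "AE h in lborel. norm (kern_trunc a \<epsilon> h * (u x - u (x - h))) \<le> norm (kern_trunc a \<epsilon> h * (2 * B))"
      proof (rule AE_I2)
        fix h
        have "\<bar>u x - u (x - h)\<bar> \<le> 2 * B" using B(2)[of x] B(2)[of "x - h"] by simp
        then show "norm (kern_trunc a \<epsilon> h * (u x - u (x - h))) \<le> norm (kern_trunc a \<epsilon> h * (2 * B))"
          using B(1) by (simp add: abs_mult mult_left_mono)
      qed
    qed measurable
    have "(LINT h|lborel. kern_trunc a \<epsilon> h * D h / 2) = (LINT h|lborel. (kern_trunc a \<epsilon> h * (u x - u (x + h)) + kern_trunc a \<epsilon> h * (u x - u (x - h))) / 2)"
      by (simp add: D_def algebra_simps)
    also have "\<dots> = (sing_trunc a \<epsilon> u x + sing_trunc a \<epsilon> u x) / 2"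
      unfolding integral_divide_zero Bochner_Integration.integral_add[OF i i'] r by (simp add: sing_trunc_def[OF a])
    finally show ?thesis by simp
  qed
  have "(\<lambda>k. LINT h|lborel. kern_trunc a (e k) h * D h / 2) \<longlonglongrightarrow> (LINT h|lborel. kern a h * D h / 2)"
  proof (rule integral_dominated_convergence[OF _ _ int])
    show "AE h in lborel. (\<lambda>k. kern_trunc a (e k) h * D h / 2) \<longlonglongrightarrow> kern a h * D h / 2"
    proof (rule AE_I2)
      fix h :: 'a
      show "(\<lambda>k. kern_trunc a (e k) h * D h / 2) \<longlonglongrightarrow> kern a h * D h / 2"
      proof (cases "h = 0")
        case False
        then have "\<forall>\<^sub>F k in sequentially. e k < norm h" using e by (intro order_tendstoD(2)[OF e(1)]) auto
        then show ?thesis by (intro tendsto_eventually) (erule eventually_mono, simp add: kern_trunc_def indicator_def)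
      qed (simp add: D_def)
    qed
    show "AE h in lborel. norm (kern_trunc a (e k) h * D h / 2) \<le> kern a h * \<bar>D h\<bar>" for k
    proof (rule AE_I2)
      fix h :: 'a
      have "kern_trunc a (e k) h * \<bar>D h\<bar> \<le> kern a h * \<bar>D h\<bar>" by (intro mult_right_mono kern_trunc_le) auto
      moreover have "0 \<le> kern_trunc a (e k) h * \<bar>D h\<bar>" "0 \<le> kern a h * \<bar>D h\<bar>" by simp_all
      moreover have "norm (kern_trunc a (e k) h * D h / 2) = kern_trunc a (e k) h * \<bar>D h\<bar> / 2"
        by (simp add: abs_mult)
      ultimately show "norm (kern_trunc a (e k) h * D h / 2) \<le> kern a h * \<bar>D h\<bar>" by linarith
    qed
  qed measurable
  then show ?thesis unfolding sym[OF e(2)] D_def .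
qed

lemma set_integral_eq_sing_trunc:
  fixes u :: "'a::euclidean_space \<Rightarrow> real"
  assumes a: "0 < a" "a < 1" and [measurable]: "u \<in> borel_measurable borel"
  shows "(LINT y:{y. dist x y > e}|lborel. (u x - u y) / norm (x - y) powr (real DIM('a) + 2 * a)) = sing_trunc a e u x"
proof -
  have "(LINT y:{y. dist x y > e}|lborel. (u x - u y) / norm (x - y) powr (real DIM('a) + 2 * a))
     = (LINT y|lborel. kern_trunc a e (y - x) * (u x - u y))"
    unfolding set_lebesgue_integral_def divide_norm_powr
    by (intro Bochner_Integration.integral_cong) (auto simp: kern_trunc_def indicator_def dist_norm norm_minus_commute kern_diff_commute[of _ x])
  also have "\<dots> = (LINT h|lborel. kern_trunc a e (h + x - x) * (u x - u (h + x)))"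
    by (rule integral_translate[symmetric, of "\<lambda>y. kern_trunc a e (y - x) * (u x - u y)"]) measurable
  also have "\<dots> = sing_trunc a e u x" by (simp add: sing_trunc_def[OF a] add.commute)
  finally show ?thesis .
qed

text \<open>The reciprocal of the constant of the symbol satisfies the defining property of \<^const>\<open>frac_const\<close>: the
  principal value exists pointwise for Schwartz functions, and it agrees with the $L^2$ limit almost everywhere.
  So the choice operator returns a positive number.\<close>

theorem frac_const_pos:
  assumes a: "0 < a" "a < 1"
  shows "frac_const TYPE('a::euclidean_space) a > 0"
proof -
  let ?c = "symb_const TYPE('a) a"
  have c: "?c > 0" by (rule symb_const_pos[OF a])
  define P where "P c \<longleftrightarrow> c > 0 \<and>
     (\<forall>u :: 'a \<Rightarrow> real. schwartz u \<longrightarrow>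
        (AE x in lborel.
           ((\<lambda>\<epsilon>. c * (LINT y:{y. dist x y > \<epsilon>}|lborel.
                (u x - u y) / norm (x - y) powr (real DIM('a) + 2 * a)))
              \<longlongrightarrow> frac_laplacian a u x) (at_right 0)))" for c
  have "P (1 / ?c)"
    unfolding P_def
  proof (intro conjI allI impI)
    fix u :: "'a \<Rightarrow> real" assume u: "schwartz u"
    note [measurable] = smooth_measurable[OF schwartz_smooth[OF u]]
    have us: "u \<in> sobolev (2 * a)" by (rule schwartz_sobolev[OF u]) (use a in auto)
    define L where "L x = (LINT h|lborel. kern a h * (2 * u x - u (x + h) - u (x - h)) / 2)" for x
    have [measurable]: "L \<in> borel_measurable borel" unfolding L_def[abs_def] by measurable
    note [measurable] = L2_frac_laplacian[OF a us, THEN L2_measurable]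
    define e where "e k = inverse (real (Suc k))" for k
    have e: "e \<longlonglongrightarrow> 0" "\<And>k. 0 < e k" unfolding e_def by (rule LIMSEQ_inverse_real_of_nat) simp
    have "AE x in lborel. L x = ?c * frac_laplacian a u x"
    proof (rule norm2sq_limit_pointwise[OF _ _ _ _ sing_trunc_tendsto_frac_laplacian[OF a us e]])
      show "AE x in lborel. (\<lambda>k. sing_trunc a (e k) u x) \<longlonglongrightarrow> L x"
        unfolding L_def by (intro AE_I2 sing_trunc_pointwise[OF a u e])
    qed (use sing_trunc_measurable[OF a] in measurable)
    then show "AE x in lborel. ((\<lambda>\<epsilon>. 1 / ?c * (LINT y:{y. dist x y > \<epsilon>}|lborel. (u x - u y) / norm (x - y) powr (real DIM('a) + 2 * a)))
        \<longlongrightarrow> frac_laplacian a u x) (at_right 0)"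
    proof eventually_elim
      case (elim x)
      have "((\<lambda>\<epsilon>. sing_trunc a \<epsilon> u x) \<longlongrightarrow> L x) (at_right 0)"
        unfolding tendsto_at_iff_sequentially comp_def L_def
        by (intro allI impI sing_trunc_pointwise[OF a u]) auto
      then have "((\<lambda>\<epsilon>. 1 / ?c * sing_trunc a \<epsilon> u x) \<longlongrightarrow> 1 / ?c * L x) (at_right 0)"
        by (intro tendsto_intros)
      then show ?case using elim c by (simp add: set_integral_eq_sing_trunc[OF a])
    qed
  qed (use c in simp)
  then have "P (frac_const TYPE('a) a)" unfolding frac_const_def P_def[symmetric] by (rule someI)
  then show ?thesis by (simp add: P_def)
qed

section \<open>Test functions\<close>

lemma iter_deriv_eq_0_on_open:
  assumes S: "open S" and f: "\<And>x. x \<in> S \<Longrightarrow> f x = 0"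
  shows "x \<in> S \<Longrightarrow> iter_deriv vs f x = 0"
proof (induction vs arbitrary: x)
  case (Cons v vs)
  have "(iter_deriv vs f has_derivative (\<lambda>_. 0)) (at x)"
    by (rule has_derivative_transform_within_open[OF has_derivative_const S Cons.prems]) (simp add: Cons.IH)
  then show ?case by (simp add: iter_deriv.simps frechet_derivative_at[symmetric])
qed (simp add: f)

lemma Cc_smooth_schwartz:
  assumes f: "f \<in> Cc_smooth (U :: 'a::euclidean_space set)"
  shows "schwartz f"
  unfolding schwartz_def
proof (intro conjI allI)
  show sm: "smooth f" using f by (simp add: Cc_smooth_def)
  fix vs :: "'a list" and k :: nat
  define K where "K = closure {x. f x \<noteq> 0}"
  have K: "compact K" using f by (simp add: Cc_smooth_def Cc_def K_def)
  let ?g = "\<lambda>x. (1 + norm x) ^ k * iter_deriv vs f x"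
  have z: "iter_deriv vs f x = 0" if "x \<notin> K" for x
  proof (rule iter_deriv_eq_0_on_open[of "- K"])
    show "open (- K)" using K by (simp add: compact_imp_closed open_Compl)
    show "f y = 0" if "y \<in> - K" for y using that closure_subset[of "{x. f x \<noteq> 0}"] unfolding K_def by blast
  qed (use that in simp)
  have "continuous_on UNIV ?g"
    by (intro continuous_intros smooth_continuous smooth_iter_deriv sm)
  then have "compact (?g ` K)" by (rule compact_continuous_image[OF continuous_on_subset[OF _ subset_UNIV] K])
  then have "bounded (insert 0 (?g ` K))" by (simp add: compact_imp_bounded)
  moreover have "range ?g \<subseteq> insert 0 (?g ` K)"
  proof
    fix y assume "y \<in> range ?g"
    then obtain x where x: "y = ?g x" by blast
    show "y \<in> insert 0 (?g ` K)"
    proof (cases "x \<in> K")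
      case True then show ?thesis unfolding x by blast
    next
      case False then show ?thesis unfolding x by (simp add: z)
    qed
  qed
  ultimately show "bounded (range ?g)" by (rule bounded_subset)
qed

text \<open>The functions $t^{-k} e^{-1/t}$, extended by zero. The family is mapped into its own span by
  differentiation, which gives smoothness of the bump by induction.\<close>

definition flat_exp :: "nat \<Rightarrow> real \<Rightarrow> real" where
  "flat_exp k t = (if t > 0 then (1 / t) ^ k * exp (- (1 / t)) else 0)"

lemma flat_exp_bound: "\<bar>flat_exp k t\<bar> \<le> fact (k + 2) * t\<^sup>2"
proof (cases "t > 0")
  case True
  define y where "y = 1 / t"
  have y: "y > 0" using True by (simp add: y_def)
  have "y ^ (k + 2) / fact (k + 2) \<le> exp y"
  proof -
    have "(\<Sum>n\<in>{k+2}. y ^ n /\<^sub>R fact n) \<le> (\<Sum>n. y ^ n /\<^sub>R fact n)"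
      by (rule sum_le_suminf[OF summable_exp_generic]) (use y in simp_all)
    then show ?thesis unfolding exp_def[symmetric] by (simp only: sum.insert_remove finite.emptyI) (simp add: exp_def divide_inverse mult.commute)
  qed
  then have "y ^ (k + 2) \<le> exp y * fact (k + 2)" by (simp only: pos_divide_le_eq[OF fact_gt_zero])
  then have "y ^ (k + 2) * exp (- y) \<le> exp y * fact (k + 2) * exp (- y)" by (rule mult_right_mono) simp
  also have "\<dots> = fact (k + 2) * (exp y * exp (- y))" by (simp only: mult_ac)
  also have "\<dots> = fact (k + 2)" by (simp only: exp_minus_inverse mult_1_right)
  finally have "y ^ (k + 2) * exp (- y) \<le> fact (k + 2)" .
  then have "y ^ k * exp (- y) * y\<^sup>2 \<le> fact (k + 2)" by (simp only: power_add mult_ac)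
  then have "y ^ k * exp (- y) \<le> fact (k + 2) / y\<^sup>2" using y by (simp add: pos_le_divide_eq)
  also have "\<dots> = fact (k + 2) * t\<^sup>2" by (simp add: y_def power_divide)
  finally show ?thesis using True by (simp add: flat_exp_def y_def)
qed (simp add: flat_exp_def)

lemma flat_exp_deriv: "(flat_exp k has_real_derivative flat_exp (k + 2) t - real k * flat_exp (k + 1) t) (at t)"
proof -
  consider "t > 0" | "t < 0" | "t = 0" by linarith
  then show ?thesis
  proof cases
    case 1
    have "((\<lambda>t. (1 / t) ^ k * exp (- (1 / t))) has_real_derivative flat_exp (k + 2) t - real k * flat_exp (k + 1) t) (at t)"
    proof (cases k)
      case 0
      show ?thesis unfolding 0
        by (rule derivative_eq_intros refl | (use 1 in \<open>simp add: flat_exp_def power2_eq_square field_simps\<close>))+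
    next
      case (Suc j)
      show ?thesis unfolding Suc
        by (rule derivative_eq_intros refl | (use 1 in \<open>simp add: flat_exp_def power2_eq_square field_simps\<close>))+
    qed
    then show ?thesis
      by (rule has_field_derivative_transform_within_open[of _ _ _ "{0<..}"]) (use 1 in \<open>auto simp: flat_exp_def\<close>)
  next
    case 2
    have "((\<lambda>t. 0) has_real_derivative 0) (at t)" by simp
    then have "(flat_exp k has_real_derivative 0) (at t)"
      by (rule has_field_derivative_transform_within_open[of _ _ _ "{..<0}"]) (use 2 in \<open>auto simp: flat_exp_def\<close>)
    then show ?thesis using 2 by (simp add: flat_exp_def)
  next
    case 3
    have "((\<lambda>h. (flat_exp k (0 + h) - flat_exp k 0) / h) \<longlongrightarrow> 0) (at 0)"
    proof (rule Lim_null_comparison)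
      show "((\<lambda>h. fact (k + 2) * \<bar>h\<bar>) \<longlongrightarrow> 0) (at (0::real))" by (intro tendsto_eq_intros) auto
      show "\<forall>\<^sub>F h in at 0. norm ((flat_exp k (0 + h) - flat_exp k 0) / h) \<le> fact (k + 2) * \<bar>h\<bar>"
        unfolding eventually_at_filter
      proof (intro always_eventually allI impI)
        fix h :: real assume h: "h \<noteq> 0"
        have "\<bar>flat_exp k h\<bar> \<le> fact (k + 2) * \<bar>h\<bar> * \<bar>h\<bar>" using flat_exp_bound[of k h] by (simp add: power2_eq_square mult.assoc)
        then have "\<bar>flat_exp k h\<bar> / \<bar>h\<bar> \<le> fact (k + 2) * \<bar>h\<bar>" using h by (subst pos_divide_le_eq) simp_all
        then show "norm ((flat_exp k (0 + h) - flat_exp k 0) / h) \<le> fact (k + 2) * \<bar>h\<bar>" by (simp add: flat_exp_def[of k 0])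
      qed
    qed
    then show ?thesis using 3 by (simp add: DERIV_def flat_exp_def)
  qed
qed

text \<open>Every element is differentiable with directional derivatives in the algebra again, hence smooth. The
  real characters belong to it, so that bumps times characters are test functions.\<close>

inductive_set bump_alg :: "'a::euclidean_space \<Rightarrow> real \<Rightarrow> ('a \<Rightarrow> real) set" for p :: 'a and r :: real where
  const: "(\<lambda>x. c) \<in> bump_alg p r"
| lin: "(\<lambda>x. x \<bullet> v) \<in> bump_alg p r"
| cosine: "(\<lambda>x. cos (x \<bullet> v)) \<in> bump_alg p r"
| sine: "(\<lambda>x. sin (x \<bullet> v)) \<in> bump_alg p r"
| bump: "(\<lambda>x. flat_exp k (r\<^sup>2 - (x - p) \<bullet> (x - p))) \<in> bump_alg p r"
| add: "f \<in> bump_alg p r \<Longrightarrow> g \<in> bump_alg p r \<Longrightarrow> (\<lambda>x. f x + g x) \<in> bump_alg p r"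
| mult: "f \<in> bump_alg p r \<Longrightarrow> g \<in> bump_alg p r \<Longrightarrow> (\<lambda>x. f x * g x) \<in> bump_alg p r"

lemma bump_alg_derivative:
  assumes "f \<in> bump_alg p r"
  shows "\<exists>f'. (\<forall>x. (f has_derivative f' x) (at x)) \<and> (\<forall>v. (\<lambda>x. f' x v) \<in> bump_alg p r)"
  using assms
proof induction
  case (const c)
  show ?case by (intro exI[of _ "\<lambda>x v. 0"]) (auto intro: bump_alg.const)
next
  case (lin w)
  show ?case by (intro exI[of _ "\<lambda>x v. v \<bullet> w"]) (auto intro!: bump_alg.const derivative_eq_intros)
next
  case (cosine w)
  have "(\<lambda>x. (-1) * sin (x \<bullet> w) * (v \<bullet> w)) \<in> bump_alg p r" for v by (intro bump_alg.intros)
  then show ?case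
    by (intro exI[of _ "\<lambda>x v. (-1) * sin (x \<bullet> w) * (v \<bullet> w)"]) (auto intro!: derivative_eq_intros)
next
  case (sine w)
  have "(\<lambda>x. cos (x \<bullet> w) * (v \<bullet> w)) \<in> bump_alg p r" for v by (intro bump_alg.intros)
  then show ?case
    by (intro exI[of _ "\<lambda>x v. cos (x \<bullet> w) * (v \<bullet> w)"]) (auto intro!: derivative_eq_intros)
next
  case (bump k)
  let ?s = "\<lambda>x. r\<^sup>2 - (x - p) \<bullet> (x - p)"
  let ?f' = "\<lambda>x v. (flat_exp (k + 2) (?s x) + (- real k) * flat_exp (k + 1) (?s x)) * ((-2) * (x \<bullet> v) + 2 * (p \<bullet> v))"
  have "((\<lambda>x. flat_exp k (?s x)) has_derivative ?f' x) (at x)" for x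
  proof -
    have "(?s has_derivative (\<lambda>v. (-2) * (x \<bullet> v) + 2 * (p \<bullet> v))) (at x)"
      by (auto intro!: derivative_eq_intros simp: inner_diff_left inner_diff_right inner_commute algebra_simps)
    from has_derivative_compose[OF this flat_exp_deriv[of k "?s x", unfolded has_field_derivative_def]]
    show ?thesis by simp
  qed
  moreover have "(\<lambda>x. ?f' x v) \<in> bump_alg p r" for v
    by (intro bump_alg.mult bump_alg.add bump_alg.bump bump_alg.const bump_alg.lin)
  ultimately show ?case by (intro exI[of _ ?f']) auto
next
  case (add f g)
  then obtain f' g' where "\<And>x. (f has_derivative f' x) (at x)" "\<And>v. (\<lambda>x. f' x v) \<in> bump_alg p r"
    "\<And>x. (g has_derivative g' x) (at x)" "\<And>v. (\<lambda>x. g' x v) \<in> bump_alg p r" by auto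
  then show ?case
    by (intro exI[of _ "\<lambda>x v. f' x v + g' x v"]) (auto intro!: bump_alg.add has_derivative_add)
next
  case (mult f g)
  then obtain f' g' where "\<And>x. (f has_derivative f' x) (at x)" "\<And>v. (\<lambda>x. f' x v) \<in> bump_alg p r"
    "\<And>x. (g has_derivative g' x) (at x)" "\<And>v. (\<lambda>x. g' x v) \<in> bump_alg p r" by auto
  with mult.hyps show ?case
    by (intro exI[of _ "\<lambda>x v. f x * g' x v + f' x v * g x"]) (auto intro!: bump_alg.add bump_alg.mult has_derivative_mult)
qed

lemma bump_alg_smooth:
  assumes f: "f \<in> bump_alg p r" shows "smooth f"
proof -
  have "iter_deriv vs f \<in> bump_alg p r" for vs
  proof (induction vs)
    case (Cons v vs)
    obtain f' where f': "\<And>x. (iter_deriv vs f has_derivative f' x) (at x)" "\<And>v. (\<lambda>x. f' x v) \<in> bump_alg p r"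
      using bump_alg_derivative[OF Cons.IH] by blast
    then have "iter_deriv (v # vs) f = (\<lambda>x. f' x v)"
      by (simp add: iter_deriv.simps frechet_derivative_at[OF f'(1), symmetric])
    then show ?case using f'(2) by simp
  qed (simp add: f)
  then show ?thesis unfolding smooth_def using bump_alg_derivative differentiable_def by blast
qed

definition bump_ball :: "'a::euclidean_space \<Rightarrow> real \<Rightarrow> 'a \<Rightarrow> real" where
  "bump_ball p r x = flat_exp 0 (r\<^sup>2 - (x - p) \<bullet> (x - p))"

lemma bump_ball_pos_iff: "0 < r \<Longrightarrow> 0 < bump_ball p r x \<longleftrightarrow> x \<in> ball p r"
proof -
  assume r: "0 < r"
  have "0 < bump_ball p r x \<longleftrightarrow> (norm (x - p))\<^sup>2 < r\<^sup>2"
    by (simp add: bump_ball_def flat_exp_def power2_norm_eq_inner)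
  also have "\<dots> \<longleftrightarrow> norm (x - p) < r" using r by (metis norm_ge_zero power2_less_imp_less power_strict_mono less_imp_le zero_less_numeral)
  finally show ?thesis by (simp add: dist_norm norm_minus_commute)
qed

lemma bump_ball_bounds: "0 \<le> bump_ball p r x" "bump_ball p r x \<le> 1"
  by (auto simp: bump_ball_def flat_exp_def)

lemma bump_ball_eq_0: "0 < r \<Longrightarrow> x \<notin> ball p r \<Longrightarrow> bump_ball p r x = 0"
  using bump_ball_pos_iff[of r p x] bump_ball_bounds(1)[of p r x] by linarith

lemma bump_ball_mult_Cc_smooth:
  assumes r: "0 < r" "cball p r \<subseteq> U" and g: "g \<in> bump_alg p r"
  shows "(\<lambda>x. bump_ball p r x * g x) \<in> Cc_smooth U"
proof -
  have alg: "(\<lambda>x. bump_ball p r x * g x) \<in> bump_alg p r"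
    unfolding bump_ball_def by (intro bump_alg.mult bump_alg.bump g)
  have sub: "closure {x. bump_ball p r x * g x \<noteq> 0} \<subseteq> cball p r"
  proof (rule closure_minimal)
    show "{x. bump_ball p r x * g x \<noteq> 0} \<subseteq> cball p r"
      using bump_ball_eq_0[OF r(1), of _ p] ball_subset_cball[of p r] by fastforce
  qed simp
  then have "compact (closure {x. bump_ball p r x * g x \<noteq> 0})"
    by (meson bounded_cball bounded_subset closed_closure compact_eq_bounded_closed)
  then show ?thesis
    using sub r(2) bump_alg_smooth[OF alg] smooth_continuous[OF bump_alg_smooth[OF alg]]
    unfolding Cc_smooth_def Cc_def by auto
qed

text \<open>The fundamental lemma of the calculus of variations: multiplied by a bump, the function has vanishing
  Fourier transform, because bumps times characters are test functions.\<close>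

lemma fundamental_lemma_ball:
  fixes h :: "'a::euclidean_space \<Rightarrow> real"
  assumes h: "L2_on UNIV h" and z: "\<And>\<phi>. \<phi> \<in> Cc_smooth U \<Longrightarrow> (LINT x|lborel. h x * \<phi> x) = 0"
    and r: "0 < r" "cball p r \<subseteq> U"
  shows "AE x in lborel. x \<in> ball p r \<longrightarrow> h x = 0"
proof -
  note [measurable] = h[THEN L2_measurable]
  have [measurable]: "bump_ball p r \<in> borel_measurable borel"
    unfolding bump_ball_def[abs_def] by (rule smooth_measurable[OF bump_alg_smooth[OF bump_alg.bump]])
  define g where "g x = h x * bump_ball p r x" for x
  have [measurable]: "g \<in> borel_measurable borel" unfolding g_def[abs_def] by measurable
  have gL2: "L2_on UNIV g"
  proof (rule L2_dominated[OF _ h])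
    show "AE x in lborel. norm (g x) \<le> norm (h x)"
      using bump_ball_bounds[of p r] by (intro AE_I2) (simp add: g_def abs_mult mult_left_le)
  qed measurable
  have gL1: "integrable lborel g"
    by (rule L2_bounded_support_integrable[OF gL2, of "ball p r"]) (auto simp: g_def bump_ball_eq_0[OF r(1)])
  have "fourier_L1 g \<xi> = 0" for \<xi>
  proof -
    have c: "(LINT x|lborel. g x * cos (x \<bullet> \<xi>)) = 0" and s: "(LINT x|lborel. g x * sin (x \<bullet> \<xi>)) = 0"
      using z[OF bump_ball_mult_Cc_smooth[OF r bump_alg.cosine]] z[OF bump_ball_mult_Cc_smooth[OF r bump_alg.sine]]
      by (simp_all add: g_def mult.assoc)
    have ic: "integrable lborel (\<lambda>x. g x * cos (x \<bullet> \<xi>))" and isin: "integrable lborel (\<lambda>x. g x * sin (x \<bullet> \<xi>))"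
      by (rule Bochner_Integration.integrable_bound[OF gL1]; simp add: abs_mult mult_left_le)+
    have e: "g x *\<^sub>R cis (- (x \<bullet> \<xi>)) = of_real (g x * cos (x \<bullet> \<xi>)) - \<i> * of_real (g x * sin (x \<bullet> \<xi>))" for x
      by (simp add: complex_eq_iff)
    have "fourier_L1 g \<xi> = (LINT x|lborel. of_real (g x * cos (x \<bullet> \<xi>)) - \<i> * of_real (g x * sin (x \<bullet> \<xi>)))"
      unfolding fourier_L1_def e ..
    also have "\<dots> = (LINT x|lborel. complex_of_real (g x * cos (x \<bullet> \<xi>))) - (LINT x|lborel. \<i> * complex_of_real (g x * sin (x \<bullet> \<xi>)))"
      using ic isin by (intro Bochner_Integration.integral_diff integrable_mult_right) (simp_all only: complex_of_real_integrable_eq)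
    also have "\<dots> = 0" unfolding integral_mult_right_zero integral_complex_of_real c s by simp
    finally show ?thesis .
  qed
  then have "AE x in lborel. g x = 0" by (rule fourier_L1_zero[OF gL1 gL2])
  then show ?thesis
  proof eventually_elim
    case (elim x)
    then show ?case using bump_ball_pos_iff[OF r(1), of p x] by (auto simp: g_def)
  qed
qed

text \<open>Countably many balls cover the open set.\<close>

lemma fundamental_lemma:
  fixes h :: "'a::euclidean_space \<Rightarrow> real"
  assumes h: "L2_on UNIV h" and U: "open U" and z: "\<And>\<phi>. \<phi> \<in> Cc_smooth U \<Longrightarrow> (LINT x|lborel. h x * \<phi> x) = 0"
  shows "AE x in lborel. x \<in> U \<longrightarrow> h x = 0"
proof -
  define F where "F = {ball p r | p r. 0 < r \<and> cball p r \<subseteq> U}"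
  have "\<Union>F = U"
  proof
    show "\<Union>F \<subseteq> U" unfolding F_def using ball_subset_cball by fastforce
    show "U \<subseteq> \<Union>F"
    proof
      fix x assume "x \<in> U"
      then obtain e where "e > 0" "cball x e \<subseteq> U" using U open_contains_cball by blast
      then show "x \<in> \<Union>F" unfolding F_def by (intro UnionI[of "ball x e"]) auto
    qed
  qed
  moreover obtain F' where F': "F' \<subseteq> F" "countable F'" "\<Union>F' = \<Union>F"
    using Lindelof[of F] by (auto simp: F_def)
  have "AE x in lborel. \<forall>B\<in>F'. x \<in> B \<longrightarrow> h x = 0"
  proof (rule AE_ball_countable'[OF _ F'(2)])
    fix B assume "B \<in> F'"
    then obtain p r where "B = ball p r" "0 < r" "cball p r \<subseteq> U" using F'(1) by (auto simp: F_def)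
    then show "AE x in lborel. x \<in> B \<longrightarrow> h x = 0" using fundamental_lemma_ball[OF h z] by simp
  qed
  then show ?thesis
  proof eventually_elim
    case (elim x)
    then show ?case using F'(3) \<open>\<Union>F = U\<close> by blast
  qed
qed

section \<open>Unique continuation for Riesz potentials\<close>

text \<open>Differentiation under the integral sign: by the mean value theorem $M\,|g|$ is a majorant of the difference
  quotients, all of which have integral zero.\<close>

lemma integral_derivative_zero:
  fixes g :: "'a::euclidean_space \<Rightarrow> real" and k k' :: "real \<Rightarrow> 'a \<Rightarrow> real"
  assumes g: "integrable lborel g" and gK: "\<And>y. y \<notin> K \<Longrightarrow> g y = 0"
    and der: "\<And>\<tau> y. \<bar>\<tau>\<bar> < \<delta> \<Longrightarrow> y \<in> K \<Longrightarrow> ((\<lambda>\<tau>. k \<tau> y) has_real_derivative k' \<tau> y) (at \<tau>)"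
    and bd: "\<And>\<tau> y. \<bar>\<tau>\<bar> < \<delta> \<Longrightarrow> y \<in> K \<Longrightarrow> \<bar>k' \<tau> y\<bar> \<le> M"
    and int: "\<And>\<tau>. \<bar>\<tau>\<bar> < \<delta> \<Longrightarrow> integrable lborel (\<lambda>y. g y * k \<tau> y)"
    and meas: "\<And>\<tau>. (\<lambda>y. g y * k' \<tau> y) \<in> borel_measurable borel"
    and z: "\<And>\<tau>. \<bar>\<tau>\<bar> < \<delta> \<Longrightarrow> (LINT y|lborel. g y * k \<tau> y) = 0"
    and t: "\<bar>\<tau>\<bar> < \<delta>"
  shows "(LINT y|lborel. g y * k' \<tau> y) = 0"
proof -
  define e where "e n = (\<delta> - \<bar>\<tau>\<bar>) * inverse (real (Suc (Suc n)))" for n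
  have e: "0 < e n" "\<bar>\<tau> + e n\<bar> < \<delta>" for n
  proof -
    show e0: "0 < e n" using t by (simp add: e_def)
    have "e n < (\<delta> - \<bar>\<tau>\<bar>) * 1" unfolding e_def using t by (intro mult_strict_left_mono) (auto simp: inverse_less_1_iff)
    then show "\<bar>\<tau> + e n\<bar> < \<delta>" using e0 by simp
  qed
  have "(\<lambda>n. inverse (real (Suc (Suc n)))) \<longlonglongrightarrow> 0" using LIMSEQ_Suc[OF LIMSEQ_inverse_real_of_nat] .
  then have e0: "e \<longlonglongrightarrow> 0" unfolding e_def using tendsto_mult_right_zero by blast
  have fe: "filterlim e (at 0) sequentially"
    using e0 e(1) by (simp add: filterlim_at less_imp_neq[symmetric])
  define q where "q n y = g y * ((k (\<tau> + e n) y - k \<tau> y) / e n)" for n y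
  have q: "q n y = (g y * k (\<tau> + e n) y - g y * k \<tau> y) * inverse (e n)" for n y
    by (simp add: q_def right_diff_distrib divide_inverse)
  have qi: "integrable lborel (q n)" for n
    unfolding q[abs_def] by (intro integrable_mult_left Bochner_Integration.integrable_diff int e t)
  have q0: "(LINT y|lborel. q n y) = 0" for n
    unfolding q integral_mult_left_zero using Bochner_Integration.integral_diff[OF int[OF e(2)] int[OF t], of n] z[OF e(2), of n] z[OF t] by simp
  have "(\<lambda>n. LINT y|lborel. q n y) \<longlonglongrightarrow> (LINT y|lborel. g y * k' \<tau> y)"
  proof (rule integral_dominated_convergence[where w="\<lambda>y. M * \<bar>g y\<bar>"])
    show "integrable lborel (\<lambda>y. M * \<bar>g y\<bar>)" using g by (intro integrable_mult_right integrable_abs)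
    show "AE y in lborel. (\<lambda>n. q n y) \<longlonglongrightarrow> g y * k' \<tau> y"
    proof (rule AE_I2)
      fix y
      show "(\<lambda>n. q n y) \<longlonglongrightarrow> g y * k' \<tau> y"
      proof (cases "y \<in> K")
        case True
        then have "((\<lambda>h. (k (\<tau> + h) y - k \<tau> y) / h) \<longlongrightarrow> k' \<tau> y) (at 0)"
          using der[OF t] by (simp add: DERIV_def)
        from filterlim_compose[OF this fe] show ?thesis unfolding q_def by (intro tendsto_mult tendsto_const)
      qed (simp add: q_def gK)
    qed
    show "AE y in lborel. norm (q n y) \<le> M * \<bar>g y\<bar>" for n
    proof (rule AE_I2)
      fix y
      show "norm (q n y) \<le> M * \<bar>g y\<bar>"
      proof (cases "y \<in> K")
        case True
        have "\<exists>z>\<tau>. z < \<tau> + e n \<and> k (\<tau> + e n) y - k \<tau> y = (\<tau> + e n - \<tau>) * k' z y"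
        proof (rule MVT2)
          show "\<tau> < \<tau> + e n" using e(1)[of n] by simp
          fix x assume "\<tau> \<le> x" "x \<le> \<tau> + e n"
          then have "\<bar>x\<bar> < \<delta>" using e(2)[of n] t by linarith
          then show "((\<lambda>\<tau>. k \<tau> y) has_real_derivative k' x y) (at x)" using True by (rule der)
        qed
        then obtain w where w: "\<tau> < w" "w < \<tau> + e n" "k (\<tau> + e n) y - k \<tau> y = e n * k' w y" by auto
        then have "\<bar>w\<bar> < \<delta>" using e(2)[of n] t by linarith
        then have "\<bar>k' w y\<bar> \<le> M" using True by (rule bd)
        moreover have "q n y = g y * k' w y" unfolding q_def w(3) using e(1)[of n] by simp
        moreover have "norm (g y * k' w y) = \<bar>k' w y\<bar> * \<bar>g y\<bar>" by (simp add: abs_mult)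
        ultimately show ?thesis by (simp only: mult_right_mono abs_ge_zero)
      qed (simp add: q_def gK)
    qed
  qed (use meas borel_measurable_integrable[OF qi] in auto)
  then show ?thesis unfolding q0 by (simp add: LIMSEQ_const_iff)
qed

text \<open>Differentiation along lines suffices to apply the Laplacian, coordinate by coordinate.\<close>

lemma norm_powr_line_derivative:
  fixes w v :: "'a::euclidean_space"
  assumes "w + \<tau> *\<^sub>R v \<noteq> 0"
  shows "((\<lambda>\<tau>. norm (w + \<tau> *\<^sub>R v) powr r) has_real_derivative r * ((w + \<tau> *\<^sub>R v) \<bullet> v) * norm (w + \<tau> *\<^sub>R v) powr (r - 2)) (at \<tau>)"
proof -
  have np: "norm z powr r = (z \<bullet> z) powr (r / 2)" for z :: 'a and r
  proof (cases "z = 0")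
    case False
    then have "z \<bullet> z = norm z powr 2" by (simp add: power2_norm_eq_inner)
    then show ?thesis by (simp only: powr_powr) simp
  qed simp
  have d: "((\<lambda>\<tau>. (w + \<tau> *\<^sub>R v) \<bullet> (w + \<tau> *\<^sub>R v)) has_real_derivative 2 * ((w + \<tau> *\<^sub>R v) \<bullet> v)) (at \<tau>)"
    unfolding has_field_derivative_def
    by (auto intro!: derivative_eq_intros simp: inner_commute algebra_simps)
  have "0 < (w + \<tau> *\<^sub>R v) \<bullet> (w + \<tau> *\<^sub>R v)" using assms by simp
  from DERIV_chain2[OF has_real_derivative_powr[OF this] d, of "r / 2"]
  have "((\<lambda>\<tau>. ((w + \<tau> *\<^sub>R v) \<bullet> (w + \<tau> *\<^sub>R v)) powr (r / 2)) has_real_derivative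
     r / 2 * ((w + \<tau> *\<^sub>R v) \<bullet> (w + \<tau> *\<^sub>R v)) powr (r / 2 - 1) * (2 * ((w + \<tau> *\<^sub>R v) \<bullet> v))) (at \<tau>)" .
  then show ?thesis unfolding np[of _ r] np[of _ "r - 2"] by (simp add: diff_divide_distrib mult_ac)
qed

lemma powr_add_eq: "a + b = c \<Longrightarrow> x powr a * x powr b = x powr c" for x :: real
  by (simp add: powr_add[symmetric])

lemma powr_neg_le: "0 < d \<Longrightarrow> d \<le> x \<Longrightarrow> 0 \<le> s \<Longrightarrow> x powr - s \<le> d powr - s" for d x s :: real
  by (rule powr_mono2') auto

lemma separation:
  fixes x :: "'a::real_normed_vector"
  assumes W: "open W" and WK: "W \<inter> K = {}" and x: "x \<in> W"
  obtains d where "0 < d" "ball x d \<subseteq> W" "\<And>z y. z \<in> ball x d \<Longrightarrow> y \<in> K \<Longrightarrow> d \<le> norm (z - y)"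
proof -
  obtain e where e: "0 < e" "ball x e \<subseteq> W" using W x open_contains_ball by blast
  show ?thesis
  proof (rule that[of "e / 2"])
    show "0 < e / 2" using e by simp
    show "ball x (e / 2) \<subseteq> W" using e subset_ball[of "e/2" e x] by auto
    fix z y assume z: "z \<in> ball x (e / 2)" and y: "y \<in> K"
    have "y \<notin> ball x e" using y e WK by blast
    then show "e / 2 \<le> norm (z - y)" using z dist_triangle[of x y z] by (simp add: dist_norm)
  qed
qed

context
  fixes g :: "'a::euclidean_space \<Rightarrow> real" and K W :: "'a set"
  assumes g: "integrable lborel g" and gK: "\<And>y. y \<notin> K \<Longrightarrow> g y = 0"
    and K: "compact K" and W: "open W" and WK: "W \<inter> K = {}"
begin

lemma g_meas [measurable]: "g \<in> borel_measurable borel"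
  using borel_measurable_integrable[OF g] by simp

lemma integrable_bounded_factor:
  assumes [measurable]: "k \<in> borel_measurable borel" and b: "\<And>y. y \<in> K \<Longrightarrow> \<bar>k y\<bar> \<le> B"
  shows "integrable lborel (\<lambda>y. g y * k y)"
proof (rule Bochner_Integration.integrable_bound[OF integrable_mult_left[OF g, of B]])
  show "AE y in lborel. norm (g y * k y) \<le> norm (g y * B)"
  proof (rule AE_I2)
    fix y
    show "norm (g y * k y) \<le> norm (g y * B)"
    proof (cases "y \<in> K")
      case True
      have "\<bar>k y\<bar> \<le> \<bar>B\<bar>" using b[OF True] by linarith
      then show ?thesis unfolding real_norm_def abs_mult by (rule mult_left_mono) simp
    next
      case False
      then show ?thesis by (simp add: gK)
    qed
  qed
qed measurable

lemma potential_first_derivative_zero: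
  assumes q: "0 < q" and z: "\<And>x. x \<in> W \<Longrightarrow> (LINT y|lborel. g y * norm (x - y) powr - q) = 0" and x: "x \<in> W" and v: "norm v = 1"
  shows "(LINT y|lborel. g y * (((x - y) \<bullet> v) * norm (x - y) powr - (q + 2))) = 0"
proof -
  obtain d where d: "0 < d" "ball x d \<subseteq> W" "\<And>z y. z \<in> ball x d \<Longrightarrow> y \<in> K \<Longrightarrow> d \<le> norm (z - y)"
    using separation[OF W WK x] by blast
  have in_ball: "x + \<tau> *\<^sub>R v \<in> ball x d" if "\<bar>\<tau>\<bar> < d" for \<tau> using that v by (simp add: dist_norm)
  have sep: "d \<le> norm (x - y + \<tau> *\<^sub>R v)" if "\<bar>\<tau>\<bar> < d" "y \<in> K" for \<tau> y
    using d(3)[OF in_ball[OF that(1)] that(2)] by (simp add: algebra_simps)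
  have "(LINT y|lborel. g y * (- q * ((x - y + 0 *\<^sub>R v) \<bullet> v) * norm (x - y + 0 *\<^sub>R v) powr (- q - 2))) = 0"
  proof (rule integral_derivative_zero[OF g gK, where k="\<lambda>\<tau> y. norm (x - y + \<tau> *\<^sub>R v) powr - q"
      and k'="\<lambda>\<tau> y. - q * ((x - y + \<tau> *\<^sub>R v) \<bullet> v) * norm (x - y + \<tau> *\<^sub>R v) powr (- q - 2)" and \<delta>=d and M="q * d powr - (q + 1)"])
    fix \<tau> y assume t: "\<bar>\<tau>\<bar> < d" and y: "y \<in> K"
    let ?w = "x - y + \<tau> *\<^sub>R v"
    have w0: "0 < norm ?w" using sep[OF t y] d(1) by linarith
    show "((\<lambda>\<tau>. norm (x - y + \<tau> *\<^sub>R v) powr - q) has_real_derivative - q * (?w \<bullet> v) * norm ?w powr (- q - 2)) (at \<tau>)"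
      by (rule norm_powr_line_derivative) (use w0 in auto)
    have "\<bar>?w \<bullet> v\<bar> \<le> norm ?w" using Cauchy_Schwarz_ineq2[of ?w v] v by simp
    then have "\<bar>?w \<bullet> v\<bar> * norm ?w powr (- q - 2) \<le> norm ?w powr 1 * norm ?w powr (- q - 2)" using w0 by (intro mult_right_mono) auto
    also have "\<dots> = norm ?w powr - (q + 1)" by (rule powr_add_eq) simp
    also have "\<dots> \<le> d powr - (q + 1)" using d(1) sep[OF t y] q by (intro powr_neg_le) auto
    finally have "q * (\<bar>?w \<bullet> v\<bar> * norm ?w powr (- q - 2)) \<le> q * d powr - (q + 1)" using q by (intro mult_left_mono) auto
    then show "\<bar>- q * (?w \<bullet> v) * norm ?w powr (- q - 2)\<bar> \<le> q * d powr - (q + 1)"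
      using q by (simp add: abs_mult)
  next
    fix \<tau> assume t: "\<bar>\<tau>\<bar> < d"
    show "integrable lborel (\<lambda>y. g y * norm (x - y + \<tau> *\<^sub>R v) powr - q)"
    proof (rule integrable_bounded_factor)
      fix y assume y: "y \<in> K"
      show "\<bar>norm (x - y + \<tau> *\<^sub>R v) powr - q\<bar> \<le> d powr - q" using d(1) sep[OF t y] q powr_neg_le[of d _ q] by simp
    qed measurable
    have "x + \<tau> *\<^sub>R v \<in> W" using in_ball[OF t] d(2) by blast
    from z[OF this] show "(LINT y|lborel. g y * norm (x - y + \<tau> *\<^sub>R v) powr - q) = 0" by (simp add: algebra_simps)
  qed (use d(1) in auto)
  moreover have "g y * (- q * ((x - y + 0 *\<^sub>R v) \<bullet> v) * norm (x - y + 0 *\<^sub>R v) powr (- q - 2)) = - q * (g y * (((x - y) \<bullet> v) * norm (x - y) powr - (q + 2)))" for y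
    by (simp add: algebra_simps)
  ultimately have "- q * (LINT y|lborel. g y * (((x - y) \<bullet> v) * norm (x - y) powr - (q + 2))) = 0"
    by (simp only: integral_mult_right_zero)
  then show ?thesis using q by simp
qed

lemma potential_second_derivative_zero:
  assumes q: "0 < q" and z: "\<And>x. x \<in> W \<Longrightarrow> (LINT y|lborel. g y * norm (x - y) powr - q) = 0" and x: "x \<in> W" and v: "norm v = 1"
  shows "(LINT y|lborel. g y * (norm (x - y) powr - (q + 2) - (q + 2) * (((x - y) \<bullet> v)\<^sup>2 * norm (x - y) powr - (q + 4)))) = 0"
proof -
  obtain d where d: "0 < d" "ball x d \<subseteq> W" "\<And>z y. z \<in> ball x d \<Longrightarrow> y \<in> K \<Longrightarrow> d \<le> norm (z - y)"
    using separation[OF W WK x] by blast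
  have in_ball: "x + \<tau> *\<^sub>R v \<in> ball x d" if "\<bar>\<tau>\<bar> < d" for \<tau> using that v by (simp add: dist_norm)
  have sep: "d \<le> norm (x - y + \<tau> *\<^sub>R v)" if "\<bar>\<tau>\<bar> < d" "y \<in> K" for \<tau> y
    using d(3)[OF in_ball[OF that(1)] that(2)] by (simp add: algebra_simps)
  have vv: "v \<bullet> v = 1" using v by (simp add: norm_eq_1)
  let ?k = "\<lambda>\<tau> y. ((x - y + \<tau> *\<^sub>R v) \<bullet> v) * norm (x - y + \<tau> *\<^sub>R v) powr - (q + 2)"
  let ?k' = "\<lambda>\<tau> y. norm (x - y + \<tau> *\<^sub>R v) powr - (q + 2) + ((x - y + \<tau> *\<^sub>R v) \<bullet> v) * (- (q + 2) * ((x - y + \<tau> *\<^sub>R v) \<bullet> v) * norm (x - y + \<tau> *\<^sub>R v) powr (- (q + 2) - 2))"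
  have "(LINT y|lborel. g y * ?k' 0 y) = 0"
  proof (rule integral_derivative_zero[OF g gK, where k="?k" and k'="?k'" and \<delta>=d and M="(q + 3) * d powr - (q + 2)"])
    fix \<tau> y assume t: "\<bar>\<tau>\<bar> < d" and y: "y \<in> K"
    let ?w = "x - y + \<tau> *\<^sub>R v"
    have w0: "0 < norm ?w" using sep[OF t y] d(1) by linarith
    have "((\<lambda>\<tau>. (x - y + \<tau> *\<^sub>R v) \<bullet> v) has_real_derivative 1) (at \<tau>)"
      unfolding has_field_derivative_def by (auto intro!: derivative_eq_intros simp: vv)
    from DERIV_mult'[OF this norm_powr_line_derivative[of "x - y" \<tau> v "- (q + 2)"]]
    show "((\<lambda>\<tau>. ?k \<tau> y) has_real_derivative ?k' \<tau> y) (at \<tau>)"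
      using w0 by (simp add: add.commute)
    have le: "norm ?w powr - (q + 2) \<le> d powr - (q + 2)" using d(1) sep[OF t y] q by (intro powr_neg_le) auto
    have "\<bar>?w \<bullet> v\<bar> \<le> norm ?w" using Cauchy_Schwarz_ineq2[of ?w v] v by simp
    then have "\<bar>?w \<bullet> v\<bar>\<^sup>2 \<le> (norm ?w)\<^sup>2" by (intro power_mono) auto
    then have "(?w \<bullet> v)\<^sup>2 * norm ?w powr (- (q + 2) - 2) \<le> norm ?w powr 2 * norm ?w powr (- (q + 2) - 2)" using w0 by (intro mult_right_mono) auto
    also have "\<dots> = norm ?w powr - (q + 2)" by (rule powr_add_eq) simp
    also note le
    finally have "(q + 2) * ((?w \<bullet> v)\<^sup>2 * norm ?w powr (- (q + 2) - 2)) \<le> (q + 2) * d powr - (q + 2)" using q by (intro mult_left_mono) auto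
    moreover have "(?w \<bullet> v) * (- (q + 2) * (?w \<bullet> v) * norm ?w powr (- (q + 2) - 2)) = - ((q + 2) * ((?w \<bullet> v)\<^sup>2 * norm ?w powr (- (q + 2) - 2)))"
      unfolding power2_eq_square by (simp only: minus_mult_left[symmetric] minus_mult_right[symmetric] mult_ac)
    moreover have "0 \<le> (q + 2) * ((?w \<bullet> v)\<^sup>2 * norm ?w powr (- (q + 2) - 2))" using q by simp
    moreover have "0 \<le> norm ?w powr - (q + 2)" by simp
    ultimately have "\<bar>?k' \<tau> y\<bar> \<le> d powr - (q + 2) + (q + 2) * d powr - (q + 2)" using le by linarith
    then show "\<bar>?k' \<tau> y\<bar> \<le> (q + 3) * d powr - (q + 2)" by (simp add: distrib_right)
  next
    fix \<tau> assume t: "\<bar>\<tau>\<bar> < d"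
    show "integrable lborel (\<lambda>y. g y * ?k \<tau> y)"
    proof (rule integrable_bounded_factor[of _ "d powr - (q + 1)"])
      fix y assume y: "y \<in> K"
      let ?w = "x - y + \<tau> *\<^sub>R v"
      have w0: "0 < norm ?w" using sep[OF t y] d(1) by linarith
      have "\<bar>?w \<bullet> v\<bar> \<le> norm ?w" using Cauchy_Schwarz_ineq2[of ?w v] v by simp
      then have "\<bar>?w \<bullet> v\<bar> * norm ?w powr - (q + 2) \<le> norm ?w powr 1 * norm ?w powr - (q + 2)" using w0 by (intro mult_right_mono) auto
      also have "\<dots> = norm ?w powr - (q + 1)" by (rule powr_add_eq) simp
      also have "\<dots> \<le> d powr - (q + 1)" using d(1) sep[OF t y] q by (intro powr_neg_le) auto
      finally show "\<bar>?k \<tau> y\<bar> \<le> d powr - (q + 1)" by (simp add: abs_mult)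
    qed measurable
    have "x + \<tau> *\<^sub>R v \<in> W" using in_ball[OF t] d(2) by blast
    from potential_first_derivative_zero[OF q z this v]
    show "(LINT y|lborel. g y * ?k \<tau> y) = 0" by (simp add: algebra_simps)
  qed (use d(1) in auto)
  moreover have "?k' 0 y = norm (x - y) powr - (q + 2) - (q + 2) * (((x - y) \<bullet> v)\<^sup>2 * norm (x - y) powr - (q + 4))" for y
  proof -
    have "- (q + 2) - 2 = - (q + 4)" by simp
    then show ?thesis unfolding power2_eq_square by (simp only: scaleR_zero_left add_0_right) (simp only: minus_mult_left[symmetric] minus_mult_right[symmetric] mult_ac diff_conv_add_uminus)
  qed
  ultimately show ?thesis by (simp only:)
qed

text \<open>The sum of the second derivatives over a basis is the Laplacian, which multiplies by
  \<open>DIM('a) - (q + 2)\<close>, up to the factor \<open>- q\<close> that has been divided out, and raises the exponent by two. The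
  condition on \<open>q\<close> makes this factor nonzero, and it is inherited by the larger exponents.\<close>

lemma potential_next_power_zero:
  assumes q: "0 < q" "real DIM('a) < q + 2" and z: "\<And>x. x \<in> W \<Longrightarrow> (LINT y|lborel. g y * norm (x - y) powr - q) = 0" and x: "x \<in> W"
  shows "(LINT y|lborel. g y * norm (x - y) powr - (q + 2)) = 0"
proof -
  let ?F = "\<lambda>b y. g y * (norm (x - y) powr - (q + 2) - (q + 2) * (((x - y) \<bullet> b)\<^sup>2 * norm (x - y) powr - (q + 4)))"
  obtain d where d: "0 < d" "ball x d \<subseteq> W" "\<And>z y. z \<in> ball x d \<Longrightarrow> y \<in> K \<Longrightarrow> d \<le> norm (z - y)"
    using separation[OF W WK x] by blast
  have sep: "d \<le> norm (x - y)" if "y \<in> K" for y by (rule d(3)[OF _ that]) (simp add: d(1))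
  have i1: "integrable lborel (\<lambda>y. g y * norm (x - y) powr - (q + 2))"
  proof (rule integrable_bounded_factor[of _ "d powr - (q + 2)"])
    fix y assume y: "y \<in> K"
    have "norm (x - y) powr - (q + 2) \<le> d powr - (q + 2)" using q by (intro powr_neg_le d(1) sep[OF y]) simp
    then show "\<bar>norm (x - y) powr - (q + 2)\<bar> \<le> d powr - (q + 2)" by (simp only: abs_of_nonneg[OF powr_ge_zero])
  qed measurable
  have i2: "integrable lborel (\<lambda>y. g y * (((x - y) \<bullet> b)\<^sup>2 * norm (x - y) powr - (q + 4)))" if b: "b \<in> Basis" for b
  proof (rule integrable_bounded_factor[of _ "d powr - (q + 2)"])
    fix y assume y: "y \<in> K"
    have w0: "0 < norm (x - y)" using sep[OF y] d(1) by linarith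
    have "\<bar>(x - y) \<bullet> b\<bar>\<^sup>2 \<le> (norm (x - y))\<^sup>2" using Basis_le_norm[OF b] by (intro power_mono) auto
    then have "((x - y) \<bullet> b)\<^sup>2 * norm (x - y) powr - (q + 4) \<le> norm (x - y) powr 2 * norm (x - y) powr - (q + 4)" using w0 by (intro mult_right_mono) auto
    also have "\<dots> = norm (x - y) powr - (q + 2)" by (rule powr_add_eq) simp
    also have "\<dots> \<le> d powr - (q + 2)" using d(1) sep[OF y] q by (intro powr_neg_le) auto
    finally show "\<bar>((x - y) \<bullet> b)\<^sup>2 * norm (x - y) powr - (q + 4)\<bar> \<le> d powr - (q + 2)" by simp
  qed measurable
  have F: "integrable lborel (?F b)" if "b \<in> Basis" for b
  proof -
    have "integrable lborel (\<lambda>y. g y * norm (x - y) powr - (q + 2) - (q + 2) * (g y * (((x - y) \<bullet> b)\<^sup>2 * norm (x - y) powr - (q + 4))))"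
      by (intro Bochner_Integration.integrable_diff integrable_mult_right i1 i2 that)
    then show ?thesis by (simp only: right_diff_distrib mult.left_commute)
  qed
  have "0 = (\<Sum>b\<in>Basis. (LINT y|lborel. ?F b y))"
    using potential_second_derivative_zero[OF q(1) z x] by simp
  also have "\<dots> = (LINT y|lborel. (\<Sum>b\<in>Basis. ?F b y))" using F by (intro Bochner_Integration.integral_sum[symmetric])
  also have "\<dots> = (LINT y|lborel. (real DIM('a) - (q + 2)) * (g y * norm (x - y) powr - (q + 2)))"
  proof (rule Bochner_Integration.integral_cong[OF refl])
    fix y
    have "(\<Sum>b\<in>Basis. ((x - y) \<bullet> b)\<^sup>2) = (norm (x - y))\<^sup>2"
      unfolding power2_norm_eq_inner euclidean_inner[of "x - y" "x - y"] by (simp add: power2_eq_square)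
    moreover have "(norm (x - y))\<^sup>2 * norm (x - y) powr - (q + 4) = norm (x - y) powr - (q + 2)"
    proof (cases "x = y")
      case False
      then have "(norm (x - y))\<^sup>2 = norm (x - y) powr 2" by simp
      then show ?thesis by (simp only:) (rule powr_add_eq, simp)
    qed simp
    ultimately have *: "(\<Sum>b\<in>Basis. ((x - y) \<bullet> b)\<^sup>2 * norm (x - y) powr - (q + 4)) = norm (x - y) powr - (q + 2)"
      by (simp only: sum_distrib_right[symmetric])
    have "(\<Sum>b\<in>Basis. ?F b y) = g y * (real DIM('a) * norm (x - y) powr - (q + 2) - (q + 2) * (\<Sum>b\<in>Basis. ((x - y) \<bullet> b)\<^sup>2 * norm (x - y) powr - (q + 4)))"
      by (simp only: sum_distrib_left[symmetric] sum_subtractf sum_constant)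
    then show "(\<Sum>b\<in>Basis. ?F b y) = (real DIM('a) - (q + 2)) * (g y * norm (x - y) powr - (q + 2))"
      unfolding * by (simp only: left_diff_distrib right_diff_distrib mult_ac)
  qed
  also have "\<dots> = (real DIM('a) - (q + 2)) * (LINT y|lborel. g y * norm (x - y) powr - (q + 2))"
    by (rule integral_mult_right_zero)
  finally show ?thesis using q(2) by simp
qed

lemma potential_all_powers_zero:
  assumes q: "0 < q" "real DIM('a) < q + 2" and z: "\<And>x. x \<in> W \<Longrightarrow> (LINT y|lborel. g y * norm (x - y) powr - q) = 0"
  shows "x \<in> W \<Longrightarrow> (LINT y|lborel. g y * norm (x - y) powr - (q + 2 * real n)) = 0"
proof (induction n arbitrary: x)
  case (Suc n)
  have "(LINT y|lborel. g y * norm (x - y) powr - ((q + 2 * real n) + 2)) = 0"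
    by (rule potential_next_power_zero[OF _ _ Suc.IH Suc.prems]) (use q in auto)
  moreover have "q + 2 * real (Suc n) = (q + 2 * real n) + 2" by simp
  ultimately show ?case by (simp only:)
qed (simp add: z)

text \<open>All radial profiles about \<open>x\<close> integrate to zero, since polynomials in \<open>norm (x - y) powr - 2\<close> are dense.\<close>

lemma potential_gauss_zero:
  assumes q: "0 < q" "real DIM('a) < q + 2" and z: "\<And>x. x \<in> W \<Longrightarrow> (LINT y|lborel. g y * norm (x - y) powr - q) = 0" and x: "x \<in> W"
  shows "(LINT y|lborel. g y * exp (- (norm (x - y))\<^sup>2)) = 0"
proof -
  obtain d where d: "0 < d" "ball x d \<subseteq> W" "\<And>z y. z \<in> ball x d \<Longrightarrow> y \<in> K \<Longrightarrow> d \<le> norm (z - y)"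
    using separation[OF W WK x] by blast
  have sep: "d \<le> norm (x - y)" if "y \<in> K" for y by (rule d(3)[OF _ that]) (simp add: d(1))
  obtain R0 where R0: "\<And>y. y \<in> K \<Longrightarrow> norm y \<le> R0" using compact_imp_bounded[OF K] unfolding bounded_iff by blast
  define R where "R = max d (norm x + R0)"
  have R: "0 < R" "norm (x - y) \<le> R" if "y \<in> K" for y
    using d(1) R0[OF that] norm_triangle_ineq4[of x y] unfolding R_def by auto
  have R1: "0 < R" using d(1) by (simp add: R_def)
  \<comment> \<open>The range of $r = |x-y|^{-2}$ for $y \in K$; it is compact and avoids $0$.\<close>
  define S where "S = {R powr - 2..d powr - 2}"
  have inS: "norm (x - y) powr - 2 \<in> S" if y: "y \<in> K" for y
  proof -
    have "0 < norm (x - y)" using sep[OF y] d(1) by linarith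
    then show ?thesis unfolding S_def using R(2)[OF y] sep[OF y] d(1) by (auto intro!: powr_mono2')
  qed
  have Spos: "0 < r" if "r \<in> S" for r using that R1 unfolding S_def by (auto intro: less_le_trans[of 0 "R powr - 2"])
  \<comment> \<open>With $r = |x-y|^{-2}$, the Gaussian is $|x-y|^{-q}\,h(r)$, and $h$ is approximated by polynomials in $r$.\<close>
  define h where "h r = r powr - (q / 2) * exp (- (1 / r))" for r :: real
  have hcont: "continuous_on S h" unfolding h_def by (intro continuous_intros) (auto dest: Spos)
  define C where "C = d powr - q * (LINT y|lborel. \<bar>g y\<bar>)"
  have C0: "0 \<le> C" unfolding C_def by (intro mult_nonneg_nonneg integral_nonneg_AE) auto
  have term_int: "integrable lborel (\<lambda>y. g y * norm (x - y) powr - p)" if "0 \<le> p" for p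
  proof (rule integrable_bounded_factor[of _ "d powr - p"])
    fix y assume y: "y \<in> K"
    have "norm (x - y) powr - p \<le> d powr - p" using that by (intro powr_neg_le d(1) sep[OF y]) simp
    then show "\<bar>norm (x - y) powr - p\<bar> \<le> d powr - p" by (simp only: abs_of_nonneg[OF powr_ge_zero])
  qed measurable
  have gint: "integrable lborel (\<lambda>y. g y * exp (- (norm (x - y))\<^sup>2))"
    by (rule integrable_bounded_factor[of _ 1]) simp_all
  have bound: "\<bar>LINT y|lborel. g y * exp (- (norm (x - y))\<^sup>2)\<bar> \<le> e * C" if e: "0 < e" for e
  proof -
    obtain p where p: "real_polynomial_function p" "\<And>r. r \<in> S \<Longrightarrow> \<bar>h r - p r\<bar> < e"
      using Stone_Weierstrass_real_polynomial_function[OF _ hcont e] unfolding S_def by (metis compact_Icc)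
    obtain a n where pa: "p = (\<lambda>r. \<Sum>i\<le>n. a i * r ^ i)" using p(1) real_polynomial_function_iff_sum by blast
    have pw: "norm (x - y) powr - q * (norm (x - y) powr - 2) ^ i = norm (x - y) powr - (q + 2 * real i)" for y i
    proof (cases "x = y")
      case False
      then have "(norm (x - y) powr - 2) ^ i = norm (x - y) powr (- 2 * real i)"
        by (subst powr_realpow[symmetric]) (simp_all add: powr_powr)
      then show ?thesis by (simp only:) (rule powr_add_eq, simp)
    qed (use q in simp)
    have ex: "g y * norm (x - y) powr - q * p (norm (x - y) powr - 2) = (\<Sum>i\<le>n. a i * (g y * norm (x - y) powr - (q + 2 * real i)))" for y
      unfolding pa pw[symmetric] sum_distrib_left by (simp only: mult_ac)
    have pint: "integrable lborel (\<lambda>y. g y * norm (x - y) powr - q * p (norm (x - y) powr - 2))"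
      unfolding ex using q by (intro Bochner_Integration.integrable_sum integrable_mult_right term_int) simp
    have p0: "(LINT y|lborel. g y * norm (x - y) powr - q * p (norm (x - y) powr - 2)) = 0"
    proof -
      have "(LINT y|lborel. (\<Sum>i\<le>n. a i * (g y * norm (x - y) powr - (q + 2 * real i)))) = (\<Sum>i\<le>n. (LINT y|lborel. a i * (g y * norm (x - y) powr - (q + 2 * real i))))"
        using q by (intro Bochner_Integration.integral_sum integrable_mult_right term_int) simp
      also have "\<dots> = 0"
        by (simp only: integral_mult_right_zero potential_all_powers_zero[OF q z x] mult_zero_right sum.neutral_const)
      finally show ?thesis unfolding ex .
    qed
    let ?D = "\<lambda>y. g y * exp (- (norm (x - y))\<^sup>2) - g y * norm (x - y) powr - q * p (norm (x - y) powr - 2)"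
    have Dbd: "\<bar>?D y\<bar> \<le> (e * d powr - q) * \<bar>g y\<bar>" for y
    proof (cases "y \<in> K")
      case True
      have n0: "0 < norm (x - y)" using sep[OF True] d(1) by linarith
      have 1: "1 / (norm (x - y) powr - 2) = (norm (x - y))\<^sup>2"
        using n0 by (simp add: powr_minus inverse_eq_divide)
      have 2: "(norm (x - y) powr - 2) powr - (q / 2) = norm (x - y) powr q" by (simp add: powr_powr)
      have 3: "norm (x - y) powr - q * norm (x - y) powr q = 1" using n0 by (simp add: powr_add[symmetric])
      have "exp (- (norm (x - y))\<^sup>2) = (norm (x - y) powr - q * norm (x - y) powr q) * exp (- (norm (x - y))\<^sup>2)" unfolding 3 by simp
      also have "\<dots> = norm (x - y) powr - q * h (norm (x - y) powr - 2)" unfolding h_def 1 2 by (simp only: mult.assoc)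
      finally have "?D y = g y * (norm (x - y) powr - q * (h (norm (x - y) powr - 2) - p (norm (x - y) powr - 2)))"
        by (simp only: right_diff_distrib mult.assoc)
      then have "\<bar>?D y\<bar> = \<bar>g y\<bar> * (norm (x - y) powr - q * \<bar>h (norm (x - y) powr - 2) - p (norm (x - y) powr - 2)\<bar>)"
        by (simp only: abs_mult abs_of_nonneg[OF powr_ge_zero])
      also have "\<dots> \<le> \<bar>g y\<bar> * (d powr - q * e)"
        using q by (intro mult_left_mono mult_mono powr_neg_le d(1) sep[OF True] less_imp_le[OF p(2)[OF inS[OF True]]]) auto
      finally show ?thesis by (simp only: mult_ac)
    qed (use e in \<open>simp add: gK\<close>)
    have "(LINT y|lborel. g y * exp (- (norm (x - y))\<^sup>2)) = (LINT y|lborel. ?D y)"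
      unfolding Bochner_Integration.integral_diff[OF gint pint] p0 by simp
    also have "\<bar>LINT y|lborel. ?D y\<bar> \<le> (LINT y|lborel. (e * d powr - q) * \<bar>g y\<bar>)"
      by (rule order.trans[OF integral_abs_bound integral_mono])
         (intro integrable_abs Bochner_Integration.integrable_diff gint pint, intro integrable_mult_right integrable_abs g, rule Dbd)
    also have "\<dots> = e * C" unfolding C_def integral_mult_right_zero by (simp only: mult.assoc)
    finally show ?thesis .
  qed
  have "\<bar>LINT y|lborel. g y * exp (- (norm (x - y))\<^sup>2)\<bar> \<le> 0"
  proof (rule field_le_epsilon)
    fix e :: real assume e: "0 < e"
    have "\<bar>LINT y|lborel. g y * exp (- (norm (x - y))\<^sup>2)\<bar> \<le> e / (C + 1) * C" by (rule bound) (use e C0 in simp)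
    also have "\<dots> = e * (C / (C + 1))" by simp
    also have "\<dots> \<le> e * 1" using e C0 by (intro mult_left_mono) auto
    finally show "\<bar>LINT y|lborel. g y * exp (- (norm (x - y))\<^sup>2)\<bar> \<le> 0 + e" by simp
  qed
  then show ?thesis by simp
qed

text \<open>Moving \<open>x\<close> in the direction \<open>v\<close> turns the Gaussian into an exponential generating function of moments.\<close>

lemma potential_moment_zero:
  assumes q: "0 < q" "real DIM('a) < q + 2" and z: "\<And>x. x \<in> W \<Longrightarrow> (LINT y|lborel. g y * norm (x - y) powr - q) = 0" and x: "x \<in> W"
    and v: "norm v = 1"
  shows "(LINT y|lborel. (g y * exp (- (norm (x - y))\<^sup>2)) * ((x - y) \<bullet> v) ^ n) = 0"
proof -
  obtain d where d: "0 < d" "ball x d \<subseteq> W" "\<And>z y. z \<in> ball x d \<Longrightarrow> y \<in> K \<Longrightarrow> d \<le> norm (z - y)"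
    using separation[OF W WK x] by blast
  obtain R0 where R0: "\<And>y. y \<in> K \<Longrightarrow> norm y \<le> R0" using compact_imp_bounded[OF K] unfolding bounded_iff by blast
  define R where "R = \<bar>norm x + R0\<bar>"
  have R: "\<bar>(x - y) \<bullet> v\<bar> \<le> R" if "y \<in> K" for y
  proof -
    have "\<bar>(x - y) \<bullet> v\<bar> \<le> norm (x - y)" using Cauchy_Schwarz_ineq2[of "x - y" v] v by simp
    also have "\<dots> \<le> norm x + norm y" by (rule norm_triangle_ineq4)
    also have "\<dots> \<le> R" using R0[OF that] unfolding R_def by linarith
    finally show ?thesis .
  qed
  have Rn: "0 \<le> R" by (simp add: R_def)
  define G where "G y = g y * exp (- (norm (x - y))\<^sup>2)" for y
  have G: "integrable lborel G" unfolding G_def[abs_def]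
    by (rule integrable_bounded_factor[of _ 1]) simp_all
  have [measurable]: "G \<in> borel_measurable borel" using borel_measurable_integrable[OF G] by simp
  have GK: "G y = 0" if "y \<notin> K" for y using gK[OF that] by (simp add: G_def)
  have ebd: "\<bar>exp (- 2 * \<tau> * ((x - y) \<bullet> v))\<bar> \<le> exp (2 * d * R)" if t: "\<bar>\<tau>\<bar> < d" and y: "y \<in> K" for \<tau> y
  proof -
    have "- 2 * \<tau> * ((x - y) \<bullet> v) \<le> \<bar>- 2 * \<tau> * ((x - y) \<bullet> v)\<bar>" by (rule abs_ge_self)
    also have "\<dots> = 2 * (\<bar>\<tau>\<bar> * \<bar>(x - y) \<bullet> v\<bar>)" by (simp add: abs_mult)
    also have "\<dots> \<le> 2 * (d * R)" using t by (intro mult_left_mono mult_mono R[OF y]) auto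
    finally show ?thesis by (simp only: abs_exp_cancel exp_le_cancel_iff mult.assoc)
  qed
  have pbd: "\<bar>((x - y) \<bullet> v) ^ m\<bar> \<le> R ^ m" if "y \<in> K" for y m
    unfolding power_abs by (rule power_mono[OF R[OF that]]) simp
  have main: "(LINT y|lborel. G y * (((x - y) \<bullet> v) ^ n * exp (- 2 * \<tau> * ((x - y) \<bullet> v)))) = 0" if "\<bar>\<tau>\<bar> < d" for \<tau>
    using that
  proof (induction n arbitrary: \<tau>)
    case 0
    have "x + \<tau> *\<^sub>R v \<in> W" using d(2) 0 v by (auto simp: dist_norm)
    from potential_gauss_zero[OF q z this]
    have "(LINT y|lborel. g y * exp (- (norm (x + \<tau> *\<^sub>R v - y))\<^sup>2)) = 0" .
    moreover have "g y * exp (- (norm (x + \<tau> *\<^sub>R v - y))\<^sup>2) = exp (- \<tau>\<^sup>2) * (G y * (((x - y) \<bullet> v) ^ 0 * exp (- 2 * \<tau> * ((x - y) \<bullet> v))))" for y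
    proof -
      have vv: "v \<bullet> v = 1" using v by (simp add: norm_eq_1)
      have "x + \<tau> *\<^sub>R v - y = (x - y) + \<tau> *\<^sub>R v" by simp
      then have "(norm (x + \<tau> *\<^sub>R v - y))\<^sup>2 = (norm (x - y))\<^sup>2 + 2 * \<tau> * ((x - y) \<bullet> v) + \<tau>\<^sup>2"
        by (simp only: power2_norm_eq_inner inner_add_left inner_add_right) (simp add: vv inner_commute power2_eq_square)
      then have "- (norm (x + \<tau> *\<^sub>R v - y))\<^sup>2 = - \<tau>\<^sup>2 + (- (norm (x - y))\<^sup>2 + - 2 * \<tau> * ((x - y) \<bullet> v))" by simp
      then show ?thesis unfolding G_def by (simp only: exp_add) (simp add: mult_ac)
    qed
    ultimately have "exp (- \<tau>\<^sup>2) * (LINT y|lborel. G y * (((x - y) \<bullet> v) ^ 0 * exp (- 2 * \<tau> * ((x - y) \<bullet> v)))) = 0"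
      by (simp only: integral_mult_right_zero)
    then show ?case by simp
  next
    case (Suc n)
    let ?k = "\<lambda>\<tau> y. ((x - y) \<bullet> v) ^ n * exp (- 2 * \<tau> * ((x - y) \<bullet> v))"
    let ?k' = "\<lambda>\<tau> y. (- 2) * (((x - y) \<bullet> v) ^ Suc n * exp (- 2 * \<tau> * ((x - y) \<bullet> v)))"
    have "(LINT y|lborel. G y * ?k' \<tau> y) = 0"
    proof (rule integral_derivative_zero[OF G GK, where k="?k" and k'="?k'" and \<delta>=d and M="2 * (R ^ Suc n * exp (2 * d * R))"])
      fix \<tau> y assume t: "\<bar>\<tau>\<bar> < d" and y: "y \<in> K"
      show "((\<lambda>\<tau>. ?k \<tau> y) has_real_derivative ?k' \<tau> y) (at \<tau>)"
        by (auto intro!: derivative_eq_intros)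
      have "\<bar>((x - y) \<bullet> v) ^ Suc n\<bar> * \<bar>exp (- 2 * \<tau> * ((x - y) \<bullet> v))\<bar> \<le> R ^ Suc n * exp (2 * d * R)"
        using Rn by (intro mult_mono pbd[OF y] ebd[OF t y] zero_le_power) auto
      then show "\<bar>?k' \<tau> y\<bar> \<le> 2 * (R ^ Suc n * exp (2 * d * R))" by (simp only: abs_mult)
    next
      fix \<tau> assume t: "\<bar>\<tau>\<bar> < d"
      have "integrable lborel (\<lambda>y. g y * (exp (- (norm (x - y))\<^sup>2) * ?k \<tau> y))"
      proof (rule integrable_bounded_factor[of _ "1 * (R ^ n * exp (2 * d * R))"])
        fix y assume y: "y \<in> K"
        show "\<bar>exp (- (norm (x - y))\<^sup>2) * ?k \<tau> y\<bar> \<le> 1 * (R ^ n * exp (2 * d * R))"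
          unfolding abs_mult using Rn by (intro mult_mono pbd[OF y] ebd[OF t y] zero_le_power mult_nonneg_nonneg) auto
      qed measurable
      then show "integrable lborel (\<lambda>y. G y * ?k \<tau> y)" unfolding G_def by (simp only: mult.assoc)
      show "(LINT y|lborel. G y * ?k \<tau> y) = 0" by (rule Suc.IH[OF t])
    qed (use Suc.prems in auto)
    then have "(- 2) * (LINT y|lborel. G y * (((x - y) \<bullet> v) ^ Suc n * exp (- 2 * \<tau> * ((x - y) \<bullet> v)))) = 0"
      by (simp only: mult.left_commute[of "G _"] integral_mult_right_zero)
    then show ?case by simp
  qed
  from main[of 0] d(1) show ?thesis by (simp add: G_def)
qed

text \<open>On compact sets the exponential series of the character converges boundedly, and its terms are moments.\<close>

lemma potential_fourier_zero:
  assumes q: "0 < q" "real DIM('a) < q + 2" and z: "\<And>x. x \<in> W \<Longrightarrow> (LINT y|lborel. g y * norm (x - y) powr - q) = 0" and x: "x \<in> W"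
  shows "fourier_L1 (\<lambda>y. g y * exp (- (norm (x - y))\<^sup>2)) \<xi> = 0"
proof -
  obtain R0 where R0: "\<And>y. y \<in> K \<Longrightarrow> norm y \<le> R0" using compact_imp_bounded[OF K] unfolding bounded_iff by blast
  define R where "R = (norm x + R0) * norm \<xi>"
  have R: "\<bar>(x - y) \<bullet> \<xi>\<bar> \<le> R" if "y \<in> K" for y
  proof -
    have "\<bar>(x - y) \<bullet> \<xi>\<bar> \<le> norm (x - y) * norm \<xi>" by (rule Cauchy_Schwarz_ineq2)
    also have "\<dots> \<le> R" unfolding R_def using R0[OF that] norm_triangle_ineq4[of x y] by (intro mult_right_mono) auto
    finally show ?thesis .
  qed
  define G where "G y = g y * exp (- (norm (x - y))\<^sup>2)" for y
  have G: "integrable lborel G" unfolding G_def[abs_def]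
    by (rule integrable_bounded_factor[of _ 1]) simp_all
  have [measurable]: "G \<in> borel_measurable borel" using borel_measurable_integrable[OF G] by simp
  have GK: "G y = 0" if "y \<notin> K" for y using gK[OF that] by (simp add: G_def)
  have mom: "(LINT y|lborel. G y * ((x - y) \<bullet> \<xi>) ^ n) = 0" for n
  proof (cases "\<xi> = 0")
    case True
    obtain b :: 'a where "b \<in> Basis" using nonempty_Basis by blast
    then have "(LINT y|lborel. G y * ((x - y) \<bullet> b) ^ 0) = 0"
      using potential_moment_zero[OF q z x, of b 0] unfolding G_def by simp
    then show ?thesis using True by (cases n) simp_all
  next
    case False
    have "(LINT y|lborel. G y * ((x - y) \<bullet> sgn \<xi>) ^ n) = 0"
      unfolding G_def by (rule potential_moment_zero[OF q z x]) (use False in \<open>simp_all add: norm_sgn\<close>)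
    then have "norm \<xi> ^ n * (LINT y|lborel. G y * ((x - y) \<bullet> sgn \<xi>) ^ n) = 0" by simp
    moreover have "norm \<xi> ^ n * (G y * ((x - y) \<bullet> sgn \<xi>) ^ n) = G y * ((x - y) \<bullet> \<xi>) ^ n" for y
    proof -
      have "(x - y) \<bullet> \<xi> = norm \<xi> * ((x - y) \<bullet> sgn \<xi>)" using False by (simp add: sgn_div_norm)
      then show ?thesis by (simp only: power_mult_distrib mult_ac)
    qed
    ultimately show ?thesis by (simp only: integral_mult_right_zero[symmetric])
  qed
  define c where "c k = \<i> ^ k / fact k" for k :: nat
  define P where "P n y = (\<Sum>k<n. c k * of_real (G y * ((x - y) \<bullet> \<xi>) ^ k))" for n y
  have pint: "integrable lborel (\<lambda>y. G y * ((x - y) \<bullet> \<xi>) ^ k)" for k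
  proof -
    have "integrable lborel (\<lambda>y. g y * (exp (- (norm (x - y))\<^sup>2) * ((x - y) \<bullet> \<xi>) ^ k))"
    proof (rule integrable_bounded_factor[of _ "1 * R ^ k"])
      fix y assume y: "y \<in> K"
      show "\<bar>exp (- (norm (x - y))\<^sup>2) * ((x - y) \<bullet> \<xi>) ^ k\<bar> \<le> 1 * R ^ k"
        unfolding abs_mult power_abs using R[OF y] by (intro mult_mono power_mono) auto
    qed measurable
    then show ?thesis unfolding G_def by (simp only: mult.assoc)
  qed
  have P0: "(LINT y|lborel. P n y) = 0" for n
    unfolding P_def
    by (subst Bochner_Integration.integral_sum) (auto simp only: integral_mult_right_zero integral_complex_of_real mom complex_of_real_integrable_eq intro!: integrable_mult_right pint, simp)
  have Pe: "P n y = of_real (G y) * (\<Sum>k<n. (\<i> * of_real ((x - y) \<bullet> \<xi>)) ^ k / fact k)" for n y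
    unfolding P_def c_def sum_distrib_left by (simp add: power_mult_distrib mult_ac)
  have "(\<lambda>n. LINT y|lborel. P n y) \<longlonglongrightarrow> (LINT y|lborel. of_real (G y) * cis ((x - y) \<bullet> \<xi>))"
  proof (rule integral_dominated_convergence[where w="\<lambda>y. \<bar>G y\<bar> * exp R"])
    show "integrable lborel (\<lambda>y. \<bar>G y\<bar> * exp R)" by (intro integrable_mult_left integrable_abs G)
    show "AE y in lborel. (\<lambda>n. P n y) \<longlonglongrightarrow> of_real (G y) * cis ((x - y) \<bullet> \<xi>)"
    proof (rule AE_I2)
      fix y
      have "(\<lambda>k. (\<i> * of_real ((x - y) \<bullet> \<xi>)) ^ k /\<^sub>R fact k) sums exp (\<i> * of_real ((x - y) \<bullet> \<xi>))" by (rule exp_converges)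
      then have "(\<lambda>k. (\<i> * of_real ((x - y) \<bullet> \<xi>)) ^ k / fact k) sums cis ((x - y) \<bullet> \<xi>)"
        by (simp add: cis_conv_exp scaleR_conv_of_real divide_inverse mult.commute)
      then show "(\<lambda>n. P n y) \<longlonglongrightarrow> of_real (G y) * cis ((x - y) \<bullet> \<xi>)"
        unfolding Pe sums_def by (intro tendsto_intros)
    qed
    show "AE y in lborel. norm (P n y) \<le> \<bar>G y\<bar> * exp R" for n
    proof (rule AE_I2)
      fix y
      show "norm (P n y) \<le> \<bar>G y\<bar> * exp R"
      proof (cases "y \<in> K")
        case True
        let ?t = "\<bar>(x - y) \<bullet> \<xi>\<bar>"
        have "norm (\<Sum>k<n. (\<i> * of_real ((x - y) \<bullet> \<xi>)) ^ k / fact k) \<le> (\<Sum>k<n. norm ((\<i> * complex_of_real ((x - y) \<bullet> \<xi>)) ^ k / fact k))"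
          by (rule norm_sum)
        also have "\<dots> = (\<Sum>k<n. ?t ^ k /\<^sub>R fact k)"
          by (intro sum.cong) (simp_all add: norm_divide norm_power norm_mult divide_inverse mult.commute norm_inverse norm_fact)
        also have "\<dots> \<le> (\<Sum>k. ?t ^ k /\<^sub>R fact k)" by (rule sum_le_suminf[OF summable_exp_generic]) auto
        also have "\<dots> = exp ?t" unfolding exp_def ..
        also have "\<dots> \<le> exp R" using R[OF True] by simp
        finally show ?thesis unfolding Pe norm_mult norm_of_real by (rule mult_left_mono) simp
      qed (simp add: P_def GK)
    qed
  qed (unfold P_def, measurable)
  then have E: "(LINT y|lborel. of_real (G y) * cis ((x - y) \<bullet> \<xi>)) = 0" unfolding P0 by (simp add: LIMSEQ_const_iff)
  have "fourier_L1 G \<xi> = (LINT y|lborel. cis (- (x \<bullet> \<xi>)) * (of_real (G y) * cis ((x - y) \<bullet> \<xi>)))"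
    unfolding fourier_L1_def by (intro Bochner_Integration.integral_cong) (simp_all add: scaleR_conv_of_real cis_mult inner_diff_left mult.left_commute)
  then have "fourier_L1 G \<xi> = 0" unfolding integral_mult_right_zero E by simp
  then show ?thesis unfolding G_def[abs_def] .
qed

lemma potential_continuous:
  assumes q: "0 < q"
  shows "continuous_on W (\<lambda>x. LINT y|lborel. g y * norm (x - y) powr - q)"
proof (rule continuous_on_sequentiallyI)
  fix u x assume u: "\<forall>n. u n \<in> W" "x \<in> W" "u \<longlonglongrightarrow> x"
  obtain d where d: "0 < d" "ball x d \<subseteq> W" "\<And>z y. z \<in> ball x d \<Longrightarrow> y \<in> K \<Longrightarrow> d \<le> norm (z - y)"
    using separation[OF W WK u(2)] by blast
  have "\<forall>\<^sub>F n in sequentially. u n \<in> ball x d" using u(3) d(1) by (intro topological_tendstoD[OF u(3)]) auto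
  then obtain N where N: "\<And>n. n \<ge> N \<Longrightarrow> u n \<in> ball x d" by (auto simp: eventually_sequentially)
  have "(\<lambda>n. LINT y|lborel. g y * norm (u (n + N) - y) powr - q) \<longlonglongrightarrow> (LINT y|lborel. g y * norm (x - y) powr - q)"
  proof (rule integral_dominated_convergence[where w="\<lambda>y. \<bar>g y\<bar> * d powr - q"])
    show "integrable lborel (\<lambda>y. \<bar>g y\<bar> * d powr - q)" by (intro integrable_mult_left integrable_abs g)
    show "AE y in lborel. (\<lambda>n. g y * norm (u (n + N) - y) powr - q) \<longlonglongrightarrow> g y * norm (x - y) powr - q"
    proof (rule AE_I2)
      fix y
      show "(\<lambda>n. g y * norm (u (n + N) - y) powr - q) \<longlonglongrightarrow> g y * norm (x - y) powr - q"
      proof (cases "y \<in> K")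
        case True
        have "d \<le> norm (x - y)" by (rule d(3)[OF _ True]) (simp add: d(1))
        then have "norm (x - y) \<noteq> 0" using d(1) by linarith
        moreover have "(\<lambda>n. u (n + N)) \<longlonglongrightarrow> x" by (rule LIMSEQ_ignore_initial_segment[OF u(3)])
        ultimately show ?thesis
          by (intro tendsto_mult[OF tendsto_const] tendsto_powr[OF tendsto_norm[OF tendsto_diff[OF _ tendsto_const]] tendsto_const])
      qed (simp add: gK)
    qed
    show "AE y in lborel. norm (g y * norm (u (n + N) - y) powr - q) \<le> \<bar>g y\<bar> * d powr - q" for n
    proof (rule AE_I2)
      fix y
      show "norm (g y * norm (u (n + N) - y) powr - q) \<le> \<bar>g y\<bar> * d powr - q"
      proof (cases "y \<in> K")
        case True
        have "norm (u (n + N) - y) powr - q \<le> d powr - q" using q by (intro powr_neg_le d(1) d(3)[OF N True]) auto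
        then show ?thesis by (simp add: abs_mult mult_left_mono)
      qed (simp add: gK)
    qed
  qed measurable
  then show "(\<lambda>n. LINT y|lborel. g y * norm (u n - y) powr - q) \<longlonglongrightarrow> (LINT y|lborel. g y * norm (x - y) powr - q)"
    by (rule LIMSEQ_offset)
qed

end

text \<open>Non-empty open sets have positive measure.\<close>

lemma AE_zero_continuous_on_open:
  fixes F :: "'a::euclidean_space \<Rightarrow> real"
  assumes W: "open W" and F: "continuous_on W F" and z: "AE x in lborel. x \<in> W \<longrightarrow> F x = 0" and x: "x \<in> W"
  shows "F x = 0"
proof (rule ccontr)
  assume "F x \<noteq> 0"
  define S where "S = W \<inter> F -` (- {0})"
  have S: "open S" unfolding S_def using F W by (rule continuous_open_preimage) auto
  have "x \<in> S" using x \<open>F x \<noteq> 0\<close> by (simp add: S_def)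
  then have "(\<integral>\<^sup>+x. indicator S x \<partial>lborel) > 0"
    using S by (intro nn_integral_open_pos[OF _ S]) auto
  moreover have "(\<integral>\<^sup>+x. indicator S x \<partial>(lborel::'a measure)) = (\<integral>\<^sup>+x. 0 \<partial>(lborel::'a measure))"
    using z by (intro nn_integral_cong_AE) (auto elim!: eventually_mono simp: S_def indicator_def)
  ultimately show False by simp
qed

text \<open>The hypothesis, given almost everywhere, holds on all of $W$ because the potential is continuous there.\<close>

theorem riesz_potential_unique_continuation:
  fixes g :: "'a::euclidean_space \<Rightarrow> real"
  assumes g: "L2_on UNIV g" and gK: "\<And>y. y \<notin> K \<Longrightarrow> g y = 0" and K: "compact K"
    and W: "open W" "W \<noteq> {}" and WK: "W \<inter> K = {}" and q: "0 < q" "real DIM('a) < q + 2"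
    and z: "AE x in lborel. x \<in> W \<longrightarrow> (LINT y|lborel. g y * norm (x - y) powr - q) = 0"
  shows "AE y in lborel. g y = 0"
proof -
  have gi: "integrable lborel g"
    by (rule L2_bounded_support_integrable[OF g, of K]) (use K gK compact_imp_closed in \<open>auto intro: compact_imp_bounded borel_closed\<close>)
  note [measurable] = L2_measurable[OF g]
  have z': "(LINT y|lborel. g y * norm (x - y) powr - q) = 0" if "x \<in> W" for x
    by (rule AE_zero_continuous_on_open[OF W(1) potential_continuous[OF gi gK K W(1) WK q(1)] z that])
  obtain x where x: "x \<in> W" using W(2) by blast
  define G where "G y = g y * exp (- (norm (x - y))\<^sup>2)" for y
  have [measurable]: "G \<in> borel_measurable borel" unfolding G_def[abs_def] by measurable
  have G2: "L2_on UNIV G"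
  proof (rule L2_dominated[OF _ g])
    show "AE y in lborel. norm (G y) \<le> norm (g y)" by (rule AE_I2) (simp add: G_def abs_mult mult_left_le)
  qed measurable
  have G1: "integrable lborel G"
    by (rule L2_bounded_support_integrable[OF G2, of K]) (use K gK compact_imp_closed in \<open>auto intro: compact_imp_bounded borel_closed simp: G_def\<close>)
  have "fourier_L1 G \<xi> = 0" for \<xi>
    unfolding G_def by (rule potential_fourier_zero[OF gi gK K W(1) WK q z' x])
  then have "AE y in lborel. G y = 0" by (rule fourier_L1_zero[OF G1 G2])
  then show ?thesis by eventually_elim (simp add: G_def)
qed

section \<open>Lipschitz domains\<close>

text \<open>The ball is centred at distance $\rho$ below the boundary point $p$, in the direction $-e$. A displacement
  $k$ changes the height by at most $|k|$ and the height of the graph by at most $2L|k|$, so that displacements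
  with $(1+2L)|k| < \rho$ stay below the graph.\<close>

lemma lipschitz_domain_local_cone:
  fixes \<Omega> :: "'a::euclidean_space set"
  assumes op: "open \<Omega>" and r: "0 < r" and e: "norm e = 1" and g: "L-lipschitz_on {y. y \<bullet> e = 0} g"
    and chart: "\<Omega> \<inter> ball p0 r = {x \<in> ball p0 r. x \<bullet> e > g (x - (x \<bullet> e) *\<^sub>R e)}"
    and p: "p \<in> frontier \<Omega>" "p \<in> ball p0 (r / 2)" and rho: "0 < \<rho>" "\<rho> \<le> r / 8"
  shows "\<exists>z. dist p z \<le> \<rho> \<and> ball z (1 / (1 + 2 * L) * \<rho>) \<inter> \<Omega> = {}"
proof (intro exI[of _ "p - \<rho> *\<^sub>R e"] conjI)
  have mem: "x \<in> \<Omega> \<longleftrightarrow> g (x - (x \<bullet> e) *\<^sub>R e) < x \<bullet> e" if "x \<in> ball p0 r" for x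
    using chart that by blast
  have L: "0 \<le> L" using g by (rule lipschitz_on_nonneg)
  have ee: "e \<bullet> e = 1" using e by (simp add: norm_eq_1)
  show "dist p (p - \<rho> *\<^sub>R e) \<le> \<rho>" using e rho by (simp add: dist_norm)
  have "p \<notin> \<Omega>" using p(1) op by (simp add: frontier_def interior_open)
  moreover have p_in: "p \<in> ball p0 r" using p(2) r by simp
  ultimately have pg: "p \<bullet> e \<le> g (p - (p \<bullet> e) *\<^sub>R e)" using mem[OF p_in] by (simp only: not_less)
  show "ball (p - \<rho> *\<^sub>R e) (1 / (1 + 2 * L) * \<rho>) \<inter> \<Omega> = {}"
  proof (rule ccontr)
    assume "ball (p - \<rho> *\<^sub>R e) (1 / (1 + 2 * L) * \<rho>) \<inter> \<Omega> \<noteq> {}"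
    then obtain y where y: "y \<in> ball (p - \<rho> *\<^sub>R e) (1 / (1 + 2 * L) * \<rho>)" "y \<in> \<Omega>" by blast
    define k where "k = y - (p - \<rho> *\<^sub>R e)"
    have yk: "y = p - \<rho> *\<^sub>R e + k" by (simp add: k_def)
    have "norm k < 1 / (1 + 2 * L) * \<rho>" using y(1) by (simp add: k_def dist_norm norm_minus_commute)
    then have k: "(1 + 2 * L) * norm k < \<rho>" using L by (simp add: field_simps)
    have Lk: "0 \<le> L * norm k" using L by simp
    have k1: "norm k < \<rho>" using k Lk by (simp add: distrib_right)
    have ke: "\<bar>k \<bullet> e\<bar> \<le> norm k" using Cauchy_Schwarz_ineq2[of k e] e by simp
    have "dist p0 y \<le> dist p0 p + dist p y" by (rule dist_triangle)
    also have "dist p y = norm (\<rho> *\<^sub>R e - k)" by (simp add: yk dist_norm)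
    also have "\<dots> \<le> \<rho> + norm k" using norm_triangle_ineq4[of "\<rho> *\<^sub>R e" k] e rho by simp
    finally have yin: "y \<in> ball p0 r" using p(2) k1 rho by simp
    have "y - (y \<bullet> e) *\<^sub>R e - (p - (p \<bullet> e) *\<^sub>R e) = k - (k \<bullet> e) *\<^sub>R e"
      by (simp add: yk inner_add_left inner_diff_left ee algebra_simps)
    then have dle: "dist (y - (y \<bullet> e) *\<^sub>R e) (p - (p \<bullet> e) *\<^sub>R e) \<le> 2 * norm k"
      using norm_triangle_ineq4[of k "(k \<bullet> e) *\<^sub>R e"] e ke by (simp add: dist_norm)
    have "dist (g (y - (y \<bullet> e) *\<^sub>R e)) (g (p - (p \<bullet> e) *\<^sub>R e)) \<le> L * dist (y - (y \<bullet> e) *\<^sub>R e) (p - (p \<bullet> e) *\<^sub>R e)"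
      by (rule lipschitz_onD[OF g]) (auto simp: inner_diff_left ee)
    also have "\<dots> \<le> L * (2 * norm k)" using L dle by (rule mult_left_mono[rotated])
    finally have "g (p - (p \<bullet> e) *\<^sub>R e) - 2 * (L * norm k) \<le> g (y - (y \<bullet> e) *\<^sub>R e)" by (simp add: dist_real_def)
    moreover have "y \<bullet> e = p \<bullet> e - \<rho> + k \<bullet> e" by (simp add: yk inner_add_left inner_diff_left ee)
    moreover have "norm k + 2 * (L * norm k) < \<rho>" using k by (simp add: distrib_right)
    ultimately have "y \<bullet> e \<le> g (y - (y \<bullet> e) *\<^sub>R e)" using pg ke by linarith
    moreover have "y \<bullet> e > g (y - (y \<bullet> e) *\<^sub>R e)" using mem[OF yin] y(2) by (simp only:)
    ultimately show False by simp
  qed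
qed

lemma lipschitz_chart:
  fixes \<Omega> :: "'a::euclidean_space set"
  assumes dom: "bounded_lipschitz_domain \<Omega>" and p0: "p0 \<in> frontier \<Omega>"
  obtains r e L g where "0 < r" "norm e = 1" "L-lipschitz_on {y. y \<bullet> e = 0} g"
       "\<Omega> \<inter> ball p0 r = {x \<in> ball p0 r. x \<bullet> e > g (x - (x \<bullet> e) *\<^sub>R e)}"
proof -
  have "\<exists>r > 0. \<exists>e. \<exists>L. \<exists>g. norm e = 1 \<and> L-lipschitz_on {y. y \<bullet> e = 0} g \<and>
        \<Omega> \<inter> ball p0 r = {x \<in> ball p0 r. x \<bullet> e > g (x - (x \<bullet> e) *\<^sub>R e)}"
    using dom p0 unfolding bounded_lipschitz_domain_def by (elim conjE) (erule (1) bspec)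
  then show ?thesis using that by (elim exE conjE) blast
qed

text \<open>Compactness of the boundary makes the constants of the charts uniform.\<close>

lemma lipschitz_domain_exterior_balls:
  fixes \<Omega> :: "'a::euclidean_space set"
  assumes dom: "bounded_lipschitz_domain \<Omega>"
  obtains \<eta> \<rho>0 where "0 < \<eta>" "\<eta> \<le> 1" "0 < \<rho>0" "\<rho>0 \<le> 1"
    "\<And>p \<rho>. p \<in> frontier \<Omega> \<Longrightarrow> 0 < \<rho> \<Longrightarrow> \<rho> \<le> \<rho>0 \<Longrightarrow> \<exists>z. dist p z \<le> \<rho> \<and> ball z (\<eta> * \<rho>) \<inter> \<Omega> = {}"
proof -
  have op: "open \<Omega>" and bd: "bounded \<Omega>" using dom by (auto simp: bounded_lipschitz_domain_def)
  have "\<forall>p0\<in>frontier \<Omega>. \<exists>r \<eta>. 0 < r \<and> 0 < \<eta> \<and> (\<forall>p\<in>frontier \<Omega> \<inter> ball p0 (r / 2). \<forall>\<rho>. 0 < \<rho> \<longrightarrow> \<rho> \<le> r / 8 \<longrightarrow>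
     (\<exists>z. dist p z \<le> \<rho> \<and> ball z (\<eta> * \<rho>) \<inter> \<Omega> = {}))"
  proof
    fix p0 assume "p0 \<in> frontier \<Omega>"
    then obtain r e L g where c: "0 < r" "norm e = 1" "L-lipschitz_on {y. y \<bullet> e = 0} g"
       "\<Omega> \<inter> ball p0 r = {x \<in> ball p0 r. x \<bullet> e > g (x - (x \<bullet> e) *\<^sub>R e)}"
      by (rule lipschitz_chart[OF dom])
    have "0 \<le> L" using c(3) by (rule lipschitz_on_nonneg)
    then have "0 < 1 / (1 + 2 * L)" by simp
    then show "\<exists>r \<eta>. 0 < r \<and> 0 < \<eta> \<and> (\<forall>p\<in>frontier \<Omega> \<inter> ball p0 (r / 2). \<forall>\<rho>. 0 < \<rho> \<longrightarrow> \<rho> \<le> r / 8 \<longrightarrow>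
     (\<exists>z. dist p z \<le> \<rho> \<and> ball z (\<eta> * \<rho>) \<inter> \<Omega> = {}))"
      using c(1) lipschitz_domain_local_cone[OF op c] by (intro exI[of _ r] exI[of _ "1 / (1 + 2 * L)"]) auto
  qed
  then obtain r \<eta> where r: "\<And>p0. p0 \<in> frontier \<Omega> \<Longrightarrow> 0 < r p0" "\<And>p0. p0 \<in> frontier \<Omega> \<Longrightarrow> 0 < \<eta> p0"
    and ball: "\<And>p0 p \<rho>. p0 \<in> frontier \<Omega> \<Longrightarrow> p \<in> frontier \<Omega> \<Longrightarrow> p \<in> ball p0 (r p0 / 2) \<Longrightarrow> 0 < \<rho> \<Longrightarrow> \<rho> \<le> r p0 / 8 \<Longrightarrow>
        \<exists>z. dist p z \<le> \<rho> \<and> ball z (\<eta> p0 * \<rho>) \<inter> \<Omega> = {}"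
    by (metis IntI)
  have "frontier \<Omega> \<subseteq> (\<Union>p0\<in>frontier \<Omega>. ball p0 (r p0 / 2))"
    using r(1) by fastforce
  then obtain D where D: "D \<subseteq> frontier \<Omega>" "finite D" "frontier \<Omega> \<subseteq> (\<Union>p0\<in>D. ball p0 (r p0 / 2))"
    using compactE_image[OF compact_frontier_bounded[OF bd], of "frontier \<Omega>" "\<lambda>p0. ball p0 (r p0 / 2)"] by (blast intro: open_ball)
  define m where "m = Min (insert 1 (\<eta> ` D))"
  define n where "n = Min (insert 1 ((\<lambda>p0. r p0 / 8) ` D))"
  have m: "0 < m" "m \<le> 1" unfolding m_def using D(1,2) r(2) by (subst Min_gr_iff, auto)
  have n: "0 < n" "n \<le> 1" unfolding n_def using D(1,2) r(1) by (subst Min_gr_iff, auto)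
  have m3: "m \<le> \<eta> p0" and n3: "n \<le> r p0 / 8" if "p0 \<in> D" for p0
    unfolding m_def n_def using D(2) that by (blast intro: Min_le finite.insertI finite_imageI)+
  show ?thesis
  proof (rule that[OF m(1,2) n(1,2)])
    fix p \<rho> assume p: "p \<in> frontier \<Omega>" and \<rho>: "0 < \<rho>" "\<rho> \<le> n"
    obtain p0 where p0: "p0 \<in> D" "p \<in> ball p0 (r p0 / 2)" using D(3) p by blast
    have "\<rho> \<le> r p0 / 8" using \<rho>(2) n3[OF p0(1)] by linarith
    then obtain z where z: "dist p z \<le> \<rho>" "ball z (\<eta> p0 * \<rho>) \<inter> \<Omega> = {}"
      using ball[OF _ p p0(2) \<rho>(1)] D(1) p0(1) by blast
    have "m * \<rho> \<le> \<eta> p0 * \<rho>" using m3[OF p0(1)] \<rho>(1) by (intro mult_right_mono) auto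
    then have "ball z (m * \<rho>) \<subseteq> ball z (\<eta> p0 * \<rho>)" by (rule subset_ball)
    then show "\<exists>z. dist p z \<le> \<rho> \<and> ball z (m * \<rho>) \<inter> \<Omega> = {}" using z by blast
  qed
qed

lemma suminf_const_ennreal_infinite: "c \<noteq> 0 \<Longrightarrow> (\<Sum>k::nat. c) = (\<infinity>::ennreal)"
proof (rule ccontr)
  assume c: "c \<noteq> 0" and "(\<Sum>k::nat. c) \<noteq> (\<infinity>::ennreal)"
  then obtain m where m: "(\<Sum>k::nat. c) = ennreal m" "0 \<le> m" by (cases "\<Sum>k::nat. c") auto
  have le: "of_nat n * c \<le> ennreal m" for n
    using sum_le_suminf[of "\<lambda>_::nat. c" "{..<n}"] unfolding m(1) by simp
  obtain d where d: "c = ennreal d" "0 < d"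
    using le[of 1] c by (cases c) (auto simp: top_unique)
  obtain n where "m < real n * d" using reals_Archimedean3[OF d(2)] by blast
  moreover have "ennreal (real n * d) \<le> ennreal m"
    using le[of n] d by (simp add: ennreal_mult ennreal_of_nat_eq_real_of_nat)
  ultimately show False using m(2) d(2) by (simp add: ennreal_le_iff)
qed

text \<open>Infinitely many disjoint translates of equal measure fit into a bounded set.\<close>

lemma disjoint_translates_null:
  fixes S :: "'a::euclidean_space set"
  assumes S: "S \<in> sets borel" "bounded S"
    and disj: "\<And>x y s t. x \<in> S \<Longrightarrow> y \<in> S \<Longrightarrow> x + s *\<^sub>R e = y + t *\<^sub>R e \<Longrightarrow> s = (t::real)"
  shows "emeasure lborel S = 0"
proof -
  define \<tau> where "\<tau> k = inverse (real (Suc k))" for k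
  define T where "T k = (\<lambda>x. x + \<tau> k *\<^sub>R e) -` S" for k
  have T: "T k \<in> sets borel" for k
    unfolding T_def using S(1) by (intro measurable_sets_borel) auto
  have eT: "emeasure lborel (T k) = emeasure lborel S" for k
  proof -
    have "emeasure lborel (T k) = (\<integral>\<^sup>+x. indicator S (x + \<tau> k *\<^sub>R e) \<partial>lborel)"
    proof -
      have "emeasure lborel (T k) = (\<integral>\<^sup>+x. indicator (T k) x \<partial>lborel)"
        by (rule nn_integral_indicator[symmetric]) (simp add: T)
      moreover have "indicator (T k) x = (indicator S (x + \<tau> k *\<^sub>R e) :: ennreal)" for x
        by (simp add: T_def indicator_def)
      ultimately show ?thesis by simp
    qed
    also have "\<dots> = (\<integral>\<^sup>+x. indicator S x \<partial>lborel)" by (rule nn_integral_translate) (use S in simp)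
    finally show ?thesis using S by simp
  qed
  have dT: "disjoint_family T"
    unfolding disjoint_family_on_def
  proof (intro ballI impI, rule ccontr)
    fix i j :: nat assume ij: "i \<noteq> j" and "T i \<inter> T j \<noteq> {}"
    then obtain x where x: "x + \<tau> i *\<^sub>R e \<in> S" "x + \<tau> j *\<^sub>R e \<in> S" by (auto simp: T_def)
    have "(x + \<tau> i *\<^sub>R e) + \<tau> j *\<^sub>R e = (x + \<tau> j *\<^sub>R e) + \<tau> i *\<^sub>R e" by simp
    from disj[OF x this] ij show False by (simp add: \<tau>_def)
  qed
  obtain B where B: "\<And>x. x \<in> S \<Longrightarrow> norm x \<le> B" using S(2) by (auto simp: bounded_iff)
  have sub: "(\<Union>k. T k) \<subseteq> cball 0 (B + norm e)"
  proof
    fix x assume "x \<in> (\<Union>k. T k)"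
    then obtain k where "x + \<tau> k *\<^sub>R e \<in> S" by (auto simp: T_def)
    then have "norm (x + \<tau> k *\<^sub>R e) \<le> B" by (rule B)
    moreover have "norm x \<le> norm (x + \<tau> k *\<^sub>R e) + norm (\<tau> k *\<^sub>R e)" using norm_triangle_ineq4[of "x + \<tau> k *\<^sub>R e" "\<tau> k *\<^sub>R e"] by simp
    moreover have "norm (\<tau> k *\<^sub>R e) \<le> 1 * norm e" unfolding norm_scaleR by (rule mult_right_mono) (auto simp: \<tau>_def inverse_le_1_iff)
    ultimately show "x \<in> cball 0 (B + norm e)" by simp
  qed
  have "(\<Sum>k. emeasure lborel (T k)) = emeasure lborel (\<Union>k. T k)"
    using T dT by (intro suminf_emeasure) auto
  also have "\<dots> \<le> emeasure lborel (cball (0::'a) (B + norm e))" by (rule emeasure_mono[OF sub]) simp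
  also have "\<dots> < \<infinity>" by (rule emeasure_bounded_finite) simp
  finally have fin: "(\<Sum>k::nat. emeasure lborel S) < \<infinity>" unfolding eT .
  show ?thesis
  proof (rule ccontr)
    assume "emeasure lborel S \<noteq> 0"
    then have "(\<Sum>k::nat. emeasure lborel S) = \<infinity>"
      by (rule suminf_const_ennreal_infinite)
    then show False using fin by simp
  qed
qed

text \<open>In a chart the boundary is contained in a graph over the hyperplane orthogonal to $e$, and different
  translates of a graph in the direction $e$ are disjoint.\<close>

lemma lipschitz_frontier_null:
  fixes \<Omega> :: "'a::euclidean_space set"
  assumes dom: "bounded_lipschitz_domain \<Omega>"
  shows "emeasure lborel (frontier \<Omega>) = 0"
proof -
  have op: "open \<Omega>" and bd: "bounded \<Omega>" using dom by (auto simp: bounded_lipschitz_domain_def)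
  have loc: "\<exists>r>0. emeasure lborel (frontier \<Omega> \<inter> ball p0 r) = 0" if p0: "p0 \<in> frontier \<Omega>" for p0
  proof -
    obtain r e L g where c: "0 < r" "norm e = 1" "L-lipschitz_on {y. y \<bullet> e = 0} g"
       "\<Omega> \<inter> ball p0 r = {x \<in> ball p0 r. x \<bullet> e > g (x - (x \<bullet> e) *\<^sub>R e)}"
      by (rule lipschitz_chart[OF dom p0])
    have ee: "e \<bullet> e = 1" using c(2) by (simp add: norm_eq_1)
    have mem: "x \<in> \<Omega> \<longleftrightarrow> g (x - (x \<bullet> e) *\<^sub>R e) < x \<bullet> e" if "x \<in> ball p0 r" for x
      using c(4) that by blast
    let ?G = "\<lambda>x. g (x - (x \<bullet> e) *\<^sub>R e)"
    have "continuous_on UNIV ?G"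
    proof (rule continuous_on_compose2[OF lipschitz_on_continuous_on[OF c(3)]])
      show "continuous_on UNIV (\<lambda>x. x - (x \<bullet> e) *\<^sub>R e)" by (intro continuous_intros)
    qed (auto simp: inner_diff_left ee)
    then have opn: "open {x. x \<bullet> e < ?G x}" by (intro open_Collect_less continuous_intros)
    have graph: "x \<bullet> e = ?G x" if x: "x \<in> frontier \<Omega> \<inter> ball p0 r" for x
    proof (rule antisym)
      have "x \<notin> \<Omega>" using x op by (simp add: frontier_def interior_open)
      then show "x \<bullet> e \<le> ?G x" using mem[of x] x by simp
      show "?G x \<le> x \<bullet> e"
      proof (rule ccontr)
        assume "\<not> ?G x \<le> x \<bullet> e"
        then have "x \<in> {x. x \<bullet> e < ?G x} \<inter> ball p0 r" using x by simp
        moreover have "open ({x. x \<bullet> e < ?G x} \<inter> ball p0 r)" using opn by (intro open_Int) auto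
        moreover have "x \<in> closure \<Omega>" using x by (simp add: frontier_def)
        ultimately obtain y where "y \<in> \<Omega>" "y \<in> {x. x \<bullet> e < ?G x} \<inter> ball p0 r"
          unfolding closure_iff_nhds_not_empty by blast
        then show False using mem[of y] by simp
      qed
    qed
    have "emeasure lborel (frontier \<Omega> \<inter> ball p0 r) = 0"
    proof (rule disjoint_translates_null)
      show "frontier \<Omega> \<inter> ball p0 r \<in> sets borel" by (rule sets.Int[OF borel_closed[OF frontier_closed] borel_open[OF open_ball]])
      show "bounded (frontier \<Omega> \<inter> ball p0 r)" by (meson bounded_ball bounded_subset inf_le2)
      fix x y s t assume x: "x \<in> frontier \<Omega> \<inter> ball p0 r" and y: "y \<in> frontier \<Omega> \<inter> ball p0 r" and eq: "x + s *\<^sub>R e = y + t *\<^sub>R e"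
      have y': "y = x + (s - t) *\<^sub>R e" using eq by (simp add: algebra_simps)
      have "y - (y \<bullet> e) *\<^sub>R e = x - (x \<bullet> e) *\<^sub>R e" unfolding y' by (simp add: inner_add_left ee algebra_simps)
      then have "y \<bullet> e = x \<bullet> e" using graph[OF x] graph[OF y] by simp
      then show "s = t" unfolding y' by (simp add: inner_add_left ee)
    qed
    then show ?thesis using c(1) by blast
  qed
  then obtain r where r: "\<And>p0. p0 \<in> frontier \<Omega> \<Longrightarrow> 0 < r p0" "\<And>p0. p0 \<in> frontier \<Omega> \<Longrightarrow> emeasure lborel (frontier \<Omega> \<inter> ball p0 (r p0)) = 0"
    by metis
  have "frontier \<Omega> \<subseteq> (\<Union>p0\<in>frontier \<Omega>. ball p0 (r p0))" using r(1) by fastforce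
  then obtain D where D: "D \<subseteq> frontier \<Omega>" "finite D" "frontier \<Omega> \<subseteq> (\<Union>p0\<in>D. ball p0 (r p0))"
    using compactE_image[OF compact_frontier_bounded[OF bd], of "frontier \<Omega>" "\<lambda>p0. ball p0 (r p0)"] by (blast intro: open_ball)
  have ms: "frontier \<Omega> \<inter> ball p0 (r p0) \<in> sets lborel" for p0 by (simp add: sets.Int borel_closed)
  have "emeasure lborel (frontier \<Omega>) \<le> emeasure lborel (\<Union>p0\<in>D. frontier \<Omega> \<inter> ball p0 (r p0))"
  proof (rule emeasure_mono)
    show "frontier \<Omega> \<subseteq> (\<Union>p0\<in>D. frontier \<Omega> \<inter> ball p0 (r p0))" using D(3) by blast
    show "(\<Union>p0\<in>D. frontier \<Omega> \<inter> ball p0 (r p0)) \<in> sets lborel" using D(2) ms by (intro sets.finite_UN)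
  qed
  also have "\<dots> \<le> (\<Sum>p0\<in>D. emeasure lborel (frontier \<Omega> \<inter> ball p0 (r p0)))"
    using D(2) ms by (intro emeasure_subadditive_finite) auto
  also have "\<dots> = 0" using D(1) r(2) by (intro sum.neutral) blast
  finally show ?thesis by simp
qed

section \<open>The Hardy inequality for functions vanishing outside the domain\<close>

text \<open>For functions that vanish outside \<open>\<Omega>\<close>, the full and the regional operator differ on \<open>\<Omega>\<close> by multiplication
  with this weight, up to the constant \<^const>\<open>frac_const\<close>.\<close>

definition kap :: "real \<Rightarrow> 'a::euclidean_space set \<Rightarrow> 'a \<Rightarrow> ennreal" where
  "kap a \<Omega> x = (\<integral>\<^sup>+y. indicator (- \<Omega>) y * ennreal (kern a (x - y)) \<partial>lborel)"

lemma kap_measurable [measurable]: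
  fixes \<Omega> :: "'a::euclidean_space set"
  assumes [measurable]: "\<Omega> \<in> sets borel"
  shows "kap a \<Omega> \<in> borel_measurable borel"
  unfolding kap_def[abs_def] by measurable

text \<open>The complement of \<open>\<Omega>\<close> has distance at least $d$ from $x$; the integral over $|h| \ge d$ scales like $d^{-2a}$.\<close>

lemma kap_upper:
  fixes x :: "'a::euclidean_space"
  assumes a: "0 < a" and d: "0 < d" "ball x d \<subseteq> \<Omega>"
  shows "kap a \<Omega> x \<le> ennreal (d powr - (2 * a)) * (\<integral>\<^sup>+h. indicator {h. 1 \<le> norm h} h * ennreal (kern a h) \<partial>(lborel :: 'a measure))"
proof -
  let ?p = "real DIM('a) + 2 * a"
  let ?f = "\<lambda>h::'a. indicator {h. 1 \<le> norm h} h * ennreal (kern a h)"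
  have "kap a \<Omega> x \<le> (\<integral>\<^sup>+y. ennreal (d powr - ?p) * ?f (inverse d *\<^sub>R (x - y)) \<partial>lborel)"
    unfolding kap_def
  proof (rule nn_integral_mono)
    fix y
    show "indicator (- \<Omega>) y * ennreal (kern a (x - y)) \<le> ennreal (d powr - ?p) * ?f (inverse d *\<^sub>R (x - y))"
    proof (cases "y \<in> \<Omega>")
      case False
      then have "y \<notin> ball x d" using d(2) by blast
      then have n: "d \<le> norm (x - y)" by (simp add: dist_norm)
      then have "1 \<le> norm (inverse d *\<^sub>R (x - y))" using d(1) by (simp only: norm_scaleR) (simp add: field_simps)
      moreover have "kern a (x - y) = d powr - ?p * kern a (inverse d *\<^sub>R (x - y))"
        using d(1) n by (simp add: kern_def powr_mult[symmetric] mult.assoc[symmetric])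
      ultimately show ?thesis using False by (simp add: ennreal_mult)
    qed simp
  qed
  also have "\<dots> = ennreal (d powr - ?p) * (\<integral>\<^sup>+y. ?f (inverse d *\<^sub>R (x - y)) \<partial>lborel)"
    by (rule nn_integral_cmult) measurable
  also have "(\<integral>\<^sup>+y. ?f (inverse d *\<^sub>R (x - y)) \<partial>lborel) = (\<integral>\<^sup>+y. ?f (inverse d *\<^sub>R y) \<partial>lborel)"
    by (rule nn_integral_diff_left[of "\<lambda>y. ?f (inverse d *\<^sub>R y)"]) measurable
  also have "\<dots> = ennreal (inverse (\<bar>inverse d\<bar> ^ DIM('a))) * (\<integral>\<^sup>+h. ?f h \<partial>lborel)"
    by (rule nn_integral_scaleR) (use d(1) in auto)
  also have "ennreal (d powr - ?p) * (ennreal (inverse (\<bar>inverse d\<bar> ^ DIM('a))) * (\<integral>\<^sup>+h. ?f h \<partial>lborel))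
     = ennreal (d powr - ?p * d ^ DIM('a)) * (\<integral>\<^sup>+h. ?f h \<partial>lborel)"
    using d(1) by (simp add: ennreal_mult mult.assoc power_inverse)
  also have "d powr - ?p * d ^ DIM('a) = d powr - (2 * a)"
    unfolding powr_realpow[OF d(1), symmetric] by (rule powr_add_eq) simp
  finally show ?thesis .
qed

text \<open>All points of the exterior ball lie within distance $3d$ of $x$.\<close>

lemma kap_lower:
  fixes x z :: "'a::euclidean_space"
  assumes t: "0 < t" and d: "0 < d" "dist x z \<le> 2 * d" and \<eta>: "0 < \<eta>" "\<eta> \<le> 1" "ball z (\<eta> * d) \<inter> \<Omega> = {}"
  shows "ennreal (3 powr - (real DIM('a) + 2 * t) * unit_ball_vol (real DIM('a)) * \<eta> ^ DIM('a) * d powr - (2 * t)) \<le> kap t \<Omega> x"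
proof -
  let ?p = "real DIM('a) + 2 * t"
  have "ennreal ((3 * d) powr - ?p) * emeasure lborel (ball z (\<eta> * d)) = (\<integral>\<^sup>+y. ennreal ((3 * d) powr - ?p) * indicator (ball z (\<eta> * d)) y \<partial>lborel)"
    by (rule nn_integral_cmult_indicator[symmetric]) simp
  also have "\<dots> \<le> (\<integral>\<^sup>+y. indicator (- \<Omega>) y * ennreal (kern t (x - y)) + indicator {x} y * top \<partial>lborel)"
  proof (rule nn_integral_mono)
    fix y
    show "ennreal ((3 * d) powr - ?p) * indicator (ball z (\<eta> * d)) y \<le> indicator (- \<Omega>) y * ennreal (kern t (x - y)) + indicator {x} y * top"
    proof (cases "y \<in> ball z (\<eta> * d) \<and> y \<noteq> x")
      case True
      have "\<eta> * d \<le> 1 * d" using \<eta> d by (intro mult_right_mono) auto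
      then have "dist x y \<le> 3 * d" using True d(2) dist_triangle[of x y z] by simp
      then have "norm (x - y) \<le> 3 * d" by (simp add: dist_norm)
      then have "(3 * d) powr - ?p \<le> kern t (x - y)" unfolding kern_def using True t by (intro powr_neg_le) auto
      moreover have "y \<notin> \<Omega>" using True \<eta>(3) by blast
      ultimately show ?thesis using True by (simp add: ennreal_leI)
    next
      case False
      then show ?thesis by (cases "y = x") simp_all
    qed
  qed
  also have "\<dots> = kap t \<Omega> x"
    unfolding kap_def
  proof (rule nn_integral_cong_AE)
    have "AE y in lborel. y \<noteq> x" by (rule AE_lborel_singleton)
    then show "AE y in lborel. indicator (- \<Omega>) y * ennreal (kern t (x - y)) + indicator {x} y * top = indicator (- \<Omega>) y * ennreal (kern t (x - y))"
      by eventually_elim simp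
  qed
  finally have le: "ennreal ((3 * d) powr - ?p) * emeasure lborel (ball z (\<eta> * d)) \<le> kap t \<Omega> x" .
  have "emeasure lborel (ball z (\<eta> * d)) = ennreal (unit_ball_vol (real DIM('a)) * (\<eta> * d) ^ DIM('a))"
    using \<eta> d by (intro emeasure_ball) simp
  then have "ennreal ((3 * d) powr - ?p) * emeasure lborel (ball z (\<eta> * d)) = ennreal ((3 * d) powr - ?p * (unit_ball_vol (real DIM('a)) * (\<eta> * d) ^ DIM('a)))"
    by (simp add: ennreal_mult')
  also have "(3 * d) powr - ?p * (unit_ball_vol (real DIM('a)) * (\<eta> * d) ^ DIM('a))
     = 3 powr - ?p * unit_ball_vol (real DIM('a)) * \<eta> ^ DIM('a) * (d powr - ?p * d ^ DIM('a))"
    using d(1) by (simp add: powr_mult power_mult_distrib)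
  also have "d powr - ?p * d ^ DIM('a) = d powr - (2 * t)"
    unfolding powr_realpow[OF d(1), symmetric] by (rule powr_add_eq) simp
  finally show ?thesis using le by simp
qed

text \<open>With $d$ the distance to the boundary, $\kappa_a^2$ is at most of order $d^{-4a}$, and near the boundary
  $\kappa_t$ is at least of order $d^{-2t}$, where $4a \le 2t$. Away from the boundary $\kappa_a$ is bounded.\<close>

lemma kap_square_le:
  fixes \<Omega> :: "'a::euclidean_space set"
  assumes dom: "bounded_lipschitz_domain \<Omega>" and a: "0 < a" "2 * a \<le> t"
  obtains C1 C2 where "C1 < \<infinity>" "C2 < \<infinity>" "\<And>x. x \<in> \<Omega> \<Longrightarrow> (kap a \<Omega> x)\<^sup>2 \<le> C1 * kap t \<Omega> x + C2"
proof -
  have t: "0 < t" using a by simp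
  have op: "open \<Omega>" and bd: "bounded \<Omega>" using dom by (auto simp: bounded_lipschitz_domain_def)
  obtain \<eta> \<rho>0 where \<eta>: "0 < \<eta>" "\<eta> \<le> 1" and \<rho>0: "0 < \<rho>0" "\<rho>0 \<le> 1"
    and balls: "\<And>p \<rho>. p \<in> frontier \<Omega> \<Longrightarrow> 0 < \<rho> \<Longrightarrow> \<rho> \<le> \<rho>0 \<Longrightarrow> \<exists>z. dist p z \<le> \<rho> \<and> ball z (\<eta> * \<rho>) \<inter> \<Omega> = {}"
    using lipschitz_domain_exterior_balls[OF dom] by blast
  define I where "I = (\<integral>\<^sup>+h. indicator {h. 1 \<le> norm h} h * ennreal (kern a h) \<partial>(lborel :: 'a measure))"
  have I: "I < \<infinity>" unfolding I_def by (rule nn_integral_kern_large[OF a(1)])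
  define c where "c = 3 powr - (real DIM('a) + 2 * t) * unit_ball_vol (real DIM('a)) * \<eta> ^ DIM('a)"
  have c: "0 < c" unfolding c_def using \<eta> by (intro mult_pos_pos unit_ball_vol_pos zero_less_power) auto
  have ne: "frontier \<Omega> \<noteq> {}"
  proof -
    have "\<Omega> \<noteq> {}" "\<Omega> \<noteq> UNIV" using dom bd not_bounded_UNIV by (auto simp: bounded_lipschitz_domain_def)
    then show ?thesis by (rule frontier_not_empty)
  qed
  have bound: "(kap a \<Omega> x)\<^sup>2 \<le> (I\<^sup>2 * ennreal (1 / c)) * kap t \<Omega> x + I\<^sup>2 * ennreal (\<rho>0 powr - (4 * a))" if x: "x \<in> \<Omega>" for x
  proof -
    obtain p where p: "p \<in> frontier \<Omega>" "\<And>y. y \<in> frontier \<Omega> \<Longrightarrow> dist x p \<le> dist x y"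
      using distance_attains_inf[OF frontier_closed ne, of x] by blast
    define d where "d = dist x p"
    have "x \<noteq> p" using x p(1) op by (auto simp: frontier_def interior_open)
    then have d: "0 < d" by (simp add: d_def)
    have sub: "ball x d \<subseteq> \<Omega>"
    proof (rule ccontr)
      assume "\<not> ball x d \<subseteq> \<Omega>"
      then have "ball x d - \<Omega> \<noteq> {}" by blast
      moreover have "ball x d \<inter> \<Omega> \<noteq> {}" using x d by (metis IntI centre_in_ball empty_iff)
      ultimately have "ball x d \<inter> frontier \<Omega> \<noteq> {}"
        by (intro connected_Int_frontier[OF connected_ball])
      then obtain y where y: "y \<in> ball x d" "y \<in> frontier \<Omega>" by blast
      then show False using p(2)[OF y(2)] by (simp add: d_def)
    qed
    have "kap a \<Omega> x \<le> ennreal (d powr - (2 * a)) * I" unfolding I_def by (rule kap_upper[OF a(1) d sub])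
    then have "(kap a \<Omega> x)\<^sup>2 \<le> (ennreal (d powr - (2 * a)) * I)\<^sup>2" by (rule power_mono) simp
    also have "\<dots> = I\<^sup>2 * ennreal (d powr - (4 * a))"
      by (simp add: power_mult_distrib ennreal_power powr_square mult.commute)
    finally have up: "(kap a \<Omega> x)\<^sup>2 \<le> I\<^sup>2 * ennreal (d powr - (4 * a))" .
    show ?thesis
    proof (cases "d \<le> \<rho>0")
      case True
      obtain z where z: "dist p z \<le> d" "ball z (\<eta> * d) \<inter> \<Omega> = {}" using balls[OF p(1) d True] by blast
      have "dist x z \<le> 2 * d" using dist_triangle[of x z p] z(1) unfolding d_def by linarith
      from kap_lower[OF t d this \<eta> z(2)] have low: "ennreal (c * d powr - (2 * t)) \<le> kap t \<Omega> x" unfolding c_def .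
      have "d powr - (4 * a) \<le> d powr - (2 * t)" using d True \<rho>0 a by (intro powr_mono') auto
      also have "\<dots> = (1 / c) * (c * d powr - (2 * t))" using c by simp
      finally have "ennreal (d powr - (4 * a)) \<le> ennreal (1 / c) * ennreal (c * d powr - (2 * t))"
        using c by (subst ennreal_mult[symmetric]) (auto intro!: ennreal_leI)
      also have "\<dots> \<le> ennreal (1 / c) * kap t \<Omega> x" by (rule mult_left_mono[OF low]) simp
      finally have "I\<^sup>2 * ennreal (d powr - (4 * a)) \<le> I\<^sup>2 * (ennreal (1 / c) * kap t \<Omega> x)" by (rule mult_left_mono) simp
      then show ?thesis using up by (intro add_increasing2) (auto simp: mult.assoc)
    next
      case False
      have "d powr - (4 * a) \<le> \<rho>0 powr - (4 * a)" using False \<rho>0 a by (intro powr_neg_le) auto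
      then have "I\<^sup>2 * ennreal (d powr - (4 * a)) \<le> I\<^sup>2 * ennreal (\<rho>0 powr - (4 * a))" by (intro mult_left_mono ennreal_leI) auto
      then show ?thesis using up by (intro add_increasing) auto
    qed
  qed
  show ?thesis
    by (rule that[OF _ _ bound]) (use I in \<open>auto simp: ennreal_mult_less_top power2_eq_square\<close>)
qed

text \<open>For a function that vanishes outside \<open>\<Omega>\<close>, the part of its Gagliardo seminorm with one point outside
  \<open>\<Omega>\<close> is exactly the weighted norm with weight \<open>kap\<close>.\<close>

lemma hardy_finite:
  fixes u :: "'a::euclidean_space \<Rightarrow> real"
  assumes dom: "bounded_lipschitz_domain \<Omega>" and a: "0 < a" "2 * a \<le> t" "t < 1"
    and u: "u \<in> sobolev t" and z: "\<And>x. x \<notin> \<Omega> \<Longrightarrow> u x = 0"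
  shows "(\<integral>\<^sup>+x. (kap a \<Omega> x)\<^sup>2 * ennreal ((u x)\<^sup>2) \<partial>lborel) < \<infinity>"
proof -
  have t: "0 < t" using a by simp
  have [measurable]: "\<Omega> \<in> sets borel" using dom by (auto simp: bounded_lipschitz_domain_def)
  note uL = sobolev_L2[OF u]
  note [measurable] = L2_measurable[OF uL]
  obtain C1 C2 where C: "C1 < \<infinity>" "C2 < \<infinity>" "\<And>x. x \<in> \<Omega> \<Longrightarrow> (kap a \<Omega> x)\<^sup>2 \<le> C1 * kap t \<Omega> x + C2"
    using kap_square_le[OF dom a(1,2)] by blast
  have "(\<integral>\<^sup>+x. kap t \<Omega> x * ennreal ((u x)\<^sup>2) \<partial>lborel) \<le> (\<integral>\<^sup>+x. (\<integral>\<^sup>+y. ennreal (kern t (x - y) * (u x - u y)\<^sup>2) \<partial>lborel) \<partial>lborel)"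
  proof (rule nn_integral_mono)
    fix x
    have "kap t \<Omega> x * ennreal ((u x)\<^sup>2) = (\<integral>\<^sup>+y. indicator (- \<Omega>) y * ennreal (kern t (x - y)) * ennreal ((u x)\<^sup>2) \<partial>lborel)"
      unfolding kap_def by (rule nn_integral_multc[symmetric]) measurable
    also have "\<dots> \<le> (\<integral>\<^sup>+y. ennreal (kern t (x - y) * (u x - u y)\<^sup>2) \<partial>lborel)"
      by (rule nn_integral_mono) (auto simp: indicator_def z ennreal_mult)
    finally show "kap t \<Omega> x * ennreal ((u x)\<^sup>2) \<le> (\<integral>\<^sup>+y. ennreal (kern t (x - y) * (u x - u y)\<^sup>2) \<partial>lborel)" .
  qed
  also have "\<dots> < \<infinity>"
    by (rule gagliardo_finite[OF t a(3) uL]) (use u t in \<open>simp add: sobolev_iff\<close>)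
  finally have fin: "(\<integral>\<^sup>+x. kap t \<Omega> x * ennreal ((u x)\<^sup>2) \<partial>lborel) < \<infinity>" .
  have "(\<integral>\<^sup>+x. (kap a \<Omega> x)\<^sup>2 * ennreal ((u x)\<^sup>2) \<partial>lborel) \<le> (\<integral>\<^sup>+x. C1 * (kap t \<Omega> x * ennreal ((u x)\<^sup>2)) + C2 * ennreal ((norm (u x))\<^sup>2) \<partial>lborel)"
  proof (rule nn_integral_mono)
    fix x
    show "(kap a \<Omega> x)\<^sup>2 * ennreal ((u x)\<^sup>2) \<le> C1 * (kap t \<Omega> x * ennreal ((u x)\<^sup>2)) + C2 * ennreal ((norm (u x))\<^sup>2)"
    proof (cases "x \<in> \<Omega>")
      case True
      show ?thesis using mult_right_mono[OF C(3)[OF True], of "ennreal ((u x)\<^sup>2)"] by (simp add: distrib_right mult.assoc)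
    qed (simp add: z)
  qed
  also have "\<dots> = C1 * (\<integral>\<^sup>+x. kap t \<Omega> x * ennreal ((u x)\<^sup>2) \<partial>lborel) + C2 * norm2sq u"
    unfolding norm2sq_def by (subst nn_integral_add) (auto simp: nn_integral_cmult)
  also have "\<dots> < \<infinity>" using fin C norm2sq_finite[OF uL] by (simp add: ennreal_mult_less_top)
  finally show ?thesis .
qed

section \<open>The regional fractional Laplacian\<close>

definition reg_trunc :: "real \<Rightarrow> 'a::euclidean_space set \<Rightarrow> real \<Rightarrow> ('a \<Rightarrow> real) \<Rightarrow> 'a \<Rightarrow> real" where
  "reg_trunc a \<Omega> e u x = indicator \<Omega> x * (LINT y|lborel. indicator \<Omega> y * kern_trunc a e (x - y) * (u x - u y))"

text \<open>The limit of \<open>reg_trunc\<close> as the truncation is removed, for functions that vanish outside \<open>\<Omega>\<close>.\<close>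

definition reg_limit :: "real \<Rightarrow> 'a::euclidean_space set \<Rightarrow> ('a \<Rightarrow> real) \<Rightarrow> 'a \<Rightarrow> real" where
  "reg_limit a \<Omega> u x = indicator \<Omega> x * (symb_const TYPE('a) a * frac_laplacian a u x) - enn2real (kap a \<Omega> x) * u x"

lemma reg_trunc_measurable [measurable]:
  assumes [measurable]: "\<Omega> \<in> sets borel" "u \<in> borel_measurable borel"
  shows "reg_trunc a \<Omega> e u \<in> borel_measurable borel"
  unfolding reg_trunc_def[abs_def] by measurable

lemma kap_finite:
  assumes "open \<Omega>" "x \<in> \<Omega>" "0 < a"
  shows "kap a \<Omega> x < \<infinity>"
proof -
  obtain d where d: "0 < d" "ball x d \<subseteq> \<Omega>" using assms(1,2) open_contains_ball by blast
  show ?thesis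
    by (rule order.strict_trans1[OF kap_upper[OF assms(3) d]])
       (use nn_integral_kern_large[OF assms(3), where 'a='a] in \<open>auto simp: ennreal_mult_less_top\<close>)
qed

lemma integrable_kern_outside:
  fixes \<Omega> :: "'a::euclidean_space set"
  assumes "open \<Omega>" "x \<in> \<Omega>" "0 < a"
  shows "integrable lborel (\<lambda>y. indicator (- \<Omega>) y * kern a (x - y))"
    and "(LINT y|lborel. indicator (- \<Omega>) y * kern a (x - y)) = enn2real (kap a \<Omega> x)"
proof -
  have [measurable]: "\<Omega> \<in> sets borel" using assms(1) by simp
  have e: "(\<integral>\<^sup>+y. ennreal (indicator (- \<Omega>) y * kern a (x - y)) \<partial>lborel) = kap a \<Omega> x"
    unfolding kap_def by (rule nn_integral_cong) (simp add: indicator_def)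
  show "integrable lborel (\<lambda>y. indicator (- \<Omega>) y * kern a (x - y))"
    by (rule integrableI_nonneg) (use kap_finite[OF assms] in \<open>auto simp: e\<close>)
  show "(LINT y|lborel. indicator (- \<Omega>) y * kern a (x - y)) = enn2real (kap a \<Omega> x)"
    unfolding e[symmetric] by (rule integral_eq_nn_integral) auto
qed

definition kap_trunc :: "real \<Rightarrow> 'a::euclidean_space set \<Rightarrow> real \<Rightarrow> 'a \<Rightarrow> real" where
  "kap_trunc a \<Omega> e x = (LINT y|lborel. indicator (- \<Omega>) y * kern_trunc a e (x - y))"

lemma kap_trunc_bounds:
  fixes \<Omega> :: "'a::euclidean_space set"
  assumes "open \<Omega>" "x \<in> \<Omega>" "0 < a"
  shows "0 \<le> kap_trunc a \<Omega> e x" "kap_trunc a \<Omega> e x \<le> enn2real (kap a \<Omega> x)"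
    "f \<longlonglongrightarrow> 0 \<Longrightarrow> (\<And>k. 0 < f k) \<Longrightarrow> (\<lambda>k. kap_trunc a \<Omega> (f k) x) \<longlonglongrightarrow> enn2real (kap a \<Omega> x)"
proof -
  have [measurable]: "\<Omega> \<in> sets borel" using assms(1) by simp
  note i = integrable_kern_outside[OF assms]
  have le: "norm (indicator (- \<Omega>) y * kern_trunc a e (x - y)) \<le> indicator (- \<Omega>) y * kern a (x - y)" for y e
    using kern_trunc_le[of a e "x - y"] by (simp add: indicator_def)
  have ti: "integrable lborel (\<lambda>y. indicator (- \<Omega>) y * kern_trunc a e (x - y))" for e
    by (rule Bochner_Integration.integrable_bound[OF i(1)]) (measurable, use order.trans[OF le abs_ge_self] in auto)
  show "0 \<le> kap_trunc a \<Omega> e x" unfolding kap_trunc_def by (intro integral_nonneg_AE) auto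
  show "kap_trunc a \<Omega> e x \<le> enn2real (kap a \<Omega> x)"
    unfolding kap_trunc_def i(2)[symmetric] by (rule integral_mono[OF ti i(1)]) (use le in auto)
  assume f: "f \<longlonglongrightarrow> 0" "\<And>k. 0 < f k"
  show "(\<lambda>k. kap_trunc a \<Omega> (f k) x) \<longlonglongrightarrow> enn2real (kap a \<Omega> x)"
    unfolding kap_trunc_def i(2)[symmetric]
  proof (rule integral_dominated_convergence[OF _ _ i(1)])
    show "AE y in lborel. (\<lambda>k. indicator (- \<Omega>) y * kern_trunc a (f k) (x - y)) \<longlonglongrightarrow> indicator (- \<Omega>) y * kern a (x - y)"
    proof (rule AE_I2)
      fix y
      show "(\<lambda>k. indicator (- \<Omega>) y * kern_trunc a (f k) (x - y)) \<longlonglongrightarrow> indicator (- \<Omega>) y * kern a (x - y)"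
      proof (cases "x = y")
        case True
        then show ?thesis using assms(2) by simp
      next
        case False
        then have "\<forall>\<^sub>F k in sequentially. f k < norm (x - y)" using f by (intro order_tendstoD(2)[OF f(1)]) auto
        then show ?thesis by (intro tendsto_eventually) (erule eventually_mono, simp add: kern_trunc_def indicator_def)
      qed
    qed
  qed (use le in auto)
qed

lemma kap_trunc_measurable [measurable]:
  assumes [measurable]: "\<Omega> \<in> sets borel"
  shows "kap_trunc a \<Omega> e \<in> borel_measurable borel"
  unfolding kap_trunc_def[abs_def] by measurable

text \<open>The truncated integral over \<open>\<Omega>\<close> is the one over the whole space minus the part over the complement of
  \<open>\<Omega>\<close>, where $U$ is zero.\<close>

lemma reg_trunc_eq:
  fixes U :: "'a::euclidean_space \<Rightarrow> real"
  assumes a: "0 < a" "a < 1" and \<Omega>: "open \<Omega>" and U: "L2_on UNIV U" and z: "\<And>x. x \<notin> \<Omega> \<Longrightarrow> U x = 0" and e: "0 < e"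
  shows "AE x in lborel. reg_trunc a \<Omega> e U x = indicator \<Omega> x * sing_trunc a e U x - kap_trunc a \<Omega> e x * U x"
proof -
  note [measurable] = L2_measurable[OF U]
  have [measurable]: "\<Omega> \<in> sets borel" using \<Omega> by simp
  note k = integrable_kern_trunc[OF a(1) e, where 'a='a]
  show ?thesis using corr_AE_integrable[OF k U]
  proof eventually_elim
    case (elim x)
    show ?case
    proof (cases "x \<in> \<Omega>")
      case True
      have "integrable lborel (\<lambda>h. kern_trunc a e h * (U x - U (x + h)))"
        unfolding right_diff_distrib by (intro Bochner_Integration.integrable_diff integrable_mult_left k elim)
      from integrable_translate[OF this, of "- x"]
      have i: "integrable lborel (\<lambda>y. kern_trunc a e (x - y) * (U x - U y))"
        using kern_trunc_minus[of a e] by (simp add: minus_diff_eq[symmetric, of x] del: minus_diff_eq)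
      have "sing_trunc a e U x = (LINT y|lborel. kern_trunc a e (y + - x) * (U x - U (x + (y + - x))))"
        unfolding sing_trunc_def[OF a] by (rule integral_translate[symmetric, of "\<lambda>h. kern_trunc a e h * (U x - U (x + h))"]) measurable
      also have "\<dots> = (LINT y|lborel. kern_trunc a e (x - y) * (U x - U y))"
      proof (rule Bochner_Integration.integral_cong[OF refl])
        fix y show "kern_trunc a e (y + - x) * (U x - U (x + (y + - x))) = kern_trunc a e (x - y) * (U x - U y)"
          using kern_trunc_minus[of a e "x - y"] by simp
      qed
      also have "\<dots> = (LINT y|lborel. indicator \<Omega> y * kern_trunc a e (x - y) * (U x - U y) + (indicator (- \<Omega>) y * kern_trunc a e (x - y)) * U x)"
        by (rule Bochner_Integration.integral_cong[OF refl]) (auto simp: indicator_def z)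
      also have "\<dots> = (LINT y|lborel. indicator \<Omega> y * kern_trunc a e (x - y) * (U x - U y)) + kap_trunc a \<Omega> e x * U x"
      proof (subst Bochner_Integration.integral_add)
        show "integrable lborel (\<lambda>y. indicator \<Omega> y * kern_trunc a e (x - y) * (U x - U y))"
          by (rule Bochner_Integration.integrable_bound[OF i]) (measurable, auto simp: indicator_def)
        have kt: "integrable lborel (\<lambda>y. indicator (- \<Omega>) y * kern_trunc a e (x - y))"
        proof (rule Bochner_Integration.integrable_bound[OF integrable_kern_outside(1)[OF \<Omega> True a(1)]])
          show "AE y in lborel. norm (indicator (- \<Omega>) y * kern_trunc a e (x - y)) \<le> norm (indicator (- \<Omega>) y * kern a (x - y))"
            by (rule AE_I2) (simp add: indicator_def kern_trunc_le)
        qed measurable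
        then show "integrable lborel (\<lambda>y. indicator (- \<Omega>) y * kern_trunc a e (x - y) * U x)" by (rule integrable_mult_left)
      qed (simp add: kap_trunc_def)
      finally show ?thesis using True by (simp add: reg_trunc_def)
    qed (simp add: reg_trunc_def z)
  qed
qed

context
  fixes \<Omega> :: "'a::euclidean_space set" and a t :: real and U :: "'a \<Rightarrow> real"
  assumes dom: "bounded_lipschitz_domain \<Omega>" and a: "0 < a" "2 * a \<le> t" and t: "t < 1"
    and U: "U \<in> sobolev t" and z: "\<And>x. x \<notin> \<Omega> \<Longrightarrow> U x = 0"
begin

lemma a_less_1: "a < 1" using a t by simp

lemma domain_open: "open \<Omega>" using dom by (simp add: bounded_lipschitz_domain_def)

lemma domain_measurable [measurable]: "\<Omega> \<in> sets borel" using domain_open by simp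

lemma sobolev_2a: "U \<in> sobolev (2 * a)"
  by (rule sobolev_mono[OF _ a(2) U]) (use a in simp)

lemma U_L2: "L2_on UNIV U" by (rule sobolev_L2[OF U])

lemma L2_kap_U: "L2_on UNIV (\<lambda>x. enn2real (kap a \<Omega> x) * U x)"
proof (rule L2_onI)
  note [measurable] = L2_measurable[OF U_L2]
  show "(\<lambda>x. enn2real (kap a \<Omega> x) * U x) \<in> borel_measurable borel" by measurable
  have "norm2sq (\<lambda>x. enn2real (kap a \<Omega> x) * U x) \<le> (\<integral>\<^sup>+x. (kap a \<Omega> x)\<^sup>2 * ennreal ((U x)\<^sup>2) \<partial>lborel)"
    unfolding norm2sq_def
  proof (rule nn_integral_mono)
    fix x
    have "ennreal (enn2real (kap a \<Omega> x)) \<le> kap a \<Omega> x" by (cases "kap a \<Omega> x") auto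
    then have "(ennreal (enn2real (kap a \<Omega> x)))\<^sup>2 \<le> (kap a \<Omega> x)\<^sup>2" by (rule power_mono) simp
    then show "ennreal ((norm (enn2real (kap a \<Omega> x) * U x))\<^sup>2) \<le> (kap a \<Omega> x)\<^sup>2 * ennreal ((U x)\<^sup>2)"
      by (simp add: power_mult_distrib ennreal_mult ennreal_power mult_right_mono)
  qed
  also have "\<dots> < \<infinity>" by (rule hardy_finite[OF dom a t U z])
  finally show "norm2sq (\<lambda>x. enn2real (kap a \<Omega> x) * U x) < \<infinity>" .
qed

lemma L2_reg_limit: "L2_on UNIV (reg_limit a \<Omega> U)"
proof -
  note fl = L2_frac_laplacian[OF a(1) a_less_1 sobolev_2a]
  note [measurable] = L2_measurable[OF fl]
  have "L2_on UNIV (\<lambda>x. indicator \<Omega> x * (symb_const TYPE('a) a * frac_laplacian a U x))"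
    by (rule L2_dominated[OF _ L2_cmult[OF fl, of "symb_const TYPE('a) a"]]) (measurable, auto simp: indicator_def)
  from L2_diff[OF this L2_kap_U] show ?thesis unfolding reg_limit_def[abs_def] .
qed

lemma reg_limit_outside: "x \<notin> \<Omega> \<Longrightarrow> reg_limit a \<Omega> U x = 0"
  by (simp add: reg_limit_def z)

text \<open>The full part converges by the analysis of the singular integrals. The truncated weights increase to
  $\kappa_a$, and $\kappa_a |U|$ is a majorant in $L^2$ by the Hardy inequality.\<close>

lemma L2_reg_trunc_tendsto:
  assumes e: "e \<longlonglongrightarrow> 0" "\<And>k. 0 < e k"
  shows "L2_on UNIV (reg_trunc a \<Omega> (e k) U)" "(\<lambda>k. norm2sq (\<lambda>x. reg_trunc a \<Omega> (e k) U x - reg_limit a \<Omega> U x)) \<longlonglongrightarrow> 0"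
proof -
  note a1 = a_less_1
  note fl = L2_frac_laplacian[OF a(1) a1 sobolev_2a]
  note st = L2_sing_trunc[OF a(1) a1 U_L2 e(2)]
  note [measurable] = L2_measurable[OF fl] L2_measurable[OF U_L2] L2_measurable[OF st]
  let ?c = "symb_const TYPE('a) a"
  have kl: "AE x in lborel. norm (- (kap_trunc a \<Omega> (e k) x * U x)) \<le> norm (enn2real (kap a \<Omega> x) * U x)" for k
  proof (rule AE_I2)
    fix x
    show "norm (- (kap_trunc a \<Omega> (e k) x * U x)) \<le> norm (enn2real (kap a \<Omega> x) * U x)"
      using kap_trunc_bounds(1,2)[OF domain_open _ a(1), of x "e k"] z[of x]
      by (cases "x \<in> \<Omega>") (auto simp: abs_mult intro!: mult_right_mono)
  qed
  have kL: "L2_on UNIV (\<lambda>x. - (kap_trunc a \<Omega> (e k) x * U x))" for k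
    by (rule L2_dominated[OF _ L2_kap_U kl]) measurable
  have 1: "(\<lambda>k. norm2sq (\<lambda>x. indicator \<Omega> x * (sing_trunc a (e k) U x - ?c * frac_laplacian a U x))) \<longlonglongrightarrow> 0"
  proof (rule tendsto_0_bound_ennreal[OF sing_trunc_tendsto_frac_laplacian[OF a(1) a1 sobolev_2a e]])
    show "\<forall>\<^sub>F k in sequentially. norm2sq (\<lambda>x. indicator \<Omega> x * (sing_trunc a (e k) U x - ?c * frac_laplacian a U x))
      \<le> norm2sq (\<lambda>x. sing_trunc a (e k) U x - ?c * frac_laplacian a U x)"
      by (intro always_eventually allI norm2sq_mono) (simp add: indicator_def)
  qed
  have nk: "L2_on UNIV (\<lambda>x. norm (enn2real (kap a \<Omega> x) * U x))" by (rule L2_dominated[OF _ L2_kap_U]) auto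
  have 2: "(\<lambda>k. norm2sq (\<lambda>x. - (kap_trunc a \<Omega> (e k) x * U x) - (- (enn2real (kap a \<Omega> x) * U x)))) \<longlonglongrightarrow> 0"
  proof (rule norm2sq_dominated[OF _ _ nk kl])
    show "AE x in lborel. (\<lambda>k. - (kap_trunc a \<Omega> (e k) x * U x)) \<longlonglongrightarrow> - (enn2real (kap a \<Omega> x) * U x)"
    proof (rule AE_I2)
      fix x
      show "(\<lambda>k. - (kap_trunc a \<Omega> (e k) x * U x)) \<longlonglongrightarrow> - (enn2real (kap a \<Omega> x) * U x)"
      proof (cases "x \<in> \<Omega>")
        case True
        show ?thesis by (intro tendsto_intros kap_trunc_bounds(3)[OF domain_open True a(1) e])
      qed (simp add: z)
    qed
  qed measurable
  have req: "AE x in lborel. reg_trunc a \<Omega> (e k) U x = indicator \<Omega> x * sing_trunc a (e k) U x - kap_trunc a \<Omega> (e k) x * U x" for k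
    by (rule reg_trunc_eq[OF a(1) a1 domain_open U_L2 z e(2)])
  show "L2_on UNIV (reg_trunc a \<Omega> (e k) U)" for k
  proof (rule L2_cong_AE)
    have "L2_on UNIV (\<lambda>x. indicator \<Omega> x * sing_trunc a (e k) U x)"
      by (rule L2_dominated[OF _ st]) (measurable, auto simp: indicator_def)
    from L2_add[OF this kL] show "L2_on UNIV (\<lambda>x. indicator \<Omega> x * sing_trunc a (e k) U x + - (kap_trunc a \<Omega> (e k) x * U x))" .
    show "AE x in lborel. indicator \<Omega> x * sing_trunc a (e k) U x + - (kap_trunc a \<Omega> (e k) x * U x) = reg_trunc a \<Omega> (e k) U x"
      using req[of k] by eventually_elim simp
  qed measurable
  have "(\<lambda>k. norm2sq (\<lambda>x. indicator \<Omega> x * (sing_trunc a (e k) U x - ?c * frac_laplacian a U x) + (- (kap_trunc a \<Omega> (e k) x * U x) - (- (enn2real (kap a \<Omega> x) * U x))))) \<longlonglongrightarrow> 0"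
    by (rule norm2sq_tendsto_add[OF _ _ 1 2]) measurable
  moreover have "norm2sq (\<lambda>x. indicator \<Omega> x * (sing_trunc a (e k) U x - ?c * frac_laplacian a U x) + (- (kap_trunc a \<Omega> (e k) x * U x) - (- (enn2real (kap a \<Omega> x) * U x))))
     = norm2sq (\<lambda>x. reg_trunc a \<Omega> (e k) U x - reg_limit a \<Omega> U x)" for k
  proof (rule norm2sq_cong_AE)
    show "AE x in lborel. indicator \<Omega> x * (sing_trunc a (e k) U x - ?c * frac_laplacian a U x) + (- (kap_trunc a \<Omega> (e k) x * U x) - (- (enn2real (kap a \<Omega> x) * U x)))
       = reg_trunc a \<Omega> (e k) U x - reg_limit a \<Omega> U x"
      using req[of k] by eventually_elim (simp add: reg_limit_def right_diff_distrib)
  qed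
  ultimately show "(\<lambda>k. norm2sq (\<lambda>x. reg_trunc a \<Omega> (e k) U x - reg_limit a \<Omega> U x)) \<longlonglongrightarrow> 0" by simp
qed

text \<open>The integrand is bounded by the sum of the two Gagliardo integrands.\<close>

lemma form_integrable:
  assumes v: "v \<in> sobolev a"
  shows "integrable (lborel \<Otimes>\<^sub>M lborel) (\<lambda>(x, y). indicator \<Omega> x * indicator \<Omega> y * kern a (x - y) * (U x - U y) * (v x - v y))"
proof -
  note a1 = a_less_1
  note vL = sobolev_L2[OF v]
  note [measurable] = L2_measurable[OF U_L2] L2_measurable[OF vL]
  have Ua: "U \<in> sobolev a" by (rule sobolev_mono[OF _ _ U]) (use a in auto)
  have E: "(\<integral>\<^sup>+x. (\<integral>\<^sup>+y. ennreal (kern a (x - y) * (u x - u y)\<^sup>2) \<partial>lborel) \<partial>lborel) < \<infinity>" if "u \<in> sobolev a" for u :: "'a \<Rightarrow> real"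
    by (rule gagliardo_finite[OF a(1) a1]) (use that a in \<open>simp_all add: sobolev_iff\<close>)
  have "(\<integral>\<^sup>+p. ennreal (norm (case p of (x, y) \<Rightarrow> indicator \<Omega> x * indicator \<Omega> y * kern a (x - y) * (U x - U y) * (v x - v y))) \<partial>(lborel \<Otimes>\<^sub>M lborel))
    = (\<integral>\<^sup>+x. (\<integral>\<^sup>+y. ennreal (norm (indicator \<Omega> x * indicator \<Omega> y * kern a (x - y) * (U x - U y) * (v x - v y))) \<partial>lborel) \<partial>lborel)"
    by (subst lborel.nn_integral_fst[symmetric]) auto
  also have "\<dots> \<le> (\<integral>\<^sup>+x. (\<integral>\<^sup>+y. ennreal (kern a (x - y) * (U x - U y)\<^sup>2) + ennreal (kern a (x - y) * (v x - v y)\<^sup>2) \<partial>lborel) \<partial>lborel)"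
  proof (intro nn_integral_mono)
    fix x y
    have i: "\<bar>indicator \<Omega> x * indicator \<Omega> y :: real\<bar> \<le> 1" by (simp add: indicator_def)
    have "2 * \<bar>U x - U y\<bar> * \<bar>v x - v y\<bar> \<le> \<bar>U x - U y\<bar>\<^sup>2 + \<bar>v x - v y\<bar>\<^sup>2" by (rule sum_squares_bound)
    moreover have "0 \<le> \<bar>U x - U y\<bar> * \<bar>v x - v y\<bar>" by simp
    ultimately have "\<bar>U x - U y\<bar> * \<bar>v x - v y\<bar> \<le> (U x - U y)\<^sup>2 + (v x - v y)\<^sup>2" unfolding power2_abs by linarith
    then have "kern a (x - y) * (\<bar>U x - U y\<bar> * \<bar>v x - v y\<bar>) \<le> kern a (x - y) * ((U x - U y)\<^sup>2 + (v x - v y)\<^sup>2)" by (rule mult_left_mono) simp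
    moreover have "norm (indicator \<Omega> x * indicator \<Omega> y * kern a (x - y) * (U x - U y) * (v x - v y)) \<le> 1 * (kern a (x - y) * (\<bar>U x - U y\<bar> * \<bar>v x - v y\<bar>))"
    proof -
      have "norm (indicator \<Omega> x * indicator \<Omega> y * kern a (x - y) * (U x - U y) * (v x - v y)) = \<bar>indicator \<Omega> x * indicator \<Omega> y\<bar> * (kern a (x - y) * (\<bar>U x - U y\<bar> * \<bar>v x - v y\<bar>))"
        by (simp add: abs_mult)
      also have "\<dots> \<le> 1 * (kern a (x - y) * (\<bar>U x - U y\<bar> * \<bar>v x - v y\<bar>))" by (intro mult_right_mono i) simp
      finally show ?thesis .
    qed
    ultimately have "norm (indicator \<Omega> x * indicator \<Omega> y * kern a (x - y) * (U x - U y) * (v x - v y)) \<le> kern a (x - y) * (U x - U y)\<^sup>2 + kern a (x - y) * (v x - v y)\<^sup>2"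
      by (simp add: distrib_left)
    then show "ennreal (norm (indicator \<Omega> x * indicator \<Omega> y * kern a (x - y) * (U x - U y) * (v x - v y))) \<le> ennreal (kern a (x - y) * (U x - U y)\<^sup>2) + ennreal (kern a (x - y) * (v x - v y)\<^sup>2)"
      by (simp only: ennreal_plus[symmetric] mult_nonneg_nonneg kern_nonneg zero_le_power2 ennreal_leI)
  qed
  also have "\<dots> = (\<integral>\<^sup>+x. (\<integral>\<^sup>+y. ennreal (kern a (x - y) * (U x - U y)\<^sup>2) \<partial>lborel) \<partial>lborel) + (\<integral>\<^sup>+x. (\<integral>\<^sup>+y. ennreal (kern a (x - y) * (v x - v y)\<^sup>2) \<partial>lborel) \<partial>lborel)"
    by (subst nn_integral_add[symmetric]) (measurable, intro nn_integral_cong nn_integral_add, measurable)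
  also have "\<dots> < \<infinity>" using E[OF Ua] E[OF v] by simp
  finally show ?thesis by (intro integrableI_bounded) auto
qed

text \<open>Symmetrization: the double integral is averaged with its image under the exchange of $x$ and $y$, which is
  legitimate because the truncated kernel is integrable.\<close>

lemma reg_trunc_pairing:
  assumes v: "v \<in> sobolev a" and e: "0 < e"
  shows "(LINT x|lborel. reg_trunc a \<Omega> e U x * v x) =
     (LINT p|(lborel \<Otimes>\<^sub>M lborel). (case p of (x, y) \<Rightarrow> indicator \<Omega> x * indicator \<Omega> y * kern_trunc a e (x - y) * (U x - U y) * (v x - v y))) / 2"
proof -
  note vL = sobolev_L2[OF v]
  note [measurable] = L2_measurable[OF U_L2] L2_measurable[OF vL]
  define G where "G x y = indicator \<Omega> x * indicator \<Omega> y * kern_trunc a e (x - y) * (U x - U y) * v x" for x y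
  have [measurable]: "case_prod G \<in> borel_measurable (borel \<Otimes>\<^sub>M borel)" unfolding G_def by measurable
  define N where "N = (\<integral>\<^sup>+h. ennreal (kern_trunc a e (h::'a)) \<partial>lborel)"
  have N: "N < \<infinity>" using integrable_kern_trunc[OF a(1) e, where 'a='a] unfolding N_def
    by (subst nn_integral_eq_integral) auto
  have Nx: "(\<integral>\<^sup>+y. ennreal (kern_trunc a e (x - y)) \<partial>lborel) = N" for x :: 'a
    unfolding N_def using nn_integral_diff_left[of "\<lambda>h. ennreal (kern_trunc a e h)" x] by simp
  have Ny: "(\<integral>\<^sup>+x. ennreal (kern_trunc a e (x - y)) \<partial>lborel) = N" for y :: 'a
    unfolding N_def using nn_integral_translate[of "\<lambda>h. ennreal (kern_trunc a e h)" "- y"] by simp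
  have Gi: "integrable (lborel \<Otimes>\<^sub>M lborel) (case_prod G)"
  proof (rule integrableI_bounded)
    have "(\<integral>\<^sup>+p. ennreal (norm (case_prod G p)) \<partial>(lborel \<Otimes>\<^sub>M lborel)) = (\<integral>\<^sup>+x. (\<integral>\<^sup>+y. ennreal (norm (G x y)) \<partial>lborel) \<partial>lborel)"
      by (subst lborel.nn_integral_fst[symmetric]) auto
    also have "\<dots> \<le> (\<integral>\<^sup>+x. (\<integral>\<^sup>+y. (ennreal (kern_trunc a e (x - y)) * (ennreal ((norm (U x))\<^sup>2) + 2 * ennreal ((norm (v x))\<^sup>2)) + ennreal (kern_trunc a e (x - y)) * ennreal ((norm (U y))\<^sup>2)) \<partial>lborel) \<partial>lborel)"
    proof (intro nn_integral_mono)
      fix x y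
      have "2 * \<bar>U x\<bar> * \<bar>v x\<bar> \<le> \<bar>U x\<bar>\<^sup>2 + \<bar>v x\<bar>\<^sup>2" "2 * \<bar>U y\<bar> * \<bar>v x\<bar> \<le> \<bar>U y\<bar>\<^sup>2 + \<bar>v x\<bar>\<^sup>2" by (rule sum_squares_bound)+
      moreover have "\<bar>U x - U y\<bar> * \<bar>v x\<bar> \<le> (\<bar>U x\<bar> + \<bar>U y\<bar>) * \<bar>v x\<bar>" by (rule mult_right_mono) simp_all
      moreover have "0 \<le> \<bar>U x\<bar> * \<bar>v x\<bar>" "0 \<le> \<bar>U y\<bar> * \<bar>v x\<bar>" by simp_all
      ultimately have "\<bar>U x - U y\<bar> * \<bar>v x\<bar> \<le> (norm (U x))\<^sup>2 + 2 * (norm (v x))\<^sup>2 + (norm (U y))\<^sup>2" unfolding real_norm_def power2_abs distrib_right by linarith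
      then have "kern_trunc a e (x - y) * (\<bar>U x - U y\<bar> * \<bar>v x\<bar>) \<le> kern_trunc a e (x - y) * ((norm (U x))\<^sup>2 + 2 * (norm (v x))\<^sup>2 + (norm (U y))\<^sup>2)" by (rule mult_left_mono) simp
      moreover have "norm (G x y) \<le> kern_trunc a e (x - y) * (\<bar>U x - U y\<bar> * \<bar>v x\<bar>)" by (simp add: G_def abs_mult indicator_def)
      ultimately have "norm (G x y) \<le> kern_trunc a e (x - y) * ((norm (U x))\<^sup>2 + 2 * (norm (v x))\<^sup>2) + kern_trunc a e (x - y) * (norm (U y))\<^sup>2" by (simp add: distrib_left)
      then have "ennreal (norm (G x y)) \<le> ennreal (kern_trunc a e (x - y) * ((norm (U x))\<^sup>2 + 2 * (norm (v x))\<^sup>2) + kern_trunc a e (x - y) * (norm (U y))\<^sup>2)" by (rule ennreal_leI)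
      also have "\<dots> = ennreal (kern_trunc a e (x - y)) * (ennreal ((norm (U x))\<^sup>2) + 2 * ennreal ((norm (v x))\<^sup>2)) + ennreal (kern_trunc a e (x - y)) * ennreal ((norm (U y))\<^sup>2)"
        by (simp add: ennreal_plus ennreal_mult)
      finally show "ennreal (norm (G x y)) \<le> ennreal (kern_trunc a e (x - y)) * (ennreal ((norm (U x))\<^sup>2) + 2 * ennreal ((norm (v x))\<^sup>2)) + ennreal (kern_trunc a e (x - y)) * ennreal ((norm (U y))\<^sup>2)" .
    qed
    also have "\<dots> = (\<integral>\<^sup>+x. (N * (ennreal ((norm (U x))\<^sup>2) + 2 * ennreal ((norm (v x))\<^sup>2)) + (\<integral>\<^sup>+y. ennreal (kern_trunc a e (x - y)) * ennreal ((norm (U y))\<^sup>2) \<partial>lborel)) \<partial>lborel)"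
    proof (rule nn_integral_cong)
      fix x
      show "(\<integral>\<^sup>+y. (ennreal (kern_trunc a e (x - y)) * (ennreal ((norm (U x))\<^sup>2) + 2 * ennreal ((norm (v x))\<^sup>2)) + ennreal (kern_trunc a e (x - y)) * ennreal ((norm (U y))\<^sup>2)) \<partial>lborel)
        = N * (ennreal ((norm (U x))\<^sup>2) + 2 * ennreal ((norm (v x))\<^sup>2)) + (\<integral>\<^sup>+y. ennreal (kern_trunc a e (x - y)) * ennreal ((norm (U y))\<^sup>2) \<partial>lborel)"
        by (subst nn_integral_add) (simp_all add: nn_integral_multc Nx)
    qed
    also have "\<dots> = N * (norm2sq U + 2 * norm2sq v) + (\<integral>\<^sup>+x. (\<integral>\<^sup>+y. ennreal (kern_trunc a e (x - y)) * ennreal ((norm (U y))\<^sup>2) \<partial>lborel) \<partial>lborel)"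
      unfolding norm2sq_def by (subst nn_integral_add) (simp_all add: nn_integral_cmult nn_integral_add)
    also have "(\<integral>\<^sup>+x. (\<integral>\<^sup>+y. ennreal (kern_trunc a e (x - y)) * ennreal ((norm (U y))\<^sup>2) \<partial>lborel) \<partial>lborel) = (\<integral>\<^sup>+y. (\<integral>\<^sup>+x. ennreal (kern_trunc a e (x - y)) * ennreal ((norm (U y))\<^sup>2) \<partial>lborel) \<partial>lborel)"
      by (rule lborel_pair.Fubini') measurable
    also have "\<dots> = N * norm2sq U"
      unfolding norm2sq_def by (simp add: nn_integral_multc Ny nn_integral_cmult)
    finally show "(\<integral>\<^sup>+p. ennreal (norm (case_prod G p)) \<partial>(lborel \<Otimes>\<^sub>M lborel)) < \<infinity>"
      using N norm2sq_finite[OF U_L2] norm2sq_finite[OF vL] by (elim order.strict_trans1) (simp add: ennreal_mult_less_top)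
  qed measurable
  have Gs: "integrable (lborel \<Otimes>\<^sub>M lborel) (\<lambda>(x, y). G y x)"
    using lborel_pair.integrable_product_swap[OF Gi] by (simp add: split_beta)
  have Gsw: "(LINT p|(lborel \<Otimes>\<^sub>M lborel). (case p of (x, y) \<Rightarrow> G y x)) = (LINT p|(lborel \<Otimes>\<^sub>M lborel). case_prod G p)"
    using lborel_pair.integral_product_swap[OF borel_measurable_integrable[OF Gi]] by simp
  have "(LINT x|lborel. reg_trunc a \<Omega> e U x * v x) = (LINT x|lborel. (LINT y|lborel. G x y))"
  proof (rule Bochner_Integration.integral_cong[OF refl])
    fix x
    let ?F = "\<lambda>y. indicator \<Omega> y * kern_trunc a e (x - y) * (U x - U y)"
    have "(LINT y|lborel. G x y) = (LINT y|lborel. (indicator \<Omega> x * v x) * ?F y)"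
      by (rule Bochner_Integration.integral_cong[OF refl]) (simp add: G_def)
    also have "\<dots> = (indicator \<Omega> x * v x) * (LINT y|lborel. ?F y)" by (rule integral_mult_right_zero)
    finally show "reg_trunc a \<Omega> e U x * v x = (LINT y|lborel. G x y)" by (simp add: reg_trunc_def)
  qed
  also have "\<dots> = (LINT p|(lborel \<Otimes>\<^sub>M lborel). case_prod G p)"
    using lborel_pair.integral_fst[OF Gi] by simp
  also have "\<dots> = ((LINT p|(lborel \<Otimes>\<^sub>M lborel). case_prod G p) + (LINT p|(lborel \<Otimes>\<^sub>M lborel). (case p of (x, y) \<Rightarrow> G y x))) / 2"
    unfolding Gsw by simp
  also have "(LINT p|(lborel \<Otimes>\<^sub>M lborel). case_prod G p) + (LINT p|(lborel \<Otimes>\<^sub>M lborel). (case p of (x, y) \<Rightarrow> G y x))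
     = (LINT p|(lborel \<Otimes>\<^sub>M lborel). case_prod G p + (case p of (x, y) \<Rightarrow> G y x))"
    by (rule Bochner_Integration.integral_add[symmetric, OF Gi Gs])
  also have "\<dots> = (LINT p|(lborel \<Otimes>\<^sub>M lborel). (case p of (x, y) \<Rightarrow> indicator \<Omega> x * indicator \<Omega> y * kern_trunc a e (x - y) * (U x - U y) * (v x - v y)))"
  proof (rule Bochner_Integration.integral_cong[OF refl])
    fix p :: "'a \<times> 'a"
    obtain x y where p: "p = (x, y)" by (cases p)
    have k: "kern_trunc a e (y - x) = kern_trunc a e (x - y)" using kern_trunc_minus[of a e "x - y"] by simp
    show "case_prod G p + (case p of (x, y) \<Rightarrow> G y x) = (case p of (x, y) \<Rightarrow> indicator \<Omega> x * indicator \<Omega> y * kern_trunc a e (x - y) * (U x - U y) * (v x - v y))"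
      unfolding p by (simp add: G_def k) (simp add: algebra_simps)
  qed
  finally show ?thesis .
qed

lemma reg_limit_pairing:
  assumes v: "v \<in> sobolev a"
  shows "(LINT x|lborel. reg_limit a \<Omega> U x * v x) =
     (LINT x:\<Omega>|lborel. (LINT y:\<Omega>|lborel. (U x - U y) * (v x - v y) / norm (x - y) powr (real DIM('a) + 2 * a))) / 2"
proof -
  note vL = sobolev_L2[OF v]
  note [measurable] = L2_measurable[OF U_L2] L2_measurable[OF vL]
  define e where "e k = inverse (real (Suc k))" for k
  have e: "e \<longlonglongrightarrow> 0" "\<And>k. 0 < e k" unfolding e_def by (rule LIMSEQ_inverse_real_of_nat) simp
  note Fi = form_integrable[OF v]
  let ?F = "\<lambda>(x, y). indicator \<Omega> x * indicator \<Omega> y * kern a (x - y) * (U x - U y) * (v x - v y)"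
  let ?Fk = "\<lambda>k (x, y). indicator \<Omega> x * indicator \<Omega> y * kern_trunc a (e k) (x - y) * (U x - U y) * (v x - v y)"
  have "(\<lambda>k. LINT x|lborel. reg_trunc a \<Omega> (e k) U x * v x) \<longlonglongrightarrow> (LINT x|lborel. reg_limit a \<Omega> U x * v x)"
    by (rule L2_inner_tendsto[OF L2_reg_trunc_tendsto(1)[OF e] L2_reg_limit vL L2_reg_trunc_tendsto(2)[OF e]])
  moreover have "(\<lambda>k. LINT x|lborel. reg_trunc a \<Omega> (e k) U x * v x) \<longlonglongrightarrow> (LINT p|(lborel \<Otimes>\<^sub>M lborel). ?F p) / 2"
    unfolding reg_trunc_pairing[OF v e(2)]
  proof (intro tendsto_divide tendsto_const)
    show "(\<lambda>k. LINT p|(lborel \<Otimes>\<^sub>M lborel). ?Fk k p) \<longlonglongrightarrow> (LINT p|(lborel \<Otimes>\<^sub>M lborel). ?F p)"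
    proof (rule integral_dominated_convergence[OF _ _ integrable_norm[OF Fi]])
      show "AE p in lborel \<Otimes>\<^sub>M lborel. (\<lambda>k. ?Fk k p) \<longlonglongrightarrow> ?F p"
      proof (rule AE_I2)
        fix p :: "'a \<times> 'a"
        obtain x y where p: "p = (x, y)" by (cases p)
        show "(\<lambda>k. ?Fk k p) \<longlonglongrightarrow> ?F p"
        proof (cases "x = y")
          case False
          then have "\<forall>\<^sub>F k in sequentially. e k < norm (x - y)" using e by (intro order_tendstoD(2)[OF e(1)]) auto
          then show ?thesis unfolding p by (intro tendsto_eventually) (erule eventually_mono, simp add: kern_trunc_def indicator_def)
        qed (simp add: p)
      qed
      show "AE p in lborel \<Otimes>\<^sub>M lborel. norm (?Fk k p) \<le> norm (?F p)" for k
      proof (rule AE_I2)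
        fix p :: "'a \<times> 'a"
        show "norm (?Fk k p) \<le> norm (?F p)"
          using kern_trunc_le[of a "e k" "fst p - snd p"]
          by (simp add: split_beta abs_mult indicator_def mult_right_mono)
      qed
    qed measurable
  qed simp
  ultimately have "(LINT x|lborel. reg_limit a \<Omega> U x * v x) = (LINT p|(lborel \<Otimes>\<^sub>M lborel). ?F p) / 2"
    by (rule LIMSEQ_unique)
  also have "(LINT p|(lborel \<Otimes>\<^sub>M lborel). ?F p) = (LINT x|lborel. (LINT y|lborel. indicator \<Omega> x * indicator \<Omega> y * kern a (x - y) * (U x - U y) * (v x - v y)))"
    using lborel_pair.integral_fst[OF Fi] by simp
  also have "\<dots> = (LINT x:\<Omega>|lborel. (LINT y:\<Omega>|lborel. (U x - U y) * (v x - v y) / norm (x - y) powr (real DIM('a) + 2 * a)))"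
    unfolding set_lebesgue_integral_def divide_norm_powr
  proof (rule Bochner_Integration.integral_cong[OF refl])
    fix x
    have "(LINT y|lborel. indicator \<Omega> x * indicator \<Omega> y * kern a (x - y) * (U x - U y) * (v x - v y))
       = (LINT y|lborel. indicator \<Omega> x * (indicator \<Omega> y *\<^sub>R ((U x - U y) * (v x - v y) * kern a (x - y))))"
      by (rule Bochner_Integration.integral_cong[OF refl]) simp
    then show "(LINT y|lborel. indicator \<Omega> x * indicator \<Omega> y * kern a (x - y) * (U x - U y) * (v x - v y))
       = indicator \<Omega> x *\<^sub>R (LINT y|lborel. indicator \<Omega> y *\<^sub>R ((U x - U y) * (v x - v y) * kern a (x - y)))"
      by simp
  qed
  finally show ?thesis .
qed

text \<open>The bilinear form sees its arguments only through their values on \<open>\<Omega>\<close>, up to null sets in the first one.\<close>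

lemma regional_form_cong:
  fixes u v v' :: "'a \<Rightarrow> real"
  assumes [measurable]: "u \<in> borel_measurable borel" and uU: "AE x in lborel. x \<in> \<Omega> \<longrightarrow> u x = U x"
    and v': "v' \<in> borel_measurable borel" and vv: "\<And>x. x \<in> \<Omega> \<Longrightarrow> v x = v' x"
  shows "regional_form a \<Omega> u v = regional_form a \<Omega> U v'"
proof -
  note [measurable] = v' L2_measurable[OF U_L2]
  let ?I = "\<lambda>u v x. LINT y:\<Omega>|lborel. (u x - u y) * (v x - v y) / norm (x - y) powr (real DIM('a) + 2 * a)"
  have v_eq: "indicator \<Omega> x *\<^sub>R ?I u v x = indicator \<Omega> x *\<^sub>R ?I u v' x" for x
  proof (cases "x \<in> \<Omega>")
    case True
    have "?I u v x = ?I u v' x" unfolding set_lebesgue_integral_def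
      by (rule Bochner_Integration.integral_cong[OF refl]) (auto simp: indicator_def vv True)
    then show ?thesis by simp
  qed simp
  have "(LINT x:\<Omega>|lborel. ?I u v x) = (LINT x:\<Omega>|lborel. ?I u v' x)"
    unfolding set_lebesgue_integral_def[of _ \<Omega> "?I u v"] set_lebesgue_integral_def[of _ \<Omega> "?I u v'"] v_eq ..
  also have "\<dots> = (LINT x:\<Omega>|lborel. ?I U v' x)"
    unfolding set_lebesgue_integral_def
  proof (rule integral_cong_AE)
    show "AE x in lborel. indicator \<Omega> x *\<^sub>R (LINT y|lborel. indicator \<Omega> y *\<^sub>R ((u x - u y) * (v' x - v' y) / norm (x - y) powr (real DIM('a) + 2 * a)))
       = indicator \<Omega> x *\<^sub>R (LINT y|lborel. indicator \<Omega> y *\<^sub>R ((U x - U y) * (v' x - v' y) / norm (x - y) powr (real DIM('a) + 2 * a)))"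
      using uU
    proof eventually_elim
      case (elim x)
      show ?case
      proof (cases "x \<in> \<Omega>")
        case True
        have "(LINT y|lborel. indicator \<Omega> y *\<^sub>R ((u x - u y) * (v' x - v' y) / norm (x - y) powr (real DIM('a) + 2 * a)))
          = (LINT y|lborel. indicator \<Omega> y *\<^sub>R ((U x - U y) * (v' x - v' y) / norm (x - y) powr (real DIM('a) + 2 * a)))"
        proof (rule integral_cong_AE)
          show "AE y in lborel. indicator \<Omega> y *\<^sub>R ((u x - u y) * (v' x - v' y) / norm (x - y) powr (real DIM('a) + 2 * a))
            = indicator \<Omega> y *\<^sub>R ((U x - U y) * (v' x - v' y) / norm (x - y) powr (real DIM('a) + 2 * a))"
            using uU by eventually_elim (use elim True in \<open>auto simp: indicator_def\<close>)
        qed measurable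
        then show ?thesis by simp
      qed simp
    qed
  qed measurable
  finally show ?thesis unfolding regional_form_def by simp
qed

text \<open>A multiple of \<^const>\<open>reg_limit\<close> represents the form, so the weak operator exists as an $L^2$ function; two
  functions that represent the form agree by the fundamental lemma.\<close>

theorem regional_frac_laplacian_eq:
  fixes u :: "'a \<Rightarrow> real"
  assumes um: "u \<in> borel_measurable borel" and uU: "AE x in lborel. x \<in> \<Omega> \<longrightarrow> u x = U x"
  shows L2_regional: "L2_on \<Omega> (regional_frac_laplacian a \<Omega> u)"
    and regional_AE_eq: "AE x in lborel. x \<in> \<Omega> \<longrightarrow> regional_frac_laplacian a \<Omega> u x = frac_const TYPE('a) a * reg_limit a \<Omega> U x"
proof -
  let ?C = "frac_const TYPE('a) a"
  define Q where "Q w \<longleftrightarrow> L2_on \<Omega> w \<and> (\<forall>v \<in> sobolev_on a \<Omega>. (LINT x:\<Omega>|lborel. w x * v x) = regional_form a \<Omega> u v)" for w :: "'a \<Rightarrow> real"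
  define w1 where "w1 x = ?C * reg_limit a \<Omega> U x" for x
  have w1L: "L2_on UNIV w1" unfolding w1_def by (rule L2_cmult[OF L2_reg_limit])
  have w1z: "w1 x = 0" if "x \<notin> \<Omega>" for x using reg_limit_outside[OF that] by (simp add: w1_def)
  have iw1: "indicator \<Omega> x *\<^sub>R w1 x = w1 x" for x by (cases "x \<in> \<Omega>") (auto simp: w1z)
  have Qw1: "Q w1"
    unfolding Q_def
  proof (intro conjI ballI)
    show "L2_on \<Omega> w1" using w1L by (simp only: L2_on_iff_indicator[of \<Omega>] iw1)
    fix v assume "v \<in> sobolev_on a \<Omega>"
    then obtain v' where v': "v' \<in> sobolev a" "\<And>x. x \<in> \<Omega> \<Longrightarrow> v x = v' x" by (auto simp: sobolev_on_def)
    have "(LINT x:\<Omega>|lborel. w1 x * v x) = (LINT x|lborel. ?C * (reg_limit a \<Omega> U x * v' x))"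
      unfolding set_lebesgue_integral_def
      by (rule Bochner_Integration.integral_cong[OF refl]) (simp add: indicator_def v'(2) w1_def reg_limit_outside)
    also have "\<dots> = ?C * (LINT x|lborel. reg_limit a \<Omega> U x * v' x)" by (rule integral_mult_right_zero)
    also have "\<dots> = regional_form a \<Omega> U v'" unfolding reg_limit_pairing[OF v'(1)] regional_form_def by simp
    also have "\<dots> = regional_form a \<Omega> u v"
      by (rule regional_form_cong[symmetric, OF um uU L2_measurable[OF sobolev_L2[OF v'(1)]] v'(2)])
    finally show "(LINT x:\<Omega>|lborel. w1 x * v x) = regional_form a \<Omega> u v" .
  qed
  then have Qr: "Q (regional_frac_laplacian a \<Omega> u)"
    unfolding regional_frac_laplacian_def Q_def[symmetric] by (rule someI[of Q])
  then show rL: "L2_on \<Omega> (regional_frac_laplacian a \<Omega> u)" by (simp add: Q_def)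
  define h where "h x = indicator \<Omega> x *\<^sub>R regional_frac_laplacian a \<Omega> u x - w1 x" for x
  have rL': "L2_on UNIV (\<lambda>x. indicator \<Omega> x *\<^sub>R regional_frac_laplacian a \<Omega> u x)" using rL by (simp only: L2_on_iff_indicator[of \<Omega>])
  have h: "L2_on UNIV h" unfolding h_def[abs_def] by (rule L2_diff[OF rL' w1L])
  have "AE x in lborel. x \<in> \<Omega> \<longrightarrow> h x = 0"
  proof (rule fundamental_lemma[OF h domain_open])
    fix \<phi> assume phi: "\<phi> \<in> Cc_smooth \<Omega>"
    note sch = Cc_smooth_schwartz[OF phi]
    note pL = schwartz_L2[OF sch]
    have "\<phi> \<in> sobolev_on a \<Omega>" unfolding sobolev_on_def using schwartz_sobolev[OF sch, of a] a t by auto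
    then have eq: "(LINT x:\<Omega>|lborel. regional_frac_laplacian a \<Omega> u x * \<phi> x) = (LINT x:\<Omega>|lborel. w1 x * \<phi> x)"
      using Qr Qw1 unfolding Q_def by simp
    have "(LINT x|lborel. h x * \<phi> x) = (LINT x|lborel. (indicator \<Omega> x *\<^sub>R regional_frac_laplacian a \<Omega> u x) * \<phi> x) - (LINT x|lborel. w1 x * \<phi> x)"
      unfolding h_def left_diff_distrib
      by (rule Bochner_Integration.integral_diff[OF integrable_L2_mult[OF rL' pL] integrable_L2_mult[OF w1L pL]])
    also have "(LINT x|lborel. (indicator \<Omega> x *\<^sub>R regional_frac_laplacian a \<Omega> u x) * \<phi> x) = (LINT x:\<Omega>|lborel. regional_frac_laplacian a \<Omega> u x * \<phi> x)"
      unfolding set_lebesgue_integral_def by (simp add: mult.assoc)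
    also have "(LINT x|lborel. w1 x * \<phi> x) = (LINT x:\<Omega>|lborel. w1 x * \<phi> x)"
      unfolding set_lebesgue_integral_def by (rule Bochner_Integration.integral_cong[OF refl]) (metis iw1 mult_scaleR_left)
    finally show "(LINT x|lborel. h x * \<phi> x) = 0" using eq by simp
  qed
  then show "AE x in lborel. x \<in> \<Omega> \<longrightarrow> regional_frac_laplacian a \<Omega> u x = ?C * reg_limit a \<Omega> U x"
    by eventually_elim (simp add: h_def w1_def)
qed

end

section \<open>Zero extensions and weak solutions\<close>

lemma Cc_bounded:
  assumes b: "b \<in> Cc (U :: 'a::euclidean_space set)"
  obtains B where "\<And>x. \<bar>b x\<bar> \<le> B"
proof -
  have cont: "continuous_on UNIV b" and K: "compact (closure {x. b x \<noteq> 0})" using b by (simp_all add: Cc_def)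
  have "bounded (b ` closure {x. b x \<noteq> 0})"
    by (intro compact_imp_bounded compact_continuous_image continuous_on_subset[OF cont] K) simp
  then obtain B where B: "\<And>x. x \<in> closure {x. b x \<noteq> 0} \<Longrightarrow> \<bar>b x\<bar> \<le> B" by (auto simp: bounded_iff)
  have "\<bar>b x\<bar> \<le> max B 0" for x
  proof (cases "b x = 0")
    case False
    then have "x \<in> closure {x. b x \<noteq> 0}" by (intro subsetD[OF closure_subset]) simp
    then show ?thesis using B[of x] by simp
  qed simp
  then show thesis by (rule that)
qed

lemma Cc_outside: "b \<in> Cc U \<Longrightarrow> x \<notin> U \<Longrightarrow> b x = 0"
  using closure_subset[of "{x. b x \<noteq> 0}"] by (auto simp: Cc_def)

lemma Cc_measurable: "b \<in> Cc U \<Longrightarrow> b \<in> borel_measurable borel"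
  by (simp add: Cc_def borel_measurable_continuous_onI)

lemma L2_Cc_mult:
  assumes b: "b \<in> Cc (U :: 'a::euclidean_space set)" and u: "L2_on UNIV (u :: 'a \<Rightarrow> real)"
  shows "L2_on UNIV (\<lambda>x. b x * u x)"
proof -
  note [measurable] = L2_measurable[OF u] Cc_measurable[OF b]
  obtain B where B: "\<And>x. \<bar>b x\<bar> \<le> B" using Cc_bounded[OF b] by blast
  show ?thesis
  proof (rule L2_dominated[OF _ L2_cmult[OF u, of B]])
    have "\<bar>b x\<bar> * \<bar>u x\<bar> \<le> \<bar>B\<bar> * \<bar>u x\<bar>" for x using B[of x] by (intro mult_right_mono) linarith+
    then show "AE x in lborel. norm (b x * u x) \<le> norm (B * u x)" by (simp add: abs_mult)
  qed measurable
qed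

text \<open>Approximation in $H^r$ by test functions supported in $U$ implies approximation in $L^2$.\<close>

lemma sobolev_tilde_outside:
  fixes f :: "'a::euclidean_space \<Rightarrow> real"
  assumes f: "f \<in> sobolev_tilde r U" and r: "0 \<le> r" "r \<le> 2" and A: "A \<in> sets borel" "A \<inter> U = {}"
  shows "AE x in lborel. x \<in> A \<longrightarrow> f x = 0"
proof -
  have fs: "f \<in> sobolev r" using f by (simp add: sobolev_tilde_def)
  obtain \<phi> :: "nat \<Rightarrow> 'a \<Rightarrow> real" where \<phi>: "\<And>k. \<phi> k \<in> Cc_smooth U" "(\<lambda>k. sobolev_norm r (\<lambda>x. \<phi> k x - f x)) \<longlonglongrightarrow> 0"
    using f by (auto simp: sobolev_tilde_def)
  note [measurable] = A(1) L2_measurable[OF sobolev_L2[OF fs]]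
  let ?c = "ennreal ((2 * pi) ^ DIM('a))" and ?h = "\<lambda>x. indicator A x * f x"
  have "?c * norm2sq ?h \<le> ennreal ((sobolev_norm r (\<lambda>x. \<phi> k x - f x))\<^sup>2)" for k
  proof -
    have "\<phi> k x = 0" if "x \<in> A" for x using Cc_outside[of "\<phi> k" U x] \<phi>(1)[of k] that A(2) by (auto simp: Cc_smooth_def)
    then have "norm2sq ?h \<le> norm2sq (\<lambda>x. \<phi> k x - f x)" by (intro norm2sq_mono) (simp add: indicator_def)
    then have "?c * norm2sq ?h \<le> ?c * norm2sq (\<lambda>x. \<phi> k x - f x)" by (rule mult_left_mono) simp
    also have "\<dots> \<le> ennreal ((sobolev_norm r (\<lambda>x. \<phi> k x - f x))\<^sup>2)"
      by (rule norm2sq_le_sobolev_norm[OF r(1) sobolev_diff[OF r(1) schwartz_sobolev[OF Cc_smooth_schwartz[OF \<phi>(1)] r] fs]])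
    finally show ?thesis .
  qed
  moreover have "(\<lambda>k. ennreal ((sobolev_norm r (\<lambda>x. \<phi> k x - f x))\<^sup>2)) \<longlonglongrightarrow> ennreal (0\<^sup>2)"
    by (intro tendsto_ennrealI tendsto_power \<phi>(2))
  ultimately have "?c * norm2sq ?h \<le> ennreal (0\<^sup>2)" by (intro LIMSEQ_le_const) auto
  moreover have "0 < ((2 * pi) ^ DIM('a) :: real)" by (intro zero_less_power) simp
  ultimately have "norm2sq ?h = 0" by simp
  then have "AE x in lborel. ?h x = 0" by (subst (asm) norm2sq_eq_0_iff) measurable
  then show ?thesis by eventually_elim (auto simp: indicator_def)
qed

lemma lipschitz_domain_AE_cases:
  fixes \<Omega> :: "'a::euclidean_space set"
  assumes dom: "bounded_lipschitz_domain \<Omega>"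
  shows "AE x in lborel. x \<in> \<Omega> \<or> x \<in> exterior \<Omega>"
proof -
  have o: "open \<Omega>" using dom by (simp add: bounded_lipschitz_domain_def)
  have "frontier \<Omega> \<in> null_sets lborel" using lipschitz_frontier_null[OF dom] by (intro null_setsI) (simp_all add: borel_closed)
  then have "AE x in lborel. x \<notin> frontier \<Omega>" by (rule AE_not_in)
  then show ?thesis by eventually_elim (use o in \<open>auto simp: frontier_def exterior_def interior_open\<close>)
qed

text \<open>The boundary is a null set, so $u - f$ is the extension of $u|_\Omega$ by zero.\<close>

lemma zero_extension_sobolev:
  fixes u f :: "'a::euclidean_space \<Rightarrow> real"
  assumes dom: "bounded_lipschitz_domain \<Omega>" and r: "0 \<le> r" and u: "u \<in> sobolev r" and f: "f \<in> sobolev r"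
    and f0: "AE x in lborel. x \<in> \<Omega> \<longrightarrow> f x = 0" and uf: "AE x in lborel. x \<in> exterior \<Omega> \<longrightarrow> u x = f x"
  shows "(\<lambda>x. indicator \<Omega> x * u x) \<in> sobolev r"
proof (rule sobolev_cong_AE[OF sobolev_diff[OF r u f]])
  have [measurable]: "\<Omega> \<in> sets borel" using dom by (simp add: bounded_lipschitz_domain_def)
  note [measurable] = L2_measurable[OF sobolev_L2[OF u]]
  show "(\<lambda>x. indicator \<Omega> x * u x) \<in> borel_measurable borel" by measurable
  show "AE x in lborel. u x - f x = indicator \<Omega> x * u x"
    using f0 uf lipschitz_domain_AE_cases[OF dom]
    by eventually_elim (auto simp: indicator_def exterior_def dest: subsetD[OF closure_subset])
qed

lemma Cc_smooth_indicator: "\<phi> \<in> Cc_smooth \<Omega> \<Longrightarrow> (\<lambda>x. indicator \<Omega> x * \<phi> x) = \<phi>"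
  by (rule ext) (auto simp: indicator_def Cc_smooth_def Cc_outside)

text \<open>A representative of the regional fractional Laplacian of \<open>u\<close> that is defined on the whole space and vanishes
  outside \<open>\<Omega>\<close>.\<close>

definition regional_rep :: "real \<Rightarrow> 'a::euclidean_space set \<Rightarrow> ('a \<Rightarrow> real) \<Rightarrow> 'a \<Rightarrow> real" where
  "regional_rep a \<Omega> u x = frac_const TYPE('a) a * reg_limit a \<Omega> (\<lambda>x. indicator \<Omega> x * u x) x"

lemma regional_rep_outside: "x \<notin> \<Omega> \<Longrightarrow> regional_rep a \<Omega> u x = 0"
  by (simp add: regional_rep_def reg_limit_def)

context
  fixes \<Omega> :: "'a::euclidean_space set" and s t :: real
  assumes s: "0 < s" and st: "s < t" and t: "t < 1" and dom: "bounded_lipschitz_domain \<Omega>"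
begin

text \<open>The solutions for exterior data that vanish on \<open>\<Omega>\<close>, their differences and all test functions have this
  property; it makes the regional operator computable.\<close>

definition admissible :: "('a \<Rightarrow> real) \<Rightarrow> bool" where
  "admissible u \<longleftrightarrow> u \<in> sobolev t \<and> (\<lambda>x. indicator \<Omega> x * u x) \<in> sobolev t"

lemma order_bounds: "0 < s / 2" "2 * (s / 2) \<le> t" "s / 2 < 1" "0 < t / 2" "t / 2 < 1" "0 \<le> t" "t \<le> 2"
  using s st t by auto

lemma open_domain: "open \<Omega>" using dom by (simp add: bounded_lipschitz_domain_def)

lemma bounded_domain: "bounded \<Omega>" using dom by (simp add: bounded_lipschitz_domain_def)

lemma measurable_domain [measurable]: "\<Omega> \<in> sets borel" using open_domain by simp

lemma admissible_L2: "admissible u \<Longrightarrow> L2_on UNIV u"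
  by (auto simp: admissible_def sobolev_L2)

lemma admissible_diff: "admissible u \<Longrightarrow> admissible v \<Longrightarrow> admissible (\<lambda>x. u x - v x)"
  using sobolev_diff[OF order_bounds(6)] by (auto simp: admissible_def right_diff_distrib)

lemma admissible_Cc_smooth:
  assumes phi: "\<phi> \<in> Cc_smooth \<Omega>" shows "admissible \<phi>"
  unfolding admissible_def Cc_smooth_indicator[OF phi]
  using schwartz_sobolev[OF Cc_smooth_schwartz[OF phi] order_bounds(6,7)] by simp

lemma admissible_solution:
  assumes "weak_solution s t \<Omega> b q f u" and f: "f \<in> sobolev t" "AE x in lborel. x \<in> \<Omega> \<longrightarrow> f x = 0"
  shows "admissible u"
  using assms zero_extension_sobolev[OF dom order_bounds(6) _ f(1) f(2), of u]
  by (auto simp: admissible_def weak_solution_def)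

lemma L2_regional_rep: "admissible u \<Longrightarrow> L2_on UNIV (regional_rep (s / 2) \<Omega> u)"
  unfolding regional_rep_def[abs_def] admissible_def
  by (intro L2_cmult L2_reg_limit[OF dom order_bounds(1,2) t]) auto

lemma regional_rep_AE:
  assumes u: "admissible u"
  shows "AE x in lborel. x \<in> \<Omega> \<longrightarrow> regional_frac_laplacian (s / 2) \<Omega> u x = regional_rep (s / 2) \<Omega> u x"
  unfolding regional_rep_def
  by (rule regional_AE_eq[OF dom order_bounds(1,2) t])
     (use u L2_measurable[OF admissible_L2[OF u]] in \<open>auto simp: admissible_def\<close>)

lemma regional_measurable:
  assumes u: "admissible u"
  shows "(\<lambda>x. indicator \<Omega> x * regional_frac_laplacian (s / 2) \<Omega> u x) \<in> borel_measurable borel"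
proof -
  have "L2_on \<Omega> (regional_frac_laplacian (s / 2) \<Omega> u)"
    by (rule L2_regional[OF dom order_bounds(1,2) t, of "\<lambda>x. indicator \<Omega> x * u x"])
       (use u L2_measurable[OF admissible_L2[OF u]] in \<open>auto simp: admissible_def\<close>)
  then show ?thesis by (simp add: L2_on_def set_borel_measurable_def)
qed

lemma sobolev_s:
  assumes "u \<in> sobolev t" shows "u \<in> sobolev (2 * (s / 2))"
  by (rule sobolev_mono[OF _ order_bounds(2) assms]) (use s in simp)

lemma regional_rep_diff:
  assumes u: "admissible u" and v: "admissible v"
  shows "AE x in lborel. regional_rep (s / 2) \<Omega> (\<lambda>x. u x - v x) x = regional_rep (s / 2) \<Omega> u x - regional_rep (s / 2) \<Omega> v x"
proof -
  have "AE x in lborel. frac_laplacian (s / 2) (\<lambda>x. indicator \<Omega> x * u x - indicator \<Omega> x * v x) x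
      = frac_laplacian (s / 2) (\<lambda>x. indicator \<Omega> x * u x) x - frac_laplacian (s / 2) (\<lambda>x. indicator \<Omega> x * v x) x"
    by (rule frac_laplacian_diff[OF order_bounds(1,3)]; rule sobolev_s) (use u v in \<open>simp_all add: admissible_def\<close>)
  then show ?thesis
    by eventually_elim (simp add: regional_rep_def reg_limit_def right_diff_distrib)
qed

lemma regional_rep_cong:
  assumes u: "admissible u" and v: "admissible v" and uv: "AE x in lborel. u x = v x"
  shows "AE x in lborel. regional_rep (s / 2) \<Omega> u x = regional_rep (s / 2) \<Omega> v x"
proof -
  have "fourier (\<lambda>x. indicator \<Omega> x * u x) = fourier (\<lambda>x. indicator \<Omega> x * v x)"
    using u v uv by (intro fourier_cong_AE) (auto simp: admissible_def L2_measurable sobolev_L2)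
  then have L: "frac_laplacian (s / 2) (\<lambda>x. indicator \<Omega> x * u x) = frac_laplacian (s / 2) (\<lambda>x. indicator \<Omega> x * v x)"
    unfolding frac_laplacian_def by simp
  show ?thesis
    using uv by eventually_elim (simp add: regional_rep_def reg_limit_def L)
qed

text \<open>The coefficients vanish outside \<open>\<Omega>\<close>, so the integrals may be taken over the whole space, with the
  representatives in place of the weak operators.\<close>

lemma weak_form_eq:
  assumes b: "b \<in> Cc \<Omega>" and q: "q \<in> Cc \<Omega>" and u: "admissible u" and phi: "\<phi> \<in> Cc_smooth \<Omega>"
  shows "(LINT x:\<Omega>|lborel. b x * regional_frac_laplacian (s / 2) \<Omega> u x * regional_frac_laplacian (s / 2) \<Omega> \<phi> x)
       = (LINT x|lborel. b x * regional_rep (s / 2) \<Omega> u x * regional_rep (s / 2) \<Omega> \<phi> x)"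
    and "(LINT x:\<Omega>|lborel. q x * u x * \<phi> x) = (LINT x|lborel. q x * u x * \<phi> x)"
proof -
  let ?A = "regional_frac_laplacian (s / 2) \<Omega>" and ?R = "regional_rep (s / 2) \<Omega>"
  note p = admissible_Cc_smooth[OF phi]
  note [measurable] = regional_measurable[OF u] regional_measurable[OF p] Cc_measurable[OF b]
    L2_measurable[OF L2_regional_rep[OF u]] L2_measurable[OF L2_regional_rep[OF p]]
  have ind: "indicator \<Omega> x *\<^sub>R (b x * ?A u x * ?A \<phi> x) = b x * (indicator \<Omega> x * ?A u x) * (indicator \<Omega> x * ?A \<phi> x)" for x
    by (simp add: indicator_def)
  show "(LINT x:\<Omega>|lborel. b x * ?A u x * ?A \<phi> x) = (LINT x|lborel. b x * ?R u x * ?R \<phi> x)"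
    unfolding set_lebesgue_integral_def ind
  proof (rule integral_cong_AE)
    show "AE x in lborel. b x * (indicator \<Omega> x * ?A u x) * (indicator \<Omega> x * ?A \<phi> x) = b x * ?R u x * ?R \<phi> x"
      using regional_rep_AE[OF u] regional_rep_AE[OF p]
      by eventually_elim (auto simp: indicator_def regional_rep_outside)
  qed measurable
  show "(LINT x:\<Omega>|lborel. q x * u x * \<phi> x) = (LINT x|lborel. q x * u x * \<phi> x)"
    unfolding set_lebesgue_integral_def
    by (rule Bochner_Integration.integral_cong[OF refl]) (auto simp: indicator_def Cc_outside[OF q])
qed

lemma weak_solution_diff:
  assumes b: "b \<in> Cc \<Omega>" and q: "q \<in> Cc \<Omega>" and f: "f \<in> sobolev t" "AE x in lborel. x \<in> \<Omega> \<longrightarrow> f x = 0"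
    and u: "weak_solution s t \<Omega> b q f u" and v: "weak_solution s t \<Omega> b q f v"
  shows "weak_solution s t \<Omega> b q (\<lambda>_. 0) (\<lambda>x. u x - v x)"
  unfolding weak_solution_def
proof (intro conjI ballI)
  let ?L = "frac_laplacian (t / 2)" and ?R = "regional_rep (s / 2) \<Omega>"
  note ua = admissible_solution[OF u f] and va = admissible_solution[OF v f]
  note da = admissible_diff[OF ua va]
  show "(\<lambda>x. u x - v x) \<in> sobolev t" using da by (simp add: admissible_def)
  have "AE x in lborel. x \<in> exterior \<Omega> \<longrightarrow> u x = f x" "AE x in lborel. x \<in> exterior \<Omega> \<longrightarrow> v x = f x"
    using u v by (simp_all add: weak_solution_def)
  then show "AE x in lborel. x \<in> exterior \<Omega> \<longrightarrow> u x - v x = 0" by eventually_elim simp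
  fix \<phi> assume phi: "\<phi> \<in> Cc_smooth \<Omega>"
  note p = admissible_Cc_smooth[OF phi]
  have st: "u \<in> sobolev (2 * (t / 2))" "v \<in> sobolev (2 * (t / 2))" "\<phi> \<in> sobolev (2 * (t / 2))" using ua va p by (simp_all add: admissible_def)
  note LL = L2_frac_laplacian[OF order_bounds(4,5)]
  note fr = LL[OF st(1)] LL[OF st(2)] LL[OF st(3)] LL[OF sobolev_diff[OF _ st(1,2)]]
  have fr4: "L2_on UNIV (?L (\<lambda>x. u x - v x))" by (rule fr(4)) (use order_bounds in simp)
  note R = L2_regional_rep[OF ua] L2_regional_rep[OF va] L2_regional_rep[OF p] L2_regional_rep[OF da]
  note [measurable] = fr(1-3)[THEN L2_measurable] fr4[THEN L2_measurable] R[THEN L2_measurable] Cc_measurable[OF b]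
  have 1: "(LINT x|lborel. ?L (\<lambda>x. u x - v x) x * ?L \<phi> x) = (LINT x|lborel. ?L u x * ?L \<phi> x) - (LINT x|lborel. ?L v x * ?L \<phi> x)"
  proof -
    have "(LINT x|lborel. ?L (\<lambda>x. u x - v x) x * ?L \<phi> x) = (LINT x|lborel. ?L u x * ?L \<phi> x - ?L v x * ?L \<phi> x)"
      using frac_laplacian_diff[OF order_bounds(4,5) st(1,2)]
      by (intro integral_cong_AE) (measurable, auto elim!: eventually_mono simp: left_diff_distrib)
    also have "\<dots> = (LINT x|lborel. ?L u x * ?L \<phi> x) - (LINT x|lborel. ?L v x * ?L \<phi> x)"
      by (intro Bochner_Integration.integral_diff integrable_L2_mult fr)
    finally show ?thesis .
  qed
  have 2: "(LINT x|lborel. b x * ?R (\<lambda>x. u x - v x) x * ?R \<phi> x) = (LINT x|lborel. b x * ?R u x * ?R \<phi> x) - (LINT x|lborel. b x * ?R v x * ?R \<phi> x)"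
  proof -
    have "(LINT x|lborel. b x * ?R (\<lambda>x. u x - v x) x * ?R \<phi> x) = (LINT x|lborel. b x * ?R u x * ?R \<phi> x - b x * ?R v x * ?R \<phi> x)"
      using regional_rep_diff[OF ua va]
      by (intro integral_cong_AE) (measurable, auto elim!: eventually_mono simp: left_diff_distrib right_diff_distrib)
    also have "\<dots> = (LINT x|lborel. b x * ?R u x * ?R \<phi> x) - (LINT x|lborel. b x * ?R v x * ?R \<phi> x)"
      by (intro Bochner_Integration.integral_diff integrable_L2_mult L2_Cc_mult[OF b] R)
    finally show ?thesis .
  qed
  have 3: "(LINT x|lborel. q x * (u x - v x) * \<phi> x) = (LINT x|lborel. q x * u x * \<phi> x) - (LINT x|lborel. q x * v x * \<phi> x)"
    unfolding right_diff_distrib left_diff_distrib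
    by (intro Bochner_Integration.integral_diff integrable_L2_mult L2_Cc_mult[OF q] admissible_L2 ua va p)
  have "(LINT x|lborel. ?L u x * ?L \<phi> x) + (LINT x|lborel. b x * ?R u x * ?R \<phi> x) + (LINT x|lborel. q x * u x * \<phi> x) = 0"
    using u phi unfolding weak_solution_def weak_form_eq[OF b q ua phi, symmetric] by blast
  moreover have "(LINT x|lborel. ?L v x * ?L \<phi> x) + (LINT x|lborel. b x * ?R v x * ?R \<phi> x) + (LINT x|lborel. q x * v x * \<phi> x) = 0"
    using v phi unfolding weak_solution_def weak_form_eq[OF b q va phi, symmetric] by blast
  ultimately show "(LINT x|lborel. ?L (\<lambda>x. u x - v x) x * ?L \<phi> x)
      + (LINT x:\<Omega>|lborel. b x * regional_frac_laplacian (s / 2) \<Omega> (\<lambda>x. u x - v x) x * regional_frac_laplacian (s / 2) \<Omega> \<phi> x)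
      + (LINT x:\<Omega>|lborel. q x * (u x - v x) * \<phi> x) = 0"
    unfolding weak_form_eq[OF b q da phi] 1 2 3 by linarith
qed

lemma solution_AE_eq:
  assumes b: "b \<in> Cc \<Omega>" and q: "q \<in> Cc \<Omega>" and f: "f \<in> sobolev t" "AE x in lborel. x \<in> \<Omega> \<longrightarrow> f x = 0"
    and ev: "eigenvalue_condition s t \<Omega> b q" and u: "weak_solution s t \<Omega> b q f u"
  shows "weak_solution s t \<Omega> b q f (solution s t \<Omega> b q f)"
    and "AE x in lborel. solution s t \<Omega> b q f x = u x"
proof -
  show S: "weak_solution s t \<Omega> b q f (solution s t \<Omega> b q f)"
    unfolding solution_def by (rule someI[of "weak_solution s t \<Omega> b q f", OF u])
  have "weak_solution s t \<Omega> b q (\<lambda>_. 0) (\<lambda>x. solution s t \<Omega> b q f x - u x)"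
    by (rule weak_solution_diff[OF b q f S u])
  then have "AE x in lborel. solution s t \<Omega> b q f x - u x = 0" by (rule ev[unfolded eigenvalue_condition_def, rule_format])
  then show "AE x in lborel. solution s t \<Omega> b q f x = u x" by eventually_elim simp
qed

section \<open>Determination of the solution and of the coefficients\<close>

text \<open>At a point $x$ of $W$ the values $u(x)$ and $v(x)$ coincide, and the difference of the two integrals is the
  potential of $1_\Omega (u - v)$. Splitting the integrals is possible because $x$ has positive distance to \<open>\<Omega>\<close>.\<close>

lemma neumann_data_determines:
  fixes u v :: "'a \<Rightarrow> real"
  assumes u: "L2_on UNIV u" and v: "L2_on UNIV v" and uv: "AE x in lborel. x \<in> exterior \<Omega> \<longrightarrow> u x = v x"
    and W: "open W" "W \<noteq> {}" "W \<subseteq> exterior \<Omega>" and r: "0 < r"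
    and N: "AE x in lborel. x \<in> W \<longrightarrow> (LINT y:\<Omega>|lborel. (u x - u y) / norm (x - y) powr (real DIM('a) + 2 * r))
      = (LINT y:\<Omega>|lborel. (v x - v y) / norm (x - y) powr (real DIM('a) + 2 * r))"
  shows "AE x in lborel. u x = v x"
proof -
  note [measurable] = L2_measurable[OF u] L2_measurable[OF v]
  let ?q = "real DIM('a) + 2 * r" and ?K = "closure \<Omega>"
  have K: "compact ?K" using bounded_domain by simp
  have oE: "open (- ?K)" by (rule open_Compl[OF closed_closure])
  have dis: "- ?K \<inter> ?K = {}" by blast
  have i1: "integrable lborel (\<lambda>y. indicator \<Omega> y * w y)" if w: "L2_on UNIV w" for w :: "'a \<Rightarrow> real"
  proof (rule L2_bounded_support_integrable[of _ \<Omega>])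
    note [measurable] = L2_measurable[OF w]
    show "L2_on UNIV (\<lambda>y. indicator \<Omega> y * w y)"
      by (rule L2_dominated[OF _ w]) (measurable, auto simp: indicator_def)
  qed (use bounded_domain in auto)
  have ii: "integrable lborel (\<lambda>y. indicator \<Omega> y *\<^sub>R ((w x - w y) / norm (x - y) powr ?q))"
    if w: "L2_on UNIV w" and x: "x \<in> - ?K" for w :: "'a \<Rightarrow> real" and x
  proof -
    have i: "integrable lborel (\<lambda>y. w x * indicator \<Omega> y - indicator \<Omega> y * w y)"
      by (intro Bochner_Integration.integrable_diff integrable_mult_right i1[OF w] integrable_real_indicator)
         (use emeasure_bounded_finite[OF bounded_domain] in simp_all)
    have z: "w x * indicator \<Omega> y - indicator \<Omega> y * w y = 0" if "y \<notin> ?K" for y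
      using that closure_subset[of \<Omega>] by (auto simp: indicator_def)
    obtain d where d: "0 < d" "ball x d \<subseteq> - ?K" "\<And>z y. z \<in> ball x d \<Longrightarrow> y \<in> ?K \<Longrightarrow> d \<le> norm (z - y)"
      using separation[OF oE dis x] by blast
    have "integrable lborel (\<lambda>y. (w x * indicator \<Omega> y - indicator \<Omega> y * w y) * kern r (x - y))"
    proof (rule integrable_bounded_factor[OF i z K oE dis])
      fix y assume y: "y \<in> ?K"
      have "d \<le> norm (x - y)" by (rule d(3)[OF _ y]) (use d(1) in simp)
      then show "\<bar>kern r (x - y)\<bar> \<le> d powr - ?q"
        unfolding kern_def using powr_neg_le[OF d(1), of "norm (x - y)" ?q] r by simp
    qed measurable
    moreover have "(w x * indicator \<Omega> y - indicator \<Omega> y * w y) * kern r (x - y) = indicator \<Omega> y *\<^sub>R ((w x - w y) / norm (x - y) powr ?q)" for y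
      unfolding divide_norm_powr by (simp add: indicator_def)
    ultimately show ?thesis by simp
  qed
  define g where "g y = indicator \<Omega> y * (u y - v y)" for y
  have g: "L2_on UNIV g" unfolding g_def[abs_def]
    by (rule L2_dominated[OF _ L2_diff[OF u v]]) (measurable, auto simp: indicator_def)
  have "AE y in lborel. g y = 0"
  proof (rule riesz_potential_unique_continuation[OF g _ K W(1,2), of ?q])
    show "g y = 0" if "y \<notin> ?K" for y using that closure_subset[of \<Omega>] by (auto simp: g_def indicator_def)
    show "W \<inter> ?K = {}" using W(3) by (auto simp: exterior_def)
    show "0 < ?q" "real DIM('a) < ?q + 2" using r by simp_all
    show "AE x in lborel. x \<in> W \<longrightarrow> (LINT y|lborel. g y * norm (x - y) powr - ?q) = 0"
      using N uv
    proof eventually_elim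
      case (elim x)
      show ?case
      proof
        assume x: "x \<in> W"
        then have xe: "x \<in> - ?K" and xx: "x \<in> exterior \<Omega>" using W(3) by (auto simp: exterior_def)
        have "g y * norm (x - y) powr - ?q = indicator \<Omega> y *\<^sub>R ((v x - v y) / norm (x - y) powr ?q) - indicator \<Omega> y *\<^sub>R ((u x - u y) / norm (x - y) powr ?q)" for y
          using elim(2) xx unfolding divide_norm_powr kern_def by (simp add: g_def left_diff_distrib right_diff_distrib)
        then have "(LINT y|lborel. g y * norm (x - y) powr - ?q) = (LINT y:\<Omega>|lborel. (v x - v y) / norm (x - y) powr ?q) - (LINT y:\<Omega>|lborel. (u x - u y) / norm (x - y) powr ?q)"
          unfolding set_lebesgue_integral_def by (simp only: Bochner_Integration.integral_diff[OF ii[OF v xe] ii[OF u xe]])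
        then show "(LINT y|lborel. g y * norm (x - y) powr - ?q) = 0" using elim(1) x by simp
      qed
    qed
  qed
  then show ?thesis
    using uv lipschitz_domain_AE_cases[OF dom] by eventually_elim (auto simp: g_def indicator_def)
qed

lemma weak_solutions_subtract:
  assumes b: "b1 \<in> Cc \<Omega>" "b2 \<in> Cc \<Omega>" and q: "q1 \<in> Cc \<Omega>" "q2 \<in> Cc \<Omega>"
    and a: "admissible u1" "admissible u2"
    and u1: "weak_solution s t \<Omega> b1 q1 f u1" and u2: "weak_solution s t \<Omega> b2 q2 f u2"
    and u12: "AE x in lborel. u1 x = u2 x" and phi: "\<phi> \<in> Cc_smooth \<Omega>"
  shows "(LINT x|lborel. ((b1 x - b2 x) * regional_rep (s / 2) \<Omega> u1 x) * regional_rep (s / 2) \<Omega> \<phi> x)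
    + (LINT x|lborel. ((q1 x - q2 x) * u1 x) * \<phi> x) = 0"
proof -
  let ?R = "regional_rep (s / 2) \<Omega>" and ?L = "frac_laplacian (t / 2)"
  note p = admissible_Cc_smooth[OF phi]
  note Rp = L2_regional_rep[OF p] and pL = admissible_L2[OF p]
  note R = L2_regional_rep[OF a(1)] L2_regional_rep[OF a(2)] and uL = admissible_L2[OF a(1)] admissible_L2[OF a(2)]
  note [measurable] = R[THEN L2_measurable] Rp[THEN L2_measurable] uL[THEN L2_measurable] pL[THEN L2_measurable]
    b[THEN Cc_measurable] q[THEN Cc_measurable]
  have L12: "?L u1 = ?L u2"
    using fourier_cong_AE[OF L2_measurable[OF uL(1)] L2_measurable[OF uL(2)] u12] by (simp only: frac_laplacian_def)
  have "(LINT x|lborel. ?L u1 x * ?L \<phi> x) + (LINT x|lborel. b1 x * ?R u1 x * ?R \<phi> x) + (LINT x|lborel. q1 x * u1 x * \<phi> x) = 0"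
    using u1 phi unfolding weak_solution_def weak_form_eq[OF b(1) q(1) a(1) phi, symmetric] by blast
  moreover have "(LINT x|lborel. ?L u2 x * ?L \<phi> x) + (LINT x|lborel. b2 x * ?R u2 x * ?R \<phi> x) + (LINT x|lborel. q2 x * u2 x * \<phi> x) = 0"
    using u2 phi unfolding weak_solution_def weak_form_eq[OF b(2) q(2) a(2) phi, symmetric] by blast
  moreover have "(LINT x|lborel. b2 x * ?R u2 x * ?R \<phi> x) = (LINT x|lborel. b2 x * ?R u1 x * ?R \<phi> x)"
  proof (rule integral_cong_AE)
    show "AE x in lborel. b2 x * ?R u2 x * ?R \<phi> x = b2 x * ?R u1 x * ?R \<phi> x"
      using regional_rep_cong[OF a u12] by eventually_elim simp
  qed measurable
  moreover have "(LINT x|lborel. q2 x * u2 x * \<phi> x) = (LINT x|lborel. q2 x * u1 x * \<phi> x)"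
  proof (rule integral_cong_AE)
    show "AE x in lborel. q2 x * u2 x * \<phi> x = q2 x * u1 x * \<phi> x" using u12 by eventually_elim simp
  qed measurable
  moreover have "(LINT x|lborel. ((b1 x - b2 x) * ?R u1 x) * ?R \<phi> x) = (LINT x|lborel. b1 x * ?R u1 x * ?R \<phi> x) - (LINT x|lborel. b2 x * ?R u1 x * ?R \<phi> x)"
    unfolding left_diff_distrib
    by (intro Bochner_Integration.integral_diff integrable_L2_mult L2_Cc_mult[OF b(1)] L2_Cc_mult[OF b(2)] R Rp)
  moreover have "(LINT x|lborel. ((q1 x - q2 x) * u1 x) * \<phi> x) = (LINT x|lborel. q1 x * u1 x * \<phi> x) - (LINT x|lborel. q2 x * u1 x * \<phi> x)"
    unfolding left_diff_distrib
    by (intro Bochner_Integration.integral_diff integrable_L2_mult L2_Cc_mult[OF q(1)] L2_Cc_mult[OF q(2)] uL pL)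
  ultimately show ?thesis unfolding L12 by linarith
qed

text \<open>Test functions supported in a ball away from $K$ are not paired with $h$, and on $K$ their regional
  Laplacian is a convergent integral. By Fubini the pairing is $\int \varphi\,P$ with $P$ a potential of $g$,
  which therefore vanishes in the ball.\<close>

lemma regional_pairing_unique_continuation:
  fixes g h :: "'a \<Rightarrow> real"
  assumes g: "L2_on UNIV g" and h: "L2_on UNIV h" and K: "compact K" "K \<subseteq> \<Omega>"
    and gK: "\<And>x. x \<notin> K \<Longrightarrow> g x = 0" and hK: "\<And>x. x \<notin> K \<Longrightarrow> h x = 0"
    and eq: "\<And>\<phi>. \<phi> \<in> Cc_smooth \<Omega> \<Longrightarrow> (LINT x|lborel. g x * regional_rep (s / 2) \<Omega> \<phi> x) + (LINT x|lborel. h x * \<phi> x) = 0"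
  shows "AE x in lborel. g x = 0" and "AE x in lborel. h x = 0"
proof -
  let ?a = "s / 2"
  define q where "q = real DIM('a) + 2 * ?a"
  have q: "0 < q" using s by (simp add: q_def)
  have kern_q: "kern ?a z = norm z powr - q" for z :: 'a by (simp add: kern_def q_def)
  have gi: "integrable lborel g"
    by (rule L2_bounded_support_integrable[OF g, of K]) (use K(1) gK compact_imp_closed in \<open>auto intro: compact_imp_bounded borel_closed\<close>)
  note [measurable] = L2_measurable[OF g] L2_measurable[OF h]
  have oK: "open (\<Omega> - K)" by (intro open_Diff open_domain compact_imp_closed K)
\<comment> \<open>Otherwise \<open>\<Omega>\<close> would be open and closed, hence the whole space, which is unbounded.\<close>
  have "\<not> \<Omega> \<subseteq> K"
  proof
    assume "\<Omega> \<subseteq> K"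
    then have "closed \<Omega>" using K compact_imp_closed by (metis subset_antisym)
    moreover have "\<Omega> \<noteq> {}" using dom by (simp add: bounded_lipschitz_domain_def)
    ultimately have "\<Omega> = UNIV" using clopen[of \<Omega>] open_domain by blast
    then show False using bounded_domain not_bounded_UNIV by simp
  qed
  then obtain p where p: "p \<in> \<Omega> - K" by blast
  have dis: "(\<Omega> - K) \<inter> K = {}" by blast
  obtain d where d: "0 < d" "ball p d \<subseteq> \<Omega> - K" "\<And>z y. z \<in> ball p d \<Longrightarrow> y \<in> K \<Longrightarrow> d \<le> norm (z - y)"
    using separation[OF oK dis p] by blast
  define V where "V = ball p d"
  have V: "open V" "p \<in> V" "V \<subseteq> \<Omega>" "V \<inter> K = {}" using d(1,2) by (auto simp: V_def)
  have [measurable]: "V \<in> sets borel" by (simp add: V_def)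
  define P where "P y = (LINT x|lborel. g x * norm (y - x) powr - q)" for y
  have [measurable]: "P \<in> borel_measurable borel" unfolding P_def[abs_def] by measurable
  have kerV: "kern_trunc ?a e (x - y) = norm (y - x) powr - q" if "x \<in> K" "y \<in> V" "e < d" for x y e
  proof -
    have "e < norm (y - x)" using d(3)[of y x] that by (simp add: V_def)
    then show ?thesis by (simp add: kern_trunc_def kern_q norm_minus_commute)
  qed
  have test: "(LINT y|lborel. \<phi> y * P y) = 0" if phi: "\<phi> \<in> Cc_smooth V" for \<phi>
  proof -
    have phiO: "\<phi> \<in> Cc_smooth \<Omega>" using phi V(3) by (auto simp: Cc_smooth_def Cc_def)
    have z: "\<phi> y = 0" if "y \<notin> V" for y using phi that by (auto simp: Cc_smooth_def Cc_outside)
    have pi: "integrable lborel \<phi>" by (rule schwartz_integrable[OF Cc_smooth_schwartz[OF phi]])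
    note pa = admissible_Cc_smooth[OF phiO]
    note [measurable] = borel_measurable_integrable[OF pi]
    have pt: "\<phi> \<in> sobolev t" using pa by (simp add: admissible_def)
    have zO: "\<phi> y = 0" if "y \<notin> \<Omega>" for y using z that V(3) by blast
    have "h x * \<phi> x = 0" for x using hK[of x] z[of x] V(4) by auto
    then have "(LINT x|lborel. h x * \<phi> x) = 0" by (simp only: Bochner_Integration.integral_zero)
    then have "(LINT x|lborel. frac_const TYPE('a) ?a * (g x * reg_limit ?a \<Omega> \<phi> x)) = 0"
      using eq[OF phiO] unfolding regional_rep_def Cc_smooth_indicator[OF phiO] by (simp add: mult.left_commute)
    then have lim0: "(LINT x|lborel. reg_limit ?a \<Omega> \<phi> x * g x) = 0"
      using frac_const_pos[OF order_bounds(1,3), where 'a='a] by (simp add: mult.commute)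
\<comment> \<open>All truncation radii are below $d$, so on $K$ the truncated operator does not change with $k$.\<close>
    define e where "e k = d / (real k + 2)" for k
    have e: "e \<longlonglongrightarrow> 0" "\<And>k. 0 < e k" "\<And>k. e k < d"
    proof -
      have "(\<lambda>k. d / real (k + 2)) \<longlonglongrightarrow> 0" by (rule LIMSEQ_ignore_initial_segment[OF lim_const_over_n])
      then show "e \<longlonglongrightarrow> 0" by (simp add: e_def[abs_def] add.commute)
      show "0 < e k" "e k < d" for k using d(1) by (simp_all add: e_def divide_less_eq)
    qed
    note tr = L2_reg_trunc_tendsto[OF dom order_bounds(1,2) t pt zO e(1,2)]
    have tl: "(\<lambda>k. LINT x|lborel. reg_trunc ?a \<Omega> (e k) \<phi> x * g x) \<longlonglongrightarrow> (LINT x|lborel. reg_limit ?a \<Omega> \<phi> x * g x)"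
      by (rule L2_inner_tendsto[OF tr(1) L2_reg_limit[OF dom order_bounds(1,2) t pt zO] g tr(2)])
    define k0 :: "'a \<Rightarrow> real" where "k0 = kern_trunc ?a (d / 2)"
    have k0b: "\<bar>k0 w\<bar> \<le> (d / 2) powr - q" for w
      unfolding k0_def kern_trunc_def kern_q using powr_neg_le[of "d / 2" "norm w" q] d(1) q by (auto simp: indicator_def)
    have [measurable]: "k0 \<in> borel_measurable borel" unfolding k0_def by measurable
    define F where "F x y = g x * \<phi> y * k0 (x - y)" for x y
    have F0: "F x y = \<phi> y * (g x * norm (y - x) powr - q)" for x y
    proof (cases "x \<in> K \<and> y \<in> V")
      case True
      then have "k0 (x - y) = norm (y - x) powr - q" unfolding k0_def using d(1) by (intro kerV) auto
      then show ?thesis by (simp add: F_def)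
    next
      case False
      then have "g x * \<phi> y = 0" using gK[of x] z[of y] by auto
      then show ?thesis unfolding F_def by auto
    qed
    have gp: "integrable (lborel \<Otimes>\<^sub>M lborel) (\<lambda>p. g (fst p) * \<phi> (snd p))"
    proof (rule lborel_pair.Fubini_integrable)
      have "integrable lborel (\<lambda>x. \<bar>g x\<bar> * (LINT y|lborel. \<bar>\<phi> y\<bar>))" by (intro integrable_mult_left integrable_abs gi)
      then show "integrable lborel (\<lambda>x. LINT y|lborel. norm (g (fst (x, y)) * \<phi> (snd (x, y))))" by (simp add: abs_mult)
      show "AE x in lborel. integrable lborel (\<lambda>y. g (fst (x, y)) * \<phi> (snd (x, y)))" using pi by simp
    qed measurable
    have Fi: "integrable (lborel \<Otimes>\<^sub>M lborel) (case_prod F)"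
    proof (rule Bochner_Integration.integrable_bound[OF integrable_mult_left[OF gp, of "(d / 2) powr - q"]])
      show "case_prod F \<in> borel_measurable (lborel \<Otimes>\<^sub>M lborel)" unfolding F_def by measurable
      show "AE p in lborel \<Otimes>\<^sub>M lborel. norm (case_prod F p) \<le> norm (g (fst p) * \<phi> (snd p) * (d / 2) powr - q)"
      proof (rule AE_I2)
        fix p :: "'a \<times> 'a"
        have "norm (case_prod F p) = norm (g (fst p) * \<phi> (snd p)) * \<bar>k0 (fst p - snd p)\<bar>" by (simp add: F_def split_beta abs_mult)
        also have "\<dots> \<le> norm (g (fst p) * \<phi> (snd p)) * (d / 2) powr - q" by (rule mult_left_mono[OF k0b]) simp
        finally show "norm (case_prod F p) \<le> norm (g (fst p) * \<phi> (snd p) * (d / 2) powr - q)" by (simp only: norm_mult) simp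
      qed
    qed
    have rt: "reg_trunc ?a \<Omega> (e k) \<phi> x * g x = - (LINT y|lborel. F x y)" for k x
    proof (cases "x \<in> K")
      case True
      have x: "x \<in> \<Omega>" "\<phi> x = 0" using True K(2) z V(4) by auto
      have "reg_trunc ?a \<Omega> (e k) \<phi> x * g x = (LINT y|lborel. (indicator \<Omega> y * kern_trunc ?a (e k) (x - y) * (\<phi> x - \<phi> y)) * g x)"
        unfolding reg_trunc_def using x(1) by simp
      also have "\<dots> = (LINT y|lborel. - F x y)"
      proof (rule Bochner_Integration.integral_cong[OF refl])
        fix y
        show "indicator \<Omega> y * kern_trunc ?a (e k) (x - y) * (\<phi> x - \<phi> y) * g x = - F x y"
          using kerV[OF True _ e(3), of y k] z[of y] V(3) by (cases "y \<in> V") (auto simp: F0 x indicator_def)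
      qed
      finally show ?thesis by simp
    qed (simp add: gK F_def)
    have "(\<lambda>k::nat. LINT x|lborel. - (LINT y|lborel. F x y)) \<longlonglongrightarrow> 0" using tl unfolding rt lim0 .
    then have "(LINT x|lborel. (LINT y|lborel. F x y)) = 0" by (simp add: LIMSEQ_const_iff)
    then have "(LINT y|lborel. (LINT x|lborel. F x y)) = 0" using lborel_pair.Fubini_integral[OF Fi] by simp
    then show ?thesis unfolding F0 P_def by simp
  qed
  have Pb: "\<bar>P y\<bar> \<le> (LINT x|lborel. \<bar>g x\<bar>) * d powr - q" if y: "y \<in> V" for y
  proof -
    have "\<bar>P y\<bar> \<le> (LINT x|lborel. \<bar>g x\<bar> * d powr - q)"
      unfolding P_def real_norm_def[symmetric]
    proof (rule Bochner_Integration.integral_norm_bound_integral)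
      have le: "norm (g x * norm (y - x) powr - q) \<le> norm (g x) * d powr - q" for x
      proof (cases "x \<in> K")
        case True
        have "norm (y - x) powr - q \<le> d powr - q" by (rule powr_neg_le[OF d(1) d(3)]) (use y True q in \<open>auto simp: V_def\<close>)
        then show ?thesis by (simp add: abs_mult mult_left_mono)
      qed (simp add: gK)
      show gd: "integrable lborel (\<lambda>x. norm (g x) * d powr - q)" by (intro integrable_mult_left integrable_norm gi)
      show "integrable lborel (\<lambda>x. g x * norm (y - x) powr - q)"
        by (rule Bochner_Integration.integrable_bound[OF gd]) (measurable, use order.trans[OF le abs_ge_self] in auto)
      show "norm (g x * norm (y - x) powr - q) \<le> norm (g x) * d powr - q" for x by (rule le)
    qed
    then show ?thesis by simp
  qed
  have PL: "L2_on UNIV (\<lambda>y. indicator V y * P y)"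
  proof (rule L2_dominated)
    let ?M = "(LINT x|lborel. \<bar>g x\<bar>) * d powr - q"
    show "L2_on UNIV (\<lambda>y. ?M * indicator V y)" by (intro L2_cmult L2_indicator) (simp_all add: V_def)
    show "AE y in lborel. norm (indicator V y * P y) \<le> norm (?M * indicator V y)"
      by (rule AE_I2) (use order.trans[OF Pb abs_ge_self] in \<open>auto simp: indicator_def\<close>)
  qed measurable
  have Pz: "AE y in lborel. y \<in> V \<longrightarrow> indicator V y * P y = 0"
  proof (rule fundamental_lemma[OF PL V(1)])
    fix \<phi> assume phi: "\<phi> \<in> Cc_smooth V"
    have "indicator V y * P y * \<phi> y = \<phi> y * P y" for y
      using phi by (cases "y \<in> V") (auto simp: Cc_smooth_def Cc_outside)
    then show "(LINT y|lborel. indicator V y * P y * \<phi> y) = 0" using test[OF phi] by (simp only:)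
  qed
  show g0: "AE x in lborel. g x = 0"
  proof (rule riesz_potential_unique_continuation[OF g gK K(1) V(1) _ V(4) q])
    show "V \<noteq> {}" using V(2) by blast
    show "real DIM('a) < q + 2" using s by (simp add: q_def)
    show "AE y in lborel. y \<in> V \<longrightarrow> (LINT x|lborel. g x * norm (y - x) powr - q) = 0"
      using Pz by eventually_elim (simp add: P_def)
  qed
  have "AE x in lborel. x \<in> \<Omega> \<longrightarrow> h x = 0"
  proof (rule fundamental_lemma[OF h open_domain])
    fix \<phi> assume phi: "\<phi> \<in> Cc_smooth \<Omega>"
    have "(LINT x|lborel. g x * regional_rep ?a \<Omega> \<phi> x) = 0"
      by (rule integral_eq_zero_AE) (use g0 in \<open>eventually_elim, simp\<close>)
    then show "(LINT x|lborel. h x * \<phi> x) = 0" using eq[OF phi] by simp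
  qed
  then show "AE x in lborel. h x = 0"
    by eventually_elim (use K(2) hK in blast)
qed

end

text \<open>Near a point where two continuous coefficients differ, $w$ vanishes; so the point is not in the support of $w$.\<close>

lemma eq_on_support_in:
  fixes c1 c2 w z :: "'a::euclidean_space \<Rightarrow> real"
  assumes \<Omega>: "open \<Omega>" and c: "continuous_on UNIV c1" "continuous_on UNIV c2"
    and wz: "AE x in lborel. x \<in> \<Omega> \<longrightarrow> w x = z x" and z: "AE x in lborel. (c1 x - c2 x) * z x = 0"
    and x: "x \<in> support_in \<Omega> w"
  shows "c1 x = c2 x"
proof (rule ccontr)
  assume ne: "c1 x \<noteq> c2 x"
  define V where "V = \<Omega> \<inter> {y. c1 y \<noteq> c2 y}"
  have "open V" unfolding V_def by (intro open_Int \<Omega> open_Collect_neq c)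
  moreover have "V \<subseteq> \<Omega>" by (simp add: V_def)
  moreover have "AE y in lborel. y \<in> V \<longrightarrow> w y = 0" using wz z by eventually_elim (auto simp: V_def)
  moreover have "x \<in> V" using x ne by (simp add: V_def support_in_def)
  ultimately show False using x unfolding support_in_def by blast
qed

theorem theorem1p2:
  fixes \<Omega> W :: "(real ^ 'n) set"
    and s t :: real
    and b1 b2 q1 q2 f u1 u2 :: "real ^ 'n \<Rightarrow> real"
  assumes "0 < s" and "s < t" and "t < 1"
    and "bounded_lipschitz_domain \<Omega>"
    and "b1 \<in> Cc \<Omega>" and "b2 \<in> Cc \<Omega>" and "q1 \<in> Cc \<Omega>" and "q2 \<in> Cc \<Omega>"
    and "eigenvalue_condition s t \<Omega> b1 q1"
    and "eigenvalue_condition s t \<Omega> b2 q2"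
    and "f \<in> sobolev_tilde t (exterior \<Omega>)"
    and "\<not> (AE x in lborel. f x = 0)"
    and "weak_solution s t \<Omega> b1 q1 f u1"
    and "weak_solution s t \<Omega> b2 q2 f u2"
    and "open W" and "W \<noteq> {}" and "W \<subseteq> exterior \<Omega>"
    and "AE x in lborel. x \<in> W \<longrightarrow>
           nonlocal_neumann s t \<Omega> b1 q1 f x = nonlocal_neumann s t \<Omega> b2 q2 f x"
  shows "(AE x in lborel. u1 x = u2 x) \<and>
         (\<forall>x \<in> support_in \<Omega> u1. q1 x = q2 x) \<and>
         (\<forall>x \<in> support_in \<Omega> (regional_frac_laplacian (s / 2) \<Omega> u1). b1 x = b2 x)"
proof -
  note s = assms(1) and st = assms(2) and t = assms(3) and dom = assms(4)
  note b = assms(5,6) and q = assms(7,8) and ev = assms(9,10) and u1 = assms(13) and u2 = assms(14)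
  note cx = s st t dom
  let ?R = "regional_rep (s / 2) \<Omega>" and ?L = "frac_laplacian (t / 2)"
  have [measurable]: "\<Omega> \<in> sets borel" and o: "open \<Omega>" using dom by (auto simp: bounded_lipschitz_domain_def)
  have f: "f \<in> sobolev t" using assms(11) by (simp add: sobolev_tilde_def)
  have f0: "AE x in lborel. x \<in> \<Omega> \<longrightarrow> f x = 0"
  proof (rule sobolev_tilde_outside[OF assms(11)])
    show "\<Omega> \<inter> exterior \<Omega> = {}" using closure_subset[of \<Omega>] by (auto simp: exterior_def)
  qed (use s st t in simp_all)
  have a: "admissible \<Omega> t u1" "admissible \<Omega> t u2"
    using admissible_solution[OF cx u1 f f0] admissible_solution[OF cx u2 f f0] by simp_all
  note S1 = solution_AE_eq[OF cx b(1) q(1) f f0 ev(1) u1] and S2 = solution_AE_eq[OF cx b(2) q(2) f f0 ev(2) u2]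
  let ?S1 = "solution s t \<Omega> b1 q1 f" and ?S2 = "solution s t \<Omega> b2 q2 f"
  have C: "0 < frac_const TYPE(real ^ 'n) t" by (rule frac_const_pos) (use s st t in simp_all)
  have "AE x in lborel. ?S1 x = ?S2 x"
  proof (rule neumann_data_determines[OF cx _ _ _ assms(15-17), where r=t])
    show "L2_on UNIV ?S1" "L2_on UNIV ?S2" using S1(1) S2(1) by (auto simp: weak_solution_def sobolev_L2)
    have "AE x in lborel. x \<in> exterior \<Omega> \<longrightarrow> ?S1 x = f x" "AE x in lborel. x \<in> exterior \<Omega> \<longrightarrow> ?S2 x = f x"
      using S1(1) S2(1) by (simp_all add: weak_solution_def)
    then show "AE x in lborel. x \<in> exterior \<Omega> \<longrightarrow> ?S1 x = ?S2 x" by eventually_elim simp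
    show "0 < t" using s st by simp
    show "AE x in lborel. x \<in> W \<longrightarrow> (LINT y:\<Omega>|lborel. (?S1 x - ?S1 y) / norm (x - y) powr (real DIM(real ^ 'n) + 2 * t))
      = (LINT y:\<Omega>|lborel. (?S2 x - ?S2 y) / norm (x - y) powr (real DIM(real ^ 'n) + 2 * t))"
      using assms(18) unfolding nonlocal_neumann_def by eventually_elim (use C in simp)
  qed
  then have u12: "AE x in lborel. u1 x = u2 x" using S1(2) S2(2) by eventually_elim simp
  note R = L2_regional_rep[OF cx a(1)] L2_regional_rep[OF cx a(2)]
  note uL = admissible_L2[OF cx a(1)] admissible_L2[OF cx a(2)]
  let ?K = "\<lambda>c :: real ^ 'n \<Rightarrow> real. closure {x. c x \<noteq> 0}"
  let ?KK = "(?K b1 \<union> ?K b2) \<union> (?K q1 \<union> ?K q2)"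
  have out: "b1 x = 0" "b2 x = 0" "q1 x = 0" "q2 x = 0" if "x \<notin> ?KK" for x
  proof -
    have z: "c x = 0" if "x \<notin> ?K c" for c using subsetD[OF closure_subset, of x "{x. c x \<noteq> 0}"] that by blast
    show "b1 x = 0" "b2 x = 0" "q1 x = 0" "q2 x = 0" using that by (auto intro!: z)
  qed
  note bR = L2_Cc_mult[OF b(1) R(1)] L2_Cc_mult[OF b(2) R(1)] and qu = L2_Cc_mult[OF q(1) uL(1)] L2_Cc_mult[OF q(2) uL(1)]
  have zero: "AE x in lborel. (b1 x - b2 x) * ?R u1 x = 0" "AE x in lborel. (q1 x - q2 x) * u1 x = 0"
  proof -
    let ?g = "\<lambda>x. (b1 x - b2 x) * ?R u1 x" and ?h = "\<lambda>x. (q1 x - q2 x) * u1 x"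
    have gL: "L2_on UNIV ?g" and hL: "L2_on UNIV ?h" unfolding left_diff_distrib by (intro L2_diff bR qu)+
    have K: "compact ?KK" "?KK \<subseteq> \<Omega>" using b q unfolding Cc_def by (blast intro: compact_Un)+
    have gK: "?g x = 0" and hK: "?h x = 0" if "x \<notin> ?KK" for x using out[OF that] by simp_all
    note eq = weak_solutions_subtract[OF cx b q a u1 u2 u12]
    show "AE x in lborel. ?g x = 0" by (rule regional_pairing_unique_continuation(1)[OF cx gL hL K gK hK eq])
    show "AE x in lborel. ?h x = 0" by (rule regional_pairing_unique_continuation(2)[OF cx gL hL K gK hK eq])
  qed
  have cont: "continuous_on UNIV b1" "continuous_on UNIV b2" "continuous_on UNIV q1" "continuous_on UNIV q2"
    using b q by (simp_all add: Cc_def)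
  have "q1 x = q2 x" if "x \<in> support_in \<Omega> u1" for x
    by (rule eq_on_support_in[OF o cont(3,4) _ zero(2) that]) simp
  moreover have "b1 x = b2 x" if "x \<in> support_in \<Omega> (regional_frac_laplacian (s / 2) \<Omega> u1)" for x
    by (rule eq_on_support_in[OF o cont(1,2) regional_rep_AE[OF cx a(1)] zero(1) that])
  ultimately show ?thesis using u12 by blast
qed

end
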